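(* Let $\Lambda=(\Lambda^{(1)},\dots,\Lambda^{(N)};\sim)$ be a finite higher-rank graph with vertex set $V$, and set \[ \mathfrak{S}:=\{\rho(H)\mid H \text{ is a sink subgraph of } \Lambda\}. \] Then: (1) $\mathcal{NT}(\Lambda)$ has nonnegative subharmonic phase transitions exactly at $\{\log\lambda \mid 1\le \lambda\in\mathfrak{S}\}$; that is, for $\beta \geq 0$ there exists $F\subsetneq\{1,\dots,N\}$ with $\mathrm{E}_\beta^F(\mathcal{NT}(\Lambda))\neq\emptyset$ if and only if $\beta=\log\lambda$ for some $\lambda\in\mathfrak{S}$ with $\lambda\geq 1$. (2) For every $F\subsetneq\{1,\dots,N\}$ and every $\lambda\in\mathfrak{S}$ with $\lambda\ge 1$, \[ \mathrm{G\text{-}E}_{\log\lambda}^F(\mathcal{NT}(\Lambda))\simeq \mathrm{T}_{\log\lambda}^F(A). \] (3) If $\lambda<\lambda'$ are successive elements of $\mathfrak{S}$, then for all $\beta>0$ with $\beta\in(\log\lambda,\log\lambda']$, \[ \emptyset\neq \mathrm{G\text{-}E}_\beta^{\mathrm{fin}}(\mathcal{NT}(\Lambda))\simeq \left\langle \delta_v \mid v\in V,\ \rho\big(\overleftarrow{\Lambda}(v)\big)\le\lambda\right\rangle . \] Here $\simeq$ denotes a weak*-homeomorphism, implemented by the map $\Phi^F$ defined in the context (with $F=\{1,\dots,N\}$ in (3)).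
   Context: **Higher-rank graphs.** Let $N\ge1$ and let $\mathbf{1},\dots,\mathbf{N}$ be the canonical generators of $\mathbb{Z}_+^N$ (write $\mathbf{i}$ for the $i$-th one). Let $(V,E,r,s)$ be a directed graph with $V$ (nonempty) and $E$ finite, whose edges are partitioned into $N$ colours, $E=E_1\sqcup\dots\sqcup E_N$. Paths are read from right to left; $s(\mu)$ and $r(\mu)$ are the initial and terminal vertices of a path $\mu$; vertices are the paths of length $0$. If $n_i$ is the number of edges of colour $i$ in $\mu$, let $\ell(\mu)=(n_1,\dots,n_N)$ and $|\mu|=n_1+\dots+n_N$. A higher-rank structure is an equivalence relation $\sim$ on the set $E^\bullet$ of paths (compatible with concatenation, $r$, $s$, $\ell$) with the unique factorization property: whenever $\ell(\lambda)=\underline m+\underline n$ there are unique (up to $\sim$) $\mu,\nu$ with $\ell(\mu)=\underline n$, $\ell(\nu)=\underline m$, $r(\mu)=r(\lambda)$, $s(\nu)=s(\lambda)$ and $\lambda\sim\mu\nu$. The finite higher-rank graph is $\Lambda:=E^\bullet/\!\sim$, i.e. a finite $N$-graph in the usual sense; $\Lambda^{(i)}$ is the $V\times V$ matrix with $\Lambda^{(i)}_{ts}$ = number of $i$-coloured edges from $v_s$ to $v_t$. The matrices $\Lambda^{(1)},\dots,\Lambda^{(N)}$ commute. One writes $\Lambda=(\Lambda^{(1)},\dots,\Lambda^{(N)};\sim)$. For $F\subseteq\{1,\dots,N\}$ and $\underline n\in\mathbb{Z}_+^N$, write $\underline n\in F$ if $\{i\mid n_i\ne0\}\subseteq F$.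 **Subgraphs and spectral radii.** $\rho(\Lambda^{(i)})$ is the spectral radius (Perron–Frobenius eigenvalue) of $\Lambda^{(i)}$, and $\rho(\Lambda):=\max_i\rho(\Lambda^{(i)})$; similarly for subgraphs. A sink subgraph $H=(H^{(1)},\dots,H^{(N)};\sim)$ of $\Lambda$ is a (nonempty) subgraph such that, for one permutation of the vertices (the same for all $i$), $\Lambda^{(i)}=\begin{bmatrix}*&0\\ *&H^{(i)}\end{bmatrix}$ for all $i=1,\dots,N$; i.e. $H$ consists of a set $W$ of vertices such that every edge starting in $W$ ends in $W$, with all edges of $\Lambda$ between vertices of $W$. $\Lambda$ is a sink subgraph of itself. For $v\in V$, $\overleftarrow{\Lambda}(v)$ is the subgraph with vertex set $\{w\in V\mid \text{there is a path in }\Lambda\text{ from } v \text{ to } w\}$ (including $v$) and all edges of $\Lambda$ connecting these vertices. Convention: $\log0=-\infty$. **The algebra.** For $\lambda,\mu\in\Lambda$ let $\Lambda^{\min}(\lambda,\mu)=\{(\alpha,\alpha')\mid \lambda\alpha=\mu\alpha',\ \ell(\lambda\alpha)=\ell(\lambda)\vee\ell(\mu)\}$. $\mathcal{NT}(\Lambda)$ is the universal C*-algebra generated by partial isometries $\{T_\mu\}_{\mu\in\Lambda}$ such that: $\{T_v\}_{v\in V}$ are pairwise orthogonal projections; $T_\lambda T_\mu=\delta_{s(\lambda),r(\mu)}T_{\lambda\mu}$; and $T_\lambda^*T_\mu=\sum_{(\alpha,\alpha')\in\Lambda^{\min}(\lambda,\mu)}T_\alpha T_{\alpha'}^*$. It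 is unital with unit $\sum_{v\in V}T_v$. Let $A:=\mathrm{C}^*(T_v\mid v\in V)\simeq\mathbb{C}^{|V|}$. **KMS-states.** The gauge action is $\gamma_{\underline z}(T_\mu)=\underline z^{\ell(\mu)}T_\mu$, $\underline z\in\mathbb{T}^N$, and $\sigma_r=\gamma_{(e^{ir},\dots,e^{ir})}$, $r\in\mathbb{R}$. A state $\varphi$ of $\mathcal{NT}(\Lambda)$ is a $(\sigma,\beta)$-KMS state if \[\varphi(T_\lambda T_\mu^*\cdot T_{\lambda'}T_{\mu'}^* )=e^{-(|\lambda|-|\mu|)\beta}\varphi(T_{\lambda'}T_{\mu'}^*\cdot T_\lambda T_\mu^* )\quad\text{for all }\lambda,\mu,\lambda',\mu'\in\Lambda\] (the same formula is used for $\beta=0$). $\mathrm{E}_\beta(\mathcal{NT}(\Lambda))$ is the set of these states. Set \[Q_{\mathbf i}:=1-\sum_{e\in\Lambda,\ \ell(e)=\mathbf i}T_eT_e^*,\quad Q_F:=\prod_{i\in F}Q_{\mathbf i},\quad Q_F^{\underline n}:=\sum_{\ell(\mu)=\underline n}T_\mu Q_FT_\mu^*\ \ (\underline n\in F),\] with $Q_\emptyset=1$. For $F\subseteq\{1,\dots,N\}$, \[\mathrm{E}_\beta^F(\mathcal{NT}(\Lambda)):=\Big\{\varphi\in\mathrm{E}_\beta(\mathcal{NT}(\Lambda))\ \Big|\ \sum_{\underline n\in F}\varphi(Q_F^{\underline n})=1\text{ and }\varphi(Q_{\mathbf i})=0\text{ for all }i\notin F\Big\},\] $\mathrm{E}_\beta^{\mathrm{fin}}:=\mathrm{E}_\beta^{\{1,\dots,N\}}$,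 and $\mathrm{G\text{-}E}_\beta^F$, $\mathrm{G\text{-}E}_\beta^{\mathrm{fin}}$ denote the subsets of gauge-invariant states (those with $\varphi=\varphi\circ E$, $E$ the conditional expectation onto the fixed point algebra of $\gamma$). $\mathcal{NT}(\Lambda)$ has a nonnegative subharmonic phase transition at $\beta\ge0$ if $\mathrm{E}_\beta^F(\mathcal{NT}(\Lambda))\ne\emptyset$ for some $F\subsetneq\{1,\dots,N\}$. **Traces on $A$.** $\mathrm{T}(A)$ is the set of states of $A$, identified with nonnegative vectors $(\tau(T_v))_{v\in V}$ of $\ell^1$-norm $1$; $\delta_v$ is the state corresponding to the basis vector at $v$; $\langle\cdot\rangle$ denotes the simplex (convex hull) generated by the given states. For $F\ne\emptyset$ let $c^F_{\tau,\beta}:=\sum\{e^{-|\mu|\beta}\tau(T_{s(\mu)})\mid\mu\in\Lambda,\ \ell(\mu)\in F\}$ and \[\mathrm{T}_\beta^F(A):=\{\tau\in\mathrm{T}(A)\mid c_{\tau,\beta}^F<\infty\text{ and }\Lambda^{(i)}\tau=e^\beta\tau\text{ for all }i\notin F\};\] for $F=\emptyset$, $\mathrm{T}_\beta^\emptyset(A):=\{\tau\in\mathrm{T}(A)\mid\Lambda^{(i)}\tau=e^\beta\tau\text{ for all }i=1,\dots,N\}$. **The map.** $\Phi^F$ is defined on $\mathrm{G\text{-}E}_\beta^F(\mathcal{NT}(\Lambda))$ by $\Phi^F(\varphi)(T_v)=\varphi(Q_F)^{-1}\varphi(Q_FT_vQ_F)$ for $v\in V$ (for $F=\emptyset$ this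 is just $\varphi\mapsto\varphi|_A$). *)

theory Defs
  imports
    "HOL-Analysis.Analysis"
    "HOL-Library.Function_Algebras"
    "Jordan_Normal_Form.Spectral_Radius"
begin

no_notation vec_index (infixl "$" 100)

section \<open>Bounded operators on the separable Hilbert space\<close>

typedef l2 = "{x :: nat \<Rightarrow> complex. summable (\<lambda>n. (cmod (x n))\<^sup>2)}"
  morphisms coord Abs_l2
  by (rule exI[of _ "\<lambda>_. 0"]) simp

setup_lifting type_definition_l2

lemma summable_l2_add:
  fixes x y :: "nat \<Rightarrow> complex"
  assumes "summable (\<lambda>n. (cmod (x n))\<^sup>2)" "summable (\<lambda>n. (cmod (y n))\<^sup>2)"
  shows "summable (\<lambda>n. (cmod (x n + y n))\<^sup>2)"
proof (rule summable_comparison_test'[where N = 0])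
  show "summable (\<lambda>n. 2 * (cmod (x n))\<^sup>2 + 2 * (cmod (y n))\<^sup>2)"
    by (intro summable_add summable_mult assms)
  show "norm ((cmod (x n + y n))\<^sup>2) \<le> 2 * (cmod (x n))\<^sup>2 + 2 * (cmod (y n))\<^sup>2" for n
  proof -
    have "(cmod (x n + y n))\<^sup>2 \<le> (cmod (x n) + cmod (y n))\<^sup>2"
      by (intro power_mono norm_triangle_ineq norm_ge_zero)
    moreover have "0 \<le> (cmod (x n) - cmod (y n))\<^sup>2" by simp
    ultimately show ?thesis by (simp add: power2_sum power2_diff)
  qed
qed

lemma summable_l2_scale:
  fixes x :: "nat \<Rightarrow> complex"
  assumes "summable (\<lambda>n. (cmod (x n))\<^sup>2)"
  shows "summable (\<lambda>n. (cmod (c * x n))\<^sup>2)"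
  using summable_mult[OF assms, of "(cmod c)\<^sup>2"] by (simp add: norm_mult power_mult_distrib)

lemma summable_l2_inner:
  fixes x y :: "nat \<Rightarrow> complex"
  assumes "summable (\<lambda>n. (cmod (x n))\<^sup>2)" "summable (\<lambda>n. (cmod (y n))\<^sup>2)"
  shows "summable (\<lambda>n. x n * cnj (y n))"
proof (rule summable_comparison_test'[where N = 0])
  show "summable (\<lambda>n. (cmod (x n))\<^sup>2 + (cmod (y n))\<^sup>2)"
    by (intro summable_add assms)
  show "norm (x n * cnj (y n)) \<le> (cmod (x n))\<^sup>2 + (cmod (y n))\<^sup>2" for n
  proof -
    have "0 \<le> (cmod (x n) - cmod (y n))\<^sup>2" by simp
    moreover have "0 \<le> (cmod (x n))\<^sup>2 + (cmod (y n))\<^sup>2" by simp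
    ultimately show ?thesis unfolding norm_mult complex_mod_cnj power2_diff by linarith
  qed
qed

lift_definition l2_scale :: "complex \<Rightarrow> l2 \<Rightarrow> l2" is "\<lambda>c x n. c * x n"
  by (rule summable_l2_scale)

lift_definition cinner :: "l2 \<Rightarrow> l2 \<Rightarrow> complex" is "\<lambda>x y. \<Sum>n. x n * cnj (y n)" .

instantiation l2 :: real_vector
begin

lift_definition zero_l2 :: l2 is "\<lambda>_. 0" by simp
lift_definition plus_l2 :: "l2 \<Rightarrow> l2 \<Rightarrow> l2" is "\<lambda>x y n. x n + y n" by (rule summable_l2_add)
lift_definition uminus_l2 :: "l2 \<Rightarrow> l2" is "\<lambda>x n. - x n" by simp
lift_definition minus_l2 :: "l2 \<Rightarrow> l2 \<Rightarrow> l2" is "\<lambda>x y n. x n - y n"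
  using summable_l2_add[where y = "\<lambda>n. - y n" for y] by simp
lift_definition scaleR_l2 :: "real \<Rightarrow> l2 \<Rightarrow> l2" is "\<lambda>r x n. complex_of_real r * x n"
  by (rule summable_l2_scale)

instance
proof
  fix x y z :: l2 and a b :: real
  show "x + y + z = x + (y + z)" by transfer (simp add: algebra_simps)
  show "x + y = y + x" by transfer (simp add: algebra_simps)
  show "0 + x = x" by transfer simp
  show "- x + x = 0" by transfer simp
  show "x - y = x + - y" by transfer simp
  show "a *\<^sub>R (x + y) = a *\<^sub>R x + a *\<^sub>R y" by transfer (simp add: algebra_simps)
  show "(a + b) *\<^sub>R x = a *\<^sub>R x + b *\<^sub>R x" by transfer (simp add: algebra_simps)
  show "a *\<^sub>R b *\<^sub>R x = (a * b) *\<^sub>R x" by transfer (simp add: algebra_simps)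
  show "1 *\<^sub>R x = x" by transfer simp
qed

end

instantiation l2 :: real_inner
begin

definition inner_l2 :: "l2 \<Rightarrow> l2 \<Rightarrow> real" where "inner_l2 x y = Re (cinner x y)"
definition norm_l2 :: "l2 \<Rightarrow> real" where "norm_l2 x = sqrt (inner x x)"
definition sgn_l2 :: "l2 \<Rightarrow> l2" where "sgn_l2 x = x /\<^sub>R norm x"
definition dist_l2 :: "l2 \<Rightarrow> l2 \<Rightarrow> real" where "dist_l2 x y = norm (x - y)"
definition uniformity_l2 :: "(l2 \<times> l2) filter" where
  "uniformity_l2 = (INF e\<in>{0<..}. principal {(x, y). dist x y < e})"
definition open_l2 :: "l2 set \<Rightarrow> bool" where
  "open_l2 U \<longleftrightarrow> (\<forall>x\<in>U. eventually (\<lambda>(x', y). x' = x \<longrightarrow> y \<in> U) uniformity)"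

instance
proof
  fix x y z :: l2 and a b :: real and U :: "l2 set"
  show "sgn x = x /\<^sub>R norm x" by (simp add: sgn_l2_def)
  show "dist x y = norm (x - y)" by (rule dist_l2_def)
  show "uniformity = (INF e\<in>{0<..}. principal {(x, y :: l2). dist x y < e})"
    by (rule uniformity_l2_def)
  show "open U \<longleftrightarrow> (\<forall>x\<in>U. eventually (\<lambda>(x', y). x' = x \<longrightarrow> y \<in> U) uniformity)"
    by (rule open_l2_def)
  show "norm x = sqrt (inner x x)" by (rule norm_l2_def)
  have Re_cinner: "inner x y = (\<Sum>n. Re (coord x n * cnj (coord y n)))" for x y :: l2
    unfolding inner_l2_def by transfer (simp add: Re_suminf summable_l2_inner)
  have sm: "summable (\<lambda>n. Re (coord x n * cnj (coord y n)))" for x y :: l2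
    by (rule summable_Re, rule summable_l2_inner) (use coord in auto)
  show "inner x y = inner y x"
    unfolding Re_cinner by (rule suminf_cong) (simp add: algebra_simps)
  show "inner (x + y) z = inner x z + inner y z"
    unfolding Re_cinner suminf_add[OF sm sm]
    by (rule suminf_cong) (simp add: plus_l2.rep_eq algebra_simps)
  show "inner (a *\<^sub>R x) y = a * inner x y"
    unfolding Re_cinner suminf_mult[OF sm, symmetric]
    by (rule suminf_cong) (simp add: scaleR_l2.rep_eq algebra_simps)
  have sq: "inner x x = (\<Sum>n. (cmod (coord x n))\<^sup>2)" for x :: l2
    unfolding Re_cinner by (rule suminf_cong) (simp add: complex_mult_cnj cmod_power2)
  have ssq: "summable (\<lambda>n. (cmod (coord x n))\<^sup>2)" using coord by auto
  show "0 \<le> inner x x" unfolding sq by (intro suminf_nonneg ssq) simp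
  have "inner x x = 0 \<longleftrightarrow> (\<forall>n. (cmod (coord x n))\<^sup>2 = 0)"
    unfolding sq by (rule suminf_eq_zero_iff[OF ssq]) simp
  also have "\<dots> \<longleftrightarrow> x = 0" by (auto simp: coord_inject[symmetric] zero_l2.rep_eq fun_eq_iff)
  finally show "inner x x = 0 \<longleftrightarrow> x = 0" .
qed

end

typedef bop = "{A :: l2 \<Rightarrow>\<^sub>L l2. \<forall>c x. blinfun_apply A (l2_scale c x) = l2_scale c (blinfun_apply A x)}"
  morphisms blin Abs_bop
  by (rule exI[of _ 0]) (auto simp: zero_l2.rep_eq l2_scale.rep_eq coord_inject[symmetric])

setup_lifting type_definition_bop

lemma l2_scale_add: "l2_scale c (x + y) = l2_scale c x + l2_scale c y"
  by transfer (simp add: algebra_simps)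

lemma l2_scale_minus: "l2_scale c (- x) = - l2_scale c x"
  by transfer simp

lemma l2_scale_diff: "l2_scale c (x - y) = l2_scale c x - l2_scale c y"
  by transfer (simp add: algebra_simps)

lemma l2_scale_zero: "l2_scale c 0 = 0"
  by transfer simp

lemma l2_scale_scaleR: "l2_scale c (r *\<^sub>R x) = r *\<^sub>R l2_scale c x"
  by transfer (simp add: algebra_simps)

lemma l2_scale_comm: "l2_scale c (l2_scale d x) = l2_scale d (l2_scale c x)"
  by transfer (simp add: algebra_simps)

lemma norm_l2_scale: "norm (l2_scale c x) = cmod c * norm x"
proof -
  have "inner x x = (\<Sum>n. Re (coord x n * cnj (coord x n)))" for x :: l2
    unfolding inner_l2_def by transfer (simp add: Re_suminf summable_l2_inner)
  moreover have "Re (coord x n * cnj (coord x n)) = (cmod (coord x n))\<^sup>2" for x n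
    by (simp add: complex_mult_cnj cmod_power2)
  ultimately have "inner x x = (\<Sum>n. (cmod (coord x n))\<^sup>2)" for x :: l2
    by simp
  moreover have "summable (\<lambda>n. (cmod (coord x n))\<^sup>2)" using coord by auto
  ultimately have "inner (l2_scale c x) (l2_scale c x) = (cmod c)\<^sup>2 * inner x x"
    by (simp add: l2_scale.rep_eq norm_mult power_mult_distrib suminf_mult)
  then show ?thesis by (simp add: norm_eq_sqrt_inner real_sqrt_mult)
qed

lemma bounded_linear_l2_scale: "bounded_linear (l2_scale c)"
  by (rule bounded_linear_intro[where K = "cmod c"])
     (simp_all add: l2_scale_add l2_scale_scaleR norm_l2_scale mult.commute)

lemma exists_nonzero_l2: "\<exists>x :: l2. x \<noteq> 0"
proof -
  have "summable (\<lambda>n. (cmod (if n = 0 then 1 else 0 :: complex))\<^sup>2)"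
    by (rule summable_finite[of "{0}"]) auto
  then have "coord (Abs_l2 (\<lambda>n. if n = 0 then 1 else 0)) 0 = 1"
    by (subst Abs_l2_inverse) auto
  then show ?thesis by (metis zero_l2.rep_eq zero_neq_one)
qed

text \<open>The algebra \<open>B(H)\<close> of bounded complex-linear operators on \<open>H = \<ell>\<^sup>2(\<nat>)\<close>, with the
  operator norm.\<close>

instantiation bop :: real_vector
begin

lift_definition zero_bop :: bop is 0 by (simp add: l2_scale_zero)
lift_definition plus_bop :: "bop \<Rightarrow> bop \<Rightarrow> bop" is "(+)"
  by (simp add: blinfun.add_left l2_scale_add)
lift_definition uminus_bop :: "bop \<Rightarrow> bop" is "uminus"
  by (simp add: blinfun.minus_left l2_scale_minus)
lift_definition minus_bop :: "bop \<Rightarrow> bop \<Rightarrow> bop" is "(-)"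
  by (simp add: blinfun.diff_left l2_scale_diff)
lift_definition scaleR_bop :: "real \<Rightarrow> bop \<Rightarrow> bop" is scaleR
  by (simp add: blinfun.scaleR_left l2_scale_scaleR)

instance
proof
  fix x y z :: bop and a b :: real
  show "x + y + z = x + (y + z)" by transfer (simp add: algebra_simps)
  show "x + y = y + x" by transfer (simp add: algebra_simps)
  show "0 + x = x" by transfer simp
  show "- x + x = 0" by transfer simp
  show "x - y = x + - y" by transfer simp
  show "a *\<^sub>R (x + y) = a *\<^sub>R x + a *\<^sub>R y" by transfer (simp add: algebra_simps)
  show "(a + b) *\<^sub>R x = a *\<^sub>R x + b *\<^sub>R x" by transfer (simp add: algebra_simps)
  show "a *\<^sub>R b *\<^sub>R x = (a * b) *\<^sub>R x" by transfer (simp add: algebra_simps)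
  show "1 *\<^sub>R x = x" by transfer simp
qed

end

instantiation bop :: real_normed_algebra_1
begin

lift_definition one_bop :: bop is "id_blinfun" by simp
lift_definition times_bop :: "bop \<Rightarrow> bop \<Rightarrow> bop" is "(o\<^sub>L)" by simp
lift_definition norm_bop :: "bop \<Rightarrow> real" is norm .

definition sgn_bop :: "bop \<Rightarrow> bop" where "sgn_bop x = x /\<^sub>R norm x"
definition dist_bop :: "bop \<Rightarrow> bop \<Rightarrow> real" where "dist_bop x y = norm (x - y)"
definition uniformity_bop :: "(bop \<times> bop) filter" where
  "uniformity_bop = (INF e\<in>{0<..}. principal {(x, y). dist x y < e})"
definition open_bop :: "bop set \<Rightarrow> bool" where
  "open_bop U \<longleftrightarrow> (\<forall>x\<in>U. eventually (\<lambda>(x', y). x' = x \<longrightarrow> y \<in> U) uniformity)"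

instance
proof
  fix x y z :: bop and a b :: real and U :: "bop set"
  show "x * y * z = x * (y * z)" by transfer (rule blinfun_eqI, simp)
  show "(x + y) * z = x * z + y * z" by transfer (rule blinfun_eqI, simp add: blinfun.add_left)
  show "x * (y + z) = x * y + x * z" by transfer (rule blinfun_eqI, simp add: blinfun.add_left blinfun.add_right)
  show "a *\<^sub>R x * y = a *\<^sub>R (x * y)"
    by transfer (rule blinfun_eqI, simp add: blinfun.scaleR_left)
  show "x * a *\<^sub>R y = a *\<^sub>R (x * y)"
    by transfer (rule blinfun_eqI, simp add: blinfun.scaleR_left blinfun.scaleR_right)
  show "1 * x = x" by transfer (rule blinfun_eqI, simp)
  show "x * 1 = x" by transfer (rule blinfun_eqI, simp)
  obtain v :: l2 where "v \<noteq> 0" using exists_nonzero_l2 by blast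
  then have "id_blinfun v \<noteq> (0 :: l2 \<Rightarrow>\<^sub>L l2) v" by simp
  then show "0 \<noteq> (1 :: bop)" by transfer metis
  show "sgn x = x /\<^sub>R norm x" by (simp add: sgn_bop_def)
  show "dist x y = norm (x - y)" by (rule dist_bop_def)
  show "uniformity = (INF e\<in>{0<..}. principal {(x, y :: bop). dist x y < e})"
    by (rule uniformity_bop_def)
  show "open U \<longleftrightarrow> (\<forall>x\<in>U. eventually (\<lambda>(x', y). x' = x \<longrightarrow> y \<in> U) uniformity)"
    by (rule open_bop_def)
  show "norm x = 0 \<longleftrightarrow> x = 0" by transfer simp
  show "norm (x + y) \<le> norm x + norm y" by transfer (rule norm_triangle_ineq)
  show "norm (a *\<^sub>R x) = \<bar>a\<bar> * norm x" by transfer simp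
  show "norm (x * y) \<le> norm x * norm y" by transfer (rule norm_blinfun_compose)
  have "norm (id_blinfun :: l2 \<Rightarrow>\<^sub>L l2) = 1"
  proof (rule antisym)
    show "norm (id_blinfun :: l2 \<Rightarrow>\<^sub>L l2) \<le> 1" by (rule norm_blinfun_bound) auto
    have "norm v \<le> norm (id_blinfun :: l2 \<Rightarrow>\<^sub>L l2) * norm v"
      using norm_blinfun[of "id_blinfun :: l2 \<Rightarrow>\<^sub>L l2" v] by simp
    then show "1 \<le> norm (id_blinfun :: l2 \<Rightarrow>\<^sub>L l2)" using \<open>v \<noteq> 0\<close> by simp
  qed
  then show "norm (1 :: bop) = 1" by transfer
qed

end

lift_definition bop_scale :: "complex \<Rightarrow> bop \<Rightarrow> bop" is "\<lambda>c A. Blinfun (l2_scale c) o\<^sub>L A"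
  by (simp add: bounded_linear_Blinfun_apply[OF bounded_linear_l2_scale] l2_scale_comm)

definition bop_star :: "bop \<Rightarrow> bop" where
  "bop_star A = (THE B. \<forall>x y. cinner (blinfun_apply (blin A) x) y = cinner x (blinfun_apply (blin B) y))"


section \<open>Finite higher-rank graphs\<close>

text \<open>A path is written \<open>(v, [e\<^sub>1, \<dots>, e\<^sub>k])\<close>, where \<open>v\<close> is its initial vertex and the edges are
  read from right to left: \<open>e\<^sub>k\<close> starts at \<open>v\<close> and \<open>e\<^sub>1\<close> is traversed last.  The paths of
  length \<open>0\<close> are the \<open>(v, [])\<close>.  The vertex set is the whole (finite) type \<open>'v\<close>, and the colours
  are \<open>1, \<dots>, N\<close> with \<open>N = ncolours G\<close>.\<close>

type_synonym ('v, 'e) path = "'v \<times> 'e list"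

record ('v, 'e) hrg =
  ncolours :: nat
  edges :: "'e set"
  src :: "'e \<Rightarrow> 'v"
  rng :: "'e \<Rightarrow> 'v"
  colour :: "'e \<Rightarrow> nat"
  sim :: "(('v, 'e) path \<times> ('v, 'e) path) set"

definition path_src :: "('v, 'e) path \<Rightarrow> 'v" where
  "path_src p = fst p"

fun path_rng :: "('v, 'e) hrg \<Rightarrow> ('v, 'e) path \<Rightarrow> 'v" where
  "path_rng G (v, []) = v"
| "path_rng G (v, e # es) = rng G e"

fun is_path :: "('v, 'e) hrg \<Rightarrow> ('v, 'e) path \<Rightarrow> bool" where
  "is_path G (v, []) \<longleftrightarrow> True"
| "is_path G (v, e # es) \<longleftrightarrow> e \<in> edges G \<and> src G e = path_rng G (v, es) \<and> is_path G (v, es)"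

definition paths :: "('v, 'e) hrg \<Rightarrow> ('v, 'e) path set" where
  "paths G = {p. is_path G p}"

definition path_deg :: "('v, 'e) hrg \<Rightarrow> ('v, 'e) path \<Rightarrow> nat \<Rightarrow> nat" where
  "path_deg G p = (\<lambda>i. count_list (map (colour G) (snd p)) i)"

definition path_comp :: "('v, 'e) path \<Rightarrow> ('v, 'e) path \<Rightarrow> ('v, 'e) path" where
  "path_comp p q = (fst q, snd p @ snd q)"

definition factorization ::
    "('v, 'e) hrg \<Rightarrow> ('v, 'e) path \<Rightarrow> (nat \<Rightarrow> nat) \<Rightarrow> (nat \<Rightarrow> nat) \<Rightarrow> ('v, 'e) path \<Rightarrow> ('v, 'e) path \<Rightarrow> bool"
  where
  "factorization G l n m p q \<longleftrightarrow>
     p \<in> paths G \<and> q \<in> paths G \<and> path_deg G p = n \<and> path_deg G q = m \<and>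
     path_rng G p = path_rng G l \<and> path_src q = path_src l \<and> path_src p = path_rng G q \<and>
     (l, path_comp p q) \<in> sim G"

locale finite_hrg =
  fixes G :: "('v :: finite, 'e) hrg"
  assumes ncolours_pos: "1 \<le> ncolours G"
    and finite_edges: "finite (edges G)"
    and colour_edges: "colour G ` edges G \<subseteq> {1..ncolours G}"
    and sim_equiv: "equiv (paths G) (sim G)"
    and sim_invariants: "(p, q) \<in> sim G \<Longrightarrow>
      path_src p = path_src q \<and> path_rng G p = path_rng G q \<and> path_deg G p = path_deg G q"
    and sim_comp: "(p, p') \<in> sim G \<Longrightarrow> (q, q') \<in> sim G \<Longrightarrow> path_src p = path_rng G q \<Longrightarrow>
      (path_comp p q, path_comp p' q') \<in> sim G"
    and factorization_exists: "l \<in> paths G \<Longrightarrow> path_deg G l = m + n \<Longrightarrow>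
      \<exists>p q. factorization G l n m p q"
    and factorization_unique: "l \<in> paths G \<Longrightarrow> path_deg G l = m + n \<Longrightarrow>
      factorization G l n m p q \<Longrightarrow> factorization G l n m p' q' \<Longrightarrow>
      (p, p') \<in> sim G \<and> (q, q') \<in> sim G"

text \<open>The category \<open>\<Lambda> = E\<^sup>\<bullet>/\<sim>\<close>.  Source, range, degree and composition of classes are computed
  on representatives.\<close>

type_synonym ('v, 'e) mor = "('v, 'e) path set"

definition Lam :: "('v, 'e) hrg \<Rightarrow> ('v, 'e) mor set" where
  "Lam G = paths G // sim G"

definition rep :: "('v, 'e) mor \<Rightarrow> ('v, 'e) path" where
  "rep \<mu> = (SOME p. p \<in> \<mu>)"

definition msrc :: "('v, 'e) mor \<Rightarrow> 'v" where
  "msrc \<mu> = path_src (rep \<mu>)"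

definition mrng :: "('v, 'e) hrg \<Rightarrow> ('v, 'e) mor \<Rightarrow> 'v" where
  "mrng G \<mu> = path_rng G (rep \<mu>)"

definition mdeg :: "('v, 'e) hrg \<Rightarrow> ('v, 'e) mor \<Rightarrow> nat \<Rightarrow> nat" where
  "mdeg G \<mu> = path_deg G (rep \<mu>)"

definition mlen :: "('v, 'e) hrg \<Rightarrow> ('v, 'e) mor \<Rightarrow> nat" where
  "mlen G \<mu> = (\<Sum>i\<in>{1..ncolours G}. mdeg G \<mu> i)"

definition mcomp :: "('v, 'e) hrg \<Rightarrow> ('v, 'e) mor \<Rightarrow> ('v, 'e) mor \<Rightarrow> ('v, 'e) mor" where
  "mcomp G \<mu> \<nu> = sim G `` {path_comp (rep \<mu>) (rep \<nu>)}"

definition vert :: "('v, 'e) hrg \<Rightarrow> 'v \<Rightarrow> ('v, 'e) mor" where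
  "vert G v = sim G `` {(v, [])}"

definition unit_deg :: "nat \<Rightarrow> nat \<Rightarrow> nat" where
  "unit_deg i = (\<lambda>j. if j = i then 1 else 0)"

definition degs_in :: "nat set \<Rightarrow> (nat \<Rightarrow> nat) set" where
  "degs_in F = {n. {i. n i \<noteq> 0} \<subseteq> F}"

definition Lam_min :: "('v, 'e) hrg \<Rightarrow> ('v, 'e) mor \<Rightarrow> ('v, 'e) mor \<Rightarrow> (('v, 'e) mor \<times> ('v, 'e) mor) set"
  where
  "Lam_min G \<kappa> \<mu> = {(\<alpha>, \<alpha>'). \<alpha> \<in> Lam G \<and> \<alpha>' \<in> Lam G \<and>
     msrc \<kappa> = mrng G \<alpha> \<and> msrc \<mu> = mrng G \<alpha>' \<and> mcomp G \<kappa> \<alpha> = mcomp G \<mu> \<alpha>' \<and>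
     mdeg G (mcomp G \<kappa> \<alpha>) = (\<lambda>i. max (mdeg G \<kappa> i) (mdeg G \<mu> i))}"


section \<open>Adjacency matrices, sink subgraphs and spectral radii\<close>

text \<open>The edges of \<open>\<Lambda>\<close> of colour \<open>i\<close> are its elements of degree \<open>\<^bold>i\<close>.  (An edge and a
  path of length one are the same thing unless \<open>\<sim>\<close> identifies parallel edges of one colour;
  in that case it is the classes that are the edges of the \<open>N\<close>-graph \<open>\<Lambda>\<close>.)\<close>

definition adj :: "('v :: finite, 'e) hrg \<Rightarrow> nat \<Rightarrow> real ^ 'v ^ 'v" where
  "adj G i = (\<chi> t s. real (card {e \<in> Lam G. mdeg G e = unit_deg i \<and> msrc e = s \<and> mrng G e = t}))"

text \<open>The block of \<open>\<Lambda>\<^sup>(\<^sup>i\<^sup>)\<close> at a set \<open>W\<close> of vertices, i.e. the \<open>i\<close>-th adjacency matrix of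
  the subgraph on \<open>W\<close> with all edges of \<open>\<Lambda>\<close> between vertices of \<open>W\<close>; the function
  \<^term>\<open>from_nat_into W\<close> enumerates the finite set \<open>W\<close> by \<open>0, \<dots>, card W - 1\<close>.\<close>

definition adj_block :: "('v :: finite, 'e) hrg \<Rightarrow> nat \<Rightarrow> 'v set \<Rightarrow> complex Matrix.mat" where
  "adj_block G i W = Matrix.mat (card W) (card W)
     (\<lambda>(j, k). complex_of_real (adj G i $ from_nat_into W j $ from_nat_into W k))"

definition rho :: "('v :: finite, 'e) hrg \<Rightarrow> 'v set \<Rightarrow> real" where
  "rho G W = Max ((\<lambda>i. spectral_radius (adj_block G i W)) ` {1..ncolours G})"

definition sink_subgraph :: "('v, 'e) hrg \<Rightarrow> 'v set \<Rightarrow> bool" where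
  "sink_subgraph G W \<longleftrightarrow> W \<noteq> {} \<and> (\<forall>e\<in>edges G. src G e \<in> W \<longrightarrow> rng G e \<in> W)"

definition sink_radii :: "('v :: finite, 'e) hrg \<Rightarrow> real set" where
  "sink_radii G = {rho G W | W. sink_subgraph G W}"

definition forward :: "('v, 'e) hrg \<Rightarrow> 'v \<Rightarrow> 'v set" where
  "forward G v = {w. \<exists>p\<in>paths G. path_src p = v \<and> path_rng G p = w}"

definition elog :: "real \<Rightarrow> ereal" where
  "elog x = (if x = 0 then - \<infinity> else ereal (ln x))"


section \<open>The Toeplitz algebra of a finite higher-rank graph\<close>

text \<open>Families of operators on \<open>H\<close> that satisfy the defining relations of \<open>\<N>\<T>(\<Lambda>)\<close>.\<close>

definition toeplitz_family :: "('v :: finite, 'e) hrg \<Rightarrow> (('v, 'e) mor \<Rightarrow> bop) \<Rightarrow> bool" where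
  "toeplitz_family G S \<longleftrightarrow>
     (\<forall>\<mu>\<in>Lam G. S \<mu> * bop_star (S \<mu>) * S \<mu> = S \<mu>) \<and>
     (\<forall>v. bop_star (S (vert G v)) = S (vert G v)) \<and>
     (\<forall>v w. S (vert G v) * S (vert G w) = (if v = w then S (vert G v) else 0)) \<and>
     (\<forall>\<kappa>\<in>Lam G. \<forall>\<mu>\<in>Lam G. S \<kappa> * S \<mu> = (if msrc \<kappa> = mrng G \<mu> then S (mcomp G \<kappa> \<mu>) else 0)) \<and>
     (\<forall>\<kappa>\<in>Lam G. \<forall>\<mu>\<in>Lam G. bop_star (S \<kappa>) * S \<mu> =
        (\<Sum>(\<alpha>, \<alpha>')\<in>Lam_min G \<kappa> \<mu>. S \<alpha> * bop_star (S \<alpha>')))"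

text \<open>The universal C*-algebra \<open>\<N>\<T>(\<Lambda>)\<close> is realised in the usual way: it is the C*-algebra
  generated by \<open>T\<^sub>\<mu> = (S\<^sub>\<mu>)\<^sub>S\<close> in the \<open>\<ell>\<^sup>\<infinity>\<close>-product of copies of \<open>B(H)\<close> indexed by all
  families \<open>S\<close> as above.  Evaluation at \<open>S\<close> is the representation with \<open>T\<^sub>\<mu> \<mapsto> S\<^sub>\<mu>\<close>.  Because
  \<open>\<Lambda>\<close> is countable, any C*-algebra generated by such a family is separable, so it has a faithful
  representation on \<open>H = \<ell>\<^sup>2(\<nat>)\<close> (degenerate families are allowed), and no other Hilbert spaces
  are needed for universality.

  Elements of \<open>\<N>\<T>(\<Lambda>)\<close> are functions of \<open>S\<close>, normalised to vanish off the set of Toeplitz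
  families.  Sums and products are the pointwise ones; note that the pointwise \<open>1\<close> is not
  the unit of \<open>\<N>\<T>(\<Lambda>)\<close>, which is \<open>nt_unit\<close> below.\<close>

type_synonym ('v, 'e) nt = "(('v, 'e) mor \<Rightarrow> bop) \<Rightarrow> bop"

definition nt_T :: "('v :: finite, 'e) hrg \<Rightarrow> ('v, 'e) mor \<Rightarrow> ('v, 'e) nt" where
  "nt_T G \<mu> = (\<lambda>S. if toeplitz_family G S then S \<mu> else 0)"

definition nt_scale :: "complex \<Rightarrow> ('v, 'e) nt \<Rightarrow> ('v, 'e) nt" where
  "nt_scale c x = (\<lambda>S. bop_scale c (x S))"

definition nt_star :: "('v, 'e) nt \<Rightarrow> ('v, 'e) nt" where
  "nt_star x = (\<lambda>S. bop_star (x S))"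

definition nt_norm :: "('v :: finite, 'e) hrg \<Rightarrow> ('v, 'e) nt \<Rightarrow> real" where
  "nt_norm G x = (SUP S\<in>{S. toeplitz_family G S}. norm (x S))"

inductive_set nt_poly :: "('v :: finite, 'e) hrg \<Rightarrow> ('v, 'e) nt set" for G where
  gen: "\<mu> \<in> Lam G \<Longrightarrow> nt_T G \<mu> \<in> nt_poly G"
| star: "x \<in> nt_poly G \<Longrightarrow> nt_star x \<in> nt_poly G"
| scale: "x \<in> nt_poly G \<Longrightarrow> nt_scale c x \<in> nt_poly G"
| add: "x \<in> nt_poly G \<Longrightarrow> y \<in> nt_poly G \<Longrightarrow> x + y \<in> nt_poly G"
| mult: "x \<in> nt_poly G \<Longrightarrow> y \<in> nt_poly G \<Longrightarrow> x * y \<in> nt_poly G"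

definition NT :: "('v :: finite, 'e) hrg \<Rightarrow> ('v, 'e) nt set" where
  "NT G = {x. (\<forall>S. \<not> toeplitz_family G S \<longrightarrow> x S = 0) \<and>
     (\<forall>\<epsilon>>0. \<exists>y\<in>nt_poly G. \<forall>S. toeplitz_family G S \<longrightarrow> norm (x S - y S) \<le> \<epsilon>)}"

definition nt_unit :: "('v :: finite, 'e) hrg \<Rightarrow> ('v, 'e) nt" where
  "nt_unit G = (\<Sum>v\<in>UNIV. nt_T G (vert G v))"


section \<open>Gauge action and its conditional expectation\<close>

definition torus :: "('v, 'e) hrg \<Rightarrow> (nat \<Rightarrow> complex) set" where
  "torus G = {z. \<forall>i\<in>{1..ncolours G}. cmod (z i) = 1}"

text \<open>\<open>g = \<gamma>\<^sub>z\<close>.  There is exactly one such \<open>g\<close> on \<open>\<N>\<T>(\<Lambda>)\<close> for each \<open>z\<close> in the torus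
  (*-automorphisms are automatically isometric).\<close>

definition gauge_aut :: "('v :: finite, 'e) hrg \<Rightarrow> (nat \<Rightarrow> complex) \<Rightarrow> (('v, 'e) nt \<Rightarrow> ('v, 'e) nt) \<Rightarrow> bool"
  where
  "gauge_aut G z g \<longleftrightarrow>
     bij_betw g (NT G) (NT G) \<and>
     (\<forall>x\<in>NT G. \<forall>y\<in>NT G. g (x + y) = g x + g y \<and> g (x * y) = g x * g y) \<and>
     (\<forall>x\<in>NT G. \<forall>c. g (nt_scale c x) = nt_scale c (g x)) \<and>
     (\<forall>x\<in>NT G. g (nt_star x) = nt_star (g x) \<and> nt_norm G (g x) = nt_norm G x) \<and>
     (\<forall>\<mu>\<in>Lam G. g (nt_T G \<mu>) = nt_scale (\<Prod>i\<in>{1..ncolours G}. z i ^ mdeg G \<mu> i) (nt_T G \<mu>))"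

definition fixed_alg :: "('v :: finite, 'e) hrg \<Rightarrow> ('v, 'e) nt set" where
  "fixed_alg G = {x \<in> NT G. \<forall>z\<in>torus G. \<forall>g. gauge_aut G z g \<longrightarrow> g x = x}"

text \<open>\<open>E\<close> is the conditional expectation \<open>x \<mapsto> \<integral> \<gamma>\<^sub>z(x) dz\<close> onto the fixed point algebra: a
  contractive bimodule projection (hence positive).  The last clause singles out the averaging map:
  if \<open>E \<circ> \<gamma>\<^sub>z = E\<close> for all \<open>z\<close>, then \<open>E x = E (\<integral> \<gamma>\<^sub>z(x) dz) = \<integral> \<gamma>\<^sub>z(x) dz\<close>.\<close>

definition gauge_expectation :: "('v :: finite, 'e) hrg \<Rightarrow> (('v, 'e) nt \<Rightarrow> ('v, 'e) nt) \<Rightarrow> bool" where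
  "gauge_expectation G E \<longleftrightarrow>
     (\<forall>x\<in>NT G. E x \<in> fixed_alg G \<and> nt_norm G (E x) \<le> nt_norm G x) \<and>
     (\<forall>b\<in>fixed_alg G. E b = b) \<and>
     (\<forall>x\<in>NT G. \<forall>y\<in>NT G. E (x + y) = E x + E y) \<and>
     (\<forall>x\<in>NT G. \<forall>c. E (nt_scale c x) = nt_scale c (E x)) \<and>
     (\<forall>a\<in>fixed_alg G. \<forall>b\<in>fixed_alg G. \<forall>x\<in>NT G. E (a * x * b) = a * E x * b) \<and>
     (\<forall>z\<in>torus G. \<forall>g. gauge_aut G z g \<longrightarrow> (\<forall>x\<in>NT G. E (g x) = E x))"


section \<open>KMS-states\<close>

text \<open>States are functions on the carrier \<^term>\<open>NT G\<close>, extended by \<^term>\<open>undefined\<close>.\<close>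

definition nt_state :: "('v :: finite, 'e) hrg \<Rightarrow> (('v, 'e) nt \<Rightarrow> complex) \<Rightarrow> bool" where
  "nt_state G \<phi> \<longleftrightarrow>
     \<phi> \<in> extensional (NT G) \<and>
     (\<forall>x\<in>NT G. \<forall>y\<in>NT G. \<phi> (x + y) = \<phi> x + \<phi> y) \<and>
     (\<forall>x\<in>NT G. \<forall>c. \<phi> (nt_scale c x) = c * \<phi> x) \<and>
     (\<forall>x\<in>NT G. \<phi> (nt_star x * x) \<in> \<real>\<^sub>\<ge>\<^sub>0) \<and>
     (\<forall>x\<in>NT G. cmod (\<phi> x) \<le> nt_norm G x) \<and>
     \<phi> (nt_unit G) = 1"

definition kms :: "('v :: finite, 'e) hrg \<Rightarrow> real \<Rightarrow> (('v, 'e) nt \<Rightarrow> complex) set" where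
  "kms G \<beta> = {\<phi>. nt_state G \<phi> \<and>
     (\<forall>\<kappa>\<in>Lam G. \<forall>\<mu>\<in>Lam G. \<forall>\<kappa>'\<in>Lam G. \<forall>\<mu>'\<in>Lam G.
        \<phi> ((nt_T G \<kappa> * nt_star (nt_T G \<mu>)) * (nt_T G \<kappa>' * nt_star (nt_T G \<mu>'))) =
        complex_of_real (exp (- (real (mlen G \<kappa>) - real (mlen G \<mu>)) * \<beta>)) *
          \<phi> ((nt_T G \<kappa>' * nt_star (nt_T G \<mu>')) * (nt_T G \<kappa> * nt_star (nt_T G \<mu>))))}"

definition nt_Q :: "('v :: finite, 'e) hrg \<Rightarrow> nat \<Rightarrow> ('v, 'e) nt" where
  "nt_Q G i = nt_unit G - (\<Sum>e | e \<in> Lam G \<and> mdeg G e = unit_deg i. nt_T G e * nt_star (nt_T G e))"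

text \<open>The projections \<open>Q\<^sub>i\<close> commute; the product is taken in increasing order of the indices.\<close>

definition nt_QF :: "('v :: finite, 'e) hrg \<Rightarrow> nat set \<Rightarrow> ('v, 'e) nt" where
  "nt_QF G F = foldr (\<lambda>i x. nt_Q G i * x) (sorted_list_of_set F) (nt_unit G)"

definition nt_QFn :: "('v :: finite, 'e) hrg \<Rightarrow> nat set \<Rightarrow> (nat \<Rightarrow> nat) \<Rightarrow> ('v, 'e) nt" where
  "nt_QFn G F n = (\<Sum>\<mu> | \<mu> \<in> Lam G \<and> mdeg G \<mu> = n. nt_T G \<mu> * nt_QF G F * nt_star (nt_T G \<mu>))"

definition kmsF :: "('v :: finite, 'e) hrg \<Rightarrow> nat set \<Rightarrow> real \<Rightarrow> (('v, 'e) nt \<Rightarrow> complex) set" where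
  "kmsF G F \<beta> = {\<phi> \<in> kms G \<beta>.
     ((\<lambda>n. \<phi> (nt_QFn G F n)) has_sum 1) (degs_in F) \<and> (\<forall>i\<in>{1..ncolours G} - F. \<phi> (nt_Q G i) = 0)}"

definition gauge_kmsF :: "('v :: finite, 'e) hrg \<Rightarrow> nat set \<Rightarrow> real \<Rightarrow> (('v, 'e) nt \<Rightarrow> complex) set" where
  "gauge_kmsF G F \<beta> = {\<phi> \<in> kmsF G F \<beta>. \<exists>E. gauge_expectation G E \<and> (\<forall>x\<in>NT G. \<phi> (E x) = \<phi> x)}"

definition weak_star :: "('v :: finite, 'e) hrg \<Rightarrow> (('v, 'e) nt \<Rightarrow> complex) set \<Rightarrow> (('v, 'e) nt \<Rightarrow> complex) topology"
  where
  "weak_star G X = subtopology (product_topology (\<lambda>_. euclidean) (NT G)) X"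


section \<open>Traces on \<open>A\<close>\<close>

text \<open>States of \<open>A = C*(T\<^sub>v | v \<in> V)\<close> are identified with the vectors \<open>(\<tau>(T\<^sub>v))\<^sub>v\<close>, on which the
  weak*-topology is the Euclidean one.  In this picture \<open>\<delta>\<^sub>v\<close> is \<^term>\<open>axis v 1\<close>.\<close>

definition traces :: "(real ^ 'v :: finite) set" where
  "traces = {\<tau>. (\<forall>v. 0 \<le> \<tau> $ v) \<and> (\<Sum>v\<in>UNIV. \<tau> $ v) = 1}"

definition tracesF :: "('v :: finite, 'e) hrg \<Rightarrow> nat set \<Rightarrow> real \<Rightarrow> (real ^ 'v) set" where
  "tracesF G F \<beta> = {\<tau> \<in> traces.
     (F \<noteq> {} \<longrightarrow>
       (\<lambda>\<mu>. exp (- real (mlen G \<mu>) * \<beta>) * \<tau> $ msrc \<mu>) summable_on {\<mu> \<in> Lam G. mdeg G \<mu> \<in> degs_in F}) \<and>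
     (\<forall>i\<in>{1..ncolours G} - F. adj G i *v \<tau> = exp \<beta> *\<^sub>R \<tau>)}"

text \<open>For a state \<open>\<phi>\<close> the numbers \<open>\<phi>(Q\<^sub>F)\<close> and \<open>\<phi>(Q\<^sub>F T\<^sub>v Q\<^sub>F)\<close> are nonnegative reals, so taking
  real parts only changes the type.\<close>

definition Phi :: "('v :: finite, 'e) hrg \<Rightarrow> nat set \<Rightarrow> (('v, 'e) nt \<Rightarrow> complex) \<Rightarrow> real ^ 'v" where
  "Phi G F \<phi> = (\<chi> v. Re (inverse (\<phi> (nt_QF G F)) * \<phi> (nt_QF G F * nt_T G (vert G v) * nt_QF G F)))"

end

theory Submission
  imports Defs
begin

text \<open>Let \<open>B\<^sub>i = e\<^sup>-\<^sup>\<beta> \<Lambda>\<^sup>(\<^sup>i\<^sup>)\<close>. A KMS-state \<open>\<phi>\<close> is controlled by the vector \<open>\<omega> = (\<phi>(T\<^sub>v))\<^sub>v\<close>: the KMS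
  condition gives \<open>\<phi>(Q\<^sub>F T\<^sub>v Q\<^sub>F) = \<epsilon>\<^sub>v\<close> for \<open>\<epsilon> = \<Prod>\<^sub>i\<^sub>\<in>\<^sub>F (1 - B\<^sub>i) \<omega> \<ge> 0\<close>, membership in \<open>E\<^sub>\<beta>\<^sup>F\<close> means
  \<open>\<omega> = \<Sum>\<^sub>n\<^sub>\<in>\<^sub>F B\<^sup>n \<epsilon>\<close> together with \<open>B\<^sub>i \<omega> = \<omega>\<close> for \<open>i \<notin> F\<close>, and \<open>\<Phi>\<^sup>F\<close> is the normalisation \<open>\<epsilon> / |\<epsilon>|\<close>.
  Conversely, for a trace \<open>\<tau>\<close> in \<open>T\<^sub>\<beta>\<^sup>F\<close> the Fock vectors \<open>\<delta>\<^sub>\<mu>\<close> with \<open>\<ell>(\<mu>)\<^sub>i = k\<close> for all \<open>i \<notin> F\<close>, weighted by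
  \<open>e\<^sup>-\<^sup>\<beta>\<^sup>|\<^sup>\<mu>\<^sup>| \<tau>(T\<^sub>s\<^sub>(\<^sub>\<mu>\<^sub>))\<close>, define states whose values on each \<open>T\<^sub>\<kappa> T\<^sub>\<mu>\<^sup>*\<close> are constant for large \<open>k\<close>; the limit
  is the gauge-invariant KMS-state over \<open>\<tau>\<close>.

  The support of \<open>\<omega>\<close> is a sink subgraph on which \<open>\<Lambda>\<^sup>(\<^sup>i\<^sup>) \<omega> \<le> e\<^sup>\<beta> \<omega>\<close>, with equality for \<open>i \<notin> F\<close>, so its spectral
  radius is \<open>e\<^sup>\<beta>\<close> unless \<open>F\<close> contains all colours. In the other direction, a sink subgraph carries a joint
  nonnegative eigenvector of the commuting matrices \<open>\<Lambda>\<^sup>(\<^sup>i\<^sup>)\<close> whose eigenvalue for one colour is \<open>\<rho>(H)\<close>; take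
  for \<open>F\<close> the colours with a smaller eigenvalue. For \<open>F = {1,\<dots>,N}\<close> the series of \<open>\<delta>\<^sub>v\<close> converges exactly when
  the spectral radius of the subgraph reachable from \<open>v\<close> is below \<open>e\<^sup>\<beta>\<close>.\<close>

section \<open>Operators on the Hilbert space\<close>

text \<open>The algebra is a norm closure of functions on Toeplitz families, so its general elements
  are known only through approximation. Identities, convergence and continuity are therefore settled
  on monomials \<open>mono \<kappa> \<mu>\<close> and extended by norm bounds. For a colour i
  outside F every further degree contributes the same mass again, so a sum over all paths would
  diverge. Freezing these degrees at k gives layers of mass one; a fixed monomial only shifts the
  layer, which is why its value stops depending on k. Vector states supply positivity and
  contractivity, which values on monomials do not show. Sink subgraphs are rarely irreducible, so
  eigenvectors are sought in closed cones: vectors supported in the sink set and expanded by at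
  least its spectral radius form a cone invariant under all colours, and a joint eigenvector in it
  cannot exceed that radius either. The map to traces is a quotient of evaluations. Its inverse is
  continuous because the series of B^n \<tau> is linear in \<tau> with fixed coefficient vectors,
  and states are uniformly contractive.\<close>

lemma coord_simps [simp]:
  "coord 0 n = 0" "coord (x + y) n = coord x n + coord y n" "coord (x - y) n = coord x n - coord y n"
  "coord (- x) n = - coord x n" "coord (r *\<^sub>R x) n = of_real r * coord x n"
  "coord (l2_scale c x) n = c * coord x n"
  by (simp_all add: zero_l2.rep_eq plus_l2.rep_eq minus_l2.rep_eq uminus_l2.rep_eq scaleR_l2.rep_eq
      l2_scale.rep_eq)

lemma l2_eqI: "(\<And>n. coord x n = coord y n) \<Longrightarrow> x = y"
  by (metis coord_inject ext)

lemma coord_sum [simp]: "coord (sum f A) n = (\<Sum>a\<in>A. coord (f a) n)"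
  by (induct A rule: infinite_finite_induct) auto

lemma summable_coord: "summable (\<lambda>n. (cmod (coord x n))\<^sup>2)"
  using coord by auto

lemma summable_coord_mult: "summable (\<lambda>n. coord x n * cnj (coord y n))"
  by (intro summable_l2_inner summable_coord)

lemma cinner_sums: "(\<lambda>n. coord x n * cnj (coord y n)) sums cinner x y"
  unfolding cinner.rep_eq by (intro summable_sums summable_coord_mult)

section \<open>The complex inner product\<close>

lemma cinner_add_left: "cinner (x + y) z = cinner x z + cinner y z"
  by (rule sums_unique2[OF cinner_sums], simp add: distrib_right) (intro sums_add cinner_sums)

lemma cinner_add_right: "cinner z (x + y) = cinner z x + cinner z y"
  by (rule sums_unique2[OF cinner_sums], simp add: distrib_left) (intro sums_add cinner_sums)

lemma cinner_scale_left: "cinner (l2_scale c x) z = c * cinner x z"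
  by (rule sums_unique2[OF cinner_sums], simp add: mult.assoc) (intro sums_mult cinner_sums)

lemma cinner_scale_right: "cinner x (l2_scale c z) = cnj c * cinner x z"
  by (rule sums_unique2[OF cinner_sums], simp add: mult.left_commute) (intro sums_mult cinner_sums)

lemma cinner_commute: "cinner y x = cnj (cinner x y)"
proof -
  have "(\<lambda>n. cnj (coord x n * cnj (coord y n))) sums cnj (cinner x y)"
    by (subst sums_cnj) (rule cinner_sums)
  then have "(\<lambda>n. coord y n * cnj (coord x n)) sums cnj (cinner x y)"
    by (simp add: mult.commute)
  then show ?thesis by (rule sums_unique2[OF cinner_sums])
qed

lemma l2_scale_of_real: "l2_scale (of_real r) x = r *\<^sub>R x"
  by (rule l2_eqI) simp

lemma cinner_self: "cinner x x = of_real ((norm x)\<^sup>2)"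
proof -
  have "Im (cinner x x) = 0" using cinner_commute[of x x] by (metis complex_cnj_cancel_iff complex_is_Real_iff Reals_cnj_iff)
  moreover have "Re (cinner x x) = (norm x)\<^sup>2"
    by (simp add: power2_norm_eq_inner inner_l2_def)
  ultimately show ?thesis by (simp add: complex_eq_iff)
qed

lemma norm_l2_sums: "(\<lambda>n. (cmod (coord x n))\<^sup>2) sums ((norm x)\<^sup>2)"
proof -
  have "(\<lambda>n. Re (coord x n * cnj (coord x n))) sums Re (cinner x x)"
    by (rule sums_Re[OF cinner_sums])
  moreover have "Re (coord x n * cnj (coord x n)) = (cmod (coord x n))\<^sup>2" for n
    by (simp add: complex_mult_cnj cmod_power2)
  ultimately show ?thesis by (simp add: cinner_self del: of_real_power)
qed

lemma cinner_zero [simp]: "cinner 0 x = 0" "cinner x 0 = 0"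
  using cinner_scale_left[of 0 0 x] cinner_scale_right[of x 0 0]
  by (simp_all add: l2_scale_of_real[of 0, simplified])

lemma cinner_minus_left: "cinner (- x) z = - cinner x z"
  using cinner_scale_left[of "-1" x z] l2_scale_of_real[of "-1" x] by simp

lemma cinner_minus_right: "cinner z (- x) = - cinner z x"
  using cinner_scale_right[of z "-1" x] l2_scale_of_real[of "-1" x] by simp

lemma cinner_diff_left: "cinner (x - y) z = cinner x z - cinner y z"
  using cinner_add_left[of x "- y" z] by (simp add: cinner_minus_left)

lemma cinner_diff_right: "cinner z (x - y) = cinner z x - cinner z y"
  using cinner_add_right[of z x "- y"] by (simp add: cinner_minus_right)

lemma cinner_sum_left: "cinner (sum f A) z = (\<Sum>a\<in>A. cinner (f a) z)"
  by (induct A rule: infinite_finite_induct) (auto simp: cinner_add_left)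

text \<open>Multiplying x by a unimodular scalar makes the inner product real and nonnegative, so
  the real Cauchy-Schwarz inequality applies.\<close>

lemma cinner_bound: "cmod (cinner x y) \<le> norm x * norm y"
proof (cases "cinner x y = 0")
  case False
  define c where "c = cnj (cinner x y) / cmod (cinner x y)"
  have c: "cmod c = 1" using False by (simp add: c_def norm_divide)
  have "c * cinner x y = of_real (cmod (cinner x y))"
    using False complex_norm_square[of "cinner x y"] by (simp add: c_def power2_eq_square field_simps)
  then have "cinner (l2_scale c x) y = of_real (cmod (cinner x y))"
    by (simp add: cinner_scale_left)
  then have "cmod (cinner x y) = inner (l2_scale c x) y" by (simp add: inner_l2_def)
  also have "\<dots> \<le> norm (l2_scale c x) * norm y" by (rule norm_cauchy_schwarz)
  finally show ?thesis by (simp add: norm_l2_scale c)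
qed simp

lemma norm_coord_le: "cmod (coord x n) \<le> norm x"
proof -
  have "(cmod (coord x n))\<^sup>2 \<le> (norm x)\<^sup>2"
    using sum_le_suminf[OF summable_coord, of "{n}" x] norm_l2_sums[of x]
    by (simp add: sums_iff)
  then show ?thesis by (rule power2_le_imp_le) simp
qed

text \<open>The device for producing vectors from prescribed coordinates: \<open>Abs_l2\<close> is
  unspecified off the square-summable sequences, so the norm estimate is meaningful only through the
  first conclusion.\<close>

lemma l2_norm_bound:
  assumes "\<And>N. (\<Sum>n<N. (cmod (f n))\<^sup>2) \<le> C\<^sup>2" and "0 \<le> C"
  shows "summable (\<lambda>n. (cmod (f n))\<^sup>2)" "norm (Abs_l2 f) \<le> C"
proof -
  show s: "summable (\<lambda>n. (cmod (f n))\<^sup>2)"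
    by (rule bounded_imp_summable[where B = "C\<^sup>2"]) (simp, use assms(1) in \<open>metis lessThan_Suc_atMost\<close>)
  then have "coord (Abs_l2 f) = f" by (subst Abs_l2_inverse) auto
  then have "(norm (Abs_l2 f))\<^sup>2 = (\<Sum>n. (cmod (f n))\<^sup>2)"
    using norm_l2_sums[of "Abs_l2 f"] by (simp add: sums_iff)
  also have "\<dots> \<le> C\<^sup>2" by (rule suminf_le_const[OF s assms(1)])
  finally show "norm (Abs_l2 f) \<le> C" by (rule power2_le_imp_le) (rule assms)
qed

text \<open>Coordinates of a Cauchy sequence converge. The estimate on finitely many coordinates is
  uniform in their number, so it survives the limit and yields both membership in l2 and norm
  convergence.\<close>

instance l2 :: complete_space
proof
  fix X :: "nat \<Rightarrow> l2"
  assume X: "Cauchy X"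
  have "Cauchy (\<lambda>k. coord (X k) n)" for n
  proof (rule metric_CauchyI)
    fix e :: real assume "e > 0"
    then obtain M where "\<And>i j. i \<ge> M \<Longrightarrow> j \<ge> M \<Longrightarrow> dist (X i) (X j) < e"
      using X unfolding Cauchy_def by blast
    moreover have "dist (coord (X i) n) (coord (X j) n) \<le> dist (X i) (X j)" for i j
      using norm_coord_le[of "X i - X j" n] by (simp add: dist_norm)
    ultimately show "\<exists>M. \<forall>i\<ge>M. \<forall>j\<ge>M. dist (coord (X i) n) (coord (X j) n) < e"
      by (meson le_less_trans)
  qed
  then obtain c where c: "\<And>n. (\<lambda>k. coord (X k) n) \<longlonglongrightarrow> c n"
    unfolding Cauchy_convergent_iff convergent_def by metis
  \<comment> \<open>The second index of the Cauchy estimate goes to infinity while the truncation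
    stays fixed.\<close>
  have key: "\<exists>M. \<forall>i\<ge>M. \<forall>N. (\<Sum>n<N. (cmod (coord (X i) n - c n))\<^sup>2) \<le> e\<^sup>2" if "e > 0" for e :: real
  proof -
    obtain M where M: "\<And>i j. i \<ge> M \<Longrightarrow> j \<ge> M \<Longrightarrow> dist (X i) (X j) < e"
      using X \<open>e > 0\<close> unfolding Cauchy_def by blast
    have "(\<Sum>n<N. (cmod (coord (X i) n - c n))\<^sup>2) \<le> e\<^sup>2" if i: "i \<ge> M" for i N
    proof (rule LIMSEQ_le_const2)
      show "(\<lambda>j. \<Sum>n<N. (cmod (coord (X i) n - coord (X j) n))\<^sup>2) \<longlonglongrightarrow> (\<Sum>n<N. (cmod (coord (X i) n - c n))\<^sup>2)"
        by (intro tendsto_intros c)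
      have "(\<Sum>n<N. (cmod (coord (X i) n - coord (X j) n))\<^sup>2) \<le> e\<^sup>2" if "j \<ge> M" for j
      proof -
        have "(\<Sum>n<N. (cmod (coord (X i - X j) n))\<^sup>2) \<le> (norm (X i - X j))\<^sup>2"
          using sum_le_suminf[OF summable_coord, of "{..<N}" "X i - X j"] norm_l2_sums[of "X i - X j"]
          by (simp add: sums_iff)
        also have "\<dots> \<le> e\<^sup>2" using M[OF i that] by (intro power_mono) (auto simp: dist_norm)
        finally show ?thesis by simp
      qed
      then show "\<exists>N'. \<forall>j\<ge>N'. (\<Sum>n<N. (cmod (coord (X i) n - coord (X j) n))\<^sup>2) \<le> e\<^sup>2" by blast
    qed
    then show ?thesis by blast
  qed
  obtain M where M: "\<And>N. (\<Sum>n<N. (cmod (coord (X M) n - c n))\<^sup>2) \<le> 1\<^sup>2"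
    using key[of 1] by auto
  \<comment> \<open>The candidate limit is square summable as the difference of \<open>X M\<close>
    and a square-summable error.\<close>
  have "summable (\<lambda>n. (cmod (coord (X M) n - c n))\<^sup>2)" by (rule l2_norm_bound(1)[OF M]) simp
  then have "summable (\<lambda>n. (cmod (coord (X M) n + - (coord (X M) n - c n)))\<^sup>2)"
    by (intro summable_l2_add summable_coord) (simp add: norm_minus_commute)
  then have sc: "summable (\<lambda>n. (cmod (c n))\<^sup>2)" by simp
  have cc: "coord (Abs_l2 c) = c" by (subst Abs_l2_inverse) (use sc in auto)
  have "X \<longlonglongrightarrow> Abs_l2 c"
  proof (rule metric_LIMSEQ_I)
    fix r :: real assume "r > 0"
    then obtain M where M: "\<And>i N. i \<ge> M \<Longrightarrow> (\<Sum>n<N. (cmod (coord (X i) n - c n))\<^sup>2) \<le> (r/2)\<^sup>2"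
      using key[of "r/2"] by (meson half_gt_zero)
    have "dist (X i) (Abs_l2 c) < r" if "i \<ge> M" for i
    proof -
      have "coord (X i - Abs_l2 c) = (\<lambda>n. coord (X i) n - c n)" by (rule ext) (simp add: cc)
      then have "Abs_l2 (\<lambda>n. coord (X i) n - c n) = X i - Abs_l2 c"
        using coord_inverse[of "X i - Abs_l2 c"] by simp
      then have "norm (X i - Abs_l2 c) \<le> r/2"
        using l2_norm_bound(2)[OF M[OF that]] \<open>r > 0\<close> by simp
      then show ?thesis using \<open>r > 0\<close> by (simp add: dist_norm)
    qed
    then show "\<exists>M. \<forall>i\<ge>M. dist (X i) (Abs_l2 c) < r" by blast
  qed
  then show "convergent X" by (auto simp: convergent_def)
qed

instance l2 :: banach ..

section \<open>Unit vectors and truncations\<close>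

definition l2e :: "nat \<Rightarrow> l2" where
  "l2e n = Abs_l2 (\<lambda>m. if m = n then 1 else 0)"

lemma coord_l2e [simp]: "coord (l2e n) m = (if m = n then 1 else 0)"
proof -
  have "summable (\<lambda>m. (cmod (if m = n then 1 else 0 :: complex))\<^sup>2)"
    by (rule summable_finite[of "{n}"]) auto
  then show ?thesis unfolding l2e_def by (subst Abs_l2_inverse) auto
qed

lemma cinner_l2e_right [simp]: "cinner x (l2e n) = coord x n"
proof -
  have "(\<lambda>m. coord x m * cnj (coord (l2e n) m)) sums (\<Sum>m\<in>{n}. coord x m * cnj (coord (l2e n) m))"
    by (rule sums_finite) auto
  then show ?thesis using sums_unique2[OF cinner_sums] by fastforce
qed

lemma cinner_l2e_left [simp]: "cinner (l2e n) x = cnj (coord x n)"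
  by (subst cinner_commute) simp

lemma norm_l2e [simp]: "norm (l2e n) = 1"
proof -
  have "complex_of_real ((norm (l2e n))\<^sup>2) = of_real 1"
    using cinner_self[of "l2e n"] by simp
  then have "(norm (l2e n))\<^sup>2 = 1" unfolding of_real_eq_iff .
  then show ?thesis by (simp add: power2_eq_1_iff) (metis norm_ge_zero neg_0_le_iff_le not_one_le_zero)
qed

text \<open>The squared error is the tail of the norm series. This lets the adjoint relation be
  checked on unit vectors only.\<close>

lemma l2_truncation_tendsto: "(\<lambda>N. \<Sum>n<N. l2_scale (coord x n) (l2e n)) \<longlonglongrightarrow> x"
proof -
  let ?t = "\<lambda>N. \<Sum>n<N. l2_scale (coord x n) (l2e n)"
  have c: "coord (?t N) m = (if m < N then coord x m else 0)" for N m
  proof -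
    have "coord (?t N) m = (\<Sum>n<N. if n = m then coord x m else 0)"
      unfolding coord_sum by (rule sum.cong) auto
    then show ?thesis by simp
  qed
  have n: "(norm (x - ?t N))\<^sup>2 = (norm x)\<^sup>2 - (\<Sum>n<N. (cmod (coord x n))\<^sup>2)" for N
  proof -
    have "(\<lambda>n. (cmod (coord x n))\<^sup>2 - (if n < N then (cmod (coord x n))\<^sup>2 else 0)) sums
      ((norm x)\<^sup>2 - (\<Sum>n | n < N. (cmod (coord x n))\<^sup>2))"
      by (intro sums_diff norm_l2_sums sums_If_finite) simp
    moreover have "(\<lambda>n. (cmod (coord x n))\<^sup>2 - (if n < N then (cmod (coord x n))\<^sup>2 else 0))
       = (\<lambda>n. (cmod (coord (x - ?t N) n))\<^sup>2)"
      by (intro ext) (simp only: coord_simps c, simp)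
    ultimately have "(\<lambda>n. (cmod (coord (x - ?t N) n))\<^sup>2) sums ((norm x)\<^sup>2 - (\<Sum>n | n < N. (cmod (coord x n))\<^sup>2))"
      by simp
    from sums_unique2[OF norm_l2_sums this] show ?thesis by (simp add: lessThan_def)
  qed
  have "(\<lambda>N. (norm x)\<^sup>2 - (\<Sum>n<N. (cmod (coord x n))\<^sup>2)) \<longlonglongrightarrow> (norm x)\<^sup>2 - (norm x)\<^sup>2"
    by (intro tendsto_diff tendsto_const) (use norm_l2_sums in \<open>simp add: sums_def\<close>)
  then have "(\<lambda>N. (norm (x - ?t N))\<^sup>2) \<longlonglongrightarrow> 0" unfolding n by simp
  then have "(\<lambda>N. sqrt ((norm (x - ?t N))\<^sup>2)) \<longlonglongrightarrow> sqrt 0" by (rule tendsto_real_sqrt)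
  then have "(\<lambda>N. norm (?t N - x)) \<longlonglongrightarrow> 0" by (simp add: norm_minus_commute)
  then show ?thesis by (simp add: LIM_zero_iff tendsto_norm_zero_iff)
qed

section \<open>Bounded operators and their adjoints\<close>

abbreviation ap :: "bop \<Rightarrow> l2 \<Rightarrow> l2" where "ap A \<equiv> blinfun_apply (blin A)"

lemma ap_scale: "ap A (l2_scale c x) = l2_scale c (ap A x)"
  using blin[of A] by auto

lemma ap_simps [simp]:
  "ap (A + B) x = ap A x + ap B x" "ap (A - B) x = ap A x - ap B x" "ap (- A) x = - ap A x"
  "ap 0 x = 0" "ap 1 x = x" "ap (A * B) x = ap A (ap B x)" "ap (r *\<^sub>R A) x = r *\<^sub>R ap A x"
  "ap (bop_scale c A) x = l2_scale c (ap A x)"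
  by (simp_all add: plus_bop.rep_eq minus_bop.rep_eq uminus_bop.rep_eq zero_bop.rep_eq one_bop.rep_eq
      times_bop.rep_eq scaleR_bop.rep_eq bop_scale.rep_eq blinfun.add_left blinfun.diff_left
      blinfun.minus_left blinfun.scaleR_left bounded_linear_Blinfun_apply[OF bounded_linear_l2_scale])

lemma ap_sum: "ap A (sum f I) = (\<Sum>i\<in>I. ap A (f i))" by (simp add: blinfun.sum_right)

lemma ap_sum_left [simp]: "ap (sum f I) x = (\<Sum>i\<in>I. ap (f i) x)"
  by (induct I rule: infinite_finite_induct) auto

lemma bop_eqI: "(\<And>x. ap A x = ap B x) \<Longrightarrow> A = B"
  by (metis blin_inject blinfun_eqI)

lemma norm_ap: "norm (ap A x) \<le> norm A * norm x"
  by (simp add: norm_bop.rep_eq norm_blinfun)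

lemma norm_bop_bound: "0 \<le> C \<Longrightarrow> (\<And>x. norm (ap A x) \<le> C * norm x) \<Longrightarrow> norm A \<le> C"
  unfolding norm_bop.rep_eq by (rule norm_blinfun_bound)

lemma bop_exists:
  assumes "\<And>x y. f (x + y) = f x + f y" "\<And>c x. f (l2_scale c x) = l2_scale c (f x)"
    "\<And>x. norm (f x) \<le> norm x * K"
  shows "\<exists>A. \<forall>x. ap A x = f x"
proof -
  have bl: "bounded_linear f"
    by (rule bounded_linear_intro[where K = K]) (use assms assms(2)[of "of_real r" for r] in
        \<open>auto simp: l2_scale_of_real\<close>)
  then have "ap (Abs_bop (Blinfun f)) x = f x" for x
    by (subst Abs_bop_inverse) (auto simp: bounded_linear_Blinfun_apply assms)
  then show ?thesis by blast
qed

lemma tendsto_cinner_left: "(f \<longlongrightarrow> a) F \<Longrightarrow> ((\<lambda>n. cinner (f n) z) \<longlongrightarrow> cinner a z) F"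
proof -
  have "bounded_linear (\<lambda>x. cinner x z)"
    by (rule bounded_linear_intro[where K = "norm z"])
      (auto simp: cinner_add_left cinner_bound cinner_scale_left[of "of_real r" for r, unfolded l2_scale_of_real]
        scaleR_conv_of_real)
  then show "(f \<longlongrightarrow> a) F \<Longrightarrow> ?thesis" by (rule bounded_linear.tendsto)
qed

text \<open>The n-th coordinate of the adjoint at y has to be the pairing of y with the image of the
  n-th unit vector. Square summability of these numbers comes from testing against their own
  truncation.\<close>

lemma adjoint_exists: "\<exists>B. \<forall>x y. cinner (ap A x) y = cinner x (ap B y)"
proof -
  define b where "b y n = cinner y (ap A (l2e n))" for y n
  have bd: "(\<Sum>n<N. (cmod (b y n))\<^sup>2) \<le> (norm A * norm y)\<^sup>2" for y N
  proof -
    define x where "x = (\<Sum>n<N. l2_scale (b y n) (l2e n))"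
    let ?s = "\<Sum>n<N. (cmod (b y n))\<^sup>2"
    have cx: "coord x m = (if m < N then b y m else 0)" for m
    proof -
      have "coord x m = (\<Sum>n<N. if n = m then b y m else 0)"
        unfolding coord_sum x_def by (rule sum.cong) auto
      then show ?thesis by simp
    qed
    have "(\<lambda>n. (cmod (coord x n))\<^sup>2) sums (\<Sum>n<N. (cmod (coord x n))\<^sup>2)"
      by (rule sums_finite) (auto simp: cx)
    then have nx: "(norm x)\<^sup>2 = ?s"
      using sums_unique2[OF norm_l2_sums] by (simp add: cx)
    have "cinner (ap A x) y = (\<Sum>n<N. b y n * cinner (ap A (l2e n)) y)"
      by (simp add: x_def ap_sum cinner_sum_left ap_scale cinner_scale_left)
    also have "\<dots> = (\<Sum>n<N. of_real ((cmod (b y n))\<^sup>2))"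
      by (intro sum.cong refl) (metis b_def cinner_commute complex_norm_square of_real_power)
    also have "\<dots> = of_real ?s" by simp
    finally have "?s = cmod (cinner (ap A x) y)" 
      by (simp add: sum_nonneg del: of_real_sum)
    also have "\<dots> \<le> norm (ap A x) * norm y" by (rule cinner_bound)
    also have "\<dots> \<le> norm A * norm x * norm y" by (intro mult_right_mono norm_ap) simp
    finally have "(norm x)\<^sup>2 \<le> (norm A * norm y) * norm x" using nx by (simp add: ac_simps)
    then have "norm x \<le> norm A * norm y"
      by (cases "x = 0") (auto simp: power2_eq_square)
    then show ?thesis using nx by (metis norm_ge_zero power_mono)
  qed
  note bs = l2_norm_bound[OF bd mult_nonneg_nonneg[OF norm_ge_zero norm_ge_zero]]
  have cb: "coord (Abs_l2 (b y)) = b y" for y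
    by (subst Abs_l2_inverse) (use bs(1) in auto)
  have "\<exists>B. \<forall>y. ap B y = Abs_l2 (b y)"
  proof (rule bop_exists)
    show "Abs_l2 (b (x + y)) = Abs_l2 (b x) + Abs_l2 (b y)" for x y
      by (rule l2_eqI) (simp add: cb, simp add: b_def cinner_add_left)
    show "Abs_l2 (b (l2_scale c x)) = l2_scale c (Abs_l2 (b x))" for c x
      by (rule l2_eqI) (simp add: cb, simp add: b_def cinner_scale_left)
    show "norm (Abs_l2 (b y)) \<le> norm y * norm A" for y
      using bs(2)[of y] by (simp add: mult.commute)
  qed
  then obtain B where B: "\<And>y. ap B y = Abs_l2 (b y)" by blast
  have basis: "cinner (ap A (l2e n)) y = cinner (l2e n) (ap B y)" for n y
    by (simp add: B cb b_def cinner_commute[of _ y])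
  have "cinner (ap A x) y = cinner x (ap B y)" for x y
  proof (rule LIMSEQ_unique)
    let ?t = "\<lambda>N. \<Sum>n<N. l2_scale (coord x n) (l2e n)"
    have "(\<lambda>N. ap A (?t N)) \<longlonglongrightarrow> ap A x"
      by (intro blinfun.tendsto l2_truncation_tendsto tendsto_const)
    then show "(\<lambda>N. cinner (ap A (?t N)) y) \<longlonglongrightarrow> cinner (ap A x) y" by (rule tendsto_cinner_left)
    have "cinner (ap A (?t N)) y = cinner (?t N) (ap B y)" for N
      by (simp add: ap_sum cinner_sum_left ap_scale cinner_scale_left basis)
    then show "(\<lambda>N. cinner (ap A (?t N)) y) \<longlonglongrightarrow> cinner x (ap B y)"
      using tendsto_cinner_left[OF l2_truncation_tendsto] by simp
  qed
  then show ?thesis by blast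
qed

lemma cinner_ext: "(\<And>x. cinner x y = cinner x z) \<Longrightarrow> y = z"
  by (rule l2_eqI) (metis cinner_l2e_left complex_cnj_cancel_iff)

lemma bop_star_unique:
  assumes "\<And>x y. cinner (ap A x) y = cinner x (ap B y)"
  shows "bop_star A = B"
  unfolding bop_star_def
proof (rule the_equality)
  show "\<And>C. \<forall>x y. cinner (ap A x) y = cinner x (ap C y) \<Longrightarrow> C = B"
    by (rule bop_eqI, rule cinner_ext) (metis assms)
qed (use assms in blast)

lemma cinner_star: "cinner (ap A x) y = cinner x (ap (bop_star A) y)"
  using adjoint_exists[of A] bop_star_unique by metis

lemma cinner_star_left: "cinner (ap (bop_star A) x) y = cinner x (ap A y)"
  by (metis cinner_commute cinner_star)

lemma bop_star_star [simp]: "bop_star (bop_star A) = A"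
  by (rule bop_star_unique) (rule cinner_star_left)

lemma bop_star_add [simp]: "bop_star (A + B) = bop_star A + bop_star B"
  by (rule bop_star_unique) (simp add: cinner_add_left cinner_add_right cinner_star)

lemma bop_star_diff [simp]: "bop_star (A - B) = bop_star A - bop_star B"
  by (rule bop_star_unique) (simp add: cinner_diff_left cinner_diff_right cinner_star)

lemma bop_star_mult [simp]: "bop_star (A * B) = bop_star B * bop_star A"
  by (rule bop_star_unique) (simp add: cinner_star)

lemma bop_star_scale [simp]: "bop_star (bop_scale c A) = bop_scale (cnj c) (bop_star A)"
  by (rule bop_star_unique) (simp add: cinner_scale_left cinner_scale_right cinner_star)

lemma bop_star_zero [simp]: "bop_star 0 = 0"
  by (rule bop_star_unique) simp

lemma bop_star_sum [simp]: "bop_star (sum f I) = (\<Sum>i\<in>I. bop_star (f i))"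
  by (induct I rule: infinite_finite_induct) auto

text \<open>Estimating the squared norm of the adjoint at x by a pairing with x gives one
  inequality; the other is the same statement for the adjoint.\<close>

lemma norm_bop_star [simp]: "norm (bop_star A) = norm A"
proof -
  have le: "norm (bop_star A) \<le> norm A" for A
  proof (rule norm_bop_bound)
    fix x
    let ?z = "ap (bop_star A) x"
    have "(norm ?z)\<^sup>2 = cmod (cinner ?z ?z)" by (simp add: cinner_self norm_power)
    also have "\<dots> = cmod (cinner x (ap A ?z))" by (simp add: cinner_star_left)
    also have "\<dots> \<le> norm x * (norm A * norm ?z)"
      by (rule order_trans[OF cinner_bound]) (intro mult_left_mono norm_ap norm_ge_zero)
    finally have "norm ?z * norm ?z \<le> (norm A * norm x) * norm ?z"
      by (simp add: power2_eq_square ac_simps)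
    then show "norm ?z \<le> norm A * norm x" by (cases "?z = 0") auto
  qed simp
  from le[of A] le[of "bop_star A"] show ?thesis by simp
qed

lemma bop_scale_simps [simp]:
  "bop_scale c 0 = 0" "bop_scale 0 A = 0" "bop_scale 1 A = A"
  "bop_scale c (bop_scale d A) = bop_scale (c * d) A"
  "bop_scale c A * B = bop_scale c (A * B)" "A * bop_scale c B = bop_scale c (A * B)"
  "bop_scale (-1) A = - A"
  by (rule bop_eqI, rule l2_eqI, simp add: ap_scale mult.assoc)+

lemma bop_scale_add: "bop_scale c (A + B) = bop_scale c A + bop_scale c B"
  by (rule bop_eqI, rule l2_eqI, simp add: algebra_simps)

lemma bop_scale_add_left: "bop_scale (c + d) A = bop_scale c A + bop_scale d A"
  by (rule bop_eqI, rule l2_eqI, simp add: algebra_simps)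

lemma bop_scale_diff: "bop_scale c (A - B) = bop_scale c A - bop_scale c B"
  by (rule bop_eqI, rule l2_eqI, simp add: algebra_simps)

lemma bop_scale_sum: "bop_scale c (sum f I) = (\<Sum>i\<in>I. bop_scale c (f i))"
  by (induct I rule: infinite_finite_induct) (auto simp: bop_scale_add)

lemma bop_scale_sum_left: "bop_scale (sum f I) A = (\<Sum>i\<in>I. bop_scale (f i) A)"
  by (induct I rule: infinite_finite_induct) (auto simp: bop_scale_add_left)

lemma norm_bop_scale [simp]: "norm (bop_scale c A) = cmod c * norm A"
proof -
  have le: "norm (bop_scale c A) \<le> cmod c * norm A" for c A
    by (rule norm_bop_bound) (auto simp: norm_l2_scale mult.assoc intro!: mult_left_mono norm_ap)
  show ?thesis
  proof (cases "c = 0")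
    case False
    then have "A = bop_scale (inverse c) (bop_scale c A)" by simp
    then have "norm A \<le> cmod (inverse c) * norm (bop_scale c A)" by (metis le)
    then have "cmod c * norm A \<le> norm (bop_scale c A)" using False
      by (simp add: norm_inverse norm_divide divide_simps mult.commute)
    then show ?thesis using le[of c A] by simp
  qed simp
qed

text \<open>The limit is taken among real-linear bounded maps; complex homogeneity is inherited
  pointwise.\<close>

instance bop :: complete_space
proof
  fix X :: "nat \<Rightarrow> bop"
  assume "Cauchy X"
  moreover have "dist (blin A) (blin B) = dist A B" for A B
    by (simp add: dist_norm norm_bop.rep_eq minus_bop.rep_eq)
  ultimately have "Cauchy (\<lambda>n. blin (X n))" by (simp add: Cauchy_def)
  then obtain L where L: "(\<lambda>n. blin (X n)) \<longlonglongrightarrow> L"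
    by (meson Cauchy_convergent convergent_def)
  have ap_L: "(\<lambda>n. ap (X n) x) \<longlonglongrightarrow> L x" for x
    by (intro blinfun.tendsto L tendsto_const)
  have "L (l2_scale c x) = l2_scale c (L x)" for c x
  proof (rule LIMSEQ_unique)
    show "(\<lambda>n. ap (X n) (l2_scale c x)) \<longlonglongrightarrow> L (l2_scale c x)" by (rule ap_L)
    show "(\<lambda>n. ap (X n) (l2_scale c x)) \<longlonglongrightarrow> l2_scale c (L x)"
      unfolding ap_scale by (intro bounded_linear.tendsto[OF bounded_linear_l2_scale] ap_L)
  qed
  then have "blin (Abs_bop L) = L" by (intro Abs_bop_inverse) auto
  then have "dist (X n) (Abs_bop L) = dist (blin (X n)) L" for n
    by (simp add: dist_norm norm_bop.rep_eq minus_bop.rep_eq)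
  then have "X \<longlonglongrightarrow> Abs_bop L" using L by (simp add: tendsto_iff)
  then show "convergent X" by (auto simp: convergent_def)
qed

text \<open>The initial projection P is a self-adjoint idempotent, hence a contraction, and the
  squared norm of S x is the pairing of P x with x.\<close>

lemma norm_partial_isometry:
  assumes "S * bop_star S * S = S"
  shows "norm S \<le> 1"
proof (rule norm_bop_bound)
  fix x
  let ?P = "bop_star S * S"
  have P: "?P * ?P = ?P" using assms by (metis mult.assoc)
  have "(norm (ap ?P x))\<^sup>2 = cmod (cinner (ap ?P x) (ap ?P x))"
    by (simp add: cinner_self norm_power)
  also have "\<dots> = cmod (cinner (ap (?P * ?P) x) x)"
    by (simp add: cinner_star_left cinner_star)
  also have "\<dots> \<le> norm (ap ?P x) * norm x" unfolding P by (rule cinner_bound)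
  finally have Px: "norm (ap ?P x) \<le> norm x"
    by (cases "ap ?P x = 0") (auto simp: power2_eq_square)
  have "(norm (ap S x))\<^sup>2 = cmod (cinner (ap S x) (ap S x))"
    by (simp add: cinner_self norm_power)
  also have "\<dots> = cmod (cinner (ap ?P x) x)" by (simp add: cinner_star_left)
  also have "\<dots> \<le> norm (ap ?P x) * norm x" by (rule cinner_bound)
  also have "\<dots> \<le> norm x * norm x" by (intro mult_right_mono Px) simp
  also have "\<dots> = (norm x)\<^sup>2" by (simp add: power2_eq_square)
  finally have "norm (ap S x) \<le> norm x" by (rule power2_le_imp_le) simp
  then show "norm (ap S x) \<le> 1 * norm x" by simp
qed simp

section \<open>The category of a higher-rank graph\<close>

lemma path_rng_append: "path_rng G (v, xs @ ys) = path_rng G (path_rng G (v, ys), xs)"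
  by (cases xs) auto

lemma is_path_append:
  "is_path G (v, xs @ ys) \<longleftrightarrow> is_path G (v, ys) \<and> is_path G (path_rng G (v, ys), xs)"
  by (induct xs) (auto simp: path_rng_append)

lemma path_comp_simps:
  assumes "path_src p = path_rng G q"
  shows "path_rng G (path_comp p q) = path_rng G p" "path_src (path_comp p q) = path_src q"
    "path_comp p q \<in> paths G \<longleftrightarrow> p \<in> paths G \<and> q \<in> paths G"
  using assms by (cases p; cases q; auto simp: path_comp_def path_src_def paths_def path_rng_append is_path_append)+

lemma path_deg_comp: "path_deg G (path_comp p q) = path_deg G p + path_deg G q"
  by (auto simp: path_deg_def path_comp_def)

lemma path_comp_assoc: "path_comp (path_comp p q) r = path_comp p (path_comp q r)"
  by (simp add: path_comp_def)

lemma path_deg_0_iff: "path_deg G p = 0 \<longleftrightarrow> snd p = []"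
proof
  assume "path_deg G p = 0"
  then have "count_list (map (colour G) (snd p)) i = 0" for i
    by (auto simp: path_deg_def fun_eq_iff)
  then have "set (map (colour G) (snd p)) = {}" by (metis count_list_0_iff equals0I)
  then show "snd p = []" by simp
qed (auto simp: path_deg_def)

context finite_hrg
begin

abbreviation LD :: "(nat \<Rightarrow> nat) \<Rightarrow> ('v, 'e) mor set" where
  "LD n \<equiv> {\<mu>. \<mu> \<in> Lam G \<and> mdeg G \<mu> = n}"

abbreviation cls :: "('v, 'e) path \<Rightarrow> ('v, 'e) mor" where
  "cls p \<equiv> sim G `` {p}"

section \<open>Morphisms as classes of paths\<close>

lemma sim_refl: "p \<in> paths G \<Longrightarrow> (p, p) \<in> sim G"
  using sim_equiv by (meson equivE refl_onD)

lemma sim_sym: "(p, q) \<in> sim G \<Longrightarrow> (q, p) \<in> sim G"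
  using sim_equiv by (meson equivE symE)

lemma sim_paths: "(p, q) \<in> sim G \<Longrightarrow> p \<in> paths G \<and> q \<in> paths G"
  using sim_equiv by (auto simp: equiv_def refl_on_def)

lemma cls_eqI: "(p, q) \<in> sim G \<Longrightarrow> cls p = cls q"
  by (rule equiv_class_eq[OF sim_equiv])

lemma cls_in [simp]: "p \<in> paths G \<Longrightarrow> cls p \<in> Lam G"
  by (simp add: Lam_def quotientI)

lemma rep_cls: assumes "p \<in> paths G" shows "(p, rep (cls p)) \<in> sim G"
proof -
  have "p \<in> cls p" using assms sim_refl by auto
  then have "rep (cls p) \<in> cls p" unfolding rep_def by (rule someI)
  then show ?thesis by auto
qed

lemma rep_path: assumes "\<mu> \<in> Lam G" shows "rep \<mu> \<in> paths G" "cls (rep \<mu>) = \<mu>"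
proof -
  obtain p where p: "p \<in> paths G" "\<mu> = cls p"
    using assms by (auto simp: Lam_def elim: quotientE)
  then show "rep \<mu> \<in> paths G" "cls (rep \<mu>) = \<mu>"
    using rep_cls sim_paths cls_eqI by metis+
qed

lemma cls_simps:
  assumes "p \<in> paths G"
  shows "msrc (cls p) = path_src p" "mrng G (cls p) = path_rng G p" "mdeg G (cls p) = path_deg G p"
  using sim_invariants[OF rep_cls[OF assms]] by (auto simp: msrc_def mrng_def mdeg_def)

lemma mcomp_cls:
  assumes "p \<in> paths G" "q \<in> paths G" "path_src p = path_rng G q"
  shows "mcomp G (cls p) (cls q) = cls (path_comp p q)"
  unfolding mcomp_def
  by (rule cls_eqI, rule sim_sym, rule sim_comp[OF rep_cls[OF assms(1)] rep_cls[OF assms(2)] assms(3)])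

lemma mcomp_in [simp]:
  assumes "\<mu> \<in> Lam G" "\<nu> \<in> Lam G" "msrc \<mu> = mrng G \<nu>"
  shows "mcomp G \<mu> \<nu> \<in> Lam G" "msrc (mcomp G \<mu> \<nu>) = msrc \<nu>" "mrng G (mcomp G \<mu> \<nu>) = mrng G \<mu>"
    "mdeg G (mcomp G \<mu> \<nu>) = mdeg G \<mu> + mdeg G \<nu>"
proof -
  have *: "path_src (rep \<mu>) = path_rng G (rep \<nu>)" using assms by (simp add: msrc_def mrng_def)
  note p = path_comp_simps[OF *]
  have "path_comp (rep \<mu>) (rep \<nu>) \<in> paths G" using p rep_path assms by auto
  then show "mcomp G \<mu> \<nu> \<in> Lam G" "msrc (mcomp G \<mu> \<nu>) = msrc \<nu>" "mrng G (mcomp G \<mu> \<nu>) = mrng G \<mu>"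
    "mdeg G (mcomp G \<mu> \<nu>) = mdeg G \<mu> + mdeg G \<nu>"
    using p by (auto simp: mcomp_def cls_simps path_deg_comp) (auto simp: msrc_def mrng_def mdeg_def)
qed

lemma mcomp_assoc:
  assumes "\<mu> \<in> Lam G" "\<nu> \<in> Lam G" "\<xi> \<in> Lam G" "msrc \<mu> = mrng G \<nu>" "msrc \<nu> = mrng G \<xi>"
  shows "mcomp G (mcomp G \<mu> \<nu>) \<xi> = mcomp G \<mu> (mcomp G \<nu> \<xi>)"
proof -
  obtain p q r where "p \<in> paths G" "q \<in> paths G" "r \<in> paths G" "\<mu> = cls p" "\<nu> = cls q" "\<xi> = cls r"
    using assms rep_path by metis
  then show ?thesis using assms
    by (simp add: mcomp_cls cls_simps path_comp_simps path_comp_assoc)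
qed

lemma vert_simps [simp]:
  "vert G v \<in> Lam G" "msrc (vert G v) = v" "mrng G (vert G v) = v" "mdeg G (vert G v) = 0"
proof -
  have "(v, []) \<in> paths G" by (simp add: paths_def)
  then show "vert G v \<in> Lam G" "msrc (vert G v) = v" "mrng G (vert G v) = v" "mdeg G (vert G v) = 0"
    by (auto simp: vert_def cls_simps path_src_def path_deg_0_iff)
qed

lemma mcomp_vert [simp]:
  assumes "\<mu> \<in> Lam G"
  shows "mcomp G (vert G (mrng G \<mu>)) \<mu> = \<mu>" "mcomp G \<mu> (vert G (msrc \<mu>)) = \<mu>"
proof -
  have v: "(v, []) \<in> paths G" for v by (simp add: paths_def)
  show "mcomp G (vert G (mrng G \<mu>)) \<mu> = \<mu>"
    using mcomp_cls[OF v rep_path(1)[OF assms], of "mrng G \<mu>"]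
    by (simp add: rep_path assms vert_def path_comp_def path_src_def mrng_def)
  show "mcomp G \<mu> (vert G (msrc \<mu>)) = \<mu>"
    using mcomp_cls[OF rep_path(1)[OF assms] v, of "msrc \<mu>"]
    by (simp add: rep_path assms vert_def path_comp_def path_src_def msrc_def)
qed

lemma mdeg_0_vert: assumes "\<mu> \<in> Lam G" "mdeg G \<mu> = 0" shows "\<mu> = vert G (msrc \<mu>)" "mrng G \<mu> = msrc \<mu>"
proof -
  have "snd (rep \<mu>) = []" using assms by (simp add: mdeg_def path_deg_0_iff)
  then have "rep \<mu> = (msrc \<mu>, [])" by (cases "rep \<mu>") (simp add: msrc_def path_src_def)
  then show "\<mu> = vert G (msrc \<mu>)" using rep_path(2)[OF assms(1)] by (simp add: vert_def)
  then show "mrng G \<mu> = msrc \<mu>" by (metis vert_simps(3))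
qed

section \<open>Unique factorization\<close>

lemma factor_ex:
  assumes "\<xi> \<in> Lam G" "mdeg G \<xi> = m + n"
  obtains \<mu> \<nu> where "\<mu> \<in> Lam G" "\<nu> \<in> Lam G" "mdeg G \<mu> = m" "mdeg G \<nu> = n" "msrc \<mu> = mrng G \<nu>"
    "\<xi> = mcomp G \<mu> \<nu>"
proof -
  \<comment> \<open>The factorization axiom assigns the second summand of the degree to the first
    factor, so the summands are exchanged.\<close>
  have "path_deg G (rep \<xi>) = n + m" using assms by (simp add: mdeg_def add.commute)
  then obtain p q where f: "factorization G (rep \<xi>) m n p q"
    using factorization_exists[OF rep_path(1)[OF assms(1)]] by blast
  then have "mcomp G (cls p) (cls q) = \<xi>"
    using mcomp_cls cls_eqI rep_path(2)[OF assms(1)] unfolding factorization_def by metis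
  then show ?thesis using f that[of "cls p" "cls q"] by (auto simp: factorization_def cls_simps)
qed

text \<open>Unique factorization as joint cancellation: equal degrees of the left factors force
  equal degrees of the right ones, so both pairs factorize one and the same path.\<close>

lemma mcomp_cancel:
  assumes L: "\<mu> \<in> Lam G" "\<nu> \<in> Lam G" "\<mu>' \<in> Lam G" "\<nu>' \<in> Lam G"
    and s: "msrc \<mu> = mrng G \<nu>" "msrc \<mu>' = mrng G \<nu>'"
    and eq: "mcomp G \<mu> \<nu> = mcomp G \<mu>' \<nu>'" and d: "mdeg G \<mu> = mdeg G \<mu>'"
  shows "\<mu> = \<mu>' \<and> \<nu> = \<nu>'"
proof -
  have "mdeg G \<mu> + mdeg G \<nu> = mdeg G \<mu>' + mdeg G \<nu>'"
    using mcomp_in(4)[OF L(1,2) s(1)] mcomp_in(4)[OF L(3,4) s(2)] eq by simp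
  then have d': "mdeg G \<nu> = mdeg G \<nu>'" using d by (simp add: fun_eq_iff)
  define l where "l = path_comp (rep \<mu>) (rep \<nu>)"
  have st: "path_src (rep \<mu>) = path_rng G (rep \<nu>)" "path_src (rep \<mu>') = path_rng G (rep \<nu>')"
    using s by (auto simp: msrc_def mrng_def)
  have l: "l \<in> paths G" using path_comp_simps(3)[OF st(1)] rep_path L by (simp add: l_def)
  have l': "path_comp (rep \<mu>') (rep \<nu>') \<in> paths G"
    using path_comp_simps(3)[OF st(2)] rep_path L by simp
  have c: "cls (path_comp (rep \<mu>) (rep \<nu>)) = cls (path_comp (rep \<mu>') (rep \<nu>'))"
    using eq by (simp add: mcomp_def)
  then have sim: "(l, path_comp (rep \<mu>') (rep \<nu>')) \<in> sim G"
    using eq_equiv_class_iff[OF sim_equiv] l l' by (simp add: l_def)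
  have "path_deg G l = mdeg G \<nu> + mdeg G \<mu>"
    by (simp add: l_def path_deg_comp mdeg_def add.commute)
  moreover have "factorization G l (mdeg G \<mu>) (mdeg G \<nu>) (rep \<mu>) (rep \<nu>)"
    using st path_comp_simps[OF st(1)] l L rep_path sim_refl
    by (auto simp: factorization_def l_def mdeg_def)
  moreover have "factorization G l (mdeg G \<mu>) (mdeg G \<nu>) (rep \<mu>') (rep \<nu>')"
    using st path_comp_simps[OF st(2)] l L rep_path sim sim_invariants[OF sim] d d'
    by (auto simp: factorization_def mdeg_def)
  ultimately have "(rep \<mu>, rep \<mu>') \<in> sim G \<and> (rep \<nu>, rep \<nu>') \<in> sim G"
    using factorization_unique[OF l] by blast
  then show ?thesis using cls_eqI rep_path(2) L by metis
qed

lemma length_path_deg: "p \<in> paths G \<Longrightarrow> length (snd p) = (\<Sum>i\<in>{1..ncolours G}. path_deg G p i)"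
proof -
  have "is_path G (v, es) \<Longrightarrow> length es = (\<Sum>i\<in>{1..ncolours G}. count_list (map (colour G) es) i)" for v es
  proof (induct es)
    case (Cons e es)
    then have "colour G e \<in> {1..ncolours G}" using colour_edges by auto
    then have "(\<Sum>i\<in>{1..ncolours G}. if colour G e = i then 1 else 0) = (1::nat)" by simp
    moreover have "(\<Sum>i\<in>{1..ncolours G}. count_list (map (colour G) (e # es)) i) =
      (\<Sum>i\<in>{1..ncolours G}. count_list (map (colour G) es) i + (if colour G e = i then 1 else 0))"
      by (intro sum.cong) auto
    ultimately show ?case using Cons by (simp add: sum.distrib)
  qed simp
  then show "p \<in> paths G \<Longrightarrow> ?thesis" by (cases p) (auto simp: paths_def path_deg_def)
qed

lemma path_edges: "p \<in> paths G \<Longrightarrow> set (snd p) \<subseteq> edges G"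
proof -
  have "is_path G (v, es) \<Longrightarrow> set es \<subseteq> edges G" for v es by (induct es) auto
  then show "p \<in> paths G \<Longrightarrow> ?thesis" by (cases p) (auto simp: paths_def)
qed

text \<open>A degree fixes the length of a path, and a finite edge set has finitely many words of a
  given length.\<close>

lemma finite_LD [simp]: "finite (LD n)"
proof (rule finite_subset)
  let ?k = "\<Sum>i\<in>{1..ncolours G}. n i"
  show "LD n \<subseteq> cls ` (UNIV \<times> {es. set es \<subseteq> edges G \<and> length es = ?k})"
  proof
    fix \<mu> assume \<mu>: "\<mu> \<in> LD n"
    then have "path_deg G (rep \<mu>) = n" by (simp add: mdeg_def)
    then have "rep \<mu> \<in> UNIV \<times> {es. set es \<subseteq> edges G \<and> length es = ?k}"
      using \<mu> rep_path(1)[of \<mu>] length_path_deg[of "rep \<mu>"] path_edges[of "rep \<mu>"]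
      by (cases "rep \<mu>") auto
    then show "\<mu> \<in> cls ` (UNIV \<times> {es. set es \<subseteq> edges G \<and> length es = ?k})"
      using \<mu> rep_path(2)[of \<mu>, symmetric] by (intro image_eqI[where x = "rep \<mu>"]) auto
  qed
  show "finite (cls ` (UNIV \<times> {es. set es \<subseteq> edges G \<and> length es = ?k}))"
    by (intro finite_imageI finite_cartesian_product finite_lists_length_eq finite_edges) simp
qed

text \<open>Allows the morphisms to index an orthonormal family of l2, on which the Fock
  representation acts.\<close>

lemma countable_Lam: "countable (Lam G)"
proof (rule countable_subset)
  show "Lam G \<subseteq> cls ` (UNIV \<times> lists (edges G))"
  proof
    fix \<mu> assume \<mu>: "\<mu> \<in> Lam G"
    then have "rep \<mu> \<in> UNIV \<times> lists (edges G)"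
      using rep_path(1)[OF \<mu>] path_edges[of "rep \<mu>"] by (cases "rep \<mu>") auto
    then show "\<mu> \<in> cls ` (UNIV \<times> lists (edges G))" using rep_path(2)[OF \<mu>, symmetric] by (intro image_eqI[where x = "rep \<mu>"]) auto
  qed
  show "countable (cls ` (UNIV \<times> lists (edges G)))"
    by (intro countable_image countable_SIGMA countable_lists countable_finite finite_edges) simp
qed

text \<open>Degrees are functions on all natural numbers; because of this, two degrees that differ
  do so at an actual colour.\<close>

lemma mdeg_support: "\<mu> \<in> Lam G \<Longrightarrow> i \<notin> {1..ncolours G} \<Longrightarrow> mdeg G \<mu> i = 0"
proof -
  assume \<mu>: "\<mu> \<in> Lam G" and i: "i \<notin> {1..ncolours G}"
  then have "i \<notin> set (map (colour G) (snd (rep \<mu>)))"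
    using path_edges[OF rep_path(1)[OF \<mu>]] colour_edges
    by (metis (no_types, lifting) image_iff image_subset_iff list.set_map subset_iff)
  then show ?thesis by (simp add: mdeg_def path_deg_def)
qed

lemma mlen_comp:
  assumes "\<mu> \<in> Lam G" "\<nu> \<in> Lam G" "msrc \<mu> = mrng G \<nu>"
  shows "mlen G (mcomp G \<mu> \<nu>) = mlen G \<mu> + mlen G \<nu>"
  using assms by (simp add: mlen_def sum.distrib)

lemma mlen_vert [simp]: "mlen G (vert G v) = 0"
  by (simp add: mlen_def)

lemma edge_cls:
  assumes "e \<in> edges G"
  defines "\<mu> \<equiv> cls (src G e, [e])"
  shows "\<mu> \<in> Lam G" "msrc \<mu> = src G e" "mrng G \<mu> = rng G e" "mdeg G \<mu> = unit_deg (colour G e)"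
proof -
  have "(src G e, [e]) \<in> paths G" using assms by (simp add: paths_def)
  then show "\<mu> \<in> Lam G" "msrc \<mu> = src G e" "mrng G \<mu> = rng G e" "mdeg G \<mu> = unit_deg (colour G e)"
    by (auto simp: \<mu>_def cls_simps path_src_def path_deg_def unit_deg_def fun_eq_iff)
qed

lemma forward_Lam: "forward G v = {w. \<exists>\<mu>\<in>Lam G. msrc \<mu> = v \<and> mrng G \<mu> = w}"
proof -
  have "(\<exists>p\<in>paths G. path_src p = v \<and> path_rng G p = w) \<longleftrightarrow> (\<exists>\<mu>\<in>Lam G. msrc \<mu> = v \<and> mrng G \<mu> = w)" for w
    using cls_in cls_simps rep_path by (metis msrc_def mrng_def)
  then show ?thesis by (simp add: forward_def)
qed

section \<open>Minimal common extensions\<close>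

lemma Lam_min_iff:
  "(\<alpha>, \<alpha>') \<in> Lam_min G \<kappa> \<mu> \<longleftrightarrow> \<alpha> \<in> Lam G \<and> \<alpha>' \<in> Lam G \<and> msrc \<kappa> = mrng G \<alpha> \<and> msrc \<mu> = mrng G \<alpha>' \<and>
    mcomp G \<kappa> \<alpha> = mcomp G \<mu> \<alpha>' \<and> mdeg G (mcomp G \<kappa> \<alpha>) = (\<lambda>i. max (mdeg G \<kappa> i) (mdeg G \<mu> i))"
  by (simp add: Lam_min_def)

lemma finite_Lam_min [simp]:
  assumes "\<kappa> \<in> Lam G" "\<mu> \<in> Lam G" shows "finite (Lam_min G \<kappa> \<mu>)"
proof (rule finite_subset)
  let ?m = "\<lambda>i. max (mdeg G \<kappa> i) (mdeg G \<mu> i)"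
  show "Lam_min G \<kappa> \<mu> \<subseteq> LD (\<lambda>i. ?m i - mdeg G \<kappa> i) \<times> LD (\<lambda>i. ?m i - mdeg G \<mu> i)"
  proof (rule subrelI)
    fix \<alpha> \<alpha>' assume "(\<alpha>, \<alpha>') \<in> Lam_min G \<kappa> \<mu>"
    then have a: "\<alpha> \<in> Lam G" "\<alpha>' \<in> Lam G" and d: "mdeg G \<kappa> + mdeg G \<alpha> = ?m" "mdeg G \<mu> + mdeg G \<alpha>' = ?m"
      unfolding Lam_min_iff using assms mcomp_in(4) by metis+
    have "mdeg G \<alpha> i = ?m i - mdeg G \<kappa> i" "mdeg G \<alpha>' i = ?m i - mdeg G \<mu> i" for i
      using fun_cong[OF d(1), of i] fun_cong[OF d(2), of i] by simp_all
    then show "(\<alpha>, \<alpha>') \<in> LD (\<lambda>i. ?m i - mdeg G \<kappa> i) \<times> LD (\<lambda>i. ?m i - mdeg G \<mu> i)"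
      using a by auto
  qed
  show "finite (LD (\<lambda>i. ?m i - mdeg G \<kappa> i) \<times> LD (\<lambda>i. ?m i - mdeg G \<mu> i))" by simp
qed

text \<open>An extension to the join of two equal degrees adds nothing, so the extending factors are
  vertices and cancellation identifies the two paths.\<close>

lemma Lam_min_same_deg:
  assumes "\<kappa> \<in> Lam G" "\<mu> \<in> Lam G" "mdeg G \<kappa> = mdeg G \<mu>"
  shows "Lam_min G \<kappa> \<mu> = (if \<kappa> = \<mu> then {(vert G (msrc \<mu>), vert G (msrc \<mu>))} else {})"
proof -
  have *: "\<kappa> = \<mu> \<and> \<alpha> = vert G (msrc \<mu>) \<and> \<alpha>' = vert G (msrc \<mu>)" if m: "(\<alpha>, \<alpha>') \<in> Lam_min G \<kappa> \<mu>" for \<alpha> \<alpha>'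
  proof -
    have a: "\<alpha> \<in> Lam G" "\<alpha>' \<in> Lam G" "msrc \<kappa> = mrng G \<alpha>" "msrc \<mu> = mrng G \<alpha>'" "mcomp G \<kappa> \<alpha> = mcomp G \<mu> \<alpha>'"
      and d: "mdeg G \<kappa> + mdeg G \<alpha> = mdeg G \<kappa>"
      using m assms unfolding Lam_min_iff by (auto simp: fun_eq_iff)
    have "mdeg G \<alpha> = 0" using d by simp
    moreover have "\<kappa> = \<mu> \<and> \<alpha> = \<alpha>'" using mcomp_cancel[of \<kappa> \<alpha> \<mu> \<alpha>'] a assms by auto
    ultimately show ?thesis using mdeg_0_vert[of \<alpha>] a by metis
  qed
  have v: "(vert G (msrc \<mu>), vert G (msrc \<mu>)) \<in> Lam_min G \<mu> \<mu>"
    unfolding Lam_min_iff mcomp_vert(2)[OF assms(2)] by (simp add: assms(2))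
  have sub: "Lam_min G \<kappa> \<mu> \<subseteq> {(vert G (msrc \<mu>), vert G (msrc \<mu>))}"
  proof (rule subrelI)
    show "(a, b) \<in> {(vert G (msrc \<mu>), vert G (msrc \<mu>))}" if "(a, b) \<in> Lam_min G \<kappa> \<mu>" for a b
      using *[OF that] by simp
  qed
  show ?thesis
  proof (cases "\<kappa> = \<mu>")
    case True
    have "Lam_min G \<kappa> \<mu> = {(vert G (msrc \<mu>), vert G (msrc \<mu>))}"
      using sub v unfolding True by blast
    then show ?thesis unfolding True by simp
  next
    case False
    then have "Lam_min G \<kappa> \<mu> \<subseteq> {}" using *[of "fst x" "snd x" for x] by (metis (no_types, lifting) prod.collapse subsetI)
    then show ?thesis using False by simp
  qed
qed

text \<open>Cut the common extension at the join of the two degrees: the left factor is a minimal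
  common extension, and the remainder \<eta> is shared by both sides.\<close>

lemma common_extension:
  assumes L: "\<kappa> \<in> Lam G" "\<mu> \<in> Lam G" "\<xi> \<in> Lam G" "\<zeta> \<in> Lam G"
    and s: "msrc \<kappa> = mrng G \<xi>" "msrc \<mu> = mrng G \<zeta>" and eq: "mcomp G \<kappa> \<xi> = mcomp G \<mu> \<zeta>"
  obtains \<alpha> \<alpha>' \<eta> where "(\<alpha>, \<alpha>') \<in> Lam_min G \<kappa> \<mu>" "\<eta> \<in> Lam G" "msrc \<alpha> = mrng G \<eta>" "msrc \<alpha>' = mrng G \<eta>"
    "\<xi> = mcomp G \<alpha> \<eta>" "\<zeta> = mcomp G \<alpha>' \<eta>"
proof -
  let ?m = "\<lambda>i. max (mdeg G \<kappa> i) (mdeg G \<mu> i)" and ?x = "mcomp G \<kappa> \<xi>"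
  have x: "?x \<in> Lam G" "mdeg G ?x = mdeg G \<kappa> + mdeg G \<xi>" "mdeg G ?x = mdeg G \<mu> + mdeg G \<zeta>"
    using mcomp_in(4)[OF L(1,3) s(1)] mcomp_in(4)[OF L(2,4) s(2)] mcomp_in(1)[OF L(1,3) s(1)] eq by simp_all
  then have "mdeg G \<kappa> i + mdeg G \<xi> i = mdeg G \<mu> i + mdeg G \<zeta> i" for i by (metis plus_fun_apply)
  then have le: "max (mdeg G \<kappa> i) (mdeg G \<mu> i) \<le> mdeg G \<kappa> i + mdeg G \<xi> i" for i
    by (metis le_add1 max.bounded_iff)
  have "mdeg G ?x = ?m + (\<lambda>i. mdeg G ?x i - ?m i)"
    by (rule ext) (use le in \<open>simp add: x(2)\<close>)
  then obtain \<rho> \<eta> where e: "\<rho> \<in> Lam G" "\<eta> \<in> Lam G" "mdeg G \<rho> = ?m"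
      "mdeg G \<eta> = (\<lambda>i. mdeg G ?x i - ?m i)" "msrc \<rho> = mrng G \<eta>" "?x = mcomp G \<rho> \<eta>"
    by (rule factor_ex[OF x(1)])
  \<comment> \<open>Used for both \<kappa> and \<mu>: factor \<rho> with a left factor of the degree
    of \<nu>, and cancel in the long path to see that this factor is \<nu>.\<close>
  have k: "\<exists>\<alpha>. \<alpha> \<in> Lam G \<and> msrc \<nu> = mrng G \<alpha> \<and> \<rho> = mcomp G \<nu> \<alpha> \<and> msrc \<alpha> = mrng G \<eta> \<and> \<zeta> = mcomp G \<alpha> \<eta>"
    if \<nu>: "\<nu> \<in> Lam G" "\<zeta> \<in> Lam G" "msrc \<nu> = mrng G \<zeta>" "?x = mcomp G \<nu> \<zeta>" "\<And>i. mdeg G \<nu> i \<le> ?m i" for \<nu> \<zeta>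
  proof -
    have "mdeg G \<rho> = mdeg G \<nu> + (\<lambda>i. ?m i - mdeg G \<nu> i)"
      unfolding e(3) by (rule ext) (use \<nu>(5) in simp)
    then obtain \<nu>' \<alpha> where f: "\<nu>' \<in> Lam G" "\<alpha> \<in> Lam G" "mdeg G \<nu>' = mdeg G \<nu>"
        "mdeg G \<alpha> = (\<lambda>i. ?m i - mdeg G \<nu> i)" "msrc \<nu>' = mrng G \<alpha>" "\<rho> = mcomp G \<nu>' \<alpha>"
      by (rule factor_ex[OF e(1)])
    have s\<alpha>: "msrc \<alpha> = mrng G \<eta>" using f e by auto
    have "mcomp G \<nu> \<zeta> = mcomp G \<nu>' (mcomp G \<alpha> \<eta>)"
      using \<nu> e f s\<alpha> mcomp_assoc by metis
    then have "\<nu> = \<nu>' \<and> \<zeta> = mcomp G \<alpha> \<eta>"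
      using \<nu> f e s\<alpha> by (intro mcomp_cancel) auto
    then show ?thesis using f s\<alpha> by auto
  qed
  obtain \<alpha> where a: "\<alpha> \<in> Lam G" "msrc \<kappa> = mrng G \<alpha>" "\<rho> = mcomp G \<kappa> \<alpha>" "msrc \<alpha> = mrng G \<eta>" "\<xi> = mcomp G \<alpha> \<eta>"
    using k[of \<kappa> \<xi>] L s by auto
  obtain \<alpha>' where a': "\<alpha>' \<in> Lam G" "msrc \<mu> = mrng G \<alpha>'" "\<rho> = mcomp G \<mu> \<alpha>'" "msrc \<alpha>' = mrng G \<eta>" "\<zeta> = mcomp G \<alpha>' \<eta>"
    using k[of \<mu> \<zeta>] L s eq by auto
  have "(\<alpha>, \<alpha>') \<in> Lam_min G \<kappa> \<mu>" unfolding Lam_min_iff using a(1,2) a'(1,2) e(3) by (simp only: flip: a(3) a'(3))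
  then show ?thesis by (rule that) (use a a' e in simp_all)
qed

text \<open>All minimal extensions have the same degree, so \<alpha>' and \<beta>' have equal
  degrees and cancellation applies. This isolates the single surviving term of the Fock
  relation.\<close>

lemma Lam_min_unique:
  assumes L: "\<kappa> \<in> Lam G" "\<mu> \<in> Lam G" and m: "(\<alpha>, \<alpha>') \<in> Lam_min G \<kappa> \<mu>" "(\<beta>, \<beta>') \<in> Lam_min G \<kappa> \<mu>"
    and h: "\<eta> \<in> Lam G" "\<theta> \<in> Lam G" "msrc \<alpha>' = mrng G \<eta>" "msrc \<beta>' = mrng G \<theta>" "mcomp G \<alpha>' \<eta> = mcomp G \<beta>' \<theta>"
  shows "\<alpha> = \<beta> \<and> \<alpha>' = \<beta>' \<and> \<eta> = \<theta>"
proof -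
  have a: "\<alpha> \<in> Lam G" "\<alpha>' \<in> Lam G" "msrc \<kappa> = mrng G \<alpha>" "msrc \<mu> = mrng G \<alpha>'" "mcomp G \<kappa> \<alpha> = mcomp G \<mu> \<alpha>'"
    and b: "\<beta> \<in> Lam G" "\<beta>' \<in> Lam G" "msrc \<kappa> = mrng G \<beta>" "msrc \<mu> = mrng G \<beta>'" "mcomp G \<kappa> \<beta> = mcomp G \<mu> \<beta>'"
    and d: "mdeg G (mcomp G \<kappa> \<alpha>) = mdeg G (mcomp G \<kappa> \<beta>)"
    using m unfolding Lam_min_iff by metis+
  have "mdeg G \<kappa> + mdeg G \<alpha> = mdeg G \<kappa> + mdeg G \<beta>"
    using d mcomp_in(4)[OF L(1) a(1,3)] mcomp_in(4)[OF L(1) b(1,3)] by simp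
  then have d1: "mdeg G \<alpha> = mdeg G \<beta>" by simp
  have "mdeg G \<mu> + mdeg G \<alpha>' = mdeg G \<mu> + mdeg G \<beta>'"
    using d mcomp_in(4)[OF L(2) a(2,4)] mcomp_in(4)[OF L(2) b(2,4)] a(5) b(5) by simp
  then have d2: "mdeg G \<alpha>' = mdeg G \<beta>'" by simp
  have 1: "\<alpha>' = \<beta>' \<and> \<eta> = \<theta>"
    by (rule mcomp_cancel[OF a(2) h(1) b(2) h(2) h(3,4,5) d2])
  have "mcomp G \<kappa> \<alpha> = mcomp G \<kappa> \<beta>" using a(5) b(5) 1 by simp
  then have "\<kappa> = \<kappa> \<and> \<alpha> = \<beta>"
    by (rule mcomp_cancel[OF L(1) a(1) L(1) b(1) a(3) b(3) _ refl])
  with 1 show ?thesis by simp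
qed

end

section \<open>The Toeplitz algebra\<close>

lemma sum_fun_apply: "(sum f A) S = (\<Sum>a\<in>A. f a S)"
  by (induct A rule: infinite_finite_induct) auto

lemma nt_star_apply: "nt_star x S = bop_star (x S)" by (simp add: nt_star_def)
lemma nt_scale_apply: "nt_scale c x S = bop_scale c (x S)" by (simp add: nt_scale_def)

lemma nt_star_simps [simp]:
  "nt_star (nt_star x) = x" "nt_star (x + y) = nt_star x + nt_star y" "nt_star (x - y) = nt_star x - nt_star y"
  "nt_star (x * y) = nt_star y * nt_star x" "nt_star 0 = 0" "nt_star (nt_scale c x) = nt_scale (cnj c) (nt_star x)"
  by (rule ext, simp add: nt_star_apply nt_scale_apply)+

lemma nt_scale_simps [simp]:
  "nt_scale c x * y = nt_scale c (x * y)" "x * nt_scale c y = nt_scale c (x * y)"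
  "nt_scale 0 x = 0" "nt_scale c 0 = 0" "nt_scale 1 x = x" "nt_scale c (nt_scale d x) = nt_scale (c * d) x"
  by (rule ext, simp add: nt_scale_apply)+

lemma nt_scale_minus_one: "nt_scale (-1) x = - x"
  by (rule ext) (simp add: nt_scale_apply)

lemma nt_star_sum: "nt_star (sum f A) = (\<Sum>a\<in>A. nt_star (f a))"
  by (rule ext) (simp add: nt_star_apply sum_fun_apply)

context finite_hrg
begin

abbreviation T :: "('v, 'e) mor \<Rightarrow> ('v, 'e) nt" where "T \<equiv> nt_T G"
abbreviation TF :: "(('v, 'e) mor \<Rightarrow> bop) \<Rightarrow> bool" where "TF \<equiv> toeplitz_family G"
abbreviation mono :: "('v, 'e) mor \<Rightarrow> ('v, 'e) mor \<Rightarrow> ('v, 'e) nt" where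
  "mono \<kappa> \<mu> \<equiv> T \<kappa> * nt_star (T \<mu>)"

section \<open>Relations among the generators\<close>

lemma TF_D:
  assumes "TF S"
  shows "\<mu> \<in> Lam G \<Longrightarrow> S \<mu> * bop_star (S \<mu>) * S \<mu> = S \<mu>"
    "bop_star (S (vert G v)) = S (vert G v)"
    "S (vert G v) * S (vert G w) = (if v = w then S (vert G v) else 0)"
    "\<kappa> \<in> Lam G \<Longrightarrow> \<mu> \<in> Lam G \<Longrightarrow> S \<kappa> * S \<mu> = (if msrc \<kappa> = mrng G \<mu> then S (mcomp G \<kappa> \<mu>) else 0)"
    "\<kappa> \<in> Lam G \<Longrightarrow> \<mu> \<in> Lam G \<Longrightarrow> bop_star (S \<kappa>) * S \<mu> =
        (\<Sum>(\<alpha>, \<alpha>')\<in>Lam_min G \<kappa> \<mu>. S \<alpha> * bop_star (S \<alpha>'))"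
  using assms unfolding toeplitz_family_def by blast+

lemma TF_norm: "TF S \<Longrightarrow> \<mu> \<in> Lam G \<Longrightarrow> norm (S \<mu>) \<le> 1"
  by (rule norm_partial_isometry) (rule TF_D(1))

text \<open>The degenerate family keeps the index set nonempty, as the supremum defining the norm
  requires.\<close>

lemma TF_zero: "TF (\<lambda>_. 0)"
  by (auto simp: toeplitz_family_def)

lemma T_mult:
  assumes "\<kappa> \<in> Lam G" "\<mu> \<in> Lam G"
  shows "T \<kappa> * T \<mu> = (if msrc \<kappa> = mrng G \<mu> then T (mcomp G \<kappa> \<mu>) else 0)"
proof (rule ext)
  show "(T \<kappa> * T \<mu>) S = (if msrc \<kappa> = mrng G \<mu> then T (mcomp G \<kappa> \<mu>) else 0) S" for S
    using TF_D(4)[of S, OF _ assms] by (cases "TF S") (simp_all add: nt_T_def)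
qed

lemma T_vert_star [simp]: "nt_star (T (vert G v)) = T (vert G v)"
  by (rule ext) (simp add: nt_T_def nt_star_apply TF_D)

lemma T_star_mult:
  assumes "\<kappa> \<in> Lam G" "\<mu> \<in> Lam G"
  shows "nt_star (T \<kappa>) * T \<mu> = (\<Sum>(\<alpha>, \<alpha>')\<in>Lam_min G \<kappa> \<mu>. mono \<alpha> \<alpha>')"
proof (rule ext)
  show "(nt_star (T \<kappa>) * T \<mu>) S = (\<Sum>(\<alpha>, \<alpha>')\<in>Lam_min G \<kappa> \<mu>. mono \<alpha> \<alpha>') S" for S
    using TF_D(5)[of S, OF _ assms]
    by (cases "TF S") (simp_all add: nt_T_def nt_star_apply sum_fun_apply case_prod_unfold)
qed

lemma T_vert_left: "\<mu> \<in> Lam G \<Longrightarrow> T (vert G v) * T \<mu> = (if v = mrng G \<mu> then T \<mu> else 0)"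
  by (simp add: T_mult)

lemma T_vert_right: "\<mu> \<in> Lam G \<Longrightarrow> T \<mu> * T (vert G v) = (if v = msrc \<mu> then T \<mu> else 0)"
  by (auto simp: T_mult)

lemma T_star_same_deg:
  assumes "\<kappa> \<in> Lam G" "\<mu> \<in> Lam G" "mdeg G \<kappa> = mdeg G \<mu>"
  shows "nt_star (T \<kappa>) * T \<mu> = (if \<kappa> = \<mu> then T (vert G (msrc \<mu>)) else 0)"
  unfolding T_star_mult[OF assms(1,2)] Lam_min_same_deg[OF assms] by (simp add: T_vert_left)

text \<open>The inner factor \<open>nt_star (T \<mu>) * T \<kappa>'\<close> is a sum over minimal
  common extensions, and each summand is absorbed into the outer paths because the sources
  match.\<close>

lemma mono_mult:
  assumes L: "\<kappa> \<in> Lam G" "\<mu> \<in> Lam G" "\<kappa>' \<in> Lam G" "\<mu>' \<in> Lam G" and s: "msrc \<kappa> = msrc \<mu>" "msrc \<kappa>' = msrc \<mu>'"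
  shows "mono \<kappa> \<mu> * mono \<kappa>' \<mu>' =
    (\<Sum>(\<alpha>, \<alpha>')\<in>Lam_min G \<mu> \<kappa>'. mono (mcomp G \<kappa> \<alpha>) (mcomp G \<mu>' \<alpha>'))"
proof -
  have "mono \<kappa> \<mu> * mono \<kappa>' \<mu>' = T \<kappa> * (nt_star (T \<mu>) * T \<kappa>') * nt_star (T \<mu>')"
    by (simp add: mult.assoc)
  also have "\<dots> = (\<Sum>p\<in>Lam_min G \<mu> \<kappa>'. T \<kappa> * mono (fst p) (snd p) * nt_star (T \<mu>'))"
    unfolding T_star_mult[OF L(2,3)] by (simp add: sum_distrib_left sum_distrib_right case_prod_unfold)
  also have "\<dots> = (\<Sum>p\<in>Lam_min G \<mu> \<kappa>'. mono (mcomp G \<kappa> (fst p)) (mcomp G \<mu>' (snd p)))"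
  proof (rule sum.cong[OF refl])
    fix p assume p: "p \<in> Lam_min G \<mu> \<kappa>'"
    have a: "fst p \<in> Lam G" "snd p \<in> Lam G" "msrc \<mu> = mrng G (fst p)" "msrc \<kappa>' = mrng G (snd p)"
      using p Lam_min_iff[of "fst p" "snd p"] by auto
    have 1: "T \<kappa> * T (fst p) = T (mcomp G \<kappa> (fst p))" using a s L by (simp add: T_mult)
    have 2: "T \<mu>' * T (snd p) = T (mcomp G \<mu>' (snd p))" using a s L by (simp add: T_mult)
    have "T \<kappa> * mono (fst p) (snd p) * nt_star (T \<mu>') = (T \<kappa> * T (fst p)) * nt_star (T \<mu>' * T (snd p))"
      by (simp add: mult.assoc)
    then show "T \<kappa> * mono (fst p) (snd p) * nt_star (T \<mu>') = mono (mcomp G \<kappa> (fst p)) (mcomp G \<mu>' (snd p))"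
      unfolding 1 2 .
  qed
  finally show ?thesis by (simp add: case_prod_unfold)
qed

text \<open>Each generator carries the projection of its source on the right, and distinct vertex
  projections are orthogonal.\<close>

lemma mono_source_zero:
  assumes "\<kappa> \<in> Lam G" "\<mu> \<in> Lam G" "msrc \<kappa> \<noteq> msrc \<mu>" shows "mono \<kappa> \<mu> = 0"
proof -
  have "mono \<kappa> \<mu> = (T \<kappa> * T (vert G (msrc \<kappa>))) * nt_star (T \<mu> * T (vert G (msrc \<mu>)))"
    by (simp add: T_vert_right assms)
  also have "\<dots> = T \<kappa> * (T (vert G (msrc \<kappa>)) * T (vert G (msrc \<mu>))) * nt_star (T \<mu>)"
    by (simp add: mult.assoc)
  also have "\<dots> = 0" using assms(3) by (simp add: T_vert_left)
  finally show ?thesis .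
qed

text \<open>Products and adjoints of monomials stay in this span, so it coincides with
  \<open>nt_poly\<close>, yet its induction rule has no case for products. Sources are required to
  agree because all other monomials vanish.\<close>

inductive_set nt_span :: "('v, 'e) nt set" where
  mono: "\<kappa> \<in> Lam G \<Longrightarrow> \<mu> \<in> Lam G \<Longrightarrow> msrc \<kappa> = msrc \<mu> \<Longrightarrow> mono \<kappa> \<mu> \<in> nt_span"
| zero: "0 \<in> nt_span"
| scale: "x \<in> nt_span \<Longrightarrow> nt_scale c x \<in> nt_span"
| add: "x \<in> nt_span \<Longrightarrow> y \<in> nt_span \<Longrightarrow> x + y \<in> nt_span"

lemma span_sum: "(\<And>a. a \<in> A \<Longrightarrow> f a \<in> nt_span) \<Longrightarrow> sum f A \<in> nt_span"
  by (induct A rule: infinite_finite_induct) (auto intro: nt_span.intros)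

lemma span_diff: "x \<in> nt_span \<Longrightarrow> y \<in> nt_span \<Longrightarrow> x - y \<in> nt_span"
  using nt_span.add[of x "nt_scale (-1) y"] nt_span.scale[of y "-1"]
  by (simp only: nt_scale_minus_one add_uminus_conv_diff)

lemma span_mono [simp]: "\<kappa> \<in> Lam G \<Longrightarrow> \<mu> \<in> Lam G \<Longrightarrow> mono \<kappa> \<mu> \<in> nt_span"
  by (cases "msrc \<kappa> = msrc \<mu>") (auto intro: nt_span.intros simp: mono_source_zero)

lemma T_eq_mono: "\<mu> \<in> Lam G \<Longrightarrow> T \<mu> = mono \<mu> (vert G (msrc \<mu>))"
  by (simp add: T_vert_right)

lemma span_T [simp]: "\<mu> \<in> Lam G \<Longrightarrow> T \<mu> \<in> nt_span"
  using T_eq_mono[of \<mu>] span_mono[of \<mu> "vert G (msrc \<mu>)"] vert_simps(1) by metis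

lemma span_star: "x \<in> nt_span \<Longrightarrow> nt_star x \<in> nt_span"
proof (induct rule: nt_span.induct)
  case (mono \<kappa> \<mu>)
  have "nt_star (mono \<kappa> \<mu>) = mono \<mu> \<kappa>" unfolding nt_star_simps ..
  then show ?case using nt_span.mono[OF mono(2,1)] mono(3) by (simp only:)
qed (simp_all only: nt_star_simps nt_span.intros)

lemma span_mult_mono:
  assumes "x \<in> nt_span" "\<kappa>' \<in> Lam G" "\<mu>' \<in> Lam G" "msrc \<kappa>' = msrc \<mu>'"
  shows "x * mono \<kappa>' \<mu>' \<in> nt_span"
  using assms(1)
proof induct
  case (mono \<kappa> \<mu>)
  show ?case unfolding mono_mult[OF mono(1,2) assms(2,3) mono(3) assms(4)] case_prod_unfold
  proof (rule span_sum)
    fix p assume "p \<in> Lam_min G \<mu> \<kappa>'"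
    then show "mono (mcomp G \<kappa> (fst p)) (mcomp G \<mu>' (snd p)) \<in> nt_span"
      using Lam_min_iff[of "fst p" "snd p"] mono assms by (intro span_mono mcomp_in) auto
  qed
qed (simp_all only: mult_zero_left nt_scale_simps distrib_right nt_span.intros)

lemma span_mult: "y \<in> nt_span \<Longrightarrow> x \<in> nt_span \<Longrightarrow> x * y \<in> nt_span"
  by (induct rule: nt_span.induct)
    (simp_all only: mult_zero_right nt_scale_simps distrib_left nt_span.intros span_mult_mono)

lemma poly_in_span: "x \<in> nt_poly G \<Longrightarrow> x \<in> nt_span"
  by (induct rule: nt_poly.induct) (simp_all only: nt_span.intros span_star span_mult span_T)

lemma span_in_poly: "x \<in> nt_span \<Longrightarrow> x \<in> nt_poly G"
proof (induct rule: nt_span.induct)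
  case zero
  have "nt_scale 0 (T (vert G undefined)) \<in> nt_poly G" by (intro nt_poly.intros) simp
  then show ?case by (simp only: nt_scale_simps)
qed (simp_all only: nt_poly.intros)

lemma nt_poly_eq: "nt_poly G = nt_span"
  using poly_in_span span_in_poly by blast

lemma span_off: "x \<in> nt_span \<Longrightarrow> \<not> TF S \<Longrightarrow> x S = 0"
  by (induct rule: nt_span.induct) (auto simp: nt_T_def nt_scale_apply)

lemma span_bounded: "x \<in> nt_span \<Longrightarrow> \<exists>C\<ge>0. \<forall>S. norm (x S) \<le> C"
proof (induct rule: nt_span.induct)
  case (mono \<kappa> \<mu>)
  have "norm (mono \<kappa> \<mu> S) \<le> 1" for S
  proof (cases "TF S")
    case True
    have "norm (mono \<kappa> \<mu> S) \<le> norm (S \<kappa>) * norm (S \<mu>)"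
      using True norm_mult_ineq[of "S \<kappa>" "bop_star (S \<mu>)"] by (simp add: nt_T_def nt_star_apply)
    also have "\<dots> \<le> 1 * 1" using True mono by (intro mult_mono TF_norm) auto
    finally show ?thesis by simp
  qed (simp add: nt_T_def)
  then show ?case by (intro exI[of _ 1]) auto
next
  case (scale x c)
  then obtain C where "C \<ge> 0" "\<And>S. norm (x S) \<le> C" by blast
  then show ?case by (intro exI[of _ "cmod c * C"]) (auto simp: nt_scale_apply mult_left_mono)
next
  case (add x y)
  then obtain C D where "C \<ge> 0" "\<And>S. norm (x S) \<le> C" "D \<ge> 0" "\<And>S. norm (y S) \<le> D" by blast
  then show ?case by (intro exI[of _ "C + D"]) (auto intro: norm_triangle_le add_mono)
qed auto

lemma NT_iff: "x \<in> NT G \<longleftrightarrow> (\<forall>S. \<not> TF S \<longrightarrow> x S = 0) \<and> (\<forall>\<epsilon>>0. \<exists>y\<in>nt_span. \<forall>S. norm (x S - y S) \<le> \<epsilon>)"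
proof -
  have "(\<forall>S. TF S \<longrightarrow> norm (x S - y S) \<le> \<epsilon>) \<longleftrightarrow> (\<forall>S. norm (x S - y S) \<le> \<epsilon>)"
    if "\<forall>S. \<not> TF S \<longrightarrow> x S = 0" "y \<in> nt_span" "\<epsilon> > 0" for y and \<epsilon> :: real
    using span_off[OF that(2)] that(1,3) by (metis diff_zero less_eq_real_def norm_zero)
  then show ?thesis unfolding NT_def nt_poly_eq mem_Collect_eq by (smt (verit, ccfv_threshold))
qed

section \<open>The uniform closure and its norm\<close>

lemma NT_off: "x \<in> NT G \<Longrightarrow> \<not> TF S \<Longrightarrow> x S = 0"
  unfolding NT_iff by blast

lemma NT_approx:
  assumes "x \<in> NT G" "\<epsilon> > 0"
  obtains y where "y \<in> nt_span" "\<And>S. norm (x S - y S) \<le> \<epsilon>"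
  using assms unfolding NT_iff by blast

lemma NT_I:
  assumes "\<And>S. \<not> TF S \<Longrightarrow> x S = 0" "\<And>\<epsilon>. \<epsilon> > 0 \<Longrightarrow> \<exists>y\<in>nt_span. \<forall>S. norm (x S - y S) \<le> \<epsilon>"
  shows "x \<in> NT G"
  using assms unfolding NT_iff by blast

lemma span_NT: "x \<in> nt_span \<Longrightarrow> x \<in> NT G"
  by (rule NT_I) (auto simp: span_off intro!: bexI[of _ x])

lemma NT_bounded: assumes "x \<in> NT G" shows "\<exists>C\<ge>0. \<forall>S. norm (x S) \<le> C"
proof -
  obtain y where y: "y \<in> nt_span" "\<And>S. norm (x S - y S) \<le> 1"
    using NT_approx[OF assms, of 1] by auto
  obtain C where C: "C \<ge> 0" "\<And>S. norm (y S) \<le> C" using span_bounded[OF y(1)] by auto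
  have "norm (x S) \<le> 1 + C" for S
    using norm_triangle_ineq[of "x S - y S" "y S"] y(2)[of S] C(2)[of S] by simp
  then show ?thesis using C by (intro exI[of _ "1 + C"]) auto
qed

text \<open>Boundedness makes the supremum legitimate. Off the Toeplitz families the value is zero,
  and the norm is nonnegative because of the zero family.\<close>

lemma nt_norm_ge: assumes "x \<in> NT G" shows "norm (x S) \<le> nt_norm G x"
proof -
  obtain C where C: "\<And>S. norm (x S) \<le> C" using NT_bounded[OF assms] by auto
  have b: "bdd_above ((\<lambda>S. norm (x S)) ` {S. TF S})" by (rule bdd_aboveI[of _ C]) (use C in auto)
  have le: "norm (x S) \<le> nt_norm G x" if "TF S" for S
    unfolding nt_norm_def by (rule cSUP_upper[OF _ b]) (use that in simp)
  have "0 \<le> nt_norm G x" using le[OF TF_zero] norm_ge_zero order_trans by blast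
  then show ?thesis using le[of S] NT_off[OF assms, of S] by (cases "TF S") auto
qed

lemma nt_norm_le: "(\<And>S. norm (x S) \<le> C) \<Longrightarrow> nt_norm G x \<le> C"
  unfolding nt_norm_def by (rule cSUP_least) (use TF_zero in auto)

lemma nt_norm_nonneg: "x \<in> NT G \<Longrightarrow> 0 \<le> nt_norm G x"
  using nt_norm_ge norm_ge_zero order_trans by blast

lemma NT_add [simp]: assumes "x \<in> NT G" "y \<in> NT G" shows "x + y \<in> NT G"
proof (rule NT_I)
  show "\<not> TF S \<Longrightarrow> (x + y) S = 0" for S using assms by (simp add: NT_off)
  fix \<epsilon> :: real assume e: "\<epsilon> > 0"
  obtain x' where x': "x' \<in> nt_span" "\<And>S. norm (x S - x' S) \<le> \<epsilon>/2" using NT_approx[OF assms(1), of "\<epsilon>/2"] e by auto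
  obtain y' where y': "y' \<in> nt_span" "\<And>S. norm (y S - y' S) \<le> \<epsilon>/2" using NT_approx[OF assms(2), of "\<epsilon>/2"] e by auto
  have "norm ((x + y) S - (x' + y') S) \<le> \<epsilon>" for S
    using norm_triangle_ineq[of "x S - x' S" "y S - y' S"] x'(2)[of S] y'(2)[of S] by (simp add: algebra_simps)
  then show "\<exists>z\<in>nt_span. \<forall>S. norm ((x + y) S - z S) \<le> \<epsilon>" using x' y' nt_span.add by blast
qed

lemma NT_scale [simp]: assumes "x \<in> NT G" shows "nt_scale c x \<in> NT G"
proof (rule NT_I)
  show "\<not> TF S \<Longrightarrow> nt_scale c x S = 0" for S using assms by (simp add: NT_off nt_scale_apply)
  fix \<epsilon> :: real assume e: "\<epsilon> > 0"
  have d: "cmod c + 1 > 0" using norm_ge_zero[of c] by linarith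
  obtain x' where x': "x' \<in> nt_span" "\<And>S. norm (x S - x' S) \<le> \<epsilon> / (cmod c + 1)"
    using NT_approx[OF assms, of "\<epsilon> / (cmod c + 1)"] e d by auto
  have "norm (nt_scale c x S - nt_scale c x' S) \<le> \<epsilon>" for S
  proof -
    have "norm (nt_scale c x S - nt_scale c x' S) = cmod c * norm (x S - x' S)"
      by (simp add: nt_scale_apply flip: bop_scale_diff)
    also have "\<dots> \<le> (cmod c + 1) * (\<epsilon> / (cmod c + 1))" using x'(2)[of S] by (intro mult_mono) auto
    also have "\<dots> = \<epsilon>" using d by simp
    finally show ?thesis .
  qed
  then show "\<exists>z\<in>nt_span. \<forall>S. norm (nt_scale c x S - z S) \<le> \<epsilon>" using x' nt_span.scale by blast
qed

lemma NT_diff [simp]: "x \<in> NT G \<Longrightarrow> y \<in> NT G \<Longrightarrow> x - y \<in> NT G"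
  using NT_add[of x "nt_scale (-1) y"] NT_scale[of y "-1"]
  by (simp only: nt_scale_minus_one add_uminus_conv_diff)

lemma NT_star [simp]: assumes "x \<in> NT G" shows "nt_star x \<in> NT G"
proof (rule NT_I)
  show "\<not> TF S \<Longrightarrow> nt_star x S = 0" for S using assms by (simp add: NT_off nt_star_apply)
  fix \<epsilon> :: real assume e: "\<epsilon> > 0"
  obtain x' where x': "x' \<in> nt_span" "\<And>S. norm (x S - x' S) \<le> \<epsilon>" using NT_approx[OF assms e] by auto
  have "norm (nt_star x S - nt_star x' S) \<le> \<epsilon>" for S
    using x'(2)[of S] norm_bop_star[of "x S - x' S"] by (simp add: nt_star_apply)
  then show "\<exists>z\<in>nt_span. \<forall>S. norm (nt_star x S - z S) \<le> \<epsilon>" using x' span_star by blast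
qed

lemma NT_mult [simp]: assumes "x \<in> NT G" "y \<in> NT G" shows "x * y \<in> NT G"
proof (rule NT_I)
  show "\<not> TF S \<Longrightarrow> (x * y) S = 0" for S using assms by (simp add: NT_off)
  fix \<epsilon> :: real assume e: "\<epsilon> > 0"
  obtain C where C: "C \<ge> 0" "\<And>S. norm (x S) \<le> C" using NT_bounded[OF assms(1)] by auto
  obtain D where D: "D \<ge> 0" "\<And>S. norm (y S) \<le> D" using NT_bounded[OF assms(2)] by auto
  \<comment> \<open>Capping the tolerance at 1 bounds the approximant of y by D + 1; the total error
    is then at most C d + d (D + 1).\<close>
  define d where "d = min 1 (\<epsilon> / (C + D + 1))"
  have d: "d > 0" "d \<le> 1" "d * (C + D + 1) \<le> \<epsilon>"
  proof -
    have p: "C + D + 1 > 0" using C(1) D(1) by linarith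
    show "d > 0" "d \<le> 1" using e p by (auto simp: d_def)
    have "d * (C + D + 1) \<le> \<epsilon> / (C + D + 1) * (C + D + 1)"
      using p by (intro mult_right_mono) (auto simp: d_def)
    then show "d * (C + D + 1) \<le> \<epsilon>" using p by simp
  qed
  obtain x' where x': "x' \<in> nt_span" "\<And>S. norm (x S - x' S) \<le> d" using NT_approx[OF assms(1) d(1)] by auto
  obtain y' where y': "y' \<in> nt_span" "\<And>S. norm (y S - y' S) \<le> d" using NT_approx[OF assms(2) d(1)] by auto
  have "norm ((x * y) S - (x' * y') S) \<le> \<epsilon>" for S
  proof -
    have ny: "norm (y' S) \<le> D + 1"
      using norm_triangle_ineq4[of "y S" "y S - y' S"] y'(2)[of S] D(2)[of S] d(2) by simp
    have "(x * y) S - (x' * y') S = x S * (y S - y' S) + (x S - x' S) * y' S"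
      by (simp add: algebra_simps)
    then have "norm ((x * y) S - (x' * y') S) \<le> norm (x S * (y S - y' S)) + norm ((x S - x' S) * y' S)"
      by (metis norm_triangle_ineq)
    also have "\<dots> \<le> norm (x S) * norm (y S - y' S) + norm (x S - x' S) * norm (y' S)"
      by (intro add_mono norm_mult_ineq)
    also have "\<dots> \<le> C * d + d * (D + 1)"
      using C D x'(2) y'(2) ny d by (intro add_mono mult_mono) auto
    also have "\<dots> \<le> \<epsilon>" using d(3) by (simp add: algebra_simps)
    finally show ?thesis .
  qed
  then show "\<exists>z\<in>nt_span. \<forall>S. norm ((x * y) S - z S) \<le> \<epsilon>" using x' y' span_mult by blast
qed

lemma NT_zero [simp]: "0 \<in> NT G" by (intro span_NT nt_span.zero)

lemma NT_sum [simp]: "(\<And>a. a \<in> A \<Longrightarrow> f a \<in> NT G) \<Longrightarrow> sum f A \<in> NT G"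
  by (induct A rule: infinite_finite_induct) auto

lemma NT_T [simp]: "\<mu> \<in> Lam G \<Longrightarrow> T \<mu> \<in> NT G" by (intro span_NT span_T)

lemma span_unit: "nt_unit G \<in> nt_span"
  unfolding nt_unit_def by (intro span_sum span_T) simp

lemma NT_unit [simp]: "nt_unit G \<in> NT G"
  by (intro span_NT span_unit)

text \<open>\<open>F\<close> stands for the difference of two bounded linear maps.\<close>

lemma NT_eqI:
  fixes F :: "('v, 'e) nt \<Rightarrow> 'b :: real_normed_vector"
  assumes add: "\<And>x y. x \<in> NT G \<Longrightarrow> y \<in> NT G \<Longrightarrow> F (x + y) = F x + F y"
    and scale: "\<And>c x. x \<in> NT G \<Longrightarrow> F x = 0 \<Longrightarrow> F (nt_scale c x) = 0"
    and bound: "\<And>x. x \<in> NT G \<Longrightarrow> norm (F x) \<le> C * nt_norm G x"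
    and mono: "\<And>\<kappa> \<mu>. \<kappa> \<in> Lam G \<Longrightarrow> \<mu> \<in> Lam G \<Longrightarrow> msrc \<kappa> = msrc \<mu> \<Longrightarrow> F (mono \<kappa> \<mu>) = 0"
    and x: "x \<in> NT G"
  shows "F x = 0"
proof -
  have F0: "F 0 = 0" using add[of 0 0] by simp
  have sp: "F y = 0" if "y \<in> nt_span" for y
    using that by (induct rule: nt_span.induct) (simp_all only: mono F0 scale add span_NT add_0)
  have "norm (F x) \<le> 0 + \<epsilon>" if "\<epsilon> > 0" for \<epsilon>
  proof -
    have d: "\<bar>C\<bar> + 1 > 0" by linarith
    obtain y where y: "y \<in> nt_span" "\<And>S. norm (x S - y S) \<le> \<epsilon> / (\<bar>C\<bar> + 1)"
      using NT_approx[OF x, of "\<epsilon> / (\<bar>C\<bar> + 1)"] \<open>\<epsilon> > 0\<close> d by auto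
    have yN: "y \<in> NT G" by (rule span_NT[OF y(1)])
    have n: "nt_norm G (x - y) \<le> \<epsilon> / (\<bar>C\<bar> + 1)" by (rule nt_norm_le) (use y in simp)
    have "F x = F (x - y) + F y" using add[of "x - y" y] x yN by simp
    then have "norm (F x) \<le> C * nt_norm G (x - y)" using bound[of "x - y"] x yN sp[OF y(1)] by simp
    also have "\<dots> \<le> (\<bar>C\<bar> + 1) * (\<epsilon> / (\<bar>C\<bar> + 1))"
      using n nt_norm_nonneg[of "x - y"] x yN by (intro mult_mono) auto
    also have "\<dots> = \<epsilon>" using d by simp
    finally show ?thesis by simp
  qed
  then have "norm (F x) \<le> 0" by (rule field_le_epsilon)
  then show ?thesis by simp
qed

end

section \<open>The gauge action and its conditional expectation\<close>

lemma cis_power_inj: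
  assumes "a < K" "b < K" "cis (2 * pi / real K) ^ a = cis (2 * pi / real K) ^ b"
  shows "a = b"
proof -
  have e: "cis (2 * pi / real K) ^ n = exp (2 * of_real pi * \<i> * of_nat n / of_nat K)" for n
    unfolding cis_conv_exp exp_of_nat_mult[symmetric] by (simp add: mult_ac)
  have "1 \<le> K" using assms by simp
  then have "a mod K = b mod K" using complex_root_unity_eq[of K a b] assms(3) by (simp add: e)
  then show ?thesis using assms by simp
qed

lemma cis_power_K: "0 < K \<Longrightarrow> cis (2 * pi / real K) ^ K = 1"
  by (simp add: Complex.DeMoivre)

lemma cis_power_ratio:
  assumes "a < K" "b < K" "cis (2 * pi / real K) ^ a * cnj (cis (2 * pi / real K) ^ b) = 1"
  shows "a = b"
proof (rule cis_power_inj[OF assms(1,2)])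
  let ?w = "cis (2 * pi / real K)"
  have 1: "cnj (?w ^ b) * ?w ^ b = 1"
    by (simp add: cis_cnj cis_mult flip: power_mult_distrib)
  have "?w ^ a = ?w ^ a * (cnj (?w ^ b) * ?w ^ b)" by (simp only: 1 mult_1_right)
  also have "\<dots> = (?w ^ a * cnj (?w ^ b)) * ?w ^ b" by (simp only: mult.assoc)
  also have "\<dots> = ?w ^ b" by (simp only: assms(3) mult_1_left)
  finally show "?w ^ a = ?w ^ b" .
qed

text \<open>Orthogonality of the characters of the cyclic group of order K; exponents below K give
  distinct characters when they differ.\<close>

lemma root_sum:
  assumes "a < K" "b < K"
  defines "w \<equiv> cis (2 * pi / real K)"
  shows "(\<Sum>k<K. (w ^ k) ^ a * cnj ((w ^ k) ^ b)) = (if a = b then of_nat K else 0)"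
proof -
  let ?c = "w ^ a * cnj (w ^ b)"
  have eq: "(w ^ k) ^ a * cnj ((w ^ k) ^ b) = ?c ^ k" for k
    by (simp add: power_mult_distrib mult.commute flip: power_mult)
  have "w ^ K = 1" using cis_power_K[of K] assms(1) by (simp add: w_def)
  then have cK: "?c ^ K = 1" unfolding eq[of K, symmetric] by simp
  show ?thesis
  proof (cases "a = b")
    case True
    have "?c = 1" unfolding True by (simp add: w_def cis_cnj cis_mult flip: power_mult_distrib)
    then have "(\<Sum>k<K. ?c ^ k) = of_nat K"
      by (simp only: power_one sum_constant card_lessThan mult_1_right)
    from trans[OF sum.cong[OF refl eq] this] show ?thesis by (subst if_P[OF True])
  next
    case False
    then have "?c \<noteq> 1" using cis_power_ratio[OF assms(1,2)] by (auto simp: w_def)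
    then have "(\<Sum>k<K. ?c ^ k) = 0" using cK by (simp only: sum_gp_strict) simp
    then show ?thesis using False by (simp only: eq) simp
  qed
qed

context finite_hrg
begin

definition zw :: "(nat \<Rightarrow> complex) \<Rightarrow> ('v, 'e) mor \<Rightarrow> complex" where
  "zw z \<mu> = (\<Prod>i\<in>{1..ncolours G}. z i ^ mdeg G \<mu> i)"

definition rotS :: "(nat \<Rightarrow> complex) \<Rightarrow> (('v, 'e) mor \<Rightarrow> bop) \<Rightarrow> ('v, 'e) mor \<Rightarrow> bop" where
  "rotS z S = (\<lambda>\<mu>. bop_scale (zw z \<mu>) (S \<mu>))"

text \<open>The gauge automorphism in this model: rotation by z permutes the Toeplitz families, so
  precomposition with it is multiplicative and compatible with adjoints for pointwise
  reasons.\<close>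

definition rot :: "(nat \<Rightarrow> complex) \<Rightarrow> ('v, 'e) nt \<Rightarrow> ('v, 'e) nt" where
  "rot z x = (\<lambda>S. x (rotS z S))"

section \<open>The gauge action as rotation of Toeplitz families\<close>

lemma zw_norm: "z \<in> torus G \<Longrightarrow> cmod (zw z \<mu>) = 1"
  unfolding zw_def prod_norm[symmetric] by (simp add: norm_power torus_def)

lemma zw_mult_cnj: "z \<in> torus G \<Longrightarrow> zw z \<mu> * cnj (zw z \<mu>) = 1" "z \<in> torus G \<Longrightarrow> cnj (zw z \<mu>) * zw z \<mu> = 1"
  using complex_norm_square[of "zw z \<mu>"] zw_norm by (simp_all add: mult.commute)

lemma zw_cnj: "zw (\<lambda>i. cnj (z i)) \<mu> = cnj (zw z \<mu>)"
  by (simp add: zw_def)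

lemma zw_comp: "\<kappa> \<in> Lam G \<Longrightarrow> \<mu> \<in> Lam G \<Longrightarrow> msrc \<kappa> = mrng G \<mu> \<Longrightarrow> zw z (mcomp G \<kappa> \<mu>) = zw z \<kappa> * zw z \<mu>"
  by (simp add: zw_def power_add prod.distrib)

lemma zw_vert [simp]: "zw z (vert G v) = 1"
  by (simp add: zw_def)

lemma torus_cnj: "z \<in> torus G \<Longrightarrow> (\<lambda>i. cnj (z i)) \<in> torus G"
  by (simp add: torus_def)

text \<open>Only the relation with minimal common extensions mixes weights. From \<kappa> \<alpha> =
  \<mu> \<alpha>' the total weights on both sides agree, which turns the outer scalar into the one
  belonging to each summand.\<close>

lemma TF_rot:
  assumes z: "z \<in> torus G" and S: "TF S"
  shows "TF (rotS z S)"
  unfolding toeplitz_family_def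
proof (intro conjI allI ballI)
  fix \<mu> assume m: "\<mu> \<in> Lam G"
  have "rotS z S \<mu> * bop_star (rotS z S \<mu>) * rotS z S \<mu>
    = bop_scale (zw z \<mu> * (cnj (zw z \<mu>) * zw z \<mu>)) (S \<mu> * bop_star (S \<mu>) * S \<mu>)"
    by (simp add: rotS_def mult_ac)
  then show "rotS z S \<mu> * bop_star (rotS z S \<mu>) * rotS z S \<mu> = rotS z S \<mu>"
    by (simp add: zw_mult_cnj[OF z] TF_D(1)[OF S m]) (simp add: rotS_def)
next
  fix v w
  show "bop_star (rotS z S (vert G v)) = rotS z S (vert G v)" by (simp add: rotS_def TF_D[OF S])
  show "rotS z S (vert G v) * rotS z S (vert G w) = (if v = w then rotS z S (vert G v) else 0)"
    by (simp add: rotS_def TF_D(3)[OF S])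
next
  fix \<kappa> \<mu> assume m: "\<kappa> \<in> Lam G" "\<mu> \<in> Lam G"
  show "rotS z S \<kappa> * rotS z S \<mu> = (if msrc \<kappa> = mrng G \<mu> then rotS z S (mcomp G \<kappa> \<mu>) else 0)"
    using m by (simp add: rotS_def TF_D(4)[OF S m] zw_comp mult.commute)
  have "bop_star (rotS z S \<kappa>) * rotS z S \<mu> = bop_scale (cnj (zw z \<kappa>) * zw z \<mu>) (bop_star (S \<kappa>) * S \<mu>)"
    by (simp add: rotS_def mult.commute)
  also have "\<dots> = (\<Sum>p\<in>Lam_min G \<kappa> \<mu>. bop_scale (cnj (zw z \<kappa>) * zw z \<mu>) (S (fst p) * bop_star (S (snd p))))"
    by (simp add: TF_D(5)[OF S m] bop_scale_sum case_prod_unfold)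
  also have "\<dots> = (\<Sum>p\<in>Lam_min G \<kappa> \<mu>. rotS z S (fst p) * bop_star (rotS z S (snd p)))"
  proof (rule sum.cong[OF refl])
    fix p assume p: "p \<in> Lam_min G \<kappa> \<mu>"
    have a: "fst p \<in> Lam G" "snd p \<in> Lam G" "msrc \<kappa> = mrng G (fst p)" "msrc \<mu> = mrng G (snd p)"
      "mcomp G \<kappa> (fst p) = mcomp G \<mu> (snd p)"
      using p Lam_min_iff[of "fst p" "snd p"] by auto
    have e: "zw z \<kappa> * zw z (fst p) = zw z \<mu> * zw z (snd p)"
      using zw_comp[OF m(1) a(1,3), of z] zw_comp[OF m(2) a(2,4), of z] a(5) by simp
    have "cnj (zw z \<kappa>) * zw z \<mu> = cnj (zw z \<kappa>) * (zw z \<mu> * zw z (snd p)) * cnj (zw z (snd p))"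
      using zw_mult_cnj[OF z, of "snd p"] by (simp add: mult.assoc)
    also have "\<dots> = (cnj (zw z \<kappa>) * zw z \<kappa>) * zw z (fst p) * cnj (zw z (snd p))"
      by (simp only: e[symmetric] mult.assoc)
    also have "\<dots> = zw z (fst p) * cnj (zw z (snd p))" by (simp add: zw_mult_cnj[OF z])
    finally have c: "cnj (zw z \<kappa>) * zw z \<mu> = zw z (fst p) * cnj (zw z (snd p))" .
    show "bop_scale (cnj (zw z \<kappa>) * zw z \<mu>) (S (fst p) * bop_star (S (snd p)))
      = rotS z S (fst p) * bop_star (rotS z S (snd p))"
      unfolding c by (simp add: rotS_def mult.commute)
  qed
  finally show "bop_star (rotS z S \<kappa>) * rotS z S \<mu> = (\<Sum>(\<alpha>, \<alpha>')\<in>Lam_min G \<kappa> \<mu>. rotS z S \<alpha> * bop_star (rotS z S \<alpha>'))"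
    by (simp add: case_prod_unfold)
qed

lemma rotS_inverse:
  assumes "z \<in> torus G"
  shows "rotS (\<lambda>i. cnj (z i)) (rotS z S) = S" "rotS z (rotS (\<lambda>i. cnj (z i)) S) = S"
  by (rule ext, simp add: rotS_def zw_cnj zw_mult_cnj assms)+

lemma TF_rot_iff: "z \<in> torus G \<Longrightarrow> TF (rotS z S) \<longleftrightarrow> TF S"
  using TF_rot TF_rot[OF torus_cnj] rotS_inverse(1) by metis

lemma rot_inverse:
  assumes "z \<in> torus G"
  shows "rot (\<lambda>i. cnj (z i)) (rot z x) = x" "rot z (rot (\<lambda>i. cnj (z i)) x) = x"
  by (rule ext, simp add: rot_def rotS_inverse assms)+

lemma rot_simps:
  "rot z (x + y) = rot z x + rot z y" "rot z (x - y) = rot z x - rot z y" "rot z (x * y) = rot z x * rot z y"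
  "rot z (nt_star x) = nt_star (rot z x)" "rot z (nt_scale c x) = nt_scale c (rot z x)" "rot z 0 = 0"
  by (rule ext, simp add: rot_def nt_star_apply nt_scale_apply)+

lemma rot_T: "z \<in> torus G \<Longrightarrow> rot z (T \<mu>) = nt_scale (zw z \<mu>) (T \<mu>)"
  by (rule ext, simp add: rot_def nt_T_def TF_rot_iff nt_scale_apply, simp add: rotS_def)

lemma rot_mono: "z \<in> torus G \<Longrightarrow> rot z (mono \<kappa> \<mu>) = nt_scale (zw z \<kappa> * cnj (zw z \<mu>)) (mono \<kappa> \<mu>)"
  by (simp only: rot_simps rot_T nt_star_simps nt_scale_simps) (simp only: mult.commute)

lemma rot_span: assumes z: "z \<in> torus G" and x: "x \<in> nt_span" shows "rot z x \<in> nt_span"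
  using x
proof (induct rule: nt_span.induct)
  case (mono \<kappa> \<mu>)
  then show ?case unfolding rot_mono[OF z] by (intro nt_span.intros)
qed (simp_all only: rot_simps nt_span.intros)

lemma rot_NT: assumes z: "z \<in> torus G" and x: "x \<in> NT G" shows "rot z x \<in> NT G"
proof (rule NT_I)
  show "\<not> TF S \<Longrightarrow> rot z x S = 0" for S using NT_off[OF x, of "rotS z S"] TF_rot_iff[OF z] by (simp add: rot_def)
  fix \<epsilon> :: real assume "\<epsilon> > 0"
  then obtain y where y: "y \<in> nt_span" "\<And>S. norm (x S - y S) \<le> \<epsilon>" using NT_approx[OF x] by blast
  show "\<exists>y\<in>nt_span. \<forall>S. norm (rot z x S - y S) \<le> \<epsilon>"
    by (rule bexI[OF _ rot_span[OF z y(1)]]) (simp add: rot_def y(2))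
qed

lemma nt_norm_rot_le: "x \<in> NT G \<Longrightarrow> nt_norm G (rot z x) \<le> nt_norm G x"
  by (rule nt_norm_le) (simp add: rot_def nt_norm_ge)

lemma nt_norm_rot: "z \<in> torus G \<Longrightarrow> x \<in> NT G \<Longrightarrow> nt_norm G (rot z x) = nt_norm G x"
  using nt_norm_rot_le[of x z] nt_norm_rot_le[of "rot z x" "\<lambda>i. cnj (z i)"] rot_NT[of z x] rot_inverse(1)[of z x]
  by simp

lemma gauge_aut_rot: assumes z: "z \<in> torus G" shows "gauge_aut G z (rot z)"
  unfolding gauge_aut_def
proof (intro conjI ballI allI)
  show "bij_betw (rot z) (NT G) (NT G)"
    by (rule bij_betw_byWitness[where f' = "rot (\<lambda>i. cnj (z i))"])
      (auto simp: rot_inverse z rot_NT torus_cnj)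
  show "rot z (T \<mu>) = nt_scale (\<Prod>i\<in>{1..ncolours G}. z i ^ mdeg G \<mu> i) (T \<mu>)" for \<mu>
    using rot_T[OF z] by (simp only: zw_def)
qed (simp_all only: rot_simps nt_norm_rot[OF z])

text \<open>Two isometric linear maps that agree on monomials; isometry is built into
  \<open>gauge_aut\<close>. The fixed point algebra can therefore be described with
  \<open>rot\<close> alone.\<close>

lemma gauge_aut_unique:
  assumes z: "z \<in> torus G" and g: "gauge_aut G z g" and x: "x \<in> NT G"
  shows "g x = rot z x"
proof (rule ext)
  fix S
  have gadd: "g (x + y) = g x + g y" "g (x * y) = g x * g y" if "x \<in> NT G" "y \<in> NT G" for x y
    using g that unfolding gauge_aut_def by blast+
  have gsc: "g (nt_scale c x) = nt_scale c (g x)" if "x \<in> NT G" for x c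
    using g that unfolding gauge_aut_def by blast
  have gst: "g (nt_star x) = nt_star (g x)" "nt_norm G (g x) = nt_norm G x" if "x \<in> NT G" for x
    using g that unfolding gauge_aut_def by blast+
  have gT: "g (T \<mu>) = rot z (T \<mu>)" if "\<mu> \<in> Lam G" for \<mu>
    using g that unfolding gauge_aut_def rot_T[OF z] zw_def by blast
  have gNT: "g x \<in> NT G" if "x \<in> NT G" for x
    using g that bij_betw_apply[of g "NT G" "NT G" x] unfolding gauge_aut_def by blast
  have "g x S - rot z x S = 0"
  proof (rule NT_eqI[where F = "\<lambda>x. g x S - rot z x S" and C = 2])
    show "g (x + y) S - rot z (x + y) S = g x S - rot z x S + (g y S - rot z y S)"
      if "x \<in> NT G" "y \<in> NT G" for x y
      by (simp add: gadd[OF that] rot_simps)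
    show "g (nt_scale c x) S - rot z (nt_scale c x) S = 0" if "x \<in> NT G" "g x S - rot z x S = 0" for c x
      using that by (simp add: gsc rot_simps nt_scale_apply)
    show "norm (g x S - rot z x S) \<le> 2 * nt_norm G x" if "x \<in> NT G" for x
      using norm_triangle_ineq4[of "g x S" "rot z x S"] nt_norm_ge[OF gNT[OF that], of S] nt_norm_ge[OF rot_NT[OF z that], of S]
      by (simp add: gst(2)[OF that] nt_norm_rot[OF z that])
    show "g (mono \<kappa> \<mu>) S - rot z (mono \<kappa> \<mu>) S = 0" if "\<kappa> \<in> Lam G" "\<mu> \<in> Lam G" for \<kappa> \<mu>
      using that by (simp add: gadd gst gT rot_simps del: times_fun_apply)
    show "x \<in> NT G" by (rule x)
  qed
  then show "g x S = rot z x S" by simp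
qed

lemma fixed_alg_iff: "x \<in> fixed_alg G \<longleftrightarrow> x \<in> NT G \<and> (\<forall>z\<in>torus G. rot z x = x)"
  unfolding fixed_alg_def using gauge_aut_unique gauge_aut_rot by (smt (verit, best) mem_Collect_eq)

definition zr :: "nat \<Rightarrow> (nat \<Rightarrow> nat) \<Rightarrow> nat \<Rightarrow> complex" where
  "zr K j = (\<lambda>i. cis (2 * pi / real K) ^ j i)"

abbreviation JK :: "nat \<Rightarrow> (nat \<Rightarrow> nat) set" where
  "JK K \<equiv> PiE {1..ncolours G} (\<lambda>_. {..<K})"

text \<open>Stands in for the Haar integral over the torus: the mean over the finite subgroup of
  K-th roots of unity, so that a limit in K replaces integration.\<close>

definition avg :: "nat \<Rightarrow> ('v, 'e) nt \<Rightarrow> ('v, 'e) nt" where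
  "avg K x = (\<lambda>S. (1 / real K ^ ncolours G) *\<^sub>R (\<Sum>j\<in>JK K. rot (zr K j) x S))"

section \<open>Averages over finite subgroups of the torus\<close>

lemma zr_torus: "zr K j \<in> torus G"
  by (simp add: zr_def torus_def norm_power)

lemma card_JK: "card (JK K) = K ^ ncolours G"
  by (simp add: card_PiE)

lemma scaleR_bop_scale: "r *\<^sub>R (A :: bop) = bop_scale (of_real r) A"
  by (rule bop_eqI, rule l2_eqI) simp

text \<open>The mean of the weights factors over the colours into character sums, and a single
  differing exponent makes it vanish. The finite average is thus already exact once K exceeds all
  exponents.\<close>

lemma avg_mono:
  assumes K: "K > 0" "\<And>i. mdeg G \<kappa> i < K" "\<And>i. mdeg G \<mu> i < K"
    and L: "\<kappa> \<in> Lam G" "\<mu> \<in> Lam G"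
  shows "avg K (mono \<kappa> \<mu>) = (if mdeg G \<kappa> = mdeg G \<mu> then mono \<kappa> \<mu> else 0)"
proof -
  let ?w = "cis (2 * pi / real K)" and ?N = "{1..ncolours G}"
  let ?f = "\<lambda>i k. (?w ^ k) ^ mdeg G \<kappa> i * cnj ((?w ^ k) ^ mdeg G \<mu> i)"
  have "(\<Sum>j\<in>JK K. zw (zr K j) \<kappa> * cnj (zw (zr K j) \<mu>)) = (\<Sum>j\<in>JK K. \<Prod>i\<in>?N. ?f i (j i))"
    by (simp only: zw_def zr_def prod.distrib cnj_prod)
  also have "\<dots> = (\<Prod>i\<in>?N. \<Sum>k<K. ?f i k)"
    by (rule prod_sum_PiE[symmetric]) auto
  also have "\<dots> = (\<Prod>i\<in>?N. if mdeg G \<kappa> i = mdeg G \<mu> i then of_nat K else 0)"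
    by (intro prod.cong refl root_sum K)
  also have "\<dots> = (if mdeg G \<kappa> = mdeg G \<mu> then of_nat K ^ ncolours G else 0)"
  proof (cases "mdeg G \<kappa> = mdeg G \<mu>")
    case False
    then obtain i where i: "mdeg G \<kappa> i \<noteq> mdeg G \<mu> i" by (auto simp: fun_eq_iff)
    then have "i \<in> ?N" using mdeg_support[OF L(1), of i] mdeg_support[OF L(2), of i] by force
    then have "(\<Prod>i\<in>?N. if mdeg G \<kappa> i = mdeg G \<mu> i then of_nat K else 0) = (0::complex)"
      using i by (intro prod_zero) auto
    then show ?thesis using False by simp
  qed simp
  finally have s: "(\<Sum>j\<in>JK K. zw (zr K j) \<kappa> * cnj (zw (zr K j) \<mu>)) = (if mdeg G \<kappa> = mdeg G \<mu> then of_nat K ^ ncolours G else 0)" .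
  show ?thesis
  proof (rule ext)
    fix S
    have "avg K (mono \<kappa> \<mu>) S = bop_scale (of_real (1 / real K ^ ncolours G) *
        (\<Sum>j\<in>JK K. zw (zr K j) \<kappa> * cnj (zw (zr K j) \<mu>))) (mono \<kappa> \<mu> S)"
      by (simp only: avg_def rot_mono[OF zr_torus] nt_scale_apply scaleR_bop_scale bop_scale_simps bop_scale_sum_left[symmetric])
    also have "\<dots> = (if mdeg G \<kappa> = mdeg G \<mu> then mono \<kappa> \<mu> else 0) S"
      unfolding s using K(1) by simp
    finally show "avg K (mono \<kappa> \<mu>) S = (if mdeg G \<kappa> = mdeg G \<mu> then mono \<kappa> \<mu> else 0) S" .
  qed
qed

lemma avg_bound: assumes "x \<in> NT G" shows "norm (avg K x S) \<le> nt_norm G x"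
proof (cases "K = 0")
  \<comment> \<open>There is at least one colour, so the denominator is 0 and division by it yields
    the average 0.\<close>
  case True
  then have "real K ^ ncolours G = 0" using ncolours_pos by simp
  then have "avg K x S = 0" by (simp only: avg_def div_by_0 scaleR_zero_left)
  then show ?thesis using nt_norm_nonneg[OF assms] by simp
next
  case False
  then have p: "real K ^ ncolours G > 0" by simp
  have "norm (\<Sum>j\<in>JK K. rot (zr K j) x S) \<le> of_nat (card (JK K)) * nt_norm G x"
    by (rule sum_norm_bound) (simp add: rot_def nt_norm_ge[OF assms])
  also have "of_nat (card (JK K)) = real K ^ ncolours G" by (simp only: card_JK of_nat_power)
  finally have "norm (\<Sum>j\<in>JK K. rot (zr K j) x S) / real K ^ ncolours G \<le> nt_norm G x"
    using p by (simp only: pos_divide_le_eq mult.commute)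
  moreover have "norm (avg K x S) = norm (\<Sum>j\<in>JK K. rot (zr K j) x S) / real K ^ ncolours G"
    by (simp only: avg_def norm_scaleR) simp
  ultimately show ?thesis by (simp only:)
qed

lemma avg_add: "avg K (x + y) S = avg K x S + avg K y S"
  by (simp add: avg_def rot_simps sum.distrib scaleR_add_right)

lemma avg_scale: "avg K (nt_scale c x) S = bop_scale c (avg K x S)"
  by (simp only: avg_def rot_simps nt_scale_apply scaleR_bop_scale bop_scale_simps mult.commute
      bop_scale_sum[symmetric])

lemma avg_diff: "avg K (x - y) S = avg K x S - avg K y S"
  by (simp add: avg_def rot_simps sum_subtractf scaleR_diff_right)

lemma avg_bimodule:
  assumes "\<And>z. z \<in> torus G \<Longrightarrow> rot z a = a" "\<And>z. z \<in> torus G \<Longrightarrow> rot z b = b"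
  shows "avg K (a * x * b) S = a S * avg K x S * b S"
  by (simp add: avg_def rot_simps assms zr_torus sum_distrib_left sum_distrib_right)

lemma avg_fixed:
  assumes "\<And>z. z \<in> torus G \<Longrightarrow> rot z a = a" "K > 0"
  shows "avg K a S = a S"
proof -
  have "avg K a S = (1 / real K ^ ncolours G) *\<^sub>R (real (card (JK K)) *\<^sub>R a S)"
    by (simp only: avg_def assms(1)[OF zr_torus] sum_constant_scaleR)
  then show ?thesis using assms(2) by (simp only: card_JK) simp
qed

text \<open>On the span the averages stabilise, and the stable value is fixed by every rotation, not
  only by those through roots of unity.\<close>

lemma avg_stable:
  assumes "y \<in> nt_span"
  shows "\<exists>e\<in>nt_span. (\<forall>z\<in>torus G. rot z e = e) \<and> (\<exists>K0. \<forall>K\<ge>K0. \<forall>S. avg K y S = e S)"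
  using assms
proof (induct rule: nt_span.induct)
  case (mono \<kappa> \<mu>)
  define K0 where "K0 = Suc (Max ((mdeg G \<kappa> ` {1..ncolours G}) \<union> (mdeg G \<mu> ` {1..ncolours G})))"
  have lt: "mdeg G \<kappa> i < K0 \<and> mdeg G \<mu> i < K0" for i
  proof (cases "i \<in> {1..ncolours G}")
    case True
    then show ?thesis unfolding K0_def less_Suc_eq_le by (intro conjI Max_ge) auto
  next
    case False
    then show ?thesis using mdeg_support[OF mono(1) False] mdeg_support[OF mono(2) False] by (simp add: K0_def)
  qed
  let ?e = "if mdeg G \<kappa> = mdeg G \<mu> then mono \<kappa> \<mu> else 0"
  have a: "avg K (mono \<kappa> \<mu>) = ?e" if "K \<ge> K0" for K
    using lt that by (intro avg_mono mono) (auto simp: K0_def intro: less_le_trans)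
  have f: "rot z ?e = ?e" if "z \<in> torus G" for z
  proof (cases "mdeg G \<kappa> = mdeg G \<mu>")
    case True
    then have "zw z \<kappa> = zw z \<mu>" by (simp add: zw_def)
    then show ?thesis using True zw_mult_cnj(1)[OF that]
      by (simp only: True simp_thms if_True rot_mono[OF that] nt_scale_simps)
  next
    case False
    then show ?thesis by (simp only: if_False rot_simps)
  qed
  have "?e \<in> nt_span" using mono by (cases "mdeg G \<kappa> = mdeg G \<mu>") (simp_all only: simp_thms if_True if_False nt_span.intros)
  then show ?case
  proof (rule bexI[rotated], intro conjI exI[of _ K0] allI impI ballI)
    show "rot z ?e = ?e" if "z \<in> torus G" for z by (rule f[OF that])
    show "avg K (mono \<kappa> \<mu>) S = ?e S" if "K \<ge> K0" for K S by (simp only: a[OF that])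
  qed
next
  case zero
  show ?case
  proof (rule bexI[OF _ nt_span.zero], intro conjI exI[of _ 0] allI impI ballI)
    show "avg K 0 S = 0 S" for K S by (simp add: avg_def rot_simps)
  qed (rule rot_simps)
next
  case (scale x c)
  then obtain e K0 where e: "e \<in> nt_span" "\<forall>z\<in>torus G. rot z e = e" "\<And>K S. K \<ge> K0 \<Longrightarrow> avg K x S = e S" by blast
  show ?case
  proof (rule bexI[OF _ nt_span.scale[OF e(1), of c]], intro conjI exI[of _ K0] allI impI ballI)
    show "rot z (nt_scale c e) = nt_scale c e" if "z \<in> torus G" for z using e(2) that by (simp only: rot_simps)
    show "avg K (nt_scale c x) S = nt_scale c e S" if "K \<ge> K0" for K S
      by (simp only: avg_scale e(3)[OF that] nt_scale_apply)
  qed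
next
  case (add x y)
  then obtain e K0 f K1 where e: "e \<in> nt_span" "\<forall>z\<in>torus G. rot z e = e" "\<And>K S. K \<ge> K0 \<Longrightarrow> avg K x S = e S"
    and f: "f \<in> nt_span" "\<forall>z\<in>torus G. rot z f = f" "\<And>K S. K \<ge> K1 \<Longrightarrow> avg K y S = f S" by blast
  show ?case
  proof (rule bexI[OF _ nt_span.add[OF e(1) f(1)]], intro conjI exI[of _ "max K0 K1"] allI impI ballI)
    show "rot z (e + f) = e + f" if "z \<in> torus G" for z using e(2) f(2) that by (simp only: rot_simps)
    show "avg K (x + y) S = (e + f) S" if "K \<ge> max K0 K1" for K S
      using e(3)[of K S] f(3)[of K S] that by (simp add: avg_add)
  qed
qed

definition gE :: "('v, 'e) nt \<Rightarrow> ('v, 'e) nt" where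
  "gE x = (\<lambda>S. lim (\<lambda>K. avg K x S))"

text \<open>Averages are contractive and become constant on the span, so uniform approximation makes
  the sequence Cauchy for every element.\<close>

lemma avg_tendsto: assumes x: "x \<in> NT G" shows "(\<lambda>K. avg K x S) \<longlonglongrightarrow> gE x S"
proof -
  have "Cauchy (\<lambda>K. avg K x S)"
  proof (rule metric_CauchyI)
    fix \<epsilon> :: real assume e: "\<epsilon> > 0"
    obtain y where y: "y \<in> nt_span" "\<And>S. norm (x S - y S) \<le> \<epsilon>/3" using NT_approx[OF x, of "\<epsilon>/3"] e by auto
    obtain f K0 where f: "\<And>K S. K \<ge> K0 \<Longrightarrow> avg K y S = f S" using avg_stable[OF y(1)] by blast
    have d: "norm (avg K x S - f S) \<le> \<epsilon>/3" if "K \<ge> K0" for K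
    proof -
      have "norm (avg K (x - y) S) \<le> nt_norm G (x - y)" by (intro avg_bound NT_diff x span_NT y)
      also have "\<dots> \<le> \<epsilon>/3" by (rule nt_norm_le) (use y in simp)
      finally show ?thesis by (simp add: avg_diff f[OF that])
    qed
    have "dist (avg K x S) (avg L x S) < \<epsilon>" if "K \<ge> K0" "L \<ge> K0" for K L
      using norm_triangle_ineq4[of "avg K x S - f S" "avg L x S - f S"] d[OF that(1)] d[OF that(2)] e
      by (simp add: dist_norm)
    then show "\<exists>M. \<forall>K\<ge>M. \<forall>L\<ge>M. dist (avg K x S) (avg L x S) < \<epsilon>" by blast
  qed
  then show ?thesis unfolding gE_def using Cauchy_convergent convergent_LIMSEQ_iff by blast
qed

lemma gE_bound: "x \<in> NT G \<Longrightarrow> norm (gE x S) \<le> nt_norm G x"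
  by (rule LIMSEQ_le_const2[OF tendsto_norm[OF avg_tendsto]]) (use avg_bound in auto)

lemma gE_add: "x \<in> NT G \<Longrightarrow> y \<in> NT G \<Longrightarrow> gE (x + y) = gE x + gE y"
proof (rule ext)
  fix S assume x: "x \<in> NT G" and y: "y \<in> NT G"
  have "(\<lambda>K. avg K (x + y) S) \<longlonglongrightarrow> gE x S + gE y S"
    unfolding avg_add by (intro tendsto_add avg_tendsto x y)
  then show "gE (x + y) S = (gE x + gE y) S"
    using LIMSEQ_unique[OF avg_tendsto[OF NT_add[OF x y]]] by simp
qed

lemma gE_scale: "x \<in> NT G \<Longrightarrow> gE (nt_scale c x) = nt_scale c (gE x)"
proof (rule ext)
  fix S assume x: "x \<in> NT G"
  have bl: "bounded_linear (bop_scale c)"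
    by (rule bounded_linear_intro[where K = "cmod c"])
      (simp_all add: bop_scale_add scaleR_bop_scale mult.commute)
  have "(\<lambda>K. avg K (nt_scale c x) S) \<longlonglongrightarrow> bop_scale c (gE x S)"
    unfolding avg_scale by (intro bounded_linear.tendsto[OF bl] avg_tendsto x)
  then show "gE (nt_scale c x) S = nt_scale c (gE x) S"
    using LIMSEQ_unique[OF avg_tendsto[OF NT_scale[OF x]]] by (simp add: nt_scale_apply)
qed

lemma gE_span:
  assumes "y \<in> nt_span"
  shows "gE y \<in> nt_span" "z \<in> torus G \<Longrightarrow> rot z (gE y) = gE y"
proof -
  obtain e K0 where e: "e \<in> nt_span" "\<forall>z\<in>torus G. rot z e = e" "\<And>K S. K \<ge> K0 \<Longrightarrow> avg K y S = e S"
    using avg_stable[OF assms] by blast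
  have "gE y = e"
  proof (rule ext)
    fix S
    have "(\<lambda>K. avg K y S) \<longlonglongrightarrow> e S"
      by (rule tendsto_eventually, rule eventually_sequentiallyI[of K0], rule e(3))
    then show "gE y S = e S" using LIMSEQ_unique[OF avg_tendsto[OF span_NT[OF assms]]] by blast
  qed
  then show "gE y \<in> nt_span" "z \<in> torus G \<Longrightarrow> rot z (gE y) = gE y" using e by auto
qed

lemma gE_mono:
  assumes L: "\<kappa> \<in> Lam G" "\<mu> \<in> Lam G"
  shows "gE (mono \<kappa> \<mu>) = (if mdeg G \<kappa> = mdeg G \<mu> then mono \<kappa> \<mu> else 0)"
proof (rule ext)
  fix S
  define K0 where "K0 = Suc (Max ((mdeg G \<kappa> ` {1..ncolours G}) \<union> (mdeg G \<mu> ` {1..ncolours G})))"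
  have lt: "mdeg G \<kappa> i < K0 \<and> mdeg G \<mu> i < K0" for i
  proof (cases "i \<in> {1..ncolours G}")
    case True
    then show ?thesis unfolding K0_def less_Suc_eq_le by (intro conjI Max_ge) auto
  next
    case False
    then show ?thesis using mdeg_support[OF L(1) False] mdeg_support[OF L(2) False] by (simp add: K0_def)
  qed
  have a: "avg K (mono \<kappa> \<mu>) S = (if mdeg G \<kappa> = mdeg G \<mu> then mono \<kappa> \<mu> else 0) S" if "K \<ge> K0" for K
    using lt that by (subst avg_mono) (auto simp: K0_def L intro: less_le_trans)
  have "(\<lambda>K. avg K (mono \<kappa> \<mu>) S) \<longlonglongrightarrow> (if mdeg G \<kappa> = mdeg G \<mu> then mono \<kappa> \<mu> else 0) S"
    by (rule tendsto_eventually, rule eventually_sequentiallyI[of K0], rule a)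
  then show "gE (mono \<kappa> \<mu>) S = (if mdeg G \<kappa> = mdeg G \<mu> then mono \<kappa> \<mu> else 0) S"
    by (rule LIMSEQ_unique[OF avg_tendsto[OF span_NT[OF span_mono[OF L]]]])
qed

lemma gE_diff: assumes "x \<in> NT G" "y \<in> NT G" shows "gE (x - y) = gE x - gE y"
proof -
  have "gE x = gE (x - y) + gE y"
    using gE_add[OF NT_diff[OF assms] assms(2)] by (simp only: diff_add_cancel)
  then show ?thesis by (simp only: add_diff_cancel_right')
qed

lemma gE_NT: assumes x: "x \<in> NT G" shows "gE x \<in> NT G"
proof (rule NT_I)
  fix S assume S: "\<not> TF S"
  have "rot (zr K j) x S = 0" for K j
    using NT_off[OF rot_NT[OF zr_torus x] S] .
  then have "avg K x S = 0" for K by (simp add: avg_def)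
  then show "gE x S = 0" using avg_tendsto[OF x, of S] by (simp add: LIMSEQ_const_iff)
next
  fix \<epsilon> :: real assume e: "\<epsilon> > 0"
  obtain y where y: "y \<in> nt_span" "\<And>S. norm (x S - y S) \<le> \<epsilon>" using NT_approx[OF x e] by blast
  have "norm (gE x S - gE y S) \<le> \<epsilon>" for S
  proof -
    have "gE x S - gE y S = gE (x - y) S" using gE_diff[OF x span_NT[OF y(1)]] by simp
    also have "norm \<dots> \<le> nt_norm G (x - y)" by (intro gE_bound NT_diff x span_NT y)
    also have "\<dots> \<le> \<epsilon>" by (rule nt_norm_le) (use y in simp)
    finally show ?thesis .
  qed
  then show "\<exists>y\<in>nt_span. \<forall>S. norm (gE x S - y S) \<le> \<epsilon>" using gE_span(1)[OF y(1)] by blast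
qed

text \<open>An average over roots of unity need not be invariant under a general z; for the limit,
  invariance is read off on monomials and extended by contractivity.\<close>

lemma gE_rot_fixed: assumes x: "x \<in> NT G" and z: "z \<in> torus G" shows "rot z (gE x) = gE x"
proof (rule ext)
  fix S
  have "rot z (gE x) S - gE x S = 0"
  proof (rule NT_eqI[where F = "\<lambda>x. rot z (gE x) S - gE x S" and C = 2])
    show "norm (rot z (gE x) S - gE x S) \<le> 2 * nt_norm G x" if "x \<in> NT G" for x
      using norm_triangle_ineq4[of "gE x (rotS z S)" "gE x S"] gE_bound[OF that, of S] gE_bound[OF that, of "rotS z S"]
      by (simp add: rot_def)
    show "rot z (gE (mono \<kappa> \<mu>)) S - gE (mono \<kappa> \<mu>) S = 0" if "\<kappa> \<in> Lam G" "\<mu> \<in> Lam G" for \<kappa> \<mu>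
      by (simp only: gE_span(2)[OF span_mono[OF that] z] diff_self)
    show "x \<in> NT G" by (rule x)
  qed (simp_all add: gE_add gE_scale rot_simps nt_scale_apply)
  then show "rot z (gE x) S = gE x S" by simp
qed

lemma gE_rot: assumes x: "x \<in> NT G" and z: "z \<in> torus G" shows "gE (rot z x) = gE x"
proof (rule ext)
  fix S
  have "gE (rot z x) S - gE x S = 0"
  proof (rule NT_eqI[where F = "\<lambda>x. gE (rot z x) S - gE x S" and C = 2])
    show "norm (gE (rot z x) S - gE x S) \<le> 2 * nt_norm G x" if "x \<in> NT G" for x
      using norm_triangle_ineq4[of "gE (rot z x) S" "gE x S"] gE_bound[OF that, of S]
        gE_bound[OF rot_NT[OF z that], of S] by (simp add: nt_norm_rot[OF z that])
    show "gE (rot z (mono \<kappa> \<mu>)) S - gE (mono \<kappa> \<mu>) S = 0" if L: "\<kappa> \<in> Lam G" "\<mu> \<in> Lam G" for \<kappa> \<mu>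
    proof (cases "mdeg G \<kappa> = mdeg G \<mu>")
      case True
      then have "zw z \<kappa> = zw z \<mu>" by (simp add: zw_def)
      then show ?thesis using zw_mult_cnj(1)[OF z] by (simp only: rot_mono[OF z] nt_scale_simps diff_self)
    next
      case False
      then show ?thesis
        by (simp only: rot_mono[OF z] gE_scale[OF span_NT[OF span_mono[OF L]]] gE_mono[OF L] if_False
            nt_scale_simps diff_self)
    qed
    show "x \<in> NT G" by (rule x)
  qed (simp_all add: gE_add gE_scale rot_simps nt_scale_apply rot_NT z)
  then show "gE (rot z x) S = gE x S" by simp
qed

lemma gE_fixed:
  assumes "x \<in> NT G" "\<And>z. z \<in> torus G \<Longrightarrow> rot z x = x" shows "gE x = x"
proof (rule ext)
  fix S
  have "(\<lambda>K. avg K x S) \<longlonglongrightarrow> x S"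
    by (rule tendsto_eventually, rule eventually_sequentiallyI[of 1], rule avg_fixed) (use assms in auto)
  then show "gE x S = x S" using LIMSEQ_unique[OF avg_tendsto[OF assms(1)]] by blast
qed

text \<open>Provides the witness that membership in \<open>gauge_kmsF\<close> asks for.\<close>

lemma gauge_expectation_gE: "gauge_expectation G gE"
  unfolding gauge_expectation_def
proof (intro conjI ballI allI impI)
  show "gE x \<in> fixed_alg G" if "x \<in> NT G" for x
    using that by (simp add: fixed_alg_iff gE_NT gE_rot_fixed)
  show "nt_norm G (gE x) \<le> nt_norm G x" if "x \<in> NT G" for x
    by (rule nt_norm_le) (rule gE_bound[OF that])
  show "gE b = b" if "b \<in> fixed_alg G" for b
    using that by (intro gE_fixed) (auto simp: fixed_alg_iff)
  show "gE (a * x * b) = a * gE x * b" if ab: "a \<in> fixed_alg G" "b \<in> fixed_alg G" and x: "x \<in> NT G" for a b x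
  proof (rule ext)
    fix S
    have "(\<lambda>K. avg K (a * x * b) S) \<longlonglongrightarrow> a S * gE x S * b S"
      using ab by (subst avg_bimodule) (auto simp: fixed_alg_iff intro!: tendsto_intros avg_tendsto x)
    then show "gE (a * x * b) S = (a * gE x * b) S"
      using LIMSEQ_unique[OF avg_tendsto[of "a * x * b" S]] ab x by (simp add: fixed_alg_iff)
  qed
  show "gE (g x) = gE x" if "z \<in> torus G" "gauge_aut G z g" "x \<in> NT G" for z g x
    using gauge_aut_unique[OF that] gE_rot[OF that(3,1)] by simp
qed (simp_all only: gE_add gE_scale)

text \<open>Invariance under a suitable rotation multiplies the value on a monomial of unequal
  degrees by a scalar other than 1, so that value is zero. The argument covers every map meeting the
  definition, so it does not matter which one witnesses gauge invariance of a state.\<close>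

lemma gauge_expectation_mono:
  assumes E: "gauge_expectation G E" and L: "\<kappa> \<in> Lam G" "\<mu> \<in> Lam G"
  shows "E (mono \<kappa> \<mu>) = (if mdeg G \<kappa> = mdeg G \<mu> then mono \<kappa> \<mu> else 0)"
proof (cases "mdeg G \<kappa> = mdeg G \<mu>")
  case True
  then have 1: "zw z \<kappa> * cnj (zw z \<mu>) = 1" if "z \<in> torus G" for z
    using zw_mult_cnj(1)[OF that, of \<mu>] by (simp add: zw_def)
  have "rot z (mono \<kappa> \<mu>) = mono \<kappa> \<mu>" if "z \<in> torus G" for z
    by (simp only: rot_mono[OF that] 1[OF that] nt_scale_simps)
  then have "mono \<kappa> \<mu> \<in> fixed_alg G"
    unfolding fixed_alg_iff using span_NT[OF span_mono[OF L]] by blast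
  then show ?thesis using E True unfolding gauge_expectation_def by simp
next
  case False
  then obtain i where i: "mdeg G \<kappa> i \<noteq> mdeg G \<mu> i" by (auto simp: fun_eq_iff)
  then have iN: "i \<in> {1..ncolours G}" using mdeg_support[OF L(1), of i] mdeg_support[OF L(2), of i] by force
  \<comment> \<open>A root of unity of order above both exponents, placed at colour i with 1
    elsewhere, separates the two degrees.\<close>
  define K where "K = Suc (max (mdeg G \<kappa> i) (mdeg G \<mu> i))"
  define z where "z = (\<lambda>j. if j = i then cis (2 * pi / real K) else 1)"
  have z: "z \<in> torus G" by (simp add: z_def torus_def)
  have zw: "zw z \<nu> = cis (2 * pi / real K) ^ mdeg G \<nu> i" for \<nu>
  proof -
    have "zw z \<nu> = (\<Prod>j\<in>{1..ncolours G}. if j = i then cis (2 * pi / real K) ^ mdeg G \<nu> i else 1)"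
      unfolding zw_def z_def by (rule prod.cong) auto
    then show ?thesis using iN by simp
  qed
  let ?c = "zw z \<kappa> * cnj (zw z \<mu>)"
  have "mdeg G \<kappa> i < K" "mdeg G \<mu> i < K" by (auto simp: K_def)
  then have c: "?c \<noteq> 1" using cis_power_ratio i unfolding zw by blast
  have m: "mono \<kappa> \<mu> \<in> NT G" by (intro span_NT span_mono L)
  have "E (rot z (mono \<kappa> \<mu>)) = E (mono \<kappa> \<mu>)"
    using E z gauge_aut_rot[OF z] m unfolding gauge_expectation_def by blast
  moreover have "E (rot z (mono \<kappa> \<mu>)) = nt_scale ?c (E (mono \<kappa> \<mu>))"
    using E m unfolding gauge_expectation_def rot_mono[OF z] by blast
  ultimately have e: "bop_scale ?c (E (mono \<kappa> \<mu>) S) = E (mono \<kappa> \<mu>) S" for S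
    by (metis nt_scale_apply)
  have "E (mono \<kappa> \<mu>) S = 0" for S
  proof -
    have "bop_scale (?c - 1) (E (mono \<kappa> \<mu>) S) = 0"
      using bop_scale_add_left[of "?c - 1" 1 "E (mono \<kappa> \<mu>) S"] e[of S] by simp
    then have "cmod (?c - 1) * norm (E (mono \<kappa> \<mu>) S) = 0" by (metis norm_bop_scale norm_zero)
    then show ?thesis using c by simp
  qed
  then have "E (mono \<kappa> \<mu>) = 0" by (intro ext) simp
  then show ?thesis using False by (simp only: if_False)
qed

end

section \<open>Path counting operators\<close>

context finite_hrg
begin

section \<open>Weighted path counts as commuting matrices\<close>

abbreviation wt :: "real \<Rightarrow> ('v, 'e) mor \<Rightarrow> real" where
  "wt \<beta> \<mu> \<equiv> exp (- real (mlen G \<mu>) * \<beta>)"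

text \<open>The matrix monomial B^n in path form; written this way, the semigroup law
  \<open>Bop_add\<close> is unique factorization.\<close>

definition Bop :: "real \<Rightarrow> (nat \<Rightarrow> nat) \<Rightarrow> real ^ 'v \<Rightarrow> real ^ 'v" where
  "Bop \<beta> n x = (\<chi> v. \<Sum>\<mu> | \<mu> \<in> LD n \<and> mrng G \<mu> = v. wt \<beta> \<mu> * x $ msrc \<mu>)"

lemma Bop_nth: "Bop \<beta> n x $ v = (\<Sum>\<mu> | \<mu> \<in> LD n \<and> mrng G \<mu> = v. wt \<beta> \<mu> * x $ msrc \<mu>)"
  by (simp add: Bop_def)

lemma finite_LDv [simp]: "finite {\<mu> \<in> Lam G. mdeg G \<mu> = n \<and> P \<mu>}"
  by (rule finite_subset[OF _ finite_LD[of n]]) auto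

lemma wt_comp: "\<kappa> \<in> Lam G \<Longrightarrow> \<mu> \<in> Lam G \<Longrightarrow> msrc \<kappa> = mrng G \<mu> \<Longrightarrow> wt \<beta> (mcomp G \<kappa> \<mu>) = wt \<beta> \<kappa> * wt \<beta> \<mu>"
  by (simp add: mlen_comp algebra_simps flip: exp_add)

lemma Bop_linear: "linear (Bop \<beta> n)"
  by (rule linearI) (simp_all add: Finite_Cartesian_Product.vec_eq_iff Bop_nth sum.distrib distrib_left sum_distrib_left mult.left_commute)

lemma Bop_bounded_linear: "bounded_linear (Bop \<beta> n)"
  using Bop_linear by (simp add: linear_conv_bounded_linear)

lemmas Bop_add_right = linear_add[OF Bop_linear]
lemmas Bop_diff_right = linear_diff[OF Bop_linear]
lemmas Bop_scaleR = linear_scale[OF Bop_linear]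
lemmas Bop_sum_right = linear_sum[OF Bop_linear]

lemma Bop_0 [simp]: "Bop \<beta> 0 x = x"
proof (simp only: Finite_Cartesian_Product.vec_eq_iff, intro allI)
  fix v
  have "{\<mu>. \<mu> \<in> LD 0 \<and> mrng G \<mu> = v} = {vert G v}"
    using mdeg_0_vert vert_simps by fastforce
  then show "Bop \<beta> 0 x $ v = x $ v" by (simp add: Bop_nth)
qed

lemma LD_add_bij:
  "bij_betw (\<lambda>(\<alpha>, \<gamma>). mcomp G \<alpha> \<gamma>) (SIGMA \<alpha>:{\<alpha>. \<alpha> \<in> LD m \<and> mrng G \<alpha> = v}. {\<gamma>. \<gamma> \<in> LD n \<and> mrng G \<gamma> = msrc \<alpha>})
     {\<mu>. \<mu> \<in> LD (m + n) \<and> mrng G \<mu> = v}"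
proof (rule bij_betwI')
  let ?A = "SIGMA \<alpha>:{\<alpha>. \<alpha> \<in> LD m \<and> mrng G \<alpha> = v}. {\<gamma>. \<gamma> \<in> LD n \<and> mrng G \<gamma> = msrc \<alpha>}"
  show "((case p of (\<alpha>, \<gamma>) \<Rightarrow> mcomp G \<alpha> \<gamma>) = (case q of (\<alpha>, \<gamma>) \<Rightarrow> mcomp G \<alpha> \<gamma>)) = (p = q)" if "p \<in> ?A" "q \<in> ?A" for p q
    using that mcomp_cancel[of "fst p" "snd p" "fst q" "snd q"]
    by (cases p; cases q) auto
  show "(case p of (\<alpha>, \<gamma>) \<Rightarrow> mcomp G \<alpha> \<gamma>) \<in> {\<mu>. \<mu> \<in> LD (m + n) \<and> mrng G \<mu> = v}" if "p \<in> ?A" for p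
    using that by (cases p) (simp add: mcomp_in)
  show "\<exists>p\<in>?A. \<mu> = (case p of (\<alpha>, \<gamma>) \<Rightarrow> mcomp G \<alpha> \<gamma>)" if "\<mu> \<in> {\<mu>. \<mu> \<in> LD (m + n) \<and> mrng G \<mu> = v}" for \<mu>
  proof -
    have m: "\<mu> \<in> Lam G" "mdeg G \<mu> = m + n" "mrng G \<mu> = v" using that by auto
    obtain \<alpha> \<gamma> where a: "\<alpha> \<in> Lam G" "\<gamma> \<in> Lam G" "mdeg G \<alpha> = m" "mdeg G \<gamma> = n" "msrc \<alpha> = mrng G \<gamma>" "\<mu> = mcomp G \<alpha> \<gamma>"
      by (rule factor_ex[OF m(1,2)])
    have "mrng G \<alpha> = v" using a m(3) mcomp_in(3)[OF a(1,2,5)] by simp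
    then show ?thesis using a by (intro bexI[of _ "(\<alpha>, \<gamma>)"]) auto
  qed
qed

lemma Bop_add: "Bop \<beta> (m + n) x = Bop \<beta> m (Bop \<beta> n x)"
proof (simp only: Finite_Cartesian_Product.vec_eq_iff, intro allI)
  fix v
  let ?A = "\<lambda>v m. {\<alpha>. \<alpha> \<in> LD m \<and> mrng G \<alpha> = v}"
  have "Bop \<beta> (m + n) x $ v = (\<Sum>p\<in>Sigma (?A v m) (\<lambda>\<alpha>. ?A (msrc \<alpha>) n).
      wt \<beta> (case p of (\<alpha>, \<gamma>) \<Rightarrow> mcomp G \<alpha> \<gamma>) * x $ msrc (case p of (\<alpha>, \<gamma>) \<Rightarrow> mcomp G \<alpha> \<gamma>))"
    unfolding Bop_nth by (rule sum.reindex_bij_betw[OF LD_add_bij, symmetric])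
  also have "\<dots> = (\<Sum>p\<in>Sigma (?A v m) (\<lambda>\<alpha>. ?A (msrc \<alpha>) n). case p of (\<alpha>, \<gamma>) \<Rightarrow> wt \<beta> \<alpha> * (wt \<beta> \<gamma> * x $ msrc \<gamma>))"
  proof (rule sum.cong[OF refl])
    fix p assume "p \<in> Sigma (?A v m) (\<lambda>\<alpha>. ?A (msrc \<alpha>) n)"
    then obtain \<alpha> \<gamma> where p: "p = (\<alpha>, \<gamma>)" "\<alpha> \<in> Lam G" "\<gamma> \<in> Lam G" "msrc \<alpha> = mrng G \<gamma>" by auto
    show "wt \<beta> (case p of (\<alpha>, \<gamma>) \<Rightarrow> mcomp G \<alpha> \<gamma>) * x $ msrc (case p of (\<alpha>, \<gamma>) \<Rightarrow> mcomp G \<alpha> \<gamma>)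
        = (case p of (\<alpha>, \<gamma>) \<Rightarrow> wt \<beta> \<alpha> * (wt \<beta> \<gamma> * x $ msrc \<gamma>))"
      unfolding p(1) prod.case wt_comp[OF p(2-4)] mcomp_in(2)[OF p(2-4)] by simp
  qed
  also have "\<dots> = (\<Sum>\<alpha>\<in>?A v m. \<Sum>\<gamma>\<in>?A (msrc \<alpha>) n. wt \<beta> \<alpha> * (wt \<beta> \<gamma> * x $ msrc \<gamma>))"
    by (rule sum.Sigma[symmetric]) auto
  also have "\<dots> = Bop \<beta> m (Bop \<beta> n x) $ v"
    by (simp only: Bop_nth sum_distrib_left)
  finally show "Bop \<beta> (m + n) x $ v = Bop \<beta> m (Bop \<beta> n x) $ v" .
qed

text \<open>Both sides count paths of degree m + n. The commuting of the adjacency matrices enters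
  the development in this form.\<close>

lemma Bop_commute: "Bop \<beta> m (Bop \<beta> n x) = Bop \<beta> n (Bop \<beta> m x)"
  by (simp only: Bop_add[symmetric] add.commute)

lemma Bop_nonneg: "(\<And>v. 0 \<le> x $ v) \<Longrightarrow> 0 \<le> Bop \<beta> n x $ v"
  unfolding Bop_nth by (intro sum_nonneg mult_nonneg_nonneg) auto

lemma sum_Bop: "(\<Sum>v\<in>UNIV. Bop \<beta> n x $ v) = (\<Sum>\<mu>\<in>LD n. wt \<beta> \<mu> * x $ msrc \<mu>)"
proof -
  have "(\<Sum>\<mu>\<in>LD n. wt \<beta> \<mu> * x $ msrc \<mu>) = (\<Sum>v\<in>UNIV. \<Sum>\<mu>\<in>{\<mu> \<in> LD n. mrng G \<mu> = v}. wt \<beta> \<mu> * x $ msrc \<mu>)"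
    by (rule sum.group[symmetric]) auto
  then show ?thesis by (simp only: Bop_nth mem_Collect_eq)
qed

lemma mlen_unit: assumes "\<mu> \<in> LD (unit_deg i)" "i \<in> {1..ncolours G}" shows "mlen G \<mu> = 1"
proof -
  have "mlen G \<mu> = (\<Sum>j\<in>{1..ncolours G}. if j = i then 1 else 0)"
    using assms by (simp add: mlen_def unit_deg_def)
  then show ?thesis using assms(2) by simp
qed

lemma Bop_unit: assumes "i \<in> {1..ncolours G}" shows "Bop \<beta> (unit_deg i) x = exp (- \<beta>) *\<^sub>R (adj G i *v x)"
proof (simp only: Finite_Cartesian_Product.vec_eq_iff, intro allI)
  fix v
  let ?A = "{\<mu>. \<mu> \<in> LD (unit_deg i) \<and> mrng G \<mu> = v}"
  have "Bop \<beta> (unit_deg i) x $ v = (\<Sum>\<mu>\<in>?A. exp (- \<beta>) * x $ msrc \<mu>)"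
    unfolding Bop_nth using mlen_unit[OF _ assms] by (intro sum.cong refl) simp
  also have "\<dots> = (\<Sum>s\<in>UNIV. \<Sum>\<mu>\<in>{\<mu> \<in> ?A. msrc \<mu> = s}. exp (- \<beta>) * x $ msrc \<mu>)"
    by (rule sum.group[symmetric]) auto
  also have "\<dots> = (\<Sum>s\<in>UNIV. exp (- \<beta>) * (adj G i $ v $ s * x $ s))"
  proof (rule sum.cong[OF refl])
    fix s
    have "(\<Sum>\<mu>\<in>{\<mu> \<in> ?A. msrc \<mu> = s}. exp (- \<beta>) * x $ msrc \<mu>) = real (card {\<mu> \<in> ?A. msrc \<mu> = s}) * (exp (- \<beta>) * x $ s)"
      by (simp add: sum_constant)
    also have "{\<mu> \<in> ?A. msrc \<mu> = s} = {e \<in> Lam G. mdeg G e = unit_deg i \<and> msrc e = s \<and> mrng G e = v}" by auto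
    finally show "(\<Sum>\<mu>\<in>{\<mu> \<in> ?A. msrc \<mu> = s}. exp (- \<beta>) * x $ msrc \<mu>) = exp (- \<beta>) * (adj G i $ v $ s * x $ s)"
      by (simp add: adj_def conj_ac)
  qed
  also have "\<dots> = (exp (- \<beta>) *\<^sub>R (adj G i *v x)) $ v"
    by (simp add: matrix_vector_mult_def sum_distrib_left)
  finally show "Bop \<beta> (unit_deg i) x $ v = (exp (- \<beta>) *\<^sub>R (adj G i *v x)) $ v" .
qed

lemma Bop_unit_fixed_iff:
  assumes "i \<in> {1..ncolours G}"
  shows "Bop \<beta> (unit_deg i) x = x \<longleftrightarrow> adj G i *v x = exp \<beta> *\<^sub>R x"
proof
  assume "Bop \<beta> (unit_deg i) x = x"
  then have "exp (- \<beta>) *\<^sub>R (adj G i *v x) = x" by (simp only: Bop_unit[OF assms])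
  then have "exp \<beta> *\<^sub>R x = exp \<beta> *\<^sub>R (exp (- \<beta>) *\<^sub>R (adj G i *v x))" by simp
  then show "adj G i *v x = exp \<beta> *\<^sub>R x" by (simp add: exp_minus)
next
  assume "adj G i *v x = exp \<beta> *\<^sub>R x"
  then show "Bop \<beta> (unit_deg i) x = x" by (simp add: Bop_unit[OF assms] exp_minus)
qed

text \<open>The product of the operators 1 - B_i over a list; the recursion follows the order of the
  product defining \<open>nt_QF\<close>.\<close>

primrec DL :: "real \<Rightarrow> nat list \<Rightarrow> real ^ 'v \<Rightarrow> real ^ 'v" where
  "DL \<beta> [] x = x"
| "DL \<beta> (i # js) x = DL \<beta> js x - Bop \<beta> (unit_deg i) (DL \<beta> js x)"

lemma Bop_DL: "Bop \<beta> n (DL \<beta> js x) = DL \<beta> js (Bop \<beta> n x)"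
proof (induct js)
  case (Cons i js)
  then show ?case using Bop_commute[of \<beta> n "unit_deg i" "DL \<beta> js x"] by (simp add: Bop_diff_right)
qed simp

section \<open>Truncated geometric series in several colours\<close>

definition box :: "nat set \<Rightarrow> nat \<Rightarrow> (nat \<Rightarrow> nat) set" where
  "box J K = {n. \<forall>i. if i \<in> J then n i < K else n i = 0}"

lemma finite_box: "finite J \<Longrightarrow> finite (box J K)"
proof (rule finite_subset)
  show "box J K \<subseteq> {f. \<forall>x. (x \<in> J \<longrightarrow> f x \<in> {..<K}) \<and> (x \<notin> J \<longrightarrow> f x = 0)}"
    by (auto simp: box_def split: if_splits)
  show "finite J \<Longrightarrow> finite {f. \<forall>x. (x \<in> J \<longrightarrow> f x \<in> {..<K}) \<and> (x \<notin> J \<longrightarrow> f x = (0::nat))}"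
    by (rule finite_set_of_finite_funs) auto
qed

definition Rop :: "real \<Rightarrow> nat set \<Rightarrow> nat \<Rightarrow> real ^ 'v \<Rightarrow> real ^ 'v" where
  "Rop \<beta> J K x = (\<Sum>n\<in>box J K. Bop \<beta> n x)"

definition ku :: "nat \<Rightarrow> nat \<Rightarrow> nat \<Rightarrow> nat" where
  "ku i k = (\<lambda>j. if j = i then k else 0)"

lemma ku_simps: "ku i 0 = 0" "ku i (Suc k) = unit_deg i + ku i k"
  by (auto simp: ku_def unit_deg_def fun_eq_iff)

lemma Rop_insert:
  assumes "i \<notin> J" "finite J"
  shows "Rop \<beta> (insert i J) K x = (\<Sum>k<K. Bop \<beta> (ku i k) (Rop \<beta> J K x))"
proof -
  have b: "bij_betw (\<lambda>(k, n). ku i k + n) ({..<K} \<times> box J K) (box (insert i J) K)"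
  proof (rule bij_betwI[where g = "\<lambda>n. (n i, n(i := 0))"])
    show "(\<lambda>(k, n). ku i k + n) \<in> {..<K} \<times> box J K \<rightarrow> box (insert i J) K"
      using assms(1) by (auto simp: box_def ku_def)
    show "(\<lambda>n. (n i, n(i := 0))) \<in> box (insert i J) K \<rightarrow> {..<K} \<times> box J K"
      using assms(1) by (auto simp: box_def split: if_splits)
    show "(\<lambda>n. (n i, n(i := 0))) ((\<lambda>(k, n). ku i k + n) p) = p" if "p \<in> {..<K} \<times> box J K" for p
      using that assms(1) by (cases p) (auto simp: box_def ku_def fun_eq_iff)
    show "(\<lambda>(k, n). ku i k + n) ((\<lambda>n. (n i, n(i := 0))) n) = n" for n
      by (auto simp: ku_def fun_eq_iff)
  qed
  have "Rop \<beta> (insert i J) K x = (\<Sum>p\<in>{..<K} \<times> box J K. Bop \<beta> (case p of (k, n) \<Rightarrow> ku i k + n) x)"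
    unfolding Rop_def by (rule sum.reindex_bij_betw[OF b, symmetric])
  also have "\<dots> = (\<Sum>k<K. \<Sum>n\<in>box J K. Bop \<beta> (ku i k) (Bop \<beta> n x))"
    by (simp add: sum.cartesian_product case_prod_unfold Bop_add)
  finally show ?thesis by (simp add: Rop_def Bop_sum_right)
qed

lemma Rop_nonneg: "(\<And>v. 0 \<le> x $ v) \<Longrightarrow> 0 \<le> Rop \<beta> J K x $ v"
  by (auto simp: Rop_def intro!: sum_nonneg Bop_nonneg)

lemma Rop_diff: "Rop \<beta> J K (x - y) = Rop \<beta> J K x - Rop \<beta> J K y"
  by (simp add: Rop_def Bop_diff_right sum_subtractf)

lemma Rop_Bop: "Rop \<beta> J K (Bop \<beta> n x) = Bop \<beta> n (Rop \<beta> J K x)"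
  unfolding Rop_def Bop_sum_right by (intro sum.cong refl Bop_commute)

text \<open>One colour at a time, the geometric sum times 1 - B_i telescopes to 1 - B_i^K, and the
  subtracted term is nonnegative. Positivity is assumed for all lists because every tail of the list
  occurs along the way.\<close>

lemma Rop_DL_le:
  assumes "\<And>js v. distinct js \<Longrightarrow> set js \<subseteq> F \<Longrightarrow> 0 \<le> DL \<beta> js x $ v"
    and "distinct js" "set js \<subseteq> F"
  shows "Rop \<beta> (set js) K (DL \<beta> js x) $ v \<le> x $ v"
  using assms(2,3)
proof (induct js)
  case Nil
  have "box {} K = {0}" by (auto simp: box_def fun_eq_iff)
  then show ?case by (simp add: Rop_def)
next
  case (Cons i js)
  let ?z = "DL \<beta> js x" and ?R = "Rop \<beta> (set js) K (DL \<beta> js x)"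
  have z: "0 \<le> ?z $ v" for v using assms(1)[of js] Cons(2,3) by simp
  have w: "Rop \<beta> (set js) K (DL \<beta> (i # js) x) = ?R - Bop \<beta> (unit_deg i) ?R"
    by (simp only: DL.simps Rop_diff Rop_Bop)
  have "Rop \<beta> (set (i # js)) K (DL \<beta> (i # js) x) = (\<Sum>k<K. Bop \<beta> (ku i k) (Rop \<beta> (set js) K (DL \<beta> (i # js) x)))"
    using Cons(2) by (simp add: Rop_insert del: DL.simps)
  also have "\<dots> = (\<Sum>k<K. Bop \<beta> (ku i k) (?R - Bop \<beta> (unit_deg i) ?R))"
    by (simp only: w)
  also have "\<dots> = (\<Sum>k<K. Bop \<beta> (ku i k) ?R - Bop \<beta> (ku i (Suc k)) ?R)"
    by (simp only: Bop_diff_right ku_simps Bop_add) (simp only: Bop_commute[of \<beta> "unit_deg i"])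
  also have "\<dots> = ?R - Bop \<beta> (ku i K) ?R"
    using sum_lessThan_telescope'[of "\<lambda>k. Bop \<beta> (ku i k) ?R" K] by (simp only: ku_simps(1) Bop_0)
  finally have "Rop \<beta> (set (i # js)) K (DL \<beta> (i # js) x) $ v = ?R $ v - Bop \<beta> (ku i K) ?R $ v" by simp
  also have "\<dots> \<le> ?R $ v" using Bop_nonneg[OF Rop_nonneg[OF z]] by simp
  also have "\<dots> \<le> x $ v" using Cons by simp
  finally show ?case .
qed

lemma finite_sum_DL_le:
  assumes "\<And>js v. distinct js \<Longrightarrow> set js \<subseteq> F \<Longrightarrow> 0 \<le> DL \<beta> js x $ v"
    and js: "distinct js" "set js \<subseteq> F" and A: "finite A" "A \<subseteq> degs_in (set js)"
  shows "(\<Sum>n\<in>A. Bop \<beta> n (DL \<beta> js x) $ v) \<le> x $ v"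
proof -
  \<comment> \<open>Exceeds every entry of the degrees in A. If A or the list is empty, no entry has
    to be bounded and the value of \<open>Max\<close> is irrelevant.\<close>
  define K where "K = Suc (Max ((\<lambda>(n, i). n i) ` (A \<times> set js)))"
  have "A \<subseteq> box (set js) K"
  proof
    fix n assume n: "n \<in> A"
    have "n i < K" if "i \<in> set js" for i
      unfolding K_def less_Suc_eq_le by (rule Max_ge) (use n that A(1) in \<open>auto intro!: image_eqI[of _ _ "(n, i)"]\<close>)
    moreover have "n i = 0" if "i \<notin> set js" for i using n A(2) that by (auto simp: degs_in_def)
    ultimately show "n \<in> box (set js) K" by (simp add: box_def)
  qed
  then have "(\<Sum>n\<in>A. Bop \<beta> n (DL \<beta> js x) $ v) \<le> (\<Sum>n\<in>box (set js) K. Bop \<beta> n (DL \<beta> js x) $ v)"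
    by (intro sum_mono2 finite_box Bop_nonneg assms(1) js) auto
  also have "\<dots> = Rop \<beta> (set js) K (DL \<beta> js x) $ v" by (simp add: Rop_def)
  also have "\<dots> \<le> x $ v" by (rule Rop_DL_le[OF assms(1) js])
  finally show ?thesis .
qed

section \<open>From finite sums to unconditional sums of vectors\<close>

lemma total_bounded_linear: "bounded_linear (\<lambda>x :: real ^ 'v. \<Sum>v\<in>UNIV. x $ v)"
  by (intro bounded_linear_sum bounded_linear_vec_nth)

lemma has_sum_vec_iff:
  fixes f :: "'a \<Rightarrow> real ^ 'v"
  shows "(f has_sum s) A \<longleftrightarrow> (\<forall>v. ((\<lambda>n. f n $ v) has_sum s $ v) A)"
proof
  assume "(f has_sum s) A"
  then show "\<forall>v. ((\<lambda>n. f n $ v) has_sum s $ v) A"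
    using has_sum_bounded_linear[OF bounded_linear_vec_nth] by (auto simp: o_def)
next
  assume *: "\<forall>v. ((\<lambda>n. f n $ v) has_sum s $ v) A"
  show "(f has_sum s) A"
    unfolding has_sum_def using * by (intro vec_tendstoI) (simp add: has_sum_def)
qed

text \<open>If the total mass \<open>\<Sum>\<^sub>n |B\<^sup>n \<epsilon>|\<close> exhausts \<open>\<omega>\<close>, the coordinatewise inequality above
  is an equality in the limit.\<close>

lemma DL_has_sum:
  assumes D: "\<And>js v. distinct js \<Longrightarrow> set js \<subseteq> F \<Longrightarrow> 0 \<le> DL \<beta> js x $ v"
    and js: "distinct js" "set js = F"
    and s: "((\<lambda>n. \<Sum>v\<in>UNIV. Bop \<beta> n (DL \<beta> js x) $ v) has_sum (\<Sum>v\<in>UNIV. x $ v)) (degs_in F)"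
  shows "((\<lambda>n. Bop \<beta> n (DL \<beta> js x)) has_sum x) (degs_in F)"
proof -
  let ?f = "\<lambda>v n. Bop \<beta> n (DL \<beta> js x) $ v"
  have nn: "0 \<le> ?f v n" for v n by (intro Bop_nonneg D js) (use js in auto)
  have le: "sum (?f v) A \<le> x $ v" if "finite A" "A \<subseteq> degs_in F" for v A
    using finite_sum_DL_le[where js = js and A = A and v = v and F = F and x = x and \<beta> = \<beta>] D js that by simp
  have sm: "?f v summable_on degs_in F" for v
    by (rule nonneg_bdd_above_summable_on) (use nn le in \<open>auto intro!: bdd_aboveI[of _ "x $ v"]\<close>)
  have inf_le: "infsum (?f v) (degs_in F) \<le> x $ v" for v
    by (rule infsum_le_finite_sums[OF sm le])
  have "((\<lambda>n. Bop \<beta> n (DL \<beta> js x)) has_sum (\<chi> v. infsum (?f v) (degs_in F))) (degs_in F)"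
    unfolding has_sum_vec_iff using has_sum_infsum[OF sm] by simp
  then have "((\<lambda>n. \<Sum>v\<in>UNIV. ?f v n) has_sum (\<Sum>v\<in>UNIV. infsum (?f v) (degs_in F))) (degs_in F)"
    using has_sum_bounded_linear[OF total_bounded_linear] by (fastforce simp: o_def)
  then have "(\<Sum>v\<in>UNIV. infsum (?f v) (degs_in F)) = (\<Sum>v\<in>UNIV. x $ v)"
    using s has_sum_unique by blast
  then have "(\<Sum>v\<in>UNIV. x $ v - infsum (?f v) (degs_in F)) = 0" by (simp add: sum_subtractf)
  then have "x $ v - infsum (?f v) (degs_in F) = 0" for v
    using inf_le by (subst (asm) sum_nonneg_eq_0_iff) auto
  then have "(?f v has_sum x $ v) (degs_in F)" for v
    using has_sum_infsum[OF sm[of v]] by simp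
  then show ?thesis unfolding has_sum_vec_iff by blast
qed

text \<open>Either colour i is absent or one unit of it can be removed: the index form of the
  equation S = S_0 + B_i S for a series S.\<close>

lemma degs_in_insert_union:
  assumes "i \<notin> R"
  shows "degs_in (insert i R) = degs_in R \<union> (\<lambda>n. unit_deg i + n) ` degs_in (insert i R)"
    and "degs_in R \<inter> (\<lambda>n. unit_deg i + n) ` degs_in (insert i R) = {}"
proof -
  have "n \<in> degs_in R \<union> (\<lambda>n. unit_deg i + n) ` degs_in (insert i R)" if n: "n \<in> degs_in (insert i R)" for n
  proof (cases "n i = 0")
    case True
    then show ?thesis using n by (auto simp: degs_in_def)
  next
    case False
    then have e: "n = unit_deg i + n(i := n i - 1)" by (auto simp: unit_deg_def fun_eq_iff)
    have "n(i := n i - 1) \<in> degs_in (insert i R)" using n by (auto simp: degs_in_def)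
    then show ?thesis using e by blast
  qed
  then show "degs_in (insert i R) = degs_in R \<union> (\<lambda>n. unit_deg i + n) ` degs_in (insert i R)"
    by (auto simp: degs_in_def unit_deg_def split: if_splits)
  show "degs_in R \<inter> (\<lambda>n. unit_deg i + n) ` degs_in (insert i R) = {}"
    using assms by (auto simp: degs_in_def unit_deg_def)
qed

text \<open>Applying 1 - B_i to the series leaves exactly the degrees without colour i. With R empty
  this recovers x from its series; a general R carries the induction over the list.\<close>

lemma DL_of_sum:
  assumes "distinct js" "set js \<inter> R = {}"
    and "((\<lambda>n. Bop \<beta> n x) has_sum s) (degs_in (set js \<union> R))"
  shows "((\<lambda>n. Bop \<beta> n x) has_sum DL \<beta> js s) (degs_in R)"
  using assms
proof (induct js arbitrary: R s)
  case (Cons i js)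
  have R: "set js \<inter> insert i R = {}" "i \<notin> R" using Cons(2,3) by auto
  have "set js \<union> insert i R = set (i # js) \<union> R" by auto
  then have h: "((\<lambda>n. Bop \<beta> n x) has_sum DL \<beta> js s) (degs_in (insert i R))"
    using Cons(1)[OF _ R(1)] Cons(2,4) by (metis distinct.simps(2))
  have "((\<lambda>n. Bop \<beta> (unit_deg i) (Bop \<beta> n x)) has_sum Bop \<beta> (unit_deg i) (DL \<beta> js s)) (degs_in (insert i R))"
    using has_sum_bounded_linear[OF Bop_bounded_linear h] by (simp only: o_def)
  then have "((\<lambda>n. Bop \<beta> n x) \<circ> (\<lambda>n. unit_deg i + n) has_sum Bop \<beta> (unit_deg i) (DL \<beta> js s)) (degs_in (insert i R))"
    by (simp only: o_def Bop_add)
  then have h2: "((\<lambda>n. Bop \<beta> n x) has_sum Bop \<beta> (unit_deg i) (DL \<beta> js s)) ((\<lambda>n. unit_deg i + n) ` degs_in (insert i R))"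
    by (subst has_sum_reindex) (auto intro!: inj_onI)
  have "((\<lambda>n. Bop \<beta> n x) has_sum DL \<beta> js s - Bop \<beta> (unit_deg i) (DL \<beta> js s))
    (degs_in (insert i R) - (\<lambda>n. unit_deg i + n) ` degs_in (insert i R))"
    by (rule has_sum_Diff[OF h h2]) (use degs_in_insert_union(1)[OF R(2)] in blast)
  moreover have "degs_in (insert i R) - (\<lambda>n. unit_deg i + n) ` degs_in (insert i R) = degs_in R"
    using degs_in_insert_union[OF R(2)] by blast
  ultimately show ?case by simp
qed simp

end

section \<open>Perron--Frobenius theory\<close>

text \<open>The principal block at W in the matrix type on which the spectral radius is defined; for
  an adjacency matrix it is \<open>adj_block\<close>.\<close>

definition block :: "real ^ 'v ^ 'v \<Rightarrow> 'v :: finite set \<Rightarrow> complex Matrix.mat" where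
  "block M W = Matrix.mat (card W) (card W)
     (\<lambda>(j, k). complex_of_real (M $ from_nat_into W j $ from_nat_into W k))"

lemma block_carrier: "block M W \<in> carrier_mat (card W) (card W)"
  by (simp add: block_def)

lemma block_mult:
  assumes "y \<in> carrier_vec (card W)" "j < card W"
  shows "vec_index (block M W *\<^sub>v y) j = (\<Sum>k<card W. of_real (M $ from_nat_into W j $ from_nat_into W k) * vec_index y k)"
  using assms by (simp add: block_def scalar_prod_def atLeast0LessThan)

text \<open>Transfers eigenvectors between vectors indexed by natural numbers and functions on W, so
  that the enumeration of W disappears from later arguments.\<close>

lemma block_eigenvalue_iff:
  fixes M :: "real ^ 'v ^ 'v :: finite"
  shows "eigenvalue (block M W) \<mu> \<longleftrightarrow>
    (\<exists>z. (\<exists>v\<in>W. z v \<noteq> 0) \<and> (\<forall>v\<in>W. (\<Sum>u\<in>W. of_real (M $ v $ u) * z u) = \<mu> * z v))"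
proof -
  let ?n = "card W" and ?f = "from_nat_into W"
  have b: "bij_betw ?f {..<?n} W" by (rule bij_betw_from_nat_into_finite) simp
  have fW: "?f j \<in> W" if "j < ?n" for j using bij_betwE[OF b] that by blast
  have sumW: "(\<Sum>k<?n. of_real (M $ v $ ?f k) * z (?f k)) = (\<Sum>u\<in>W. of_real (M $ v $ u) * z u)" for v and z :: "'v \<Rightarrow> complex"
    by (rule sum.reindex_bij_betw[OF b])
  have dim: "dim_row (block M W) = ?n" by (simp add: block_def)
  show ?thesis
  proof
    assume "eigenvalue (block M W) \<mu>"
    then obtain y where y: "y \<in> carrier_vec ?n" "y \<noteq> 0\<^sub>v ?n" "block M W *\<^sub>v y = \<mu> \<cdot>\<^sub>v y"
      unfolding eigenvalue_def eigenvector_def dim by blast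
    define z where "z v = vec_index y (the_inv_into {..<?n} ?f v)" for v
    have zf: "z (?f k) = vec_index y k" if "k < ?n" for k
      unfolding z_def using the_inv_into_f_f[OF bij_betw_imp_inj_on[OF b]] that by simp
    have "\<exists>k<?n. vec_index y k \<noteq> 0"
    proof (rule ccontr)
      assume "\<not> (\<exists>k<?n. vec_index y k \<noteq> 0)"
      then have "y = 0\<^sub>v ?n" using y(1) by (intro eq_vecI) auto
      then show False using y(2) by blast
    qed
    then have "\<exists>v\<in>W. z v \<noteq> 0" using zf fW by metis
    moreover have "(\<Sum>u\<in>W. of_real (M $ v $ u) * z u) = \<mu> * z v" if v: "v \<in> W" for v
    proof -
      obtain j where j: "j < ?n" "v = ?f j" using b v unfolding bij_betw_def by auto
      have "(\<Sum>u\<in>W. of_real (M $ v $ u) * z u) = (\<Sum>k<?n. of_real (M $ v $ ?f k) * z (?f k))" by (rule sumW[symmetric])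
      also have "\<dots> = (\<Sum>k<?n. of_real (M $ ?f j $ ?f k) * vec_index y k)"
        by (rule sum.cong) (auto simp: zf j)
      also have "\<dots> = vec_index (\<mu> \<cdot>\<^sub>v y) j" by (simp only: block_mult[OF y(1) j(1), symmetric] y(3))
      also have "\<dots> = \<mu> * z v" using y(1) j zf by simp
      finally show ?thesis .
    qed
    ultimately show "\<exists>z. (\<exists>v\<in>W. z v \<noteq> 0) \<and> (\<forall>v\<in>W. (\<Sum>u\<in>W. of_real (M $ v $ u) * z u) = \<mu> * z v)" by blast
  next
    assume "\<exists>z. (\<exists>v\<in>W. z v \<noteq> 0) \<and> (\<forall>v\<in>W. (\<Sum>u\<in>W. of_real (M $ v $ u) * z u) = \<mu> * z v)"
    then obtain z where z: "\<exists>v\<in>W. z v \<noteq> 0" "\<And>v. v \<in> W \<Longrightarrow> (\<Sum>u\<in>W. of_real (M $ v $ u) * z u) = \<mu> * z v" by blast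
    define y where "y = vec ?n (\<lambda>k. z (?f k))"
    have yc: "y \<in> carrier_vec ?n" by (simp add: y_def)
    have yk: "vec_index y k = z (?f k)" if "k < ?n" for k using that by (simp add: y_def)
    obtain v where v: "v \<in> W" "z v \<noteq> 0" using z(1) by blast
    then obtain j where j: "j < ?n" "v = ?f j" using b unfolding bij_betw_def by auto
    have "vec_index y j \<noteq> 0" using yk[OF j(1)] v j by simp
    then have "y \<noteq> 0\<^sub>v ?n" using j(1) by auto
    moreover have "block M W *\<^sub>v y = \<mu> \<cdot>\<^sub>v y"
    proof (rule eq_vecI)
      show "dim_vec (block M W *\<^sub>v y) = dim_vec (\<mu> \<cdot>\<^sub>v y)" by (simp add: block_def y_def)
      fix j assume "j < dim_vec (\<mu> \<cdot>\<^sub>v y)"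
      then have j: "j < ?n" by (simp add: y_def)
      have "vec_index (block M W *\<^sub>v y) j = (\<Sum>k<?n. of_real (M $ ?f j $ ?f k) * z (?f k))"
        unfolding block_mult[OF yc j] by (rule sum.cong) (auto simp: yk)
      also have "\<dots> = \<mu> * z (?f j)" unfolding sumW by (rule z(2)[OF fW[OF j]])
      finally show "vec_index (block M W *\<^sub>v y) j = vec_index (\<mu> \<cdot>\<^sub>v y) j" using j yk[OF j] yc by simp
    qed
    ultimately show "eigenvalue (block M W) \<mu>"
      unfolding eigenvalue_def eigenvector_def dim using yc by blast
  qed
qed

lemma
  fixes M :: "real ^ 'v ^ 'v :: finite"
  assumes W: "W \<noteq> {}"
  shows spectral_radius_attained: "\<exists>\<mu>. eigenvalue (block M W) \<mu> \<and> cmod \<mu> = spectral_radius (block M W)"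
    and spectral_radius_ge: "eigenvalue (block M W) \<mu> \<Longrightarrow> cmod \<mu> \<le> spectral_radius (block M W)"
proof -
  have n: "0 < card W" using W by (simp add: card_gt_0_iff)
  show "\<exists>\<mu>. eigenvalue (block M W) \<mu> \<and> cmod \<mu> = spectral_radius (block M W)"
    using spectral_radius_mem_max(1)[OF block_carrier n, of M] unfolding spectrum_def by auto
  show "eigenvalue (block M W) \<mu> \<Longrightarrow> cmod \<mu> \<le> spectral_radius (block M W)"
    by (rule spectral_radius_mem_max(2)[OF block_carrier n]) (auto simp: spectrum_def)
qed

lemma spectral_radius_nonneg: "W \<noteq> {} \<Longrightarrow> 0 \<le> spectral_radius (block (M :: real ^ 'v ^ 'v :: finite) W)"
  using spectral_radius_attained[of W M] norm_ge_zero by metis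

text \<open>A Collatz-Wielandt bound. Take the least C for which C x dominates the modulus of an
  eigenvector; at a vertex w of equality, compare the eigenvalue equation with the inequality for
  x.\<close>

lemma spectral_radius_le_of_super:
  fixes M :: "real ^ 'v ^ 'v :: finite"
  assumes W: "W \<noteq> {}" and M: "\<And>v u. 0 \<le> M $ v $ u"
    and x: "\<And>v. v \<in> W \<Longrightarrow> 0 < x v" and le: "\<And>v. v \<in> W \<Longrightarrow> (\<Sum>u\<in>W. M $ v $ u * x u) \<le> c * x v"
  shows "spectral_radius (block M W) \<le> c"
proof -
  obtain \<mu> where \<mu>: "eigenvalue (block M W) \<mu>" "cmod \<mu> = spectral_radius (block M W)"
    using spectral_radius_attained[OF W] by blast
  then obtain z where z: "\<exists>v\<in>W. z v \<noteq> 0" "\<And>v. v \<in> W \<Longrightarrow> (\<Sum>u\<in>W. of_real (M $ v $ u) * z u) = \<mu> * z v"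
    unfolding block_eigenvalue_iff by blast
  define C where "C = Max ((\<lambda>v. cmod (z v) / x v) ` W)"
  have Cge: "cmod (z v) \<le> C * x v" if "v \<in> W" for v
  proof -
    have "cmod (z v) / x v \<le> C" unfolding C_def by (rule Max_ge) (use that in auto)
    then show ?thesis using x[OF that] by (simp add: pos_divide_le_eq)
  qed
  have "C \<in> (\<lambda>v. cmod (z v) / x v) ` W" unfolding C_def by (rule Max_in) (use W in auto)
  then obtain w where w: "w \<in> W" "C = cmod (z w) / x w" by blast
  have Cw: "cmod (z w) = C * x w" using w x[OF w(1)] by simp
  have Cpos: "0 < C"
  proof -
    obtain v where v: "v \<in> W" "z v \<noteq> 0" using z(1) by blast
    then have "0 < C * x v" using Cge[OF v(1)] by (meson less_le_trans zero_less_norm_iff)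
    then show ?thesis using x[OF v(1)] by (simp add: zero_less_mult_iff)
  qed
  have "cmod \<mu> * (C * x w) = cmod (\<Sum>u\<in>W. of_real (M $ w $ u) * z u)"
    using z(2)[OF w(1)] by (simp add: norm_mult Cw)
  also have "\<dots> \<le> (\<Sum>u\<in>W. M $ w $ u * cmod (z u))"
    by (rule order_trans[OF norm_sum]) (simp add: norm_mult M)
  also have "\<dots> \<le> (\<Sum>u\<in>W. M $ w $ u * (C * x u))"
    by (intro sum_mono mult_left_mono Cge M)
  also have "\<dots> = C * (\<Sum>u\<in>W. M $ w $ u * x u)" by (simp add: sum_distrib_left mult_ac)
  also have "\<dots> \<le> C * (c * x w)" using Cpos le[OF w(1)] by simp
  finally have "cmod \<mu> * (C * x w) \<le> c * (C * x w)" by (simp add: mult_ac)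
  then show ?thesis using Cpos x[OF w(1)] \<mu>(2) by simp
qed

lemma spectral_radius_ge_of_eigen:
  fixes M :: "real ^ 'v ^ 'v :: finite"
  assumes W: "W \<noteq> {}" and v: "v \<in> W" "x v \<noteq> 0"
    and eq: "\<And>v. v \<in> W \<Longrightarrow> (\<Sum>u\<in>W. M $ v $ u * x u) = c * x v"
  shows "c \<le> spectral_radius (block M W)"
proof -
  have "(\<Sum>u\<in>W. complex_of_real (M $ v $ u) * of_real (x u)) = of_real c * of_real (x v)" if "v \<in> W" for v
    using arg_cong[OF eq[OF that], of complex_of_real] by simp
  then have "eigenvalue (block M W) (of_real c)"
    unfolding block_eigenvalue_iff using v by (intro exI[of _ "\<lambda>v. of_real (x v)"]) auto
  from spectral_radius_ge[OF W this] show ?thesis by simp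
qed

text \<open>The modulus of an eigenvector for an eigenvalue of largest modulus. The triangle
  inequality yields an inequality in the direction of expansion, which is what the cones below are
  built from.\<close>

lemma spectral_radius_subeigen:
  fixes M :: "real ^ 'v ^ 'v :: finite"
  assumes W: "W \<noteq> {}" and M: "\<And>v u. 0 \<le> M $ v $ u"
  shows "\<exists>x. (\<forall>v. 0 \<le> x v) \<and> (\<exists>v\<in>W. x v \<noteq> 0) \<and> (\<forall>v\<in>W. spectral_radius (block M W) * x v \<le> (\<Sum>u\<in>W. M $ v $ u * x u))"
proof -
  obtain \<mu> where \<mu>: "eigenvalue (block M W) \<mu>" "cmod \<mu> = spectral_radius (block M W)"
    using spectral_radius_attained[OF W] by blast
  then obtain z where z: "\<exists>v\<in>W. z v \<noteq> 0" "\<And>v. v \<in> W \<Longrightarrow> (\<Sum>u\<in>W. of_real (M $ v $ u) * z u) = \<mu> * z v"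
    unfolding block_eigenvalue_iff by blast
  have "spectral_radius (block M W) * cmod (z v) \<le> (\<Sum>u\<in>W. M $ v $ u * cmod (z u))" if "v \<in> W" for v
  proof -
    have "spectral_radius (block M W) * cmod (z v) = cmod (\<Sum>u\<in>W. of_real (M $ v $ u) * z u)"
      unfolding z(2)[OF that] by (simp add: norm_mult \<mu>(2))
    also have "\<dots> \<le> (\<Sum>u\<in>W. M $ v $ u * cmod (z u))"
      by (rule order_trans[OF norm_sum]) (simp add: norm_mult M)
    finally show ?thesis .
  qed
  then show ?thesis using z(1) by (intro exI[of _ "\<lambda>v. cmod (z v)"]) auto
qed

section \<open>Eigenvectors in closed cones\<close>

lemma compact_simplex: "compact {x :: real ^ 'v :: finite. (\<forall>v. 0 \<le> x $ v) \<and> (\<Sum>v\<in>UNIV. x $ v) = 1}"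
proof -
  let ?K = "{x :: real ^ 'v. (\<forall>v. 0 \<le> x $ v) \<and> (\<Sum>v\<in>UNIV. x $ v) = 1}"
  have "closed ?K" by (intro closed_Collect_conj closed_Collect_all closed_Collect_le closed_Collect_eq continuous_intros)
  moreover have "bounded ?K"
  proof (rule boundedI[where B = 1])
    fix x assume x: "x \<in> ?K"
    have "norm x \<le> (\<Sum>v\<in>UNIV. \<bar>x $ v\<bar>)" by (rule norm_le_l1_cart)
    also have "\<dots> = 1" using x by simp
    finally show "norm x \<le> 1" .
  qed
  ultimately show ?thesis by (simp add: compact_eq_bounded_closed)
qed

text \<open>Closed convex cones in the nonnegative orthant other than 0; intersecting with an
  eigenspace keeps this form as long as a nonzero vector remains.\<close>

definition pos_cone :: "(real ^ 'v :: finite) set \<Rightarrow> bool" where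
  "pos_cone C \<longleftrightarrow> closed C \<and> (\<forall>x\<in>C. \<forall>y\<in>C. x + y \<in> C) \<and> (\<forall>x\<in>C. \<forall>c\<ge>0. c *\<^sub>R x \<in> C) \<and> (\<forall>x\<in>C. \<forall>v. 0 \<le> x $ v) \<and> (\<exists>x\<in>C. x \<noteq> 0)"

lemma nonneg_total_pos:
  fixes x :: "real ^ 'v :: finite"
  assumes "\<And>v. 0 \<le> x $ v" "x \<noteq> 0"
  shows "0 < (\<Sum>v\<in>UNIV. x $ v)"
proof -
  have "(\<Sum>v\<in>UNIV. x $ v) \<noteq> 0"
    using assms by (auto simp: sum_nonneg_eq_0_iff Finite_Cartesian_Product.vec_eq_iff)
  then show ?thesis using assms(1) by (simp add: less_le sum_nonneg)
qed

text \<open>Brouwer's theorem, applied to \<open>x \<mapsto> A x / |A x|\<close> on the base of the cone.\<close>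

lemma cone_eigenvector:
  fixes A :: "real ^ 'v :: finite \<Rightarrow> real ^ 'v"
  assumes C: "pos_cone C" and A: "linear A" and inv: "\<And>x. x \<in> C \<Longrightarrow> A x \<in> C"
  shows "\<exists>x\<in>C. x \<noteq> 0 \<and> (\<exists>c\<ge>0. A x = c *\<^sub>R x)"
proof (cases "\<exists>x\<in>C. x \<noteq> 0 \<and> A x = 0")
  case True
  then show ?thesis by (metis order_refl scaleR_zero_left)
next
  case False
  note c = C[unfolded pos_cone_def]
  let ?t = "\<lambda>x :: real ^ 'v. \<Sum>v\<in>UNIV. x $ v"
  define K where "K = {x \<in> C. ?t x = 1}"
  have tpos: "0 < ?t x" if "x \<in> C" "x \<noteq> 0" for x using that c by (intro nonneg_total_pos) auto
  have "K = {x. (\<forall>v. 0 \<le> x $ v) \<and> ?t x = 1} \<inter> C" using c by (auto simp: K_def)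
  moreover have "closed C" using c by blast
  ultimately have "compact K" using compact_Int_closed[OF compact_simplex] by (simp only:)
  moreover have "convex K"
    unfolding convex_def
  proof (intro ballI allI impI)
    fix x y and a b :: real assume x: "x \<in> K" and y: "y \<in> K" and ab: "0 \<le> a" "0 \<le> b" "a + b = 1"
    have "a *\<^sub>R x + b *\<^sub>R y \<in> C" using x y ab c by (auto simp: K_def)
    moreover have "?t (a *\<^sub>R x + b *\<^sub>R y) = a * ?t x + b * ?t y" by (simp add: sum.distrib sum_distrib_left)
    ultimately show "a *\<^sub>R x + b *\<^sub>R y \<in> K" using x y ab by (simp add: K_def)
  qed
  moreover have "K \<noteq> {}"
  proof -
    obtain x where x: "x \<in> C" "x \<noteq> 0" using c by blast
    have "(1 / ?t x) *\<^sub>R x \<in> C" using x tpos[OF x] c by simp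
    moreover have "?t ((1 / ?t x) *\<^sub>R x) = (1 / ?t x) * ?t x" by (simp add: sum_distrib_left del: times_divide_eq_left)
    ultimately show ?thesis using tpos[OF x] by (auto simp: K_def)
  qed
  moreover have Kne: "A x \<in> C \<and> A x \<noteq> 0" if "x \<in> K" for x
  proof -
    have "x \<noteq> 0" using that by (auto simp: K_def)
    then show ?thesis using that False inv by (auto simp: K_def)
  qed
  have cA: "continuous_on K A" using A by (simp add: linear_continuous_on linear_conv_bounded_linear)
  have cf: "continuous_on K (\<lambda>x. (1 / ?t (A x)) *\<^sub>R A x)"
  proof (intro continuous_intros cA ballI)
    show "?t (A x) \<noteq> 0" if "x \<in> K" for x using tpos Kne[OF that] by force
  qed
  have fK: "(\<lambda>x. (1 / ?t (A x)) *\<^sub>R A x) \<in> K \<rightarrow> K"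
  proof
    fix x assume x: "x \<in> K"
    have p: "0 < ?t (A x)" using tpos Kne[OF x] by blast
    have "(1 / ?t (A x)) *\<^sub>R A x \<in> C" using Kne[OF x] p c by simp
    moreover have "?t ((1 / ?t (A x)) *\<^sub>R A x) = (1 / ?t (A x)) * ?t (A x)" by (simp add: sum_distrib_left del: times_divide_eq_left)
    ultimately show "(1 / ?t (A x)) *\<^sub>R A x \<in> K" using p by (simp add: K_def)
  qed
  ultimately obtain x where x: "x \<in> K" "(1 / ?t (A x)) *\<^sub>R A x = x"
    using brouwer[OF _ _ _ cf fK] by blast
  have p: "0 < ?t (A x)" using tpos Kne[OF x(1)] by blast
  then have "A x = ?t (A x) *\<^sub>R ((1 / ?t (A x)) *\<^sub>R A x)" by simp
  then have "A x = ?t (A x) *\<^sub>R x" by (simp only: x(2))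
  moreover have "x \<in> C" "x \<noteq> 0" using x(1) by (auto simp: K_def)
  ultimately show ?thesis using p less_imp_le by blast
qed

text \<open>Eigenvectors of one operator for one eigenvalue form a smaller cone of the same kind,
  invariant under the other operators because they commute with it.\<close>

lemma common_eigenvector:
  fixes A :: "'i \<Rightarrow> real ^ 'v :: finite \<Rightarrow> real ^ 'v"
  assumes "finite I" "pos_cone C" "\<And>i. i \<in> I \<Longrightarrow> linear (A i)" "\<And>i x. i \<in> I \<Longrightarrow> x \<in> C \<Longrightarrow> A i x \<in> C"
    and "\<And>i j x. i \<in> I \<Longrightarrow> j \<in> I \<Longrightarrow> A i (A j x) = A j (A i x)"
  shows "\<exists>x\<in>C. x \<noteq> 0 \<and> (\<forall>i\<in>I. \<exists>c\<ge>0. A i x = c *\<^sub>R x)"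
  using assms
proof (induct I arbitrary: C rule: finite_induct)
  case empty
  then show ?case by (auto simp: pos_cone_def)
next
  case (insert i I)
  obtain x0 c where x0: "x0 \<in> C" "x0 \<noteq> 0" "c \<ge> 0" "A i x0 = c *\<^sub>R x0"
    using cone_eigenvector[OF insert(4), of "A i"] insert(5,6) by blast
  define D where "D = {x \<in> C. A i x = c *\<^sub>R x}"
  have lin: "linear (A i)" using insert(5) by simp
  have c: "closed C" "\<forall>x\<in>C. \<forall>y\<in>C. x + y \<in> C" "\<forall>x\<in>C. \<forall>c\<ge>0. c *\<^sub>R x \<in> C" "\<forall>x\<in>C. \<forall>v. 0 \<le> x $ v"
    using insert(4) by (auto simp: pos_cone_def)
  have cont: "continuous_on UNIV (A i)" using lin by (simp add: linear_continuous_on linear_conv_bounded_linear)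
  have D: "pos_cone D"
    unfolding pos_cone_def
  proof (intro conjI)
    have "D = C \<inter> {x. A i x = c *\<^sub>R x}" by (auto simp: D_def)
    then show "closed D" using c(1) cont by (simp add: closed_Int closed_Collect_eq continuous_intros)
    show "\<forall>x\<in>D. \<forall>y\<in>D. x + y \<in> D" using c(2) by (simp add: D_def linear_add[OF lin] scaleR_add_right)
    show "\<forall>x\<in>D. \<forall>k\<ge>0. k *\<^sub>R x \<in> D" using c(3) by (simp add: D_def linear_scale[OF lin] mult.commute)
    show "\<forall>x\<in>D. \<forall>v. 0 \<le> x $ v" using c(4) by (simp add: D_def)
    show "\<exists>x\<in>D. x \<noteq> 0" using x0 by (auto simp: D_def)
  qed
  have "\<exists>x\<in>D. x \<noteq> 0 \<and> (\<forall>j\<in>I. \<exists>c\<ge>0. A j x = c *\<^sub>R x)"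
  proof (rule insert(3)[OF D])
    show "linear (A j)" if "j \<in> I" for j using insert(5) that by simp
    show "A j x \<in> D" if "j \<in> I" "x \<in> D" for j x
    proof -
      have "A i (A j x) = A j (A i x)" using insert(7) that by simp
      also have "\<dots> = c *\<^sub>R A j x" using that insert(5)[of j] by (simp add: D_def linear_scale)
      finally show ?thesis using insert(6) that by (simp add: D_def)
    qed
    show "A j (A k x) = A k (A j x)" if "j \<in> I" "k \<in> I" for j k x using insert(7) that by simp
  qed
  then show ?case using x0(3) by (auto simp: D_def)
qed

context finite_hrg
begin

section \<open>Sink sets and joint eigenvectors of the adjacency matrices\<close>

abbreviation sr :: "nat \<Rightarrow> 'v set \<Rightarrow> real" where
  "sr i W \<equiv> spectral_radius (block (adj G i) W)"

lemma rho_sr: "rho G W = Max ((\<lambda>i. sr i W) ` {1..ncolours G})"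
  by (simp add: rho_def adj_block_def block_def)

lemma sr_le_rho: "i \<in> {1..ncolours G} \<Longrightarrow> sr i W \<le> rho G W"
  unfolding rho_sr by (rule Max_ge) auto

lemma rho_attained: "\<exists>i\<in>{1..ncolours G}. rho G W = sr i W"
proof -
  have "rho G W \<in> (\<lambda>i. sr i W) ` {1..ncolours G}"
    unfolding rho_sr using ncolours_pos by (intro Max_in) auto
  then show ?thesis by blast
qed

lemma adj_nonneg: "0 \<le> adj G i $ t $ s"
  by (simp add: adj_def)

lemma sink_Lam:
  assumes W: "sink_subgraph G W" and \<mu>: "\<mu> \<in> Lam G" "msrc \<mu> \<in> W"
  shows "mrng G \<mu> \<in> W"
proof -
  have "is_path G (v, es) \<Longrightarrow> v \<in> W \<Longrightarrow> path_rng G (v, es) \<in> W" for v es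
    using W by (induct es) (auto simp: sink_subgraph_def)
  then show ?thesis using rep_path(1)[OF \<mu>(1)] \<mu>(2) unfolding msrc_def mrng_def path_src_def paths_def
    by (metis mem_Collect_eq prod.collapse)
qed

lemma adj_sink_zero: assumes "sink_subgraph G W" "s \<in> W" "t \<notin> W" shows "adj G i $ t $ s = 0"
proof -
  have "{e \<in> Lam G. mdeg G e = unit_deg i \<and> msrc e = s \<and> mrng G e = t} = {}"
    using sink_Lam[OF assms(1)] assms(2,3) by auto
  then show ?thesis by (simp add: adj_def)
qed

lemma adj_supported:
  assumes "\<And>v. v \<notin> W \<Longrightarrow> x $ v = 0"
  shows "(adj G i *v x) $ v = (\<Sum>u\<in>W. adj G i $ v $ u * x $ u)"
  unfolding matrix_vector_mult_def vec_lambda_beta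
  by (rule sum.mono_neutral_right) (use assms in auto)

lemma adj_supported_zero:
  assumes "sink_subgraph G W" "\<And>v. v \<notin> W \<Longrightarrow> x $ v = 0" "v \<notin> W"
  shows "(adj G i *v x) $ v = 0"
proof -
  have "(adj G i *v x) $ v = (\<Sum>u\<in>W. adj G i $ v $ u * x $ u)" by (rule adj_supported) (rule assms(2))
  then show ?thesis using adj_sink_zero[OF assms(1) _ assms(3)] by simp
qed

lemma adj_mult_nonneg: "(\<And>v. 0 \<le> x $ v) \<Longrightarrow> 0 \<le> (adj G i *v x) $ v"
  unfolding matrix_vector_mult_def by (auto intro!: sum_nonneg mult_nonneg_nonneg adj_nonneg)

lemma adj_commute:
  assumes "i \<in> {1..ncolours G}" "j \<in> {1..ncolours G}"
  shows "adj G i *v (adj G j *v x) = adj G j *v (adj G i *v x)"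
  using Bop_commute[of 0 "unit_deg i" "unit_deg j" x]
  by (simp only: Bop_unit[OF assms(1)] Bop_unit[OF assms(2)] minus_zero exp_zero scaleR_one)

text \<open>Only an inequality is imposed: the modulus of an eigenvector provides no more, and
  nonnegative matrices commuting with colour i preserve it.\<close>

definition subcone :: "nat \<Rightarrow> real \<Rightarrow> 'v set \<Rightarrow> (real ^ 'v) set" where
  "subcone i c W = {x. (\<forall>v. 0 \<le> x $ v) \<and> (\<forall>v. v \<notin> W \<longrightarrow> x $ v = 0) \<and> (\<forall>v. c * x $ v \<le> (adj G i *v x) $ v)}"

lemma subcone_eigen:
  assumes W: "sink_subgraph G W" and i: "i \<in> {1..ncolours G}" and ne: "\<exists>x\<in>subcone i c W. x \<noteq> 0"
  shows "\<exists>x\<in>subcone i c W. x \<noteq> 0 \<and> (\<forall>j\<in>{1..ncolours G}. \<exists>d\<ge>0. adj G j *v x = d *\<^sub>R x)"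
proof (rule common_eigenvector)
  have lin: "linear (\<lambda>x. adj G j *v x)" for j by (rule matrix_vector_mul_linear)
  show "pos_cone (subcone i c W)"
    unfolding pos_cone_def
  proof (intro conjI ne)
    show "closed (subcone i c W)"
      unfolding subcone_def matrix_vector_mult_def vec_lambda_beta imp_conv_disj
      by (intro closed_Collect_conj closed_Collect_all closed_Collect_disj closed_Collect_le closed_Collect_eq
          closed_Collect_const continuous_intros)
    show "\<forall>x\<in>subcone i c W. \<forall>y\<in>subcone i c W. x + y \<in> subcone i c W"
      by (auto simp: subcone_def linear_add[OF lin] distrib_left intro: add_mono)
    show "\<forall>x\<in>subcone i c W. \<forall>k\<ge>0. k *\<^sub>R x \<in> subcone i c W"
    proof (intro ballI allI impI)
      fix x and k :: real assume x: "x \<in> subcone i c W" and k: "0 \<le> k"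
      have "c * (k * x $ v) \<le> k * (adj G i *v x) $ v" for v
        using mult_left_mono[of "c * x $ v" "(adj G i *v x) $ v" k] x k by (simp add: subcone_def mult_ac)
      then show "k *\<^sub>R x \<in> subcone i c W" using x k by (simp add: subcone_def linear_scale[OF lin])
    qed
    show "\<forall>x\<in>subcone i c W. \<forall>v. 0 \<le> x $ v" by (simp add: subcone_def)
  qed
  show "adj G j *v x \<in> subcone i c W" if j: "j \<in> {1..ncolours G}" and x: "x \<in> subcone i c W" for j x
  proof -
    \<comment> \<open>Colour j acts on the nonnegative excess of colour i over c x; commuting then
      gives the inequality for the image of x.\<close>
    have "0 \<le> (adj G i *v x - c *\<^sub>R x) $ v" for v using x by (simp add: subcone_def)
    then have "0 \<le> (adj G j *v (adj G i *v x - c *\<^sub>R x)) $ v" for v by (rule adj_mult_nonneg)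
    then have "c * (adj G j *v x) $ v \<le> (adj G i *v (adj G j *v x)) $ v" for v
      by (simp add: linear_diff[OF lin] linear_scale[OF lin] adj_commute[OF i j])
    then show ?thesis using x adj_supported_zero[OF W, of x] by (simp add: subcone_def adj_mult_nonneg)
  qed
  show "adj G j *v (adj G k *v x) = adj G k *v (adj G j *v x)" if "j \<in> {1..ncolours G}" "k \<in> {1..ncolours G}" for j k x
    by (rule adj_commute[OF that])
qed (simp_all add: matrix_vector_mul_linear)

text \<open>Support in W restricts the global eigenvector equation to the block at W.\<close>

lemma eigen_le_sr:
  assumes "W \<noteq> {}" "\<And>v. v \<notin> W \<Longrightarrow> x $ v = 0" "x \<noteq> 0" "adj G i *v x = c *\<^sub>R x"
  shows "c \<le> sr i W"
proof -
  obtain v where v: "x $ v \<noteq> 0" using assms(3) by (auto simp: Finite_Cartesian_Product.vec_eq_iff)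
  show ?thesis
  proof (rule spectral_radius_ge_of_eigen[OF assms(1)])
    show "v \<in> W" using v assms(2) by blast
    show "x $ v \<noteq> 0" by (rule v)
    show "(\<Sum>u\<in>W. adj G i $ v $ u * x $ u) = c * x $ v" for v
      using adj_supported[OF assms(2), where i = i and v = v] assms(4) by simp
  qed
qed

text \<open>In the cone for c = \<open>sr i W\<close> a joint eigenvector has i-eigenvalue at least
  c by membership and at most c because it is an eigenvalue of the block. The modulus of a block
  eigenvector shows that the cone is not zero.\<close>

lemma joint_eigenvector:
  assumes W: "sink_subgraph G W" and i: "i \<in> {1..ncolours G}"
  shows "\<exists>x. (\<forall>v. 0 \<le> x $ v) \<and> (\<forall>v. v \<notin> W \<longrightarrow> x $ v = 0) \<and> x \<noteq> 0 \<and> adj G i *v x = sr i W *\<^sub>R x \<and>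
    (\<forall>j\<in>{1..ncolours G}. \<exists>d\<ge>0. d \<le> sr j W \<and> adj G j *v x = d *\<^sub>R x)"
proof -
  have Wne: "W \<noteq> {}" using W by (simp add: sink_subgraph_def)
  obtain y where y: "\<And>v. 0 \<le> y v" "\<exists>v\<in>W. y v \<noteq> 0" "\<And>v. v \<in> W \<Longrightarrow> sr i W * y v \<le> (\<Sum>u\<in>W. adj G i $ v $ u * y u)"
    using spectral_radius_subeigen[OF Wne adj_nonneg] by blast
  \<comment> \<open>Extension by zero off W. Edges do not leave W, so the image vanishes there too
    and the inequality holds at every vertex.\<close>
  define z where "z = (\<chi> v. if v \<in> W then y v else 0)"
  have zs: "v \<notin> W \<Longrightarrow> z $ v = 0" for v by (simp add: z_def)
  have "(\<Sum>u\<in>W. adj G i $ v $ u * z $ u) = (\<Sum>u\<in>W. adj G i $ v $ u * y u)" for v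
    by (rule sum.cong) (auto simp: z_def)
  then have "sr i W * z $ v \<le> (adj G i *v z) $ v" for v
    using y(3)[of v] adj_supported[OF zs, where i = i and v = v] adj_supported_zero[OF W zs, where i = i and v = v]
    by (cases "v \<in> W") (auto simp: z_def)
  then have "z \<in> subcone i (sr i W) W" using y(1) by (simp add: subcone_def z_def)
  moreover have "z \<noteq> 0" using y(2) by (auto simp: z_def Finite_Cartesian_Product.vec_eq_iff)
  ultimately have ne: "\<exists>x\<in>subcone i (sr i W) W. x \<noteq> 0" by blast
  obtain x where x: "x \<in> subcone i (sr i W) W" "x \<noteq> 0" "\<forall>j\<in>{1..ncolours G}. \<exists>d\<ge>0. adj G j *v x = d *\<^sub>R x"
    using subcone_eigen[OF W i ne] by blast
  have x0: "\<And>v. 0 \<le> x $ v" "\<And>v. v \<notin> W \<Longrightarrow> x $ v = 0" "\<And>v. sr i W * x $ v \<le> (adj G i *v x) $ v"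
    using x(1) by (auto simp: subcone_def)
  have ev: "\<exists>d\<ge>0. d \<le> sr j W \<and> adj G j *v x = d *\<^sub>R x" if j: "j \<in> {1..ncolours G}" for j
  proof -
    obtain d where d: "0 \<le> d" "adj G j *v x = d *\<^sub>R x" using bspec[OF x(3) j] by blast
    have "d \<le> sr j W" by (rule eigen_le_sr[OF Wne _ x(2) d(2)]) (rule x0(2))
    then show ?thesis using d by (intro exI[of _ d]) simp
  qed
  obtain d where d: "d \<le> sr i W" "adj G i *v x = d *\<^sub>R x" using ev[OF i] by blast
  obtain v where "x $ v \<noteq> 0" using x(2) by (auto simp: Finite_Cartesian_Product.vec_eq_iff)
  then have "0 < x $ v" using x0(1)[of v] by simp
  moreover have "sr i W * x $ v \<le> d * x $ v" using x0(3)[of v] d(2) by simp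
  ultimately have "sr i W \<le> d" by simp
  then have e: "adj G i *v x = sr i W *\<^sub>R x" using d by simp
  show ?thesis
    using x0(1,2) x(2) e ev by blast
qed

text \<open>The joint eigenvector of the smaller sink set is supported there, hence its eigenvalue
  is also one of the larger block.\<close>

lemma sr_mono:
  assumes "sink_subgraph G W" "W \<subseteq> W'" "i \<in> {1..ncolours G}"
  shows "sr i W \<le> sr i W'"
proof -
  obtain x where x: "\<And>v. 0 \<le> x $ v" "\<And>v. v \<notin> W \<Longrightarrow> x $ v = 0" "x \<noteq> 0" "adj G i *v x = sr i W *\<^sub>R x"
    "\<And>j. j \<in> {1..ncolours G} \<Longrightarrow> \<exists>d\<ge>0. d \<le> sr j W \<and> adj G j *v x = d *\<^sub>R x"
    using joint_eigenvector[OF assms(1,3)] by blast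
  show ?thesis
  proof (rule eigen_le_sr[OF _ _ x(3,4)])
    show "W' \<noteq> {}" using assms(1,2) by (auto simp: sink_subgraph_def)
    show "x $ v = 0" if "v \<notin> W'" for v using x(2)[of v] that assms(2) by blast
  qed
qed

lemma rho_mono:
  assumes "sink_subgraph G W" "W \<subseteq> W'" shows "rho G W \<le> rho G W'"
proof -
  obtain i where i: "i \<in> {1..ncolours G}" "rho G W = sr i W" using rho_attained[of W] by blast
  show ?thesis unfolding i(2) by (rule order_trans[OF sr_mono[OF assms i(1)] sr_le_rho[OF i(1)]])
qed

lemma rho_nonneg: "W \<noteq> {} \<Longrightarrow> 0 \<le> rho G W"
proof -
  assume W: "W \<noteq> {}"
  obtain i where i: "rho G W = sr i W" using rho_attained[of W] by blast
  show ?thesis unfolding i by (rule spectral_radius_nonneg[OF W])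
qed

lemma sink_forward: "sink_subgraph G (forward G v)"
proof -
  have "v \<in> forward G v" unfolding forward_Lam using vert_simps by blast
  moreover have "rng G e \<in> forward G v" if e: "e \<in> edges G" "src G e \<in> forward G v" for e
  proof -
    obtain \<mu> where m: "\<mu> \<in> Lam G" "msrc \<mu> = v" "mrng G \<mu> = src G e" using e(2) unfolding forward_Lam by blast
    note c = edge_cls[OF e(1)]
    have s: "msrc (cls (src G e, [e])) = mrng G \<mu>" using c(2) m(3) by simp
    note k = mcomp_in[OF c(1) m(1) s]
    show ?thesis unfolding forward_Lam mem_Collect_eq
      by (rule bexI[OF _ k(1)]) (simp only: k(2,3) c(3) m(2) simp_thms)
  qed
  ultimately show ?thesis by (auto simp: sink_subgraph_def)
qed

lemma forward_subset: "sink_subgraph G W \<Longrightarrow> v \<in> W \<Longrightarrow> forward G v \<subseteq> W"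
  unfolding forward_Lam using sink_Lam[of W] by auto

lemma forward_self: "v \<in> forward G v"
  unfolding forward_Lam using vert_simps by blast

end

section \<open>KMS-states and their restrictions to the vertices\<close>

context finite_hrg
begin

section \<open>Range projections of paths of a fixed degree\<close>

definition PT :: "(nat \<Rightarrow> nat) \<Rightarrow> ('v, 'e) nt" where
  "PT n = (\<Sum>\<mu>\<in>LD n. mono \<mu> \<mu>)"

abbreviation Tv :: "'v \<Rightarrow> ('v, 'e) nt" where "Tv v \<equiv> T (vert G v)"

lemma PT_span: "PT n \<in> nt_span"
  unfolding PT_def by (rule span_sum) auto

lemma LD_factor_bij:
  assumes "\<And>i. m i \<le> (l i :: nat)"
  shows "\<And>\<xi>. \<xi> \<in> LD l \<Longrightarrow> \<exists>\<mu> \<alpha>. \<mu> \<in> LD m \<and> \<alpha> \<in> Lam G \<and> msrc \<mu> = mrng G \<alpha> \<and> \<xi> = mcomp G \<mu> \<alpha>"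
proof -
  fix \<xi> assume x: "\<xi> \<in> LD l"
  then have "mdeg G \<xi> = m + (\<lambda>i. l i - m i)" using assms by (simp add: fun_eq_iff)
  moreover have "\<xi> \<in> Lam G" using x by simp
  ultimately obtain \<mu> \<alpha> where "\<mu> \<in> Lam G" "\<alpha> \<in> Lam G" "mdeg G \<mu> = m" "mdeg G \<alpha> = (\<lambda>i. l i - m i)"
    "msrc \<mu> = mrng G \<alpha>" "\<xi> = mcomp G \<mu> \<alpha>"
    using factor_ex by blast
  then show "\<exists>\<mu> \<alpha>. \<mu> \<in> LD m \<and> \<alpha> \<in> Lam G \<and> msrc \<mu> = mrng G \<alpha> \<and> \<xi> = mcomp G \<mu> \<alpha>" by blast
qed

text \<open>By unique factorization, a path whose degree is the join of m and n is the same as a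
  pair of paths of degrees m and n with a chosen minimal common extension. In particular these
  projections commute.\<close>

lemma PT_mult: "PT m * PT n = PT (\<lambda>i. max (m i) (n i))"
proof -
  let ?l = "\<lambda>i. max (m i) (n i)"
  let ?S = "SIGMA q:LD m \<times> LD n. Lam_min G (fst q) (snd q)"
  have b: "bij_betw (\<lambda>(q, p). mcomp G (fst q) (fst p)) ?S (LD ?l)"
  proof (rule bij_betwI')
    fix x y assume x: "x \<in> ?S" and y: "y \<in> ?S"
    obtain \<mu> \<nu> \<alpha> \<alpha>' where x': "x = ((\<mu>, \<nu>), (\<alpha>, \<alpha>'))" by (metis surj_pair)
    obtain \<mu>1 \<nu>1 \<alpha>1 \<alpha>1' where y': "y = ((\<mu>1, \<nu>1), (\<alpha>1, \<alpha>1'))" by (metis surj_pair)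
    have X: "\<mu> \<in> Lam G" "mdeg G \<mu> = m" "\<nu> \<in> Lam G" "mdeg G \<nu> = n" "\<alpha> \<in> Lam G" "\<alpha>' \<in> Lam G"
      "msrc \<mu> = mrng G \<alpha>" "msrc \<nu> = mrng G \<alpha>'" "mcomp G \<mu> \<alpha> = mcomp G \<nu> \<alpha>'"
      using x unfolding x' by (auto simp: Lam_min_iff)
    have Y: "\<mu>1 \<in> Lam G" "mdeg G \<mu>1 = m" "\<nu>1 \<in> Lam G" "mdeg G \<nu>1 = n" "\<alpha>1 \<in> Lam G" "\<alpha>1' \<in> Lam G"
      "msrc \<mu>1 = mrng G \<alpha>1" "msrc \<nu>1 = mrng G \<alpha>1'" "mcomp G \<mu>1 \<alpha>1 = mcomp G \<nu>1 \<alpha>1'"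
      using y unfolding y' by (auto simp: Lam_min_iff)
    show "((case x of (q, p) \<Rightarrow> mcomp G (fst q) (fst p)) = (case y of (q, p) \<Rightarrow> mcomp G (fst q) (fst p))) = (x = y)"
    proof
      assume "(case x of (q, p) \<Rightarrow> mcomp G (fst q) (fst p)) = (case y of (q, p) \<Rightarrow> mcomp G (fst q) (fst p))"
      then have e: "mcomp G \<mu> \<alpha> = mcomp G \<mu>1 \<alpha>1" by (simp add: x' y')
      have 1: "\<mu> = \<mu>1 \<and> \<alpha> = \<alpha>1" by (rule mcomp_cancel[OF X(1,5) Y(1,5) X(7) Y(7) e]) (simp add: X Y)
      have e': "mcomp G \<nu> \<alpha>' = mcomp G \<nu>1 \<alpha>1'" using e X(9) Y(9) by simp
      have 2: "\<nu> = \<nu>1 \<and> \<alpha>' = \<alpha>1'" by (rule mcomp_cancel[OF X(3,6) Y(3,6) X(8) Y(8) e']) (simp add: X Y)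
      show "x = y" using 1 2 by (simp add: x' y')
    qed simp
    show "(case x of (q, p) \<Rightarrow> mcomp G (fst q) (fst p)) \<in> LD ?l"
      using x X mcomp_in[OF X(1,5,7)] unfolding x' by (simp add: Lam_min_def)
  next
    fix \<xi> assume xi: "\<xi> \<in> LD ?l"
    obtain \<mu> \<alpha> where X: "\<mu> \<in> LD m" "\<alpha> \<in> Lam G" "msrc \<mu> = mrng G \<alpha>" "\<xi> = mcomp G \<mu> \<alpha>"
      using LD_factor_bij[of m ?l, OF _ xi] by auto
    obtain \<nu> \<alpha>' where Y: "\<nu> \<in> LD n" "\<alpha>' \<in> Lam G" "msrc \<nu> = mrng G \<alpha>'" "\<xi> = mcomp G \<nu> \<alpha>'"
      using LD_factor_bij[of n ?l, OF _ xi] by auto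
    have "(\<alpha>, \<alpha>') \<in> Lam_min G \<mu> \<nu>"
      unfolding Lam_min_iff
    proof (intro conjI X(2,3) Y(2,3))
      show "mcomp G \<mu> \<alpha> = mcomp G \<nu> \<alpha>'" using X(4) Y(4) by (rule subst)
      have "mdeg G \<xi> = ?l" "mdeg G \<mu> = m" "mdeg G \<nu> = n" using xi X(1) Y(1) by auto
      then show "mdeg G (mcomp G \<mu> \<alpha>) = (\<lambda>i. max (mdeg G \<mu> i) (mdeg G \<nu> i))"
        by (simp only: X(4)[symmetric])
    qed
    then show "\<exists>x\<in>?S. \<xi> = (case x of (q, p) \<Rightarrow> mcomp G (fst q) (fst p))"
      using X Y by (intro bexI[of _ "((\<mu>, \<nu>), (\<alpha>, \<alpha>'))"]) auto
  qed
  have "PT m * PT n = (\<Sum>q\<in>LD m \<times> LD n. mono (fst q) (fst q) * mono (snd q) (snd q))"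
    unfolding PT_def by (simp only: sum_product sum.cartesian_product case_prod_unfold)
  also have "\<dots> = (\<Sum>q\<in>LD m \<times> LD n. \<Sum>p\<in>Lam_min G (fst q) (snd q). mono (mcomp G (fst q) (fst p)) (mcomp G (fst q) (fst p)))"
  proof (rule sum.cong[OF refl])
    fix q assume q: "q \<in> LD m \<times> LD n"
    then have L: "fst q \<in> Lam G" "snd q \<in> Lam G" by auto
    have "mcomp G (snd q) (snd p) = mcomp G (fst q) (fst p)" if "p \<in> Lam_min G (fst q) (snd q)" for p
      using that Lam_min_iff[of "fst p" "snd p"] by simp
    then show "mono (fst q) (fst q) * mono (snd q) (snd q)
        = (\<Sum>p\<in>Lam_min G (fst q) (snd q). mono (mcomp G (fst q) (fst p)) (mcomp G (fst q) (fst p)))"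
      unfolding mono_mult[OF L(1) L(1) L(2) L(2) refl refl] case_prod_unfold by (intro sum.cong refl) (simp only:)
  qed
  also have "\<dots> = (\<Sum>x\<in>?S. (\<lambda>\<xi>. mono \<xi> \<xi>) (case x of (q, p) \<Rightarrow> mcomp G (fst q) (fst p)))"
    by (subst sum.Sigma) (auto simp: case_prod_unfold intro!: finite_cartesian_product)
  also have "\<dots> = PT ?l"
    unfolding PT_def by (rule sum.reindex_bij_betw[OF b])
  finally show ?thesis .
qed

lemma Tv_mono: "\<mu> \<in> Lam G \<Longrightarrow> Tv v * mono \<mu> \<nu> = (if v = mrng G \<mu> then mono \<mu> \<nu> else 0)"
  using T_vert_left[of \<mu> v] by (simp only: mult.assoc[symmetric] if_distrib[of "\<lambda>x. x * _"] mult_zero_left cong: if_cong)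

lemma mono_Tv: assumes "\<nu> \<in> Lam G" shows "mono \<mu> \<nu> * Tv v = (if v = mrng G \<nu> then mono \<mu> \<nu> else 0)"
proof -
  have "mono \<mu> \<nu> * Tv v = nt_star (Tv v * mono \<nu> \<mu>)"
    by (simp only: nt_star_simps T_vert_star)
  also have "\<dots> = (if v = mrng G \<nu> then mono \<mu> \<nu> else 0)"
    unfolding Tv_mono[OF assms] by (cases "v = mrng G \<nu>") (simp_all only: if_True if_False simp_thms nt_star_simps)
  finally show ?thesis .
qed

lemma PT_Tv: "PT n * Tv v = (\<Sum>\<mu>\<in>{\<mu> \<in> LD n. mrng G \<mu> = v}. mono \<mu> \<mu>)" "Tv v * PT n = PT n * Tv v"
proof -
  have 1: "PT n * Tv v = (\<Sum>\<mu>\<in>LD n. if v = mrng G \<mu> then mono \<mu> \<mu> else 0)"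
    unfolding PT_def sum_distrib_right by (rule sum.cong[OF refl]) (auto simp only: mono_Tv mem_Collect_eq)
  have 2: "Tv v * PT n = (\<Sum>\<mu>\<in>LD n. if v = mrng G \<mu> then mono \<mu> \<mu> else 0)"
    unfolding PT_def sum_distrib_left by (rule sum.cong[OF refl]) (auto simp only: Tv_mono mem_Collect_eq)
  show "Tv v * PT n = PT n * Tv v" by (simp only: 1 2)
  show "PT n * Tv v = (\<Sum>\<mu>\<in>{\<mu> \<in> LD n. mrng G \<mu> = v}. mono \<mu> \<mu>)"
    unfolding 1 eq_commute[of _ v] by (rule sum.inter_filter[symmetric]) simp
qed

lemma PT_star: "nt_star (PT n) = PT n"
  unfolding PT_def nt_star_sum nt_star_simps ..

lemma nt_unit_span:
  assumes "x \<in> nt_span" shows "nt_unit G * x = x" "x * nt_unit G = x"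
proof -
  have l: "nt_unit G * mono \<mu> \<nu> = mono \<mu> \<nu>" if "\<mu> \<in> Lam G" for \<mu> \<nu>
  proof -
    have "nt_unit G * mono \<mu> \<nu> = (\<Sum>v\<in>UNIV. if v = mrng G \<mu> then mono \<mu> \<nu> else 0)"
      unfolding nt_unit_def sum_distrib_right by (simp only: Tv_mono[OF that])
    then show ?thesis by (simp only: sum.delta finite UNIV_I if_True)
  qed
  have r: "mono \<mu> \<nu> * nt_unit G = mono \<mu> \<nu>" if "\<nu> \<in> Lam G" for \<mu> \<nu>
  proof -
    have "mono \<mu> \<nu> * nt_unit G = (\<Sum>v\<in>UNIV. if v = mrng G \<nu> then mono \<mu> \<nu> else 0)"
      unfolding nt_unit_def sum_distrib_left by (simp only: mono_Tv[OF that])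
    then show ?thesis by (simp only: sum.delta finite UNIV_I if_True)
  qed
  show "nt_unit G * x = x" using assms
    by (induct rule: nt_span.induct) (simp_all only: l mult_zero_right nt_scale_simps distrib_left)
  show "x * nt_unit G = x" using assms
    by (induct rule: nt_span.induct) (simp_all only: r mult_zero_left nt_scale_simps distrib_right)
qed

section \<open>Products of the defect projections\<close>

lemma nt_Q_eq: "nt_Q G i = nt_unit G - PT (unit_deg i)"
  by (simp add: nt_Q_def PT_def)

definition QL :: "nat list \<Rightarrow> ('v, 'e) nt" where
  "QL js = foldr (\<lambda>i x. nt_Q G i * x) js (nt_unit G)"

lemma QL_simps: "QL [] = nt_unit G" "QL (i # js) = nt_Q G i * QL js"
  by (simp_all add: QL_def)

lemma nt_QF_QL: "nt_QF G F = QL (sorted_list_of_set F)"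
  by (simp add: nt_QF_def QL_def)

lemma nt_Q_span: "nt_Q G i \<in> nt_span"
  unfolding nt_Q_eq by (intro span_diff span_unit PT_span)

lemma QL_span: "QL js \<in> nt_span"
  by (induct js) (simp_all only: QL_simps span_unit span_mult nt_Q_span)

lemma unit_star: "nt_star (nt_unit G) = nt_unit G"
  unfolding nt_unit_def nt_star_sum T_vert_star ..

lemma Q_star: "nt_star (nt_Q G i) = nt_Q G i"
  by (simp only: nt_Q_eq nt_star_simps unit_star PT_star)

lemma Q_idem: "nt_Q G i * nt_Q G i = nt_Q G i"
proof -
  have "PT (unit_deg i) * PT (unit_deg i) = PT (unit_deg i)" by (simp only: PT_mult max.idem)
  then show ?thesis
    by (simp only: nt_Q_eq left_diff_distrib right_diff_distrib nt_unit_span[OF span_unit] nt_unit_span[OF PT_span] diff_self diff_zero)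
qed

lemma Q_commute:
  assumes "x \<in> nt_span" "PT (unit_deg i) * x = x * PT (unit_deg i)"
  shows "nt_Q G i * x = x * nt_Q G i"
  by (simp only: nt_Q_eq left_diff_distrib right_diff_distrib nt_unit_span[OF assms(1)] assms(2))

lemma QL_commute:
  assumes "x \<in> nt_span" "\<And>i. PT (unit_deg i) * x = x * PT (unit_deg i)"
  shows "QL js * x = x * QL js"
proof (induct js)
  case (Cons i js)
  have "QL (i # js) * x = nt_Q G i * (QL js * x)" by (simp only: QL_simps mult.assoc)
  also have "\<dots> = (nt_Q G i * x) * QL js" by (simp only: Cons mult.assoc)
  also have "\<dots> = x * QL (i # js)" by (simp only: Q_commute[OF assms] QL_simps mult.assoc)
  finally show ?case .
qed (simp only: QL_simps nt_unit_span[OF assms(1)])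

lemma PT_commute: "PT m * PT n = PT n * PT m"
  by (simp only: PT_mult max.commute)

lemma QL_Q: "nt_Q G i * QL js = QL js * nt_Q G i"
proof -
  have "PT (unit_deg j) * nt_Q G i = nt_Q G i * PT (unit_deg j)" for j
    by (rule Q_commute[OF PT_span PT_commute, symmetric])
  then show ?thesis by (intro QL_commute[OF nt_Q_span, symmetric])
qed

lemma QL_Tv: "QL js * Tv v = Tv v * QL js"
  by (rule QL_commute) (auto simp only: span_T vert_simps PT_Tv(2))

lemma QL_star: "nt_star (QL js) = QL js"
proof (induct js)
  case (Cons i js)
  show ?case by (simp only: QL_simps nt_star_simps Cons Q_star QL_Q)
qed (simp only: QL_simps unit_star)

lemma QL_idem: "QL js * QL js = QL js"
proof (induct js)
  case (Cons i js)
  have "QL (i # js) * QL (i # js) = nt_Q G i * (QL js * nt_Q G i) * QL js"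
    by (simp only: QL_simps mult.assoc)
  also have "\<dots> = (nt_Q G i * nt_Q G i) * (QL js * QL js)"
    by (simp only: QL_Q[symmetric] mult.assoc)
  also have "\<dots> = QL (i # js)" by (simp only: Q_idem Cons QL_simps)
  finally show ?case .
qed (simp only: QL_simps nt_unit_span[OF span_unit])

lemma Tv_idem: "Tv v * Tv v = Tv v"
  by (simp add: T_vert_left)

text \<open>Puts a projection into the form on which positivity of a state speaks; the nonnegativity
  of \<open>DL\<close> on vertex vectors originates here.\<close>

lemma QL_Tv_square: "nt_star (QL js * Tv v) * (QL js * Tv v) = QL js * Tv v"
proof -
  have "nt_star (QL js * Tv v) * (QL js * Tv v) = Tv v * (QL js * QL js) * Tv v"
    by (simp only: nt_star_simps T_vert_star QL_star mult.assoc)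
  also have "\<dots> = QL js * (Tv v * Tv v)" by (simp only: QL_idem QL_Tv[symmetric] mult.assoc)
  finally show ?thesis by (simp only: Tv_idem)
qed

lemma QL_Tv_QL: "QL js * Tv v * QL js = QL js * Tv v"
proof -
  have "QL js * Tv v * QL js = QL js * (QL js * Tv v)" by (simp only: mult.assoc QL_Tv[symmetric])
  also have "\<dots> = QL js * Tv v" by (simp only: mult.assoc[symmetric] QL_idem)
  finally show ?thesis .
qed

section \<open>States and their vertex vectors\<close>

lemma nt_stateD:
  assumes "nt_state G \<phi>"
  shows "x \<in> NT G \<Longrightarrow> y \<in> NT G \<Longrightarrow> \<phi> (x + y) = \<phi> x + \<phi> y" "x \<in> NT G \<Longrightarrow> \<phi> (nt_scale c x) = c * \<phi> x"
    "x \<in> NT G \<Longrightarrow> \<phi> (nt_star x * x) \<in> \<real>\<^sub>\<ge>\<^sub>0" "x \<in> NT G \<Longrightarrow> cmod (\<phi> x) \<le> nt_norm G x" "\<phi> (nt_unit G) = 1"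
    "\<phi> \<in> extensional (NT G)"
  using assms unfolding nt_state_def by blast+

lemma state_zero: "nt_state G \<phi> \<Longrightarrow> \<phi> 0 = 0"
  using nt_stateD(1)[of \<phi> 0 0] by simp

lemma state_diff: assumes "nt_state G \<phi>" "x \<in> NT G" "y \<in> NT G" shows "\<phi> (x - y) = \<phi> x - \<phi> y"
proof -
  have "\<phi> x = \<phi> (x - y) + \<phi> y"
    using nt_stateD(1)[OF assms(1) NT_diff[OF assms(2,3)] assms(3)] by (simp only: diff_add_cancel)
  then show ?thesis by simp
qed

lemma state_sum:
  assumes "nt_state G \<phi>" "\<And>a. a \<in> A \<Longrightarrow> f a \<in> NT G" shows "\<phi> (sum f A) = (\<Sum>a\<in>A. \<phi> (f a))"
  using assms(2)
proof (induct A rule: infinite_finite_induct)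
  case (insert a A)
  then have "\<phi> (f a + sum f A) = \<phi> (f a) + \<phi> (sum f A)"
    by (intro nt_stateD(1)[OF assms(1)] NT_sum) auto
  then show ?case using insert by (simp only: sum.insert[OF insert(1,2)]) simp
qed (simp_all only: sum.infinite sum.empty state_zero[OF assms(1)] simp_thms)

definition om :: "(('v, 'e) nt \<Rightarrow> complex) \<Rightarrow> real ^ 'v" where
  "om \<phi> = (\<chi> v. Re (\<phi> (Tv v)))"

lemma om_T:
  assumes "nt_state G \<phi>"
  shows "\<phi> (Tv v) = of_real (om \<phi> $ v)" "0 \<le> om \<phi> $ v" "(\<Sum>v\<in>UNIV. om \<phi> $ v) = 1"
proof -
  have sq: "nt_star (Tv v) * Tv v = Tv v" for v by (simp only: T_vert_star Tv_idem)
  have "\<phi> (nt_star (Tv v) * Tv v) \<in> \<real>\<^sub>\<ge>\<^sub>0" for v by (intro nt_stateD(3)[OF assms] NT_T vert_simps)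
  then have p: "\<phi> (Tv v) \<in> \<real>\<^sub>\<ge>\<^sub>0" for v by (simp only: sq)
  show 1: "\<phi> (Tv v) = of_real (om \<phi> $ v)" for v
    using p[of v] by (auto simp: om_def nonneg_Reals_def)
  show "0 \<le> om \<phi> $ v" using p[of v] by (auto simp: om_def nonneg_Reals_def)
  have "(\<Sum>v\<in>UNIV. \<phi> (Tv v)) = 1"
    using nt_stateD(5)[OF assms] state_sum[OF assms, of UNIV Tv] by (simp add: nt_unit_def)
  then have "complex_of_real (\<Sum>v\<in>UNIV. om \<phi> $ v) = of_real 1" by (simp add: 1)
  then show "(\<Sum>v\<in>UNIV. om \<phi> $ v) = 1" by (simp only: of_real_eq_iff)
qed

section \<open>The KMS condition on monomials\<close>

lemma kmsD:
  assumes "\<phi> \<in> kms G \<beta>"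
  shows "nt_state G \<phi>"
    "\<kappa> \<in> Lam G \<Longrightarrow> \<mu> \<in> Lam G \<Longrightarrow> \<kappa>' \<in> Lam G \<Longrightarrow> \<mu>' \<in> Lam G \<Longrightarrow>
       \<phi> (mono \<kappa> \<mu> * mono \<kappa>' \<mu>') = of_real (exp (- (real (mlen G \<kappa>) - real (mlen G \<mu>)) * \<beta>)) * \<phi> (mono \<kappa>' \<mu>' * mono \<kappa> \<mu>)"
  using assms unfolding kms_def by blast+

text \<open>The KMS condition speaks of pairs of monomials, so T_\<mu> is written with a vertex on
  its right and the remaining factors are merged into one monomial. If source and range do not
  match, both sides vanish.\<close>

lemma kms_conj_mono:
  assumes k: "\<phi> \<in> kms G \<beta>" and L: "\<mu> \<in> Lam G" "\<kappa> \<in> Lam G" "\<nu> \<in> Lam G"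
  shows "\<phi> (T \<mu> * mono \<kappa> \<nu> * nt_star (T \<mu>)) = of_real (wt \<beta> \<mu>) * \<phi> (mono \<kappa> \<nu> * nt_star (T \<mu>) * T \<mu>)"
proof (cases "msrc \<mu> = mrng G \<nu>")
  case True
  have e: "mono \<kappa> \<nu> * nt_star (T \<mu>) = mono \<kappa> (mcomp G \<mu> \<nu>)"
  proof -
    have "T \<mu> * T \<nu> = T (mcomp G \<mu> \<nu>)" using True L by (simp add: T_mult)
    then show ?thesis by (simp only: mult.assoc nt_star_simps(4)[symmetric])
  qed
  have m: "T \<mu> = mono \<mu> (vert G (msrc \<mu>))" by (rule T_eq_mono[OF L(1)])
  have "\<phi> (mono \<mu> (vert G (msrc \<mu>)) * mono \<kappa> (mcomp G \<mu> \<nu>)) = of_real (exp (- (real (mlen G \<mu>) - real (mlen G (vert G (msrc \<mu>)))) * \<beta>))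
      * \<phi> (mono \<kappa> (mcomp G \<mu> \<nu>) * mono \<mu> (vert G (msrc \<mu>)))"
    by (rule kmsD(2)[OF k]) (simp_all add: L True)
  then have "\<phi> (T \<mu> * mono \<kappa> (mcomp G \<mu> \<nu>)) = of_real (wt \<beta> \<mu>) * \<phi> (mono \<kappa> (mcomp G \<mu> \<nu>) * T \<mu>)"
    by (simp only: m[symmetric] mlen_vert of_nat_0 diff_zero)
  then show ?thesis by (simp only: e[symmetric] mult.assoc)
next
  case False
  have "nt_star (T \<nu>) * nt_star (T \<mu>) = nt_star (T \<mu> * T \<nu>)" by (simp only: nt_star_simps)
  also have "\<dots> = 0" using False L by (simp only: T_mult if_False nt_star_simps)
  finally have z: "nt_star (T \<nu>) * nt_star (T \<mu>) = 0" .
  have "mono \<kappa> \<nu> * nt_star (T \<mu>) = 0" by (simp only: mult.assoc z mult_zero_right)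
  then have "T \<mu> * mono \<kappa> \<nu> * nt_star (T \<mu>) = 0" "mono \<kappa> \<nu> * nt_star (T \<mu>) * T \<mu> = 0"
    by (simp_all only: mult.assoc mult_zero_left mult_zero_right)
      (simp only: mult.assoc[symmetric] mult_zero_left)?
  then show ?thesis by (simp only: state_zero[OF kmsD(1)[OF k]] mult_zero_right)
qed

lemma T_star_T: "\<mu> \<in> Lam G \<Longrightarrow> nt_star (T \<mu>) * T \<mu> = Tv (msrc \<mu>)"
  by (simp only: T_star_same_deg simp_thms if_True)

lemma kms_conj:
  assumes k: "\<phi> \<in> kms G \<beta>" and \<mu>: "\<mu> \<in> Lam G" and a: "a \<in> nt_span"
  shows "\<phi> (T \<mu> * a * nt_star (T \<mu>)) = of_real (wt \<beta> \<mu>) * \<phi> (a * Tv (msrc \<mu>))"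
proof -
  note st = kmsD(1)[OF k]
  have N1: "T \<mu> * a * nt_star (T \<mu>) \<in> NT G" if "a \<in> nt_span" for a by (intro NT_mult NT_star NT_T \<mu> span_NT that)
  have N2: "a * Tv (msrc \<mu>) \<in> NT G" if "a \<in> nt_span" for a by (intro NT_mult NT_T vert_simps span_NT that)
  show ?thesis using a
  proof (induct rule: nt_span.induct)
    case (mono \<kappa> \<nu>)
    show ?case using kms_conj_mono[OF k \<mu> mono(1,2)] by (simp only: mult.assoc T_star_T[OF \<mu>])
  next
    case zero
    show ?case by (simp only: mult_zero_left mult_zero_right state_zero[OF st])
  next
    case (scale x c)
    show ?case
      by (simp only: nt_scale_simps nt_stateD(2)[OF st N1[OF scale(1)]] nt_stateD(2)[OF st N2[OF scale(1)]]
          scale(2) mult.left_commute)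
  next
    case (add x y)
    then show ?case by (simp only: distrib_left distrib_right nt_stateD(1)[OF st N1 N1] nt_stateD(1)[OF st N2 N2])
  qed
qed

lemma kms_diag:
  assumes "\<phi> \<in> kms G \<beta>" "\<mu> \<in> Lam G"
  shows "\<phi> (mono \<mu> \<mu>) = of_real (wt \<beta> \<mu> * om \<phi> $ msrc \<mu>)"
proof -
  have e: "T \<mu> * Tv (msrc \<mu>) * nt_star (T \<mu>) = mono \<mu> \<mu>" using assms(2) by (simp add: T_vert_right)
  show ?thesis
    using kms_conj[OF assms span_T[OF vert_simps(1)], of "msrc \<mu>"] om_T(1)[OF kmsD(1)[OF assms(1)]]
    by (simp add: e Tv_idem del: times_fun_apply)
qed

text \<open>The KMS condition brings the adjoint of T_\<mu> to the left of T_\<kappa>, where the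
  product is zero because distinct paths of one degree have orthogonal ranges.\<close>

lemma kms_same_deg:
  assumes k: "\<phi> \<in> kms G \<beta>" and L: "\<kappa> \<in> Lam G" "\<mu> \<in> Lam G" "mdeg G \<kappa> = mdeg G \<mu>" "\<kappa> \<noteq> \<mu>"
  shows "\<phi> (mono \<kappa> \<mu>) = 0"
proof -
  have z: "nt_star (T \<mu>) * T \<kappa> = 0" using T_star_same_deg[OF L(2,1) L(3)[symmetric]] L(4) by simp
  let ?u = "vert G (msrc \<kappa>)" and ?w = "vert G (msrc \<mu>)"
  have "mono ?w \<mu> * mono \<kappa> ?u = T ?w * (nt_star (T \<mu>) * T \<kappa>) * nt_star (T ?u)" by (simp only: mult.assoc)
  also have "\<dots> = 0" by (simp only: z mult_zero_left mult_zero_right)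
  finally have z': "mono ?w \<mu> * mono \<kappa> ?u = 0" .
  have "\<phi> (mono \<kappa> ?u * mono ?w \<mu>) = of_real (exp (- (real (mlen G \<kappa>) - real (mlen G ?u)) * \<beta>)) * \<phi> (mono ?w \<mu> * mono \<kappa> ?u)"
    by (rule kmsD(2)[OF k]) (simp_all add: L)
  then have *: "\<phi> (mono \<kappa> ?u * mono ?w \<mu>) = 0" by (simp only: z' state_zero[OF kmsD(1)[OF k]] mult_zero_right)
  show ?thesis
  proof (cases "msrc \<kappa> = msrc \<mu>")
    case True
    have "mono ?w \<mu> = nt_star (T \<mu> * T ?w)" by (simp only: nt_star_simps T_vert_star)
    also have "\<dots> = nt_star (T \<mu>)" by (simp only: T_vert_right[OF L(2)] simp_thms if_True)
    finally have "mono \<kappa> ?u * mono ?w \<mu> = mono \<kappa> \<mu>" by (simp only: T_eq_mono[OF L(1), symmetric])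
    then show ?thesis using * by (simp only:)
  next
    case False
    then show ?thesis by (simp only: mono_source_zero[OF L(1,2) False] state_zero[OF kmsD(1)[OF k]])
  qed
qed

section \<open>Values on range and defect projections\<close>

lemma kms_PT_Tv:
  assumes k: "\<phi> \<in> kms G \<beta>"
  shows "\<phi> (PT n * Tv v) = of_real (Bop \<beta> n (om \<phi>) $ v)"
proof -
  have "\<phi> (PT n * Tv v) = (\<Sum>\<mu>\<in>{\<mu> \<in> LD n. mrng G \<mu> = v}. \<phi> (mono \<mu> \<mu>))"
    unfolding PT_Tv(1) by (rule state_sum[OF kmsD(1)[OF k]]) (auto intro: span_NT span_mono)
  also have "\<dots> = (\<Sum>\<mu>\<in>{\<mu> \<in> LD n. mrng G \<mu> = v}. of_real (wt \<beta> \<mu> * om \<phi> $ msrc \<mu>))"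
    by (rule sum.cong[OF refl]) (use kms_diag[OF k] in auto)
  also have "\<dots> = of_real (Bop \<beta> n (om \<phi>) $ v)" by (simp add: Bop_nth)
  finally show ?thesis .
qed

lemma PT_0: "PT 0 = nt_unit G"
proof -
  have "LD 0 = range (vert G)" using mdeg_0_vert(1) vert_simps by fastforce
  moreover have "inj (vert G)" by (rule inj_on_inverseI[where g = msrc]) simp
  ultimately have "PT 0 = (\<Sum>v\<in>UNIV. mono (vert G v) (vert G v))" by (simp add: PT_def sum.reindex)
  then show ?thesis by (simp only: T_vert_star Tv_idem nt_unit_def)
qed

text \<open>The prefix of degree n lets the induction close: expanding one defect projection
  multiplies range projections, and since n has no entry in the new colour, the join of n with that
  unit degree is their sum.\<close>

lemma kms_PT_QL_Tv:
  assumes k: "\<phi> \<in> kms G \<beta>" and "distinct js" "\<And>i. i \<in> set js \<Longrightarrow> n i = 0"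
  shows "\<phi> (PT n * QL js * Tv v) = of_real (Bop \<beta> n (DL \<beta> js (om \<phi>)) $ v)"
  using assms(2,3)
proof (induct js arbitrary: n)
  case Nil
  then show ?case by (simp only: QL_simps nt_unit_span[OF PT_span] kms_PT_Tv[OF k] DL.simps)
next
  case (Cons i js)
  let ?n = "\<lambda>j. max (n j) (unit_deg i j)"
  have n: "?n = n + unit_deg i" using Cons(3)[of i] by (auto simp: fun_eq_iff unit_deg_def)
  have "PT n * QL (i # js) * Tv v = PT n * (nt_unit G - PT (unit_deg i)) * QL js * Tv v"
    by (simp only: QL_simps nt_Q_eq mult.assoc)
  also have "\<dots> = PT n * QL js * Tv v - PT ?n * QL js * Tv v"
    by (simp only: right_diff_distrib left_diff_distrib nt_unit_span[OF PT_span] PT_mult)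
  finally have "\<phi> (PT n * QL (i # js) * Tv v) = \<phi> (PT n * QL js * Tv v) - \<phi> (PT ?n * QL js * Tv v)"
    by (simp only: state_diff[OF kmsD(1)[OF k]] NT_mult span_NT PT_span QL_span NT_T vert_simps)
  also have "\<dots> = of_real (Bop \<beta> n (DL \<beta> js (om \<phi>)) $ v) - of_real (Bop \<beta> ?n (DL \<beta> js (om \<phi>)) $ v)"
    using Cons(2,3) by (intro arg_cong2[where f = "(-)"] Cons(1)) (auto simp: unit_deg_def)
  also have "\<dots> = of_real (Bop \<beta> n (DL \<beta> (i # js) (om \<phi>)) $ v)"
    unfolding n Bop_add by (simp add: Bop_diff_right)
  finally show ?case .
qed

lemma kms_QL_Tv:
  assumes k: "\<phi> \<in> kms G \<beta>" and "distinct js"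
  shows "\<phi> (QL js * Tv v) = of_real (DL \<beta> js (om \<phi>) $ v)" "0 \<le> DL \<beta> js (om \<phi>) $ v"
proof -
  have "\<phi> (PT 0 * QL js * Tv v) = of_real (Bop \<beta> 0 (DL \<beta> js (om \<phi>)) $ v)"
    by (rule kms_PT_QL_Tv[OF k assms(2)]) simp
  then show 1: "\<phi> (QL js * Tv v) = of_real (DL \<beta> js (om \<phi>) $ v)"
    by (simp only: PT_0 nt_unit_span[OF QL_span] Bop_0)
  have "\<phi> (nt_star (QL js * Tv v) * (QL js * Tv v)) \<in> \<real>\<^sub>\<ge>\<^sub>0"
    by (intro nt_stateD(3)[OF kmsD(1)[OF k]] NT_mult span_NT QL_span span_T vert_simps)
  then show "0 \<le> DL \<beta> js (om \<phi>) $ v" by (simp only: QL_Tv_square 1) simp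
qed

lemma kms_QL:
  assumes k: "\<phi> \<in> kms G \<beta>" and "distinct js"
  shows "\<phi> (QL js) = of_real (\<Sum>v\<in>UNIV. DL \<beta> js (om \<phi>) $ v)"
proof -
  have "\<phi> (QL js) = \<phi> (\<Sum>v\<in>UNIV. QL js * Tv v)"
    by (simp only: sum_distrib_left[symmetric] nt_unit_def[symmetric] nt_unit_span[OF QL_span])
  also have "\<dots> = (\<Sum>v\<in>UNIV. \<phi> (QL js * Tv v))"
    by (rule state_sum[OF kmsD(1)[OF k]]) (intro NT_mult span_NT QL_span span_T vert_simps)
  finally show ?thesis by (simp add: kms_QL_Tv[OF assms])
qed

lemma kms_QFn:
  assumes k: "\<phi> \<in> kms G \<beta>"
  shows "\<phi> (nt_QFn G F n) = of_real (\<Sum>v\<in>UNIV. Bop \<beta> n (DL \<beta> (sorted_list_of_set F) (om \<phi>)) $ v)"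
proof -
  let ?js = "sorted_list_of_set F"
  have "\<phi> (nt_QFn G F n) = (\<Sum>\<mu>\<in>LD n. \<phi> (T \<mu> * QL ?js * nt_star (T \<mu>)))"
    unfolding nt_QFn_def nt_QF_QL
    by (rule state_sum[OF kmsD(1)[OF k]], rule NT_mult[OF NT_mult[OF NT_T span_NT[OF QL_span]] NT_star[OF NT_T]]) auto
  also have "\<dots> = (\<Sum>\<mu>\<in>LD n. of_real (wt \<beta> \<mu> * DL \<beta> ?js (om \<phi>) $ msrc \<mu>))"
    by (rule sum.cong[OF refl]) (simp add: kms_conj[OF k _ QL_span] kms_QL_Tv(1)[OF k])
  finally show ?thesis by (simp add: sum_Bop)
qed

lemma kms_Q:
  assumes k: "\<phi> \<in> kms G \<beta>"
  shows "\<phi> (nt_Q G i) = of_real (\<Sum>v\<in>UNIV. (om \<phi> - Bop \<beta> (unit_deg i) (om \<phi>)) $ v)"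
    "Bop \<beta> (unit_deg i) (om \<phi>) $ v \<le> om \<phi> $ v"
proof -
  have "QL [i] = nt_Q G i" by (simp only: QL_simps nt_unit_span[OF nt_Q_span])
  then show "\<phi> (nt_Q G i) = of_real (\<Sum>v\<in>UNIV. (om \<phi> - Bop \<beta> (unit_deg i) (om \<phi>)) $ v)"
    using kms_QL[OF k, of "[i]"] by simp
  show "Bop \<beta> (unit_deg i) (om \<phi>) $ v \<le> om \<phi> $ v"
    using kms_QL_Tv(2)[OF k, of "[i]" v] by simp
qed

text \<open>The value is a sum over vertices of nonnegative differences, so it vanishes only if each
  of them does.\<close>

lemma kms_Q_zero_iff:
  assumes k: "\<phi> \<in> kms G \<beta>"
  shows "\<phi> (nt_Q G i) = 0 \<longleftrightarrow> Bop \<beta> (unit_deg i) (om \<phi>) = om \<phi>"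
proof -
  have "\<phi> (nt_Q G i) = 0 \<longleftrightarrow> (\<Sum>v\<in>UNIV. (om \<phi> - Bop \<beta> (unit_deg i) (om \<phi>)) $ v) = 0"
    unfolding kms_Q(1)[OF k] by (simp only: of_real_eq_0_iff)
  also have "\<dots> \<longleftrightarrow> (\<forall>v\<in>UNIV. (om \<phi> - Bop \<beta> (unit_deg i) (om \<phi>)) $ v = 0)"
    by (rule sum_nonneg_eq_0_iff) (use kms_Q(2)[OF k] in auto)
  also have "\<dots> \<longleftrightarrow> Bop \<beta> (unit_deg i) (om \<phi>) = om \<phi>"
    by (auto simp: Finite_Cartesian_Product.vec_eq_iff)
  finally show ?thesis .
qed

text \<open>From here on, the conditions singling out the F-part among KMS-states concern only the
  vector \<open>om \<phi>\<close>.\<close>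

lemma kmsF_iff:
  assumes "F \<subseteq> {1..ncolours G}"
  shows "\<phi> \<in> kmsF G F \<beta> \<longleftrightarrow> \<phi> \<in> kms G \<beta> \<and>
    ((\<lambda>n. \<Sum>v\<in>UNIV. Bop \<beta> n (DL \<beta> (sorted_list_of_set F) (om \<phi>)) $ v) has_sum 1) (degs_in F) \<and>
    (\<forall>i\<in>{1..ncolours G} - F. Bop \<beta> (unit_deg i) (om \<phi>) = om \<phi>)"
proof -
  have r: "((\<lambda>n. complex_of_real (f n)) has_sum 1) A \<longleftrightarrow> (f has_sum 1) A" for f :: "(nat \<Rightarrow> nat) \<Rightarrow> real" and A
    by (metis has_sum_of_real_iff of_real_1)
  show ?thesis
    unfolding kmsF_def by (auto simp: kms_QFn kms_Q_zero_iff r simp del: of_real_sum)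
qed

text \<open>Membership prescribes only the total mass of the series; the nonnegativity of all
  \<open>DL\<close> vectors upgrades this to convergence to \<open>om \<phi>\<close> at every
  vertex.\<close>

lemma kmsF_om_sum:
  assumes F: "F \<subseteq> {1..ncolours G}" and \<phi>: "\<phi> \<in> kmsF G F \<beta>"
  shows "((\<lambda>n. Bop \<beta> n (DL \<beta> (sorted_list_of_set F) (om \<phi>))) has_sum om \<phi>) (degs_in F)"
proof (rule DL_has_sum)
  have k: "\<phi> \<in> kms G \<beta>" using \<phi> by (simp add: kmsF_def)
  have "finite F" using F finite_subset by blast
  then show "distinct (sorted_list_of_set F)" "set (sorted_list_of_set F) = F" by auto
  show "0 \<le> DL \<beta> js (om \<phi>) $ v" if "distinct js" for js v by (rule kms_QL_Tv(2)[OF k that])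
  show "((\<lambda>n. \<Sum>v\<in>UNIV. Bop \<beta> n (DL \<beta> (sorted_list_of_set F) (om \<phi>)) $ v) has_sum (\<Sum>v\<in>UNIV. om \<phi> $ v)) (degs_in F)"
    using \<phi> unfolding kmsF_iff[OF F] by (simp add: om_T(3)[OF kmsD(1)[OF k]])
qed

lemma Phi_eq:
  assumes k: "\<phi> \<in> kms G \<beta>" and F: "F \<subseteq> {1..ncolours G}"
  shows "Phi G F \<phi> = (1 / (\<Sum>v\<in>UNIV. DL \<beta> (sorted_list_of_set F) (om \<phi>) $ v)) *\<^sub>R DL \<beta> (sorted_list_of_set F) (om \<phi>)"
proof -
  let ?js = "sorted_list_of_set F"
  have "distinct ?js" by simp
  then have "Phi G F \<phi> $ v = (1 / (\<Sum>v\<in>UNIV. DL \<beta> ?js (om \<phi>) $ v)) * DL \<beta> ?js (om \<phi>) $ v" for v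
    by (simp add: Phi_def nt_QF_QL QL_Tv_QL kms_QL[OF k] kms_QL_Tv(1)[OF k] divide_inverse
        del: times_fun_apply of_real_sum flip: of_real_inverse of_real_mult)
  then show ?thesis by (simp add: Finite_Cartesian_Product.vec_eq_iff)
qed

end

section \<open>The Fock representation and the construction of KMS-states\<close>

lemma coord_star: "coord (ap (bop_star A) y) n = cinner y (ap A (l2e n))"
  using cinner_star_left[of A y "l2e n"] by simp

text \<open>Coordinates of the adjoint are pairings with images of unit vectors, so the adjoints
  agree.\<close>

lemma bop_basis_eqI: assumes "\<And>n. ap A (l2e n) = ap B (l2e n)" shows "A = B"
proof -
  have "bop_star A = bop_star B"
    by (rule bop_eqI, rule l2_eqI) (simp add: coord_star assms)
  then show ?thesis by (metis bop_star_star)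
qed

text \<open>g assigns to an output coordinate the input coordinate that is copied there; no input is
  copied twice, so the norm does not increase.\<close>

lemma partial_shift_exists:
  assumes inj: "\<And>k l m. g k = Some m \<Longrightarrow> g l = Some m \<Longrightarrow> k = l"
  shows "\<exists>A. \<forall>x k. coord (ap A x) k = (case g k of None \<Rightarrow> 0 | Some m \<Rightarrow> coord x m)"
proof -
  define f where "f x k = (case g k of None \<Rightarrow> 0 | Some m \<Rightarrow> coord x m)" for x k
  have bd: "(\<Sum>k<N. (cmod (f x k))\<^sup>2) \<le> (norm x)\<^sup>2" for x N
  proof -
    let ?D = "{k. k < N \<and> g k \<noteq> None}"
    have "(\<Sum>k<N. (cmod (f x k))\<^sup>2) = (\<Sum>k\<in>?D. (cmod (coord x (the (g k))))\<^sup>2)"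
      by (rule sum.mono_neutral_cong_right) (auto simp: f_def split: option.splits)
    also have "\<dots> = (\<Sum>m\<in>(\<lambda>k. the (g k)) ` ?D. (cmod (coord x m))\<^sup>2)"
      by (rule sum.reindex_cong[symmetric, of "\<lambda>k. the (g k)" ?D]) (auto intro!: inj_onI dest: inj)
    also have "\<dots> \<le> (norm x)\<^sup>2"
      using sum_le_suminf[OF summable_coord, of "(\<lambda>k. the (g k)) ` ?D" x] norm_l2_sums[of x]
      by (simp add: sums_iff)
    finally show ?thesis .
  qed
  note b = l2_norm_bound[OF bd norm_ge_zero]
  have cf: "coord (Abs_l2 (f x)) = f x" for x by (subst Abs_l2_inverse) (use b(1) in auto)
  have "\<exists>A. \<forall>x. ap A x = Abs_l2 (f x)"
  proof (rule bop_exists)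
    show "Abs_l2 (f (x + y)) = Abs_l2 (f x) + Abs_l2 (f y)" for x y
      by (rule l2_eqI) (simp add: cf, simp add: f_def split: option.splits)
    show "Abs_l2 (f (l2_scale c x)) = l2_scale c (Abs_l2 (f x))" for c x
      by (rule l2_eqI) (simp add: cf, simp add: f_def split: option.splits)
    show "norm (Abs_l2 (f x)) \<le> norm x * 1" for x using b(2)[of x] by simp
  qed
  then show ?thesis using cf by (metis f_def)
qed

context finite_hrg
begin

section \<open>Creation operators on Fock space\<close>

definition enc :: "('v, 'e) mor \<Rightarrow> nat" where "enc = to_nat_on (Lam G)"

abbreviation dl :: "('v, 'e) mor \<Rightarrow> l2" where "dl \<kappa> \<equiv> l2e (enc \<kappa>)"

lemma enc_inj: "\<kappa> \<in> Lam G \<Longrightarrow> \<mu> \<in> Lam G \<Longrightarrow> enc \<kappa> = enc \<mu> \<longleftrightarrow> \<kappa> = \<mu>"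
  using inj_on_to_nat_on[OF countable_Lam] by (auto simp: enc_def inj_on_def)

definition fockP :: "('v, 'e) mor \<Rightarrow> nat \<Rightarrow> ('v, 'e) mor \<Rightarrow> bool" where
  "fockP \<mu> k \<alpha> \<longleftrightarrow> \<alpha> \<in> Lam G \<and> msrc \<mu> = mrng G \<alpha> \<and> k = enc (mcomp G \<mu> \<alpha>)"

definition fock_g :: "('v, 'e) mor \<Rightarrow> nat \<Rightarrow> nat option" where
  "fock_g \<mu> k = (if \<exists>\<alpha>. fockP \<mu> k \<alpha> then Some (enc (SOME \<alpha>. fockP \<mu> k \<alpha>)) else None)"

text \<open>The creation operator: it sends the unit vector of \<alpha> to that of the composite
  with \<mu>, and annihilates the coordinates that encode no morphism.\<close>

definition fock :: "('v, 'e) mor \<Rightarrow> bop" where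
  "fock \<mu> = (SOME A. \<forall>x k. coord (ap A x) k = (case fock_g \<mu> k of None \<Rightarrow> 0 | Some m \<Rightarrow> coord x m))"

lemma fockP_unique:
  assumes "\<mu> \<in> Lam G" "fockP \<mu> k \<alpha>" "fockP \<mu> k \<beta>" shows "\<alpha> = \<beta>"
proof -
  have a: "\<alpha> \<in> Lam G" "msrc \<mu> = mrng G \<alpha>" "\<beta> \<in> Lam G" "msrc \<mu> = mrng G \<beta>"
    "enc (mcomp G \<mu> \<alpha>) = enc (mcomp G \<mu> \<beta>)"
    using assms(2,3) unfolding fockP_def by auto
  have "mcomp G \<mu> \<alpha> = mcomp G \<mu> \<beta>"
    using a(5) enc_inj mcomp_in(1)[OF assms(1) a(1,2)] mcomp_in(1)[OF assms(1) a(3,4)] by blast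
  then show ?thesis using mcomp_cancel[OF assms(1) a(1) assms(1) a(3,2,4)] by blast
qed

lemma fock_g_Some: assumes "\<mu> \<in> Lam G" "fockP \<mu> k \<alpha>" shows "fock_g \<mu> k = Some (enc \<alpha>)"
proof -
  have "fockP \<mu> k (SOME \<alpha>. fockP \<mu> k \<alpha>)" by (rule someI[of "fockP \<mu> k"], rule assms(2))
  then have "(SOME \<alpha>. fockP \<mu> k \<alpha>) = \<alpha>" using fockP_unique assms by blast
  then show ?thesis using assms(2) unfolding fock_g_def by auto
qed

lemma fock_g_None: "(\<And>\<alpha>. \<not> fockP \<mu> k \<alpha>) \<Longrightarrow> fock_g \<mu> k = None"
  by (simp add: fock_g_def)

lemma fock_g_SomeD: assumes "\<mu> \<in> Lam G" "fock_g \<mu> k = Some m" obtains \<alpha> where "fockP \<mu> k \<alpha>" "m = enc \<alpha>"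
proof -
  obtain \<alpha> where "fockP \<mu> k \<alpha>" using assms(2) fock_g_None by force
  then show ?thesis using that fock_g_Some[OF assms(1)] assms(2) by force
qed

lemma fock_coord:
  assumes "\<mu> \<in> Lam G"
  shows "coord (ap (fock \<mu>) x) k = (case fock_g \<mu> k of None \<Rightarrow> 0 | Some m \<Rightarrow> coord x m)"
proof -
  have "\<exists>A. \<forall>x k. coord (ap A x) k = (case fock_g \<mu> k of None \<Rightarrow> 0 | Some m \<Rightarrow> coord x m)"
  proof (rule partial_shift_exists)
    fix k l m assume "fock_g \<mu> k = Some m" "fock_g \<mu> l = Some m"
    then obtain \<alpha> \<beta> where a: "fockP \<mu> k \<alpha>" "m = enc \<alpha>" "fockP \<mu> l \<beta>" "m = enc \<beta>"
      using fock_g_SomeD[OF assms] by metis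
    then have "\<alpha> = \<beta>" using enc_inj unfolding fockP_def by blast
    then show "k = l" using a unfolding fockP_def by simp
  qed
  from someI_ex[OF this] show ?thesis unfolding fock_def by blast
qed

lemma fock_dl:
  assumes "\<mu> \<in> Lam G" "\<alpha> \<in> Lam G"
  shows "ap (fock \<mu>) (dl \<alpha>) = (if msrc \<mu> = mrng G \<alpha> then dl (mcomp G \<mu> \<alpha>) else 0)"
proof (rule l2_eqI)
  fix k
  show "coord (ap (fock \<mu>) (dl \<alpha>)) k = coord (if msrc \<mu> = mrng G \<alpha> then dl (mcomp G \<mu> \<alpha>) else 0) k"
  proof (cases "\<exists>\<beta>. fockP \<mu> k \<beta>")
    case True
    then obtain \<beta> where b: "fockP \<mu> k \<beta>" by blast
    have bL: "\<beta> \<in> Lam G" using b unfolding fockP_def by blast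
    have "coord (ap (fock \<mu>) (dl \<alpha>)) k = (if \<alpha> = \<beta> then 1 else 0)"
      using enc_inj[OF bL assms(2)]
      by (simp add: fock_coord[OF assms(1)] fock_g_Some[OF assms(1) b] eq_commute[of \<beta> \<alpha>])
    moreover have "coord (if msrc \<mu> = mrng G \<alpha> then dl (mcomp G \<mu> \<alpha>) else 0) k = (if \<alpha> = \<beta> then 1 else 0)"
    proof (cases "msrc \<mu> = mrng G \<alpha>")
      case t: True
      have "k = enc (mcomp G \<mu> \<alpha>) \<longleftrightarrow> \<alpha> = \<beta>"
        using fockP_unique[OF assms(1) _ b, of \<alpha>] b t assms(2) unfolding fockP_def by blast
      then show ?thesis using t by simp
    next
      case False
      then have "\<alpha> \<noteq> \<beta>" using b unfolding fockP_def by blast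
      then show ?thesis using False by simp
    qed
    ultimately show ?thesis by simp
  next
    case False
    then have "fock_g \<mu> k = None" by (intro fock_g_None) blast
    moreover have "msrc \<mu> = mrng G \<alpha> \<Longrightarrow> k \<noteq> enc (mcomp G \<mu> \<alpha>)"
      using False assms(2) unfolding fockP_def by blast
    ultimately show ?thesis by (simp add: fock_coord[OF assms(1)])
  qed
qed

lemma fock_off: assumes "\<mu> \<in> Lam G" "n \<notin> enc ` Lam G" shows "ap (fock \<mu>) (l2e n) = 0"
proof (rule l2_eqI)
  fix k
  have "fock_g \<mu> k \<noteq> Some n"
    using fock_g_SomeD[OF assms(1)] assms(2) unfolding fockP_def by blast
  then show "coord (ap (fock \<mu>) (l2e n)) k = coord 0 k"
    by (auto simp: fock_coord[OF assms(1)] split: option.splits)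
qed

lemma fock_star_l2e:
  assumes "\<mu> \<in> Lam G"
  shows "ap (bop_star (fock \<mu>)) (l2e n) = (case fock_g \<mu> n of None \<Rightarrow> 0 | Some m \<Rightarrow> l2e m)"
proof (rule l2_eqI)
  show "coord (ap (bop_star (fock \<mu>)) (l2e n)) k = coord (case fock_g \<mu> n of None \<Rightarrow> 0 | Some m \<Rightarrow> l2e m) k" for k
    by (auto simp: coord_star fock_coord[OF assms] split: option.splits)
qed

lemma fock_star_dl:
  assumes "\<mu> \<in> Lam G" "\<alpha> \<in> Lam G" "msrc \<mu> = mrng G \<alpha>"
  shows "ap (bop_star (fock \<mu>)) (dl (mcomp G \<mu> \<alpha>)) = dl \<alpha>"
proof -
  have "fockP \<mu> (enc (mcomp G \<mu> \<alpha>)) \<alpha>" using assms by (simp only: fockP_def simp_thms)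
  then show ?thesis by (simp add: fock_star_l2e[OF assms(1)] fock_g_Some[OF assms(1)])
qed

lemma fock_star_zero:
  assumes "\<mu> \<in> Lam G" "\<kappa> \<in> Lam G" "\<And>\<alpha>. \<alpha> \<in> Lam G \<Longrightarrow> msrc \<mu> = mrng G \<alpha> \<Longrightarrow> \<kappa> \<noteq> mcomp G \<mu> \<alpha>"
  shows "ap (bop_star (fock \<mu>)) (dl \<kappa>) = 0"
proof -
  have "fock_g \<mu> (enc \<kappa>) = None"
  proof (rule fock_g_None)
    show "\<not> fockP \<mu> (enc \<kappa>) \<alpha>" for \<alpha>
      unfolding fockP_def using assms(3)[of \<alpha>] enc_inj[OF assms(2) mcomp_in(1)[OF assms(1), of \<alpha>]] by blast
  qed
  then show ?thesis by (simp add: fock_star_l2e[OF assms(1)])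
qed

lemma fock_star_off: assumes "\<mu> \<in> Lam G" "n \<notin> enc ` Lam G" shows "ap (bop_star (fock \<mu>)) (l2e n) = 0"
proof -
  have "fock_g \<mu> n = None"
  proof (rule fock_g_None)
    show "\<not> fockP \<mu> n \<alpha>" for \<alpha>
      unfolding fockP_def using assms(2) mcomp_in(1)[OF assms(1), of \<alpha>] by blast
  qed
  then show ?thesis by (simp add: fock_star_l2e[OF assms(1)])
qed

lemma fock_eqI:
  assumes "\<And>\<xi>. \<xi> \<in> Lam G \<Longrightarrow> ap A (dl \<xi>) = ap B (dl \<xi>)"
    and "\<And>n. n \<notin> enc ` Lam G \<Longrightarrow> ap A (l2e n) = ap B (l2e n)"
  shows "A = B"
proof (rule bop_basis_eqI)
  show "ap A (l2e n) = ap B (l2e n)" for n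
    using assms by (cases "n \<in> enc ` Lam G") auto
qed

lemma fock_mult:
  assumes L: "\<kappa> \<in> Lam G" "\<mu> \<in> Lam G"
  shows "fock \<kappa> * fock \<mu> = (if msrc \<kappa> = mrng G \<mu> then fock (mcomp G \<kappa> \<mu>) else 0)"
proof (rule fock_eqI)
  fix \<xi> assume x: "\<xi> \<in> Lam G"
  show "ap (fock \<kappa> * fock \<mu>) (dl \<xi>) = ap (if msrc \<kappa> = mrng G \<mu> then fock (mcomp G \<kappa> \<mu>) else 0) (dl \<xi>)"
  proof (cases "msrc \<mu> = mrng G \<xi>")
    case True
    have m: "mcomp G \<mu> \<xi> \<in> Lam G" "mrng G (mcomp G \<mu> \<xi>) = mrng G \<mu>" using mcomp_in[OF L(2) x True] by auto
    show ?thesis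
    proof (cases "msrc \<kappa> = mrng G \<mu>")
      case t: True
      have k: "mcomp G \<kappa> \<mu> \<in> Lam G" "msrc (mcomp G \<kappa> \<mu>) = msrc \<mu>" using mcomp_in[OF L t] by auto
      show ?thesis using True t
        by (simp add: fock_dl[OF L(2) x] fock_dl[OF L(1) m(1)] fock_dl[OF k(1) x] m k mcomp_assoc[OF L x t True] del: mcomp_in)
    next
      case False
      then show ?thesis using True by (simp add: fock_dl[OF L(2) x] fock_dl[OF L(1) m(1)] m del: mcomp_in)
    qed
  next
    case False
    then show ?thesis using mcomp_in[OF L] x by (auto simp: fock_dl L)
  qed
next
  show "ap (fock \<kappa> * fock \<mu>) (l2e n) = ap (if msrc \<kappa> = mrng G \<mu> then fock (mcomp G \<kappa> \<mu>) else 0) (l2e n)"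
    if "n \<notin> enc ` Lam G" for n
    using that mcomp_in(1)[OF L] by (auto simp: fock_off L)
qed

text \<open>On the vector of \<xi> the left side is nonzero exactly if \<mu> \<xi> is defined and
  also extends \<kappa>. Then \<xi> factors through exactly one minimal common extension, so one
  summand survives and produces the same vector.\<close>

lemma fock_star_mult:
  assumes L: "\<kappa> \<in> Lam G" "\<mu> \<in> Lam G"
  shows "bop_star (fock \<kappa>) * fock \<mu> = (\<Sum>(\<alpha>, \<alpha>')\<in>Lam_min G \<kappa> \<mu>. fock \<alpha> * bop_star (fock \<alpha>'))"
proof (rule fock_eqI)
  show "ap (bop_star (fock \<kappa>) * fock \<mu>) (l2e n) = ap (\<Sum>(\<alpha>, \<alpha>')\<in>Lam_min G \<kappa> \<mu>. fock \<alpha> * bop_star (fock \<alpha>')) (l2e n)"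
    if n: "n \<notin> enc ` Lam G" for n
  proof -
    have "ap (fock (fst p) * bop_star (fock (snd p))) (l2e n) = 0" if "p \<in> Lam_min G \<kappa> \<mu>" for p
      using that Lam_min_iff[of "fst p" "snd p"] n by (simp add: fock_star_off)
    then show ?thesis by (simp add: fock_off[OF L(2) n] case_prod_unfold)
  qed
next
  fix \<xi> assume x: "\<xi> \<in> Lam G"
  have R: "ap (\<Sum>(\<alpha>, \<alpha>')\<in>Lam_min G \<kappa> \<mu>. fock \<alpha> * bop_star (fock \<alpha>')) (dl \<xi>)
    = (\<Sum>p\<in>Lam_min G \<kappa> \<mu>. ap (fock (fst p)) (ap (bop_star (fock (snd p))) (dl \<xi>)))"
    by (simp add: case_prod_unfold)
  have p: "fst p \<in> Lam G" "snd p \<in> Lam G" "msrc \<kappa> = mrng G (fst p)" "msrc \<mu> = mrng G (snd p)"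
    "mcomp G \<kappa> (fst p) = mcomp G \<mu> (snd p)" "msrc (fst p) = msrc (snd p)" if "p \<in> Lam_min G \<kappa> \<mu>" for p
  proof -
    show *: "fst p \<in> Lam G" "snd p \<in> Lam G" "msrc \<kappa> = mrng G (fst p)" "msrc \<mu> = mrng G (snd p)"
      "mcomp G \<kappa> (fst p) = mcomp G \<mu> (snd p)" using that Lam_min_iff[of "fst p" "snd p"] by auto
    show "msrc (fst p) = msrc (snd p)"
      using mcomp_in(2)[OF L(1) *(1,3)] mcomp_in(2)[OF L(2) *(2,4)] *(5) by simp
  qed
  \<comment> \<open>Conversely, a nonvanishing summand produces a common extension of \<kappa> and
    \<mu>; this settles the case of a vanishing left side.\<close>
  have ext: "mcomp G \<mu> \<xi> = mcomp G \<kappa> (mcomp G (fst p) \<eta>) \<and> msrc \<kappa> = mrng G (mcomp G (fst p) \<eta>) \<and>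
      mcomp G (fst p) \<eta> \<in> Lam G \<and> msrc \<mu> = mrng G \<xi>"
    if q: "p \<in> Lam_min G \<kappa> \<mu>" "\<eta> \<in> Lam G" "msrc (snd p) = mrng G \<eta>" "\<xi> = mcomp G (snd p) \<eta>" for p \<eta>
  proof -
    have s: "msrc (fst p) = mrng G \<eta>" using q p(6)[OF q(1)] by simp
    have "mcomp G \<mu> \<xi> = mcomp G (mcomp G \<mu> (snd p)) \<eta>"
      unfolding q(4) by (rule mcomp_assoc[symmetric]) (use L p[OF q(1)] q in auto)
    also have "\<dots> = mcomp G (mcomp G \<kappa> (fst p)) \<eta>" using p(5)[OF q(1)] by simp
    also have "\<dots> = mcomp G \<kappa> (mcomp G (fst p) \<eta>)"
      by (rule mcomp_assoc) (use L p[OF q(1)] q s in auto)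
    finally show ?thesis
      using mcomp_in[OF p(1)[OF q(1)] q(2) s] mcomp_in(3)[OF p(2)[OF q(1)] q(2,3)] p(3,4)[OF q(1)] q(4) by simp
  qed
  show "ap (bop_star (fock \<kappa>) * fock \<mu>) (dl \<xi>) = ap (\<Sum>(\<alpha>, \<alpha>')\<in>Lam_min G \<kappa> \<mu>. fock \<alpha> * bop_star (fock \<alpha>')) (dl \<xi>)"
  proof (cases "msrc \<mu> = mrng G \<xi> \<and> (\<exists>\<zeta>\<in>Lam G. msrc \<kappa> = mrng G \<zeta> \<and> mcomp G \<mu> \<xi> = mcomp G \<kappa> \<zeta>)")
    case True
    then obtain \<zeta> where z: "\<zeta> \<in> Lam G" "msrc \<kappa> = mrng G \<zeta>" "mcomp G \<kappa> \<zeta> = mcomp G \<mu> \<xi>" "msrc \<mu> = mrng G \<xi>" by auto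
    have "ap (bop_star (fock \<kappa>)) (dl (mcomp G \<kappa> \<zeta>)) = dl \<zeta>" by (rule fock_star_dl[OF L(1) z(1,2)])
    then have l: "ap (bop_star (fock \<kappa>) * fock \<mu>) (dl \<xi>) = dl \<zeta>"
      using z(3,4) by (simp add: fock_dl[OF L(2) x])
    obtain \<alpha> \<alpha>' \<eta> where a: "(\<alpha>, \<alpha>') \<in> Lam_min G \<kappa> \<mu>" "\<eta> \<in> Lam G" "msrc \<alpha> = mrng G \<eta>" "msrc \<alpha>' = mrng G \<eta>"
      "\<zeta> = mcomp G \<alpha> \<eta>" "\<xi> = mcomp G \<alpha>' \<eta>"
      by (rule common_extension[OF L z(1) x z(2,4,3)])
    have "(\<Sum>p\<in>Lam_min G \<kappa> \<mu>. ap (fock (fst p)) (ap (bop_star (fock (snd p))) (dl \<xi>)))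
      = (\<Sum>p\<in>Lam_min G \<kappa> \<mu>. if p = (\<alpha>, \<alpha>') then dl \<zeta> else 0)"
    proof (rule sum.cong[OF refl])
      fix q assume q: "q \<in> Lam_min G \<kappa> \<mu>"
      show "ap (fock (fst q)) (ap (bop_star (fock (snd q))) (dl \<xi>)) = (if q = (\<alpha>, \<alpha>') then dl \<zeta> else 0)"
      proof (cases "q = (\<alpha>, \<alpha>')")
        case True
        have aL: "\<alpha> \<in> Lam G" "\<alpha>' \<in> Lam G" using p(1,2)[OF a(1)] by auto
        have "ap (bop_star (fock \<alpha>')) (dl \<xi>) = dl \<eta>" unfolding a(6) by (rule fock_star_dl[OF aL(2) a(2,4)])
        then show ?thesis using True a(3,5) by (simp add: fock_dl[OF aL(1) a(2)])
      next
        case False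
        have "ap (bop_star (fock (snd q))) (dl \<xi>) = 0"
        proof (rule fock_star_zero[OF p(2)[OF q] x])
          fix \<theta> assume t: "\<theta> \<in> Lam G" "msrc (snd q) = mrng G \<theta>"
          show "\<xi> \<noteq> mcomp G (snd q) \<theta>"
          proof
            assume "\<xi> = mcomp G (snd q) \<theta>"
            then have "mcomp G (snd q) \<theta> = mcomp G \<alpha>' \<eta>" using a(6) by simp
            then have "fst q = \<alpha> \<and> snd q = \<alpha>' \<and> \<theta> = \<eta>"
              using Lam_min_unique[OF L, of "fst q" "snd q" \<alpha> \<alpha>' \<theta> \<eta>] q a t by simp
            then show False using False by (metis prod.collapse)
          qed
        qed
        then show ?thesis using False by simp
      qed
    qed
    also have "\<dots> = dl \<zeta>" using a(1) by (simp add: L)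
    finally show ?thesis using l R by simp
  next
    case False
    have "ap (bop_star (fock \<kappa>) * fock \<mu>) (dl \<xi>) = 0"
    proof (cases "msrc \<mu> = mrng G \<xi>")
      case True
      have "ap (bop_star (fock \<kappa>)) (dl (mcomp G \<mu> \<xi>)) = 0"
        by (rule fock_star_zero[OF L(1) mcomp_in(1)[OF L(2) x True]]) (use False True in blast)
      then show ?thesis using True by (simp add: fock_dl[OF L(2) x])
    qed (simp add: fock_dl[OF L(2) x])
    moreover have "ap (fock (fst q)) (ap (bop_star (fock (snd q))) (dl \<xi>)) = 0" if q: "q \<in> Lam_min G \<kappa> \<mu>" for q
    proof -
      have "ap (bop_star (fock (snd q))) (dl \<xi>) = 0"
      proof (rule fock_star_zero[OF p(2)[OF q] x])
        fix \<theta> assume "\<theta> \<in> Lam G" "msrc (snd q) = mrng G \<theta>"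
        then show "\<xi> \<noteq> mcomp G (snd q) \<theta>" using ext[OF q, of \<theta>] False by blast
      qed
      then show ?thesis by simp
    qed
    ultimately show ?thesis using R by simp
  qed
qed

lemma fock_vert_star: "bop_star (fock (vert G v)) = fock (vert G v)"
proof (rule fock_eqI)
  fix \<xi> assume x: "\<xi> \<in> Lam G"
  show "ap (bop_star (fock (vert G v))) (dl \<xi>) = ap (fock (vert G v)) (dl \<xi>)"
  proof (cases "v = mrng G \<xi>")
    case True
    then show ?thesis using fock_star_dl[OF vert_simps(1) x, of v] x by (simp add: fock_dl)
  next
    case False
    have "ap (bop_star (fock (vert G v))) (dl \<xi>) = 0"
    proof (rule fock_star_zero[OF vert_simps(1) x])
      fix \<alpha> assume "\<alpha> \<in> Lam G" "msrc (vert G v) = mrng G \<alpha>"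
      then show "\<xi> \<noteq> mcomp G (vert G v) \<alpha>" using False by auto
    qed
    then show ?thesis using False x by (simp add: fock_dl)
  qed
qed (simp add: fock_off fock_star_off)

lemma TF_fock: "TF fock"
  unfolding toeplitz_family_def
proof (intro conjI allI ballI)
  show "fock \<mu> * bop_star (fock \<mu>) * fock \<mu> = fock \<mu>" if m: "\<mu> \<in> Lam G" for \<mu>
  proof (rule fock_eqI)
    fix \<xi> assume x: "\<xi> \<in> Lam G"
    show "ap (fock \<mu> * bop_star (fock \<mu>) * fock \<mu>) (dl \<xi>) = ap (fock \<mu>) (dl \<xi>)"
      using fock_star_dl[OF m x] by (cases "msrc \<mu> = mrng G \<xi>") (simp_all add: fock_dl[OF m x])
  qed (simp add: fock_off m)
  show "fock (vert G v) * fock (vert G w) = (if v = w then fock (vert G v) else 0)" for v w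
    using mcomp_vert(1)[OF vert_simps(1), of w] by (simp add: fock_mult)
qed (auto simp only: fock_vert_star fock_mult fock_star_mult)

section \<open>Vector states, their mixtures and limits\<close>

abbreviation vterm :: "('v, 'e) nt \<Rightarrow> ('v, 'e) mor \<Rightarrow> complex" where
  "vterm x \<kappa> \<equiv> cinner (ap (x fock) (dl \<kappa>)) (dl \<kappa>)"

lemma vterm_bound: "x \<in> NT G \<Longrightarrow> cmod (vterm x \<kappa>) \<le> nt_norm G x"
proof -
  assume x: "x \<in> NT G"
  have "cmod (vterm x \<kappa>) \<le> norm (ap (x fock) (dl \<kappa>)) * norm (dl \<kappa>)" by (rule cinner_bound)
  also have "\<dots> \<le> norm (x fock) * norm (dl \<kappa>) * norm (dl \<kappa>)" by (intro mult_right_mono norm_ap) simp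
  also have "\<dots> \<le> nt_norm G x" using nt_norm_ge[OF x] by simp
  finally show ?thesis .
qed

text \<open>A nonzero coefficient requires \<kappa> to extend \<mu> and \<nu> by the same path.
  Comparing degrees and cancelling gives \<mu> = \<nu>, so off-diagonal monomials vanish.\<close>

lemma vterm_mono:
  assumes "\<mu> \<in> Lam G" "\<nu> \<in> Lam G" "\<kappa> \<in> Lam G"
  shows "vterm (mono \<mu> \<nu>) \<kappa> = (if \<mu> = \<nu> \<and> (\<exists>\<alpha>\<in>Lam G. msrc \<mu> = mrng G \<alpha> \<and> \<kappa> = mcomp G \<mu> \<alpha>) then 1 else 0)"
proof (cases "\<exists>\<alpha>\<in>Lam G. msrc \<nu> = mrng G \<alpha> \<and> \<kappa> = mcomp G \<nu> \<alpha>")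
  case True
  then obtain \<alpha> where a: "\<alpha> \<in> Lam G" "msrc \<nu> = mrng G \<alpha>" "\<kappa> = mcomp G \<nu> \<alpha>" by blast
  have s: "ap (bop_star (fock \<nu>)) (dl \<kappa>) = dl \<alpha>" unfolding a(3) by (rule fock_star_dl[OF assms(2) a(1,2)])
  have e: "vterm (mono \<mu> \<nu>) \<kappa> = coord (ap (fock \<mu>) (dl \<alpha>)) (enc \<kappa>)"
    by (simp add: nt_T_def TF_fock nt_star_apply s)
  show ?thesis
  proof (cases "msrc \<mu> = mrng G \<alpha> \<and> mcomp G \<mu> \<alpha> = \<kappa>")
    case t: True
    have "mdeg G \<mu> + mdeg G \<alpha> = mdeg G \<nu> + mdeg G \<alpha>"
      using mcomp_in(4)[OF assms(1) a(1)] mcomp_in(4)[OF assms(2) a(1,2)] t a(3) by simp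
    then have "mdeg G \<mu> = mdeg G \<nu>" by simp
    then have "\<mu> = \<nu>" using mcomp_cancel[OF assms(1) a(1) assms(2) a(1)] t a by blast
    then show ?thesis using e t a assms by (simp add: fock_dl) blast
  next
    case False
    have "coord (ap (fock \<mu>) (dl \<alpha>)) (enc \<kappa>) = 0"
    proof (cases "msrc \<mu> = mrng G \<alpha>")
      case True
      have "enc \<kappa> \<noteq> enc (mcomp G \<mu> \<alpha>)"
        using False True enc_inj[OF assms(3) mcomp_in(1)[OF assms(1) a(1) True]] by blast
      then show ?thesis using True by (simp add: fock_dl[OF assms(1) a(1)])
    qed (simp add: fock_dl[OF assms(1) a(1)])
    then have "vterm (mono \<mu> \<nu>) \<kappa> = 0" by (simp only: e)
    moreover have "\<mu> \<noteq> \<nu>" using False a by blast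
    ultimately show ?thesis by simp
  qed
next
  case False
  have "ap (bop_star (fock \<nu>)) (dl \<kappa>) = 0"
    by (rule fock_star_zero[OF assms(2,3)]) (use False in blast)
  then have "vterm (mono \<mu> \<nu>) \<kappa> = 0" by (simp add: nt_T_def TF_fock nt_star_apply)
  then show ?thesis using False by auto
qed

text \<open>The state axioms without the convention on values outside the algebra: mixtures and
  limits are formed beforehand and restricted at the end.\<close>

definition prestate :: "(('v, 'e) nt \<Rightarrow> complex) \<Rightarrow> bool" where
  "prestate \<psi> \<longleftrightarrow> (\<forall>x\<in>NT G. \<forall>y\<in>NT G. \<psi> (x + y) = \<psi> x + \<psi> y) \<and>
     (\<forall>x\<in>NT G. \<forall>c. \<psi> (nt_scale c x) = c * \<psi> x) \<and>
     (\<forall>x\<in>NT G. \<psi> (nt_star x * x) \<in> \<real>\<^sub>\<ge>\<^sub>0) \<and>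
     (\<forall>x\<in>NT G. cmod (\<psi> x) \<le> nt_norm G x) \<and> \<psi> (nt_unit G) = 1"

lemma nt_state_restrict: "prestate \<psi> \<Longrightarrow> nt_state G (restrict \<psi> (NT G))"
  unfolding prestate_def nt_state_def by (simp del: times_fun_apply plus_fun_apply)

definition vstate :: "(('v, 'e) mor \<Rightarrow> real) \<Rightarrow> ('v, 'e) mor set \<Rightarrow> ('v, 'e) nt \<Rightarrow> complex" where
  "vstate q I x = (\<Sum>\<^sub>\<infinity>\<kappa>\<in>I. of_real (q \<kappa>) * vterm x \<kappa>)"

lemma vstate_has_sum:
  assumes q: "\<And>\<kappa>. \<kappa> \<in> I \<Longrightarrow> 0 \<le> q \<kappa>" "(q has_sum 1) I" and x: "x \<in> NT G"
  shows "((\<lambda>\<kappa>. of_real (q \<kappa>) * vterm x \<kappa>) has_sum vstate q I x) I"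
proof -
  have "(\<lambda>\<kappa>. norm (complex_of_real (q \<kappa>) * vterm x \<kappa>)) summable_on I"
  proof (rule summable_on_comparison_test)
    show "(\<lambda>\<kappa>. q \<kappa> * nt_norm G x) summable_on I"
      using q(2) by (intro summable_on_cmult_left) (auto simp: summable_on_def)
    show "norm (complex_of_real (q \<kappa>) * vterm x \<kappa>) \<le> q \<kappa> * nt_norm G x" if "\<kappa> \<in> I" for \<kappa>
      using q(1)[OF that] vterm_bound[OF x] by (simp add: norm_mult mult_left_mono del: cinner_l2e_right)
  qed simp
  then show ?thesis unfolding vstate_def by (rule has_sum_infsum[OF abs_summable_summable])
qed

lemma prestate_vstate:
  assumes q: "\<And>\<kappa>. \<kappa> \<in> I \<Longrightarrow> 0 \<le> q \<kappa>" "(q has_sum 1) I" and I: "I \<subseteq> Lam G"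
  shows "prestate (vstate q I)"
proof -
  have hs: "((\<lambda>\<kappa>. of_real (q \<kappa>) * vterm x \<kappa>) has_sum vstate q I x) I" if "x \<in> NT G" for x
    by (rule vstate_has_sum) (use q that in auto)
  show ?thesis
  unfolding prestate_def
proof (intro conjI ballI allI)
  fix x assume x: "x \<in> NT G"
  show "vstate q I (x + y) = vstate q I x + vstate q I y" if y: "y \<in> NT G" for y
    using has_sum_add[OF hs[OF x] hs[OF y]] hs[OF NT_add[OF x y]]
    by (intro has_sum_unique[where A = I]) (simp_all add: cinner_add_left distrib_left del: cinner_l2e_right)
  show "vstate q I (nt_scale c x) = c * vstate q I x" for c
    using has_sum_cmult_right[OF hs[OF x], of c] hs[OF NT_scale[OF x], of c]
    by (intro has_sum_unique[where A = I])
      (simp_all add: nt_scale_apply cinner_scale_left mult.left_commute del: cinner_l2e_right)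
  show "cmod (vstate q I x) \<le> nt_norm G x"
  proof (rule norm_infsum_le[OF hs[OF x]])
    show "((\<lambda>\<kappa>. q \<kappa> * nt_norm G x) has_sum nt_norm G x) I" using has_sum_cmult_left[OF q(2), of "nt_norm G x"] by simp
    show "cmod (of_real (q \<kappa>) * vterm x \<kappa>) \<le> q \<kappa> * nt_norm G x" if "\<kappa> \<in> I" for \<kappa>
      using q(1)[OF that] vterm_bound[OF x] by (simp add: norm_mult mult_left_mono del: cinner_l2e_right)
  qed
  \<comment> \<open>At a product of x with its adjoint each term is a weight times a squared norm,
    so the sum is that of a nonnegative real series.\<close>
  define r where "r \<kappa> = q \<kappa> * (norm (ap (x fock) (dl \<kappa>)))\<^sup>2" for \<kappa>
  have "of_real (q \<kappa>) * vterm (nt_star x * x) \<kappa> = complex_of_real (r \<kappa>)" for \<kappa>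
    using cinner_self[of "ap (x fock) (dl \<kappa>)"]
    by (simp add: r_def nt_star_apply cinner_star_left del: cinner_l2e_right)
  then have "((\<lambda>\<kappa>. complex_of_real (r \<kappa>)) has_sum vstate q I (nt_star x * x)) I"
    using hs[OF NT_mult[OF NT_star[OF x] x]] by (simp only:)
  then have re: "(r has_sum Re (vstate q I (nt_star x * x))) I" and im: "((\<lambda>_. 0) has_sum Im (vstate q I (nt_star x * x))) I"
    using has_sum_bounded_linear[OF bounded_linear_Re] has_sum_bounded_linear[OF bounded_linear_Im]
    by (fastforce simp: o_def)+
  have "0 \<le> Re (vstate q I (nt_star x * x))"
    by (rule has_sum_nonneg[OF re]) (use q(1) in \<open>simp add: r_def\<close>)
  moreover have "Im (vstate q I (nt_star x * x)) = 0" using im has_sum_unique[OF im has_sum_0] by simp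
  ultimately show "vstate q I (nt_star x * x) \<in> \<real>\<^sub>\<ge>\<^sub>0" by (simp add: complex_nonneg_Reals_iff)
next
  have 1: "vterm (nt_unit G) \<kappa> = 1" if k: "\<kappa> \<in> I" for \<kappa>
  proof -
    have kL: "\<kappa> \<in> Lam G" using k I by blast
    have "ap (nt_unit G fock) (dl \<kappa>) = (\<Sum>v\<in>UNIV. if v = mrng G \<kappa> then dl \<kappa> else 0)"
      unfolding nt_unit_def sum_fun_apply ap_sum_left
      by (rule sum.cong[OF refl]) (auto simp: nt_T_def TF_fock fock_dl[OF vert_simps(1) kL] kL)
    then show ?thesis by simp
  qed
  have "((\<lambda>\<kappa>. complex_of_real (q \<kappa>)) has_sum of_real 1) I" using q(2) by (simp only: has_sum_of_real_iff)
  then have "((\<lambda>\<kappa>. complex_of_real (q \<kappa>) * vterm (nt_unit G) \<kappa>) has_sum 1) I"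
    by (subst has_sum_cong[where g = "\<lambda>\<kappa>. complex_of_real (q \<kappa>)"]) (simp_all add: 1 del: cinner_l2e_right)
  then show "vstate q I (nt_unit G) = 1"
    by (rule has_sum_unique[OF hs[OF NT_unit]])
qed
qed

text \<open>Eventual constancy is known on monomials; the common norm bound turns it into
  convergence on the whole algebra, and every axiom survives pointwise limits.\<close>

lemma prestate_lim:
  assumes ps: "\<And>k. prestate (\<psi> k)"
    and ev: "\<And>\<kappa> \<mu>. \<kappa> \<in> Lam G \<Longrightarrow> \<mu> \<in> Lam G \<Longrightarrow> \<forall>\<^sub>F k in sequentially. \<psi> k (mono \<kappa> \<mu>) = val \<kappa> \<mu>"
  shows "prestate (\<lambda>x. lim (\<lambda>k. \<psi> k x))"
    "\<And>\<kappa> \<mu>. \<kappa> \<in> Lam G \<Longrightarrow> \<mu> \<in> Lam G \<Longrightarrow> lim (\<lambda>k. \<psi> k (mono \<kappa> \<mu>)) = val \<kappa> \<mu>"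
proof -
  have add: "\<psi> k (x + y) = \<psi> k x + \<psi> k y" if "x \<in> NT G" "y \<in> NT G" for k x y using ps[of k] that unfolding prestate_def by blast
  have sc: "\<psi> k (nt_scale c x) = c * \<psi> k x" if "x \<in> NT G" for k c x using ps[of k] that unfolding prestate_def by blast
  have pos: "\<psi> k (nt_star x * x) \<in> \<real>\<^sub>\<ge>\<^sub>0" if "x \<in> NT G" for k x using ps[of k] that unfolding prestate_def by blast
  have bd: "cmod (\<psi> k x) \<le> nt_norm G x" if "x \<in> NT G" for k x using ps[of k] that unfolding prestate_def by blast
  have un: "\<psi> k (nt_unit G) = 1" for k using ps[of k] unfolding prestate_def by blast
  have df: "\<psi> k (x - y) = \<psi> k x - \<psi> k y" if "x \<in> NT G" "y \<in> NT G" for k x y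
  proof -
    have "\<psi> k x = \<psi> k (x - y) + \<psi> k y" using add[OF NT_diff[OF that] that(2)] by (simp only: diff_add_cancel)
    then show ?thesis by simp
  qed
  have csp: "convergent (\<lambda>k. \<psi> k y)" if "y \<in> nt_span" for y
    using that
  proof (induct rule: nt_span.induct)
    case (mono \<kappa> \<mu>)
    then show ?case using tendsto_eventually[OF ev[OF mono(1,2)]] by (auto simp only: convergent_def)
  next
    case zero
    have "\<psi> k 0 = 0" for k using add[OF NT_zero NT_zero, of k] by (simp only: add_0_left) simp
    then show ?case by (simp only: convergent_const)
  next
    case (scale x c)
    then show ?case by (simp only: sc[OF span_NT[OF scale(1)]]) (intro convergent_mult convergent_const)
  next
    case (add x y)
    then show ?case by (simp only: \<open>\<And>k x y. x \<in> NT G \<Longrightarrow> y \<in> NT G \<Longrightarrow> \<psi> k (x + y) = \<psi> k x + \<psi> k y\<close> span_NT convergent_add)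
  qed
  have conv: "(\<lambda>k. \<psi> k x) \<longlonglongrightarrow> lim (\<lambda>k. \<psi> k x)" if x: "x \<in> NT G" for x
  proof -
    have "Cauchy (\<lambda>k. \<psi> k x)"
    proof (rule metric_CauchyI)
      fix e :: real assume e: "e > 0"
      obtain y where y: "y \<in> nt_span" "\<And>S. norm (x S - y S) \<le> e/4" using NT_approx[OF x, of "e/4"] e by auto
      have c: "cmod (\<psi> k x - \<psi> k y) \<le> e/4" for k
      proof -
        have "cmod (\<psi> k x - \<psi> k y) \<le> nt_norm G (x - y)"
          using bd[OF NT_diff[OF x span_NT[OF y(1)]]] df[OF x span_NT[OF y(1)]] by simp
        also have "\<dots> \<le> e/4" by (rule nt_norm_le) (use y in simp)
        finally show ?thesis .
      qed
      obtain M where M: "\<And>m n. m \<ge> M \<Longrightarrow> n \<ge> M \<Longrightarrow> dist (\<psi> m y) (\<psi> n y) < e/4"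
        using convergent_Cauchy[OF csp[OF y(1)]] e unfolding Cauchy_def by (meson zero_less_divide_iff zero_less_numeral)
      have "dist (\<psi> m x) (\<psi> n x) < e" if "m \<ge> M" "n \<ge> M" for m n
      proof -
        have eq: "\<psi> m x - \<psi> n x = (\<psi> m x - \<psi> m y) + (\<psi> m y - \<psi> n y) - (\<psi> n x - \<psi> n y)" by simp
        have "cmod (\<psi> m x - \<psi> n x) \<le> cmod (\<psi> m x - \<psi> m y) + cmod (\<psi> m y - \<psi> n y) + cmod (\<psi> n x - \<psi> n y)"
          using norm_triangle_ineq4[of "(\<psi> m x - \<psi> m y) + (\<psi> m y - \<psi> n y)" "\<psi> n x - \<psi> n y"]
            norm_triangle_ineq[of "\<psi> m x - \<psi> m y" "\<psi> m y - \<psi> n y"]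
          unfolding eq[symmetric] by linarith
        then show ?thesis using c[of m] c[of n] M[OF that] e by (simp add: dist_norm)
      qed
      then show "\<exists>M. \<forall>m\<ge>M. \<forall>n\<ge>M. dist (\<psi> m x) (\<psi> n x) < e" by blast
    qed
    then show ?thesis using Cauchy_convergent convergent_LIMSEQ_iff by blast
  qed
  show "prestate (\<lambda>x. lim (\<lambda>k. \<psi> k x))"
    unfolding prestate_def
  proof (intro conjI ballI allI)
    fix x assume x: "x \<in> NT G"
    show "lim (\<lambda>k. \<psi> k (x + y)) = lim (\<lambda>k. \<psi> k x) + lim (\<lambda>k. \<psi> k y)" if y: "y \<in> NT G" for y
      unfolding add[OF x y] by (intro limI tendsto_add conv x y)
    show "lim (\<lambda>k. \<psi> k (nt_scale c x)) = c * lim (\<lambda>k. \<psi> k x)" for c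
      unfolding sc[OF x] by (intro limI tendsto_mult tendsto_const conv x)
    show "lim (\<lambda>k. \<psi> k (nt_star x * x)) \<in> \<real>\<^sub>\<ge>\<^sub>0"
      by (rule Lim_in_closed_set[OF closed_nonneg_Reals_complex _ _ conv[OF NT_mult[OF NT_star[OF x] x]]])
        (simp_all only: pos[OF x] eventually_True sequentially_bot not_False_eq_True simp_thms)
    show "cmod (lim (\<lambda>k. \<psi> k x)) \<le> nt_norm G x"
      by (rule LIMSEQ_le_const2[OF tendsto_norm[OF conv[OF x]]]) (use bd[OF x] in blast)
  next
    show "lim (\<lambda>k. \<psi> k (nt_unit G)) = 1" unfolding un by (rule lim_const)
  qed
  show "lim (\<lambda>k. \<psi> k (mono \<kappa> \<mu>)) = val \<kappa> \<mu>" if "\<kappa> \<in> Lam G" "\<mu> \<in> Lam G" for \<kappa> \<mu>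
    by (rule limI, rule tendsto_eventually, rule ev[OF that])
qed

end

section \<open>Traces and gauge-invariant KMS-states\<close>

lemma has_sum_finite_sum:
  fixes f :: "'a \<Rightarrow> 'b \<Rightarrow> 'c :: topological_comm_monoid_add"
  assumes "finite A" "\<And>a. a \<in> A \<Longrightarrow> (f a has_sum s a) I"
  shows "((\<lambda>n. \<Sum>a\<in>A. f a n) has_sum (\<Sum>a\<in>A. s a)) I"
  using assms
proof (induct A rule: finite_induct)
  case (insert a A)
  then have "((\<lambda>n. f a n + (\<Sum>a\<in>A. f a n)) has_sum s a + (\<Sum>a\<in>A. s a)) I"
    by (intro has_sum_add) auto
  then show ?case using insert by simp
qed (simp add: has_sum_0)

lemma degs_in_empty: "degs_in {} = {0}"
  by (auto simp: degs_in_def fun_eq_iff)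

context finite_hrg
begin

lemma Sigma_deg_bij:
  "bij_betw snd (SIGMA n:D. {\<kappa> \<in> Lam G. mdeg G \<kappa> = n \<and> P \<kappa>}) {\<kappa> \<in> Lam G. mdeg G \<kappa> \<in> D \<and> P \<kappa>}"
  by (rule bij_betwI[where g = "\<lambda>\<kappa>. (mdeg G \<kappa>, \<kappa>)"]) auto

text \<open>Grouping by degree. Nonnegativity allows the passage from the sum of block sums to an
  unconditional sum over paths.\<close>

lemma paths_has_sum:
  fixes f :: "('v, 'e) mor \<Rightarrow> real"
  assumes "\<And>\<kappa>. \<kappa> \<in> Lam G \<Longrightarrow> 0 \<le> f \<kappa>"
    and s: "((\<lambda>n. \<Sum>\<kappa> | \<kappa> \<in> Lam G \<and> mdeg G \<kappa> = n \<and> P \<kappa>. f \<kappa>) has_sum s) D"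
  shows "(f has_sum s) {\<kappa> \<in> Lam G. mdeg G \<kappa> \<in> D \<and> P \<kappa>}"
proof -
  let ?B = "\<lambda>n. {\<kappa> \<in> Lam G. mdeg G \<kappa> = n \<and> P \<kappa>}"
  have i: "((\<lambda>y. f (snd (n, y))) has_sum sum f (?B n)) (?B n)" for n
    using has_sum_finite[of "?B n" f] by simp
  have "((\<lambda>p. f (snd p)) has_sum s) (Sigma D ?B)"
  proof (rule has_sum_SigmaI[OF i s])
    show "(\<lambda>p. f (snd p)) summable_on Sigma D ?B"
      by (rule summable_on_SigmaI[OF i has_sum_imp_summable[OF s]]) (use assms(1) in auto)
  qed
  then show ?thesis by (subst (asm) has_sum_reindex_bij_betw[OF Sigma_deg_bij])
qed

lemma paths_has_sumD:
  fixes f :: "('v, 'e) mor \<Rightarrow> real"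
  assumes "(f has_sum s) {\<kappa> \<in> Lam G. mdeg G \<kappa> \<in> D \<and> P \<kappa>}"
  shows "((\<lambda>n. \<Sum>\<kappa> | \<kappa> \<in> Lam G \<and> mdeg G \<kappa> = n \<and> P \<kappa>. f \<kappa>) has_sum s) D"
proof -
  let ?B = "\<lambda>n. {\<kappa> \<in> Lam G. mdeg G \<kappa> = n \<and> P \<kappa>}"
  have "((\<lambda>p. f (snd p)) has_sum s) (Sigma D ?B)"
    using assms by (subst has_sum_reindex_bij_betw[OF Sigma_deg_bij])
  then show ?thesis
    by (rule has_sum_SigmaD) (use has_sum_finite[of "?B n" f for n] in simp)
qed

lemma Bop_fixed_degs:
  assumes "\<And>i. i \<in> C \<Longrightarrow> Bop \<beta> (unit_deg i) x = x" "finite C" "m \<in> degs_in C"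
  shows "Bop \<beta> m x = x"
  using assms(3)
proof (induct "\<Sum>i\<in>C. m i" arbitrary: m)
  case 0
  have "m = 0"
  proof (rule ext)
    show "m i = 0 i" for i using 0 assms(2) by (cases "i \<in> C") (auto simp: degs_in_def)
  qed
  then show ?case by (simp only: Bop_0)
next
  case (Suc k)
  then have "(\<Sum>i\<in>C. m i) \<noteq> 0" by simp
  then obtain i where i: "i \<in> C" "m i \<noteq> 0" using assms(2) by (meson sum.neutral)
  let ?m = "m(i := m i - 1)"
  have e: "m = unit_deg i + ?m" using i by (auto simp: unit_deg_def fun_eq_iff)
  have "(\<Sum>j\<in>C. m j) = (\<Sum>j\<in>C. unit_deg i j + ?m j)" by (subst e) simp
  also have "\<dots> = 1 + (\<Sum>j\<in>C. ?m j)" using i(1) assms(2) by (simp add: sum.distrib unit_deg_def)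
  finally have "k = (\<Sum>j\<in>C. ?m j)" using Suc(2) by simp
  moreover have "{j. ?m j \<noteq> 0} \<subseteq> {j. m j \<noteq> 0}" by (auto split: if_splits)
  then have "?m \<in> degs_in C" using Suc(3) unfolding degs_in_def mem_Collect_eq by (rule subset_trans)
  ultimately have "Bop \<beta> ?m x = x" by (rule Suc(1))
  then show ?case by (subst e) (simp only: Bop_add assms(1)[OF i(1)])
qed

text \<open>In a product of two monomials only those minimal extensions contribute that close up on
  both sides. Exchanging the factors exchanges the two components of such a pair, and the weights
  change by exactly the KMS factor.\<close>

lemma kms_of_formula:
  assumes st: "nt_state G \<phi>"
    and f: "\<And>\<kappa> \<mu>. \<kappa> \<in> Lam G \<Longrightarrow> \<mu> \<in> Lam G \<Longrightarrow> \<phi> (mono \<kappa> \<mu>) = (if \<kappa> = \<mu> then of_real (wt \<beta> \<kappa> * w $ msrc \<kappa>) else 0)"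
  shows "\<phi> \<in> kms G \<beta>"
proof -
  define A where "A \<kappa> \<mu> \<kappa>' \<mu>' = {p \<in> Lam_min G \<mu> \<kappa>'. mcomp G \<kappa> (fst p) = mcomp G \<mu>' (snd p)}" for \<kappa> \<mu> \<kappa>' \<mu>'
  have val: "\<phi> (mono \<kappa> \<mu> * mono \<kappa>' \<mu>') = (\<Sum>p\<in>A \<kappa> \<mu> \<kappa>' \<mu>'. of_real (wt \<beta> \<kappa> * wt \<beta> (fst p) * w $ msrc (fst p)))"
    if L: "\<kappa> \<in> Lam G" "\<mu> \<in> Lam G" "\<kappa>' \<in> Lam G" "\<mu>' \<in> Lam G" and s: "msrc \<kappa> = msrc \<mu>" "msrc \<kappa>' = msrc \<mu>'" for \<kappa> \<mu> \<kappa>' \<mu>'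
  proof -
    have m: "mcomp G \<kappa> (fst p) \<in> Lam G" "mcomp G \<mu>' (snd p) \<in> Lam G" "wt \<beta> (mcomp G \<kappa> (fst p)) = wt \<beta> \<kappa> * wt \<beta> (fst p)"
      "msrc (mcomp G \<kappa> (fst p)) = msrc (fst p)" if "p \<in> Lam_min G \<mu> \<kappa>'" for p
    proof -
      have a: "fst p \<in> Lam G" "snd p \<in> Lam G" "msrc \<kappa> = mrng G (fst p)" "msrc \<mu>' = mrng G (snd p)"
        using that Lam_min_iff[of "fst p" "snd p"] s by auto
      show "mcomp G \<kappa> (fst p) \<in> Lam G" "msrc (mcomp G \<kappa> (fst p)) = msrc (fst p)"
        using mcomp_in[OF L(1) a(1,3)] by auto
      show "mcomp G \<mu>' (snd p) \<in> Lam G" using mcomp_in[OF L(4) a(2,4)] by auto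
      show "wt \<beta> (mcomp G \<kappa> (fst p)) = wt \<beta> \<kappa> * wt \<beta> (fst p)" by (rule wt_comp[OF L(1) a(1,3)])
    qed
    have "\<phi> (mono \<kappa> \<mu> * mono \<kappa>' \<mu>') = (\<Sum>p\<in>Lam_min G \<mu> \<kappa>'. \<phi> (mono (mcomp G \<kappa> (fst p)) (mcomp G \<mu>' (snd p))))"
      unfolding mono_mult[OF L s] case_prod_unfold
      by (rule state_sum[OF st], rule span_NT[OF span_mono]) (simp_all only: m)
    also have "\<dots> = (\<Sum>p\<in>Lam_min G \<mu> \<kappa>'. if mcomp G \<kappa> (fst p) = mcomp G \<mu>' (snd p) then of_real (wt \<beta> \<kappa> * wt \<beta> (fst p) * w $ msrc (fst p)) else 0)"
      by (rule sum.cong[OF refl]) (simp only: f m)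
    also have "\<dots> = (\<Sum>p\<in>A \<kappa> \<mu> \<kappa>' \<mu>'. of_real (wt \<beta> \<kappa> * wt \<beta> (fst p) * w $ msrc (fst p)))"
      unfolding A_def by (rule sum.inter_filter[symmetric]) (simp add: L)
    finally show ?thesis .
  qed
  have sw: "prod.swap p \<in> A \<kappa>' \<mu>' \<kappa> \<mu>"
    if L: "\<kappa> \<in> Lam G" "\<mu> \<in> Lam G" "\<kappa>' \<in> Lam G" "\<mu>' \<in> Lam G" and s: "msrc \<kappa> = msrc \<mu>" "msrc \<kappa>' = msrc \<mu>'"
      and p: "p \<in> A \<kappa> \<mu> \<kappa>' \<mu>'" for p \<kappa> \<mu> \<kappa>' \<mu>'
  proof -
    obtain \<alpha> \<alpha>' where pp: "p = (\<alpha>, \<alpha>')" by (cases p)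
    have a: "\<alpha> \<in> Lam G" "\<alpha>' \<in> Lam G" "msrc \<mu> = mrng G \<alpha>" "msrc \<kappa>' = mrng G \<alpha>'" "mcomp G \<mu> \<alpha> = mcomp G \<kappa>' \<alpha>'"
      "mdeg G (mcomp G \<mu> \<alpha>) = (\<lambda>i. max (mdeg G \<mu> i) (mdeg G \<kappa>' i))" "mcomp G \<kappa> \<alpha> = mcomp G \<mu>' \<alpha>'"
      using p unfolding A_def pp by (auto simp: Lam_min_iff)
    have s': "msrc \<kappa> = mrng G \<alpha>" "msrc \<mu>' = mrng G \<alpha>'" using s a by auto
    have d1: "mdeg G \<mu> + mdeg G \<alpha> = mdeg G \<kappa>' + mdeg G \<alpha>'"
      using mcomp_in(4)[OF L(2) a(1,3)] mcomp_in(4)[OF L(3) a(2,4)] a(5) by simp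
    have d2: "mdeg G \<kappa> + mdeg G \<alpha> = mdeg G \<mu>' + mdeg G \<alpha>'"
      using mcomp_in(4)[OF L(1) a(1) s'(1)] mcomp_in(4)[OF L(4) a(2) s'(2)] a(7) by simp
    have d3: "mdeg G \<mu> + mdeg G \<alpha> = (\<lambda>i. max (mdeg G \<mu> i) (mdeg G \<kappa>' i))"
      using mcomp_in(4)[OF L(2) a(1,3)] a(6) by simp
    \<comment> \<open>In each colour minimality leaves \<alpha> or \<alpha>' without an entry, so
      the other composite also has the join of its two degrees.\<close>
    have "mdeg G (mcomp G \<mu>' \<alpha>') i = max (mdeg G \<mu>' i) (mdeg G \<kappa> i)" for i
      using fun_cong[OF d1, of i] fun_cong[OF d2, of i] fun_cong[OF d3, of i]
      unfolding mcomp_in(4)[OF L(4) a(2) s'(2)] plus_fun_apply by linarith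
    then have "(\<alpha>', \<alpha>) \<in> Lam_min G \<mu>' \<kappa>"
      unfolding Lam_min_iff using a s' by (simp only: simp_thms) blast
    then show ?thesis using a(5) unfolding A_def pp by simp
  qed
  have "\<phi> (mono \<kappa> \<mu> * mono \<kappa>' \<mu>') = of_real (exp (- (real (mlen G \<kappa>) - real (mlen G \<mu>)) * \<beta>)) * \<phi> (mono \<kappa>' \<mu>' * mono \<kappa> \<mu>)"
    if L: "\<kappa> \<in> Lam G" "\<mu> \<in> Lam G" "\<kappa>' \<in> Lam G" "\<mu>' \<in> Lam G" for \<kappa> \<mu> \<kappa>' \<mu>'
  proof (cases "msrc \<kappa> = msrc \<mu> \<and> msrc \<kappa>' = msrc \<mu>'")
    case True
    let ?c = "exp (- (real (mlen G \<kappa>) - real (mlen G \<mu>)) * \<beta>)"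
    have b: "bij_betw prod.swap (A \<kappa> \<mu> \<kappa>' \<mu>') (A \<kappa>' \<mu>' \<kappa> \<mu>)"
    proof (rule bij_betwI[where g = prod.swap])
      show "prod.swap \<in> A \<kappa> \<mu> \<kappa>' \<mu>' \<rightarrow> A \<kappa>' \<mu>' \<kappa> \<mu>" using sw[OF L] True by blast
      show "prod.swap \<in> A \<kappa>' \<mu>' \<kappa> \<mu> \<rightarrow> A \<kappa> \<mu> \<kappa>' \<mu>'" using sw[OF L(3,4,1,2)] True by blast
    qed auto
    have "of_real ?c * \<phi> (mono \<kappa>' \<mu>' * mono \<kappa> \<mu>) = of_real ?c * (\<Sum>p\<in>A \<kappa> \<mu> \<kappa>' \<mu>'. of_real (wt \<beta> \<kappa>' * wt \<beta> (fst (prod.swap p)) * w $ msrc (fst (prod.swap p))))"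
      using val[OF L(3,4,1,2)] True sum.reindex_bij_betw[OF b, of "\<lambda>p. complex_of_real (wt \<beta> \<kappa>' * wt \<beta> (fst p) * w $ msrc (fst p))"] by simp
    also have "\<dots> = (\<Sum>p\<in>A \<kappa> \<mu> \<kappa>' \<mu>'. of_real (wt \<beta> \<kappa> * wt \<beta> (fst p) * w $ msrc (fst p)))"
      unfolding sum_distrib_left
    proof (rule sum.cong[OF refl])
      fix p assume p: "p \<in> A \<kappa> \<mu> \<kappa>' \<mu>'"
      have a: "fst p \<in> Lam G" "snd p \<in> Lam G" "msrc \<mu> = mrng G (fst p)" "msrc \<kappa>' = mrng G (snd p)"
        "mcomp G \<mu> (fst p) = mcomp G \<kappa>' (snd p)"
        using p Lam_min_iff[of "fst p" "snd p"] unfolding A_def by auto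
      have "wt \<beta> \<mu> * wt \<beta> (fst p) = wt \<beta> \<kappa>' * wt \<beta> (snd p)"
        using wt_comp[OF L(2) a(1,3)] wt_comp[OF L(3) a(2,4)] a(5) by metis
      moreover have "msrc (fst p) = msrc (snd p)"
        using mcomp_in(2)[OF L(2) a(1,3)] mcomp_in(2)[OF L(3) a(2,4)] a(5) by metis
      moreover have "?c * wt \<beta> \<mu> = wt \<beta> \<kappa>"
        by (simp add: algebra_simps flip: exp_add)
      ultimately have "?c * (wt \<beta> \<kappa>' * wt \<beta> (snd p) * w $ msrc (snd p)) = wt \<beta> \<kappa> * wt \<beta> (fst p) * w $ msrc (fst p)"
        by (metis mult.assoc)
      then show "of_real ?c * complex_of_real (wt \<beta> \<kappa>' * wt \<beta> (fst (prod.swap p)) * w $ msrc (fst (prod.swap p)))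
        = of_real (wt \<beta> \<kappa> * wt \<beta> (fst p) * w $ msrc (fst p))"
        by (simp only: fst_swap of_real_mult[symmetric])
    qed
    also have "\<dots> = \<phi> (mono \<kappa> \<mu> * mono \<kappa>' \<mu>')" using val[OF L] True by simp
    finally show ?thesis by simp
  next
    case False
    then have "mono \<kappa> \<mu> * mono \<kappa>' \<mu>' = 0 \<and> mono \<kappa>' \<mu>' * mono \<kappa> \<mu> = 0"
    proof (cases "msrc \<kappa> = msrc \<mu>")
      case True
      then have "msrc \<kappa>' \<noteq> msrc \<mu>'" using False by blast
      then show ?thesis by (simp only: mono_source_zero[OF L(3,4)] mult_zero_left mult_zero_right simp_thms)
    next
      case False
      then show ?thesis by (simp only: mono_source_zero[OF L(1,2)] mult_zero_left mult_zero_right simp_thms)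
    qed
    then show ?thesis by (simp only: state_zero[OF st] mult_zero_right)
  qed
  then show ?thesis unfolding kms_def using st by blast
qed

text \<open>Colours outside F fix \<tau>, so the weight of the paths with given range and given
  degrees in those colours does not depend on these degrees. Hence each layer is a probability
  distribution, and splitting off a prefix leaves a lower layer with the same masses.\<close>

lemma kms_exists:
  assumes F: "F \<subseteq> {1..ncolours G}" and nn: "\<And>v. 0 \<le> \<tau> $ v"
    and s: "((\<lambda>n. Bop \<beta> n \<tau>) has_sum w) (degs_in F)" and tot: "(\<Sum>v\<in>UNIV. w $ v) = 1"
    and fx: "\<And>i. i \<in> {1..ncolours G} - F \<Longrightarrow> Bop \<beta> (unit_deg i) \<tau> = \<tau>"
  shows "\<exists>\<phi>\<in>kms G \<beta>. (\<forall>x\<in>NT G. \<phi> (gE x) = \<phi> x) \<and> om \<phi> = w"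
proof -
  let ?C = "{1..ncolours G} - F"
  define q where "q \<kappa> = wt \<beta> \<kappa> * \<tau> $ msrc \<kappa>" for \<kappa>
  have q0: "0 \<le> q \<kappa>" for \<kappa> using nn by (simp add: q_def)
  \<comment> \<open>m prescribes the degrees outside F. Shifting all degrees by m does not change
    the series, since B^m fixes \<tau>.\<close>
  have layer: "(q has_sum w $ v) {\<kappa> \<in> Lam G. (\<forall>i\<in>?C. mdeg G \<kappa> i = m i) \<and> mrng G \<kappa> = v}" if m: "m \<in> degs_in ?C" for m v
  proof -
    let ?D = "(\<lambda>n. m + n) ` degs_in F"
    have "Bop \<beta> (m + n) \<tau> = Bop \<beta> n \<tau>" for n
      unfolding add.commute[of m n] Bop_add using Bop_fixed_degs[OF fx _ m] by simp
    then have "((\<lambda>n. Bop \<beta> (m + n) \<tau> $ v) has_sum w $ v) (degs_in F)"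
      using s unfolding has_sum_vec_iff by simp
    then have "((\<lambda>n. Bop \<beta> n \<tau> $ v) has_sum w $ v) ?D"
      by (subst has_sum_reindex) (auto intro!: inj_onI simp: o_def)
    then have "(q has_sum w $ v) {\<kappa> \<in> Lam G. mdeg G \<kappa> \<in> ?D \<and> mrng G \<kappa> = v}"
      by (intro paths_has_sum q0) (simp add: Bop_nth q_def)
    also have "{\<kappa> \<in> Lam G. mdeg G \<kappa> \<in> ?D \<and> mrng G \<kappa> = v} = {\<kappa> \<in> Lam G. (\<forall>i\<in>?C. mdeg G \<kappa> i = m i) \<and> mrng G \<kappa> = v}"
    proof -
      have "mdeg G \<kappa> \<in> ?D \<longleftrightarrow> (\<forall>i\<in>?C. mdeg G \<kappa> i = m i)" if k: "\<kappa> \<in> Lam G" for \<kappa>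
      proof
        assume "mdeg G \<kappa> \<in> ?D"
        then show "\<forall>i\<in>?C. mdeg G \<kappa> i = m i" by (auto simp: degs_in_def)
      next
        assume a: "\<forall>i\<in>?C. mdeg G \<kappa> i = m i"
        have "mdeg G \<kappa> i = m i + (if i \<in> F then mdeg G \<kappa> i else 0)" for i
        proof (cases "i \<in> {1..ncolours G}")
          case True
          then show ?thesis using a m by (cases "i \<in> F") (auto simp: degs_in_def)
        next
          case False
          then show ?thesis using mdeg_support[OF k False] m F by (auto simp: degs_in_def)
        qed
        then have "mdeg G \<kappa> = m + (\<lambda>i. if i \<in> F then mdeg G \<kappa> i else 0)" by (simp add: fun_eq_iff)
        moreover have "(\<lambda>i. if i \<in> F then mdeg G \<kappa> i else 0) \<in> degs_in F" by (auto simp: degs_in_def)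
        ultimately show "mdeg G \<kappa> \<in> ?D" by blast
      qed
      then show ?thesis by blast
    qed
    finally show ?thesis .
  qed
  \<comment> \<open>The K-th layer; its degrees in the colours of F are unrestricted.\<close>
  define I where "I K = {\<kappa> \<in> Lam G. \<forall>i\<in>?C. mdeg G \<kappa> i = K}" for K :: nat
  have IL: "I K \<subseteq> Lam G" for K by (auto simp: I_def)
  have q1: "(q has_sum 1) (I K)" for K
  proof -
    let ?B = "\<lambda>v. {\<kappa> \<in> Lam G. (\<forall>i\<in>?C. mdeg G \<kappa> i = (if i \<in> ?C then K else 0)) \<and> mrng G \<kappa> = v}"
    have m: "(\<lambda>i. if i \<in> ?C then K else 0) \<in> degs_in ?C" by (auto simp: degs_in_def split: if_splits)
    have i: "((\<lambda>\<kappa>. q (snd (v, \<kappa>))) has_sum w $ v) (?B v)" for v using layer[OF m, of v] by simp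
    have g: "((\<lambda>v. w $ v) has_sum 1) UNIV" using has_sum_finite[of UNIV "\<lambda>v. w $ v"] tot by simp
    have "((\<lambda>p. q (snd p)) has_sum 1) (Sigma UNIV ?B)"
    proof (rule has_sum_SigmaI[OF i g])
      show "(\<lambda>p. q (snd p)) summable_on Sigma UNIV ?B"
        by (rule summable_on_SigmaI[OF i has_sum_imp_summable[OF g]]) (simp add: q0)
    qed
    moreover have "bij_betw snd (Sigma UNIV ?B) (I K)"
      by (rule bij_betwI[where g = "\<lambda>\<kappa>. (mrng G \<kappa>, \<kappa>)"]) (auto simp: I_def)
    ultimately show ?thesis using has_sum_reindex_bij_betw by blast
  qed
  define \<psi> where "\<psi> K = vstate q (I K)" for K
  have ps: "prestate (\<psi> K)" for K unfolding \<psi>_def by (rule prestate_vstate[OF q0 q1 IL])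
  define val where "val \<kappa> \<mu> = (if \<kappa> = \<mu> then complex_of_real (wt \<beta> \<kappa> * w $ msrc \<kappa>) else 0)" for \<kappa> \<mu> :: "('v, 'e) mor"
  have psval: "\<psi> K (mono \<mu> \<nu>) = val \<mu> \<nu>" if L: "\<mu> \<in> Lam G" "\<nu> \<in> Lam G" and K: "\<And>i. i \<in> ?C \<Longrightarrow> mdeg G \<mu> i \<le> K" for K \<mu> \<nu>
  proof -
    have hs: "((\<lambda>\<kappa>. of_real (q \<kappa>) * vterm (mono \<mu> \<nu>) \<kappa>) has_sum \<psi> K (mono \<mu> \<nu>)) (I K)"
      unfolding \<psi>_def by (rule vstate_has_sum[OF q0 q1 span_NT[OF span_mono[OF L]]])
    have vt: "vterm (mono \<mu> \<nu>) \<kappa> = (if \<mu> = \<nu> \<and> (\<exists>\<alpha>\<in>Lam G. msrc \<mu> = mrng G \<alpha> \<and> \<kappa> = mcomp G \<mu> \<alpha>) then 1 else 0)" if "\<kappa> \<in> I K" for \<kappa>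
      by (rule vterm_mono[OF L]) (use that IL in blast)
    show ?thesis
    proof (cases "\<mu> = \<nu>")
      case False
      have "((\<lambda>\<kappa>. of_real (q \<kappa>) * vterm (mono \<mu> \<nu>) \<kappa>) has_sum 0) (I K)"
      proof (rule has_sum_0)
        show "of_real (q \<kappa>) * vterm (mono \<mu> \<nu>) \<kappa> = 0" if "\<kappa> \<in> I K" for \<kappa>
          unfolding vt[OF that] using False by simp
      qed
      then show ?thesis using has_sum_unique[OF hs] False by (simp add: val_def)
    next
      case True
      \<comment> \<open>Splitting \<mu> off a path of layer K leaves these degrees outside F; the
        bound on K makes the truncated difference a genuine one.\<close>
      let ?m = "\<lambda>i. if i \<in> ?C then K - mdeg G \<mu> i else 0"
      let ?A = "{\<alpha> \<in> Lam G. (\<forall>i\<in>?C. mdeg G \<alpha> i = ?m i) \<and> mrng G \<alpha> = msrc \<mu>}"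
      let ?J = "{\<kappa> \<in> I K. \<exists>\<alpha>\<in>Lam G. msrc \<mu> = mrng G \<alpha> \<and> \<kappa> = mcomp G \<mu> \<alpha>}"
      have m: "?m \<in> degs_in ?C" by (auto simp: degs_in_def split: if_splits)
      have dm: "mdeg G (mcomp G \<mu> \<alpha>) i = mdeg G \<mu> i + mdeg G \<alpha> i" if "\<alpha> \<in> Lam G" "msrc \<mu> = mrng G \<alpha>" for \<alpha> i
        using mcomp_in(4)[OF L(1) that] by simp
      have b: "bij_betw (mcomp G \<mu>) ?A ?J"
        unfolding bij_betw_def
      proof
        show "inj_on (mcomp G \<mu>) ?A"
        proof (rule inj_onI)
          fix \<alpha> \<gamma> assume a: "\<alpha> \<in> ?A" and g: "\<gamma> \<in> ?A" and e: "mcomp G \<mu> \<alpha> = mcomp G \<mu> \<gamma>"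
          have a': "\<alpha> \<in> Lam G" "msrc \<mu> = mrng G \<alpha>" using a by auto
          have g': "\<gamma> \<in> Lam G" "msrc \<mu> = mrng G \<gamma>" using g by auto
          show "\<alpha> = \<gamma>" using mcomp_cancel[OF L(1) a'(1) L(1) g'(1) a'(2) g'(2) e refl] by blast
        qed
        have memb: "mcomp G \<mu> \<alpha> \<in> I K \<longleftrightarrow> (\<forall>i\<in>?C. mdeg G \<alpha> i = ?m i)" if a: "\<alpha> \<in> Lam G" "msrc \<mu> = mrng G \<alpha>" for \<alpha>
        proof -
          have "mdeg G \<mu> i + mdeg G \<alpha> i = K \<longleftrightarrow> mdeg G \<alpha> i = ?m i" if "i \<in> ?C" for i
            using K[OF that] that by auto
          then have "(\<forall>i\<in>?C. mdeg G (mcomp G \<mu> \<alpha>) i = K) \<longleftrightarrow> (\<forall>i\<in>?C. mdeg G \<alpha> i = ?m i)"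
            unfolding dm[OF a] by (intro ball_cong refl)
          then show ?thesis using mcomp_in(1)[OF L(1) a] unfolding I_def by blast
        qed
        show "mcomp G \<mu> ` ?A = ?J"
        proof (rule subset_antisym; rule subsetI)
          fix \<kappa> assume "\<kappa> \<in> mcomp G \<mu> ` ?A"
          then obtain \<alpha> where a: "\<alpha> \<in> Lam G" "\<forall>i\<in>?C. mdeg G \<alpha> i = ?m i" "mrng G \<alpha> = msrc \<mu>" "\<kappa> = mcomp G \<mu> \<alpha>"
            by blast
          then show "\<kappa> \<in> ?J" using memb[OF a(1) a(3)[symmetric]] a(3)[symmetric] by blast
        next
          fix \<kappa> assume "\<kappa> \<in> ?J"
          then obtain \<alpha> where a: "\<alpha> \<in> Lam G" "msrc \<mu> = mrng G \<alpha>" "\<kappa> = mcomp G \<mu> \<alpha>" "mcomp G \<mu> \<alpha> \<in> I K"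
            by blast
          then have "\<alpha> \<in> ?A" using memb[OF a(1,2)] a(2)[symmetric] by blast
          then show "\<kappa> \<in> mcomp G \<mu> ` ?A" using a(3) by blast
        qed
      qed
      have "((\<lambda>\<alpha>. wt \<beta> \<mu> * q \<alpha>) has_sum wt \<beta> \<mu> * w $ msrc \<mu>) ?A"
        by (intro has_sum_cmult_right layer m)
      moreover have "q (mcomp G \<mu> \<alpha>) = wt \<beta> \<mu> * q \<alpha>" if "\<alpha> \<in> ?A" for \<alpha>
        using that wt_comp[OF L(1), of \<alpha> \<beta>] mcomp_in(2)[OF L(1), of \<alpha>] by (simp only: q_def mem_Collect_eq mult.assoc)
      ultimately have "((\<lambda>\<alpha>. q (mcomp G \<mu> \<alpha>)) has_sum wt \<beta> \<mu> * w $ msrc \<mu>) ?A"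
        by (subst has_sum_cong[where g = "\<lambda>\<alpha>. wt \<beta> \<mu> * q \<alpha>"])
      then have "(q has_sum wt \<beta> \<mu> * w $ msrc \<mu>) ?J"
        by (subst (asm) has_sum_reindex_bij_betw[OF b])
      then have "((\<lambda>\<kappa>. complex_of_real (q \<kappa>)) has_sum of_real (wt \<beta> \<mu> * w $ msrc \<mu>)) ?J"
        by (simp only: has_sum_of_real_iff)
      then have J: "((\<lambda>\<kappa>. if \<kappa> \<in> ?J then complex_of_real (q \<kappa>) else 0) has_sum of_real (wt \<beta> \<mu> * w $ msrc \<mu>)) (I K)"
        by (subst has_sum_cong_neutral[where T = ?J and g = "\<lambda>\<kappa>. complex_of_real (q \<kappa>)"]) auto
      have "of_real (q \<kappa>) * vterm (mono \<mu> \<nu>) \<kappa> = (if \<kappa> \<in> ?J then of_real (q \<kappa>) else 0)" if "\<kappa> \<in> I K" for \<kappa>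
      proof -
        let ?ex = "\<exists>\<alpha>\<in>Lam G. msrc \<mu> = mrng G \<alpha> \<and> \<kappa> = mcomp G \<mu> \<alpha>"
        have j: "\<kappa> \<in> ?J \<longleftrightarrow> ?ex" using that by blast
        have e: "(\<mu> = \<nu> \<and> ?ex) \<longleftrightarrow> ?ex" using True by blast
        show ?thesis unfolding vt[OF that] j e
          by (cases ?ex) (simp_all only: simp_thms if_True if_False mult_1_right mult_zero_right)
      qed
      then have "((\<lambda>\<kappa>. of_real (q \<kappa>) * vterm (mono \<mu> \<nu>) \<kappa>) has_sum of_real (wt \<beta> \<mu> * w $ msrc \<mu>)) (I K)"
        using J by (subst has_sum_cong)
      then show ?thesis using has_sum_unique[OF hs] True by (simp add: val_def)
    qed
  qed
  have ev: "\<forall>\<^sub>F K in sequentially. \<psi> K (mono \<mu> \<nu>) = val \<mu> \<nu>" if L: "\<mu> \<in> Lam G" "\<nu> \<in> Lam G" for \<mu> \<nu>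
  proof (rule eventually_sequentiallyI)
    fix K assume K: "Max (mdeg G \<mu> ` {1..ncolours G}) \<le> K"
    show "\<psi> K (mono \<mu> \<nu>) = val \<mu> \<nu>"
    proof (rule psval[OF L])
      fix i assume "i \<in> ?C"
      then have "mdeg G \<mu> i \<le> Max (mdeg G \<mu> ` {1..ncolours G})" by (intro Max_ge) auto
      then show "mdeg G \<mu> i \<le> K" using K by simp
    qed
  qed
  define \<phi> where "\<phi> = restrict (\<lambda>x. lim (\<lambda>K. \<psi> K x)) (NT G)"
  have st: "nt_state G \<phi>" unfolding \<phi>_def by (rule nt_state_restrict[OF prestate_lim(1)[OF ps ev]])
  have form: "\<phi> (mono \<mu> \<nu>) = val \<mu> \<nu>" if L: "\<mu> \<in> Lam G" "\<nu> \<in> Lam G" for \<mu> \<nu>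
    using prestate_lim(2)[OF ps ev L] span_NT[OF span_mono[OF L]] by (simp add: \<phi>_def del: times_fun_apply)
  have k: "\<phi> \<in> kms G \<beta>"
    by (rule kms_of_formula[OF st, of \<beta> w]) (simp only: form val_def)
  have "om \<phi> $ v = w $ v" for v
  proof -
    have "Tv v = mono (vert G v) (vert G v)" by (simp only: T_vert_star Tv_idem)
    then have "\<phi> (Tv v) = of_real (w $ v)" using form[of "vert G v" "vert G v"] by (simp add: val_def)
    then show ?thesis by (simp add: om_def)
  qed
  then have "om \<phi> = w" by (simp add: Finite_Cartesian_Product.vec_eq_iff)
  moreover have "\<phi> (gE x) = \<phi> x" if x: "x \<in> NT G" for x
  proof -
    have "\<phi> (gE x) - \<phi> x = 0"
    proof (rule NT_eqI[where F = "\<lambda>x. \<phi> (gE x) - \<phi> x" and C = 2])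
      show "\<phi> (gE (x + y)) - \<phi> (x + y) = \<phi> (gE x) - \<phi> x + (\<phi> (gE y) - \<phi> y)" if "x \<in> NT G" "y \<in> NT G" for x y
        using that by (simp add: gE_add nt_stateD(1)[OF st] gE_NT del: plus_fun_apply)
      show "\<phi> (gE (nt_scale c x)) - \<phi> (nt_scale c x) = 0" if "x \<in> NT G" "\<phi> (gE x) - \<phi> x = 0" for c x
        using that by (simp add: gE_scale nt_stateD(2)[OF st] gE_NT)
      show "cmod (\<phi> (gE x) - \<phi> x) \<le> 2 * nt_norm G x" if x: "x \<in> NT G" for x
      proof -
        have "nt_norm G (gE x) \<le> nt_norm G x" by (rule nt_norm_le, rule gE_bound[OF x])
        then show ?thesis
          using norm_triangle_ineq4[of "\<phi> (gE x)" "\<phi> x"] nt_stateD(4)[OF st x] nt_stateD(4)[OF st gE_NT[OF x]] by linarith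
      qed
      show "\<phi> (gE (mono \<kappa> \<mu>)) - \<phi> (mono \<kappa> \<mu>) = 0" if L: "\<kappa> \<in> Lam G" "\<mu> \<in> Lam G" for \<kappa> \<mu>
      proof (cases "mdeg G \<kappa> = mdeg G \<mu>")
        case True
        then show ?thesis by (simp only: gE_mono[OF L] simp_thms if_True diff_self)
      next
        case False
        then have "\<kappa> \<noteq> \<mu>" by blast
        then have "\<phi> (mono \<kappa> \<mu>) = 0" by (simp only: form[OF L] val_def if_False)
        then show ?thesis using False by (simp only: gE_mono[OF L] if_False state_zero[OF st] diff_self)
      qed
      show "x \<in> NT G" by (rule x)
    qed
    then show ?thesis by simp
  qed
  ultimately show ?thesis using k by blast
qed

text \<open>Monomials of equal degree are determined by the KMS condition and the vertex vector.
  Those of unequal degree are annihilated by both expectations, even if these are different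
  maps.\<close>

lemma gauge_kms_eqI:
  assumes k: "\<phi> \<in> kms G \<beta>" "\<phi>' \<in> kms G \<beta>"
    and E: "gauge_expectation G E" "\<And>x. x \<in> NT G \<Longrightarrow> \<phi> (E x) = \<phi> x"
    and E': "gauge_expectation G E'" "\<And>x. x \<in> NT G \<Longrightarrow> \<phi>' (E' x) = \<phi>' x"
    and o: "om \<phi> = om \<phi>'"
  shows "\<phi> = \<phi>'"
proof (rule extensionalityI[OF nt_stateD(6)[OF kmsD(1)[OF k(1)]] nt_stateD(6)[OF kmsD(1)[OF k(2)]]])
  fix x assume x: "x \<in> NT G"
  note st = kmsD(1)[OF k(1)] kmsD(1)[OF k(2)]
  have "\<phi> x - \<phi>' x = 0"
  proof (rule NT_eqI[where F = "\<lambda>x. \<phi> x - \<phi>' x" and C = 2])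
    show "\<phi> (x + y) - \<phi>' (x + y) = \<phi> x - \<phi>' x + (\<phi> y - \<phi>' y)" if "x \<in> NT G" "y \<in> NT G" for x y
      using that by (simp add: nt_stateD(1)[OF st(1)] nt_stateD(1)[OF st(2)] del: plus_fun_apply)
    show "\<phi> (nt_scale c x) - \<phi>' (nt_scale c x) = 0" if "x \<in> NT G" "\<phi> x - \<phi>' x = 0" for c x
      using that by (simp add: nt_stateD(2)[OF st(1)] nt_stateD(2)[OF st(2)])
    show "cmod (\<phi> x - \<phi>' x) \<le> 2 * nt_norm G x" if x: "x \<in> NT G" for x
      using norm_triangle_ineq4[of "\<phi> x" "\<phi>' x"] nt_stateD(4)[OF st(1) x] nt_stateD(4)[OF st(2) x] by linarith
    show "\<phi> (mono \<kappa> \<mu>) - \<phi>' (mono \<kappa> \<mu>) = 0" if L: "\<kappa> \<in> Lam G" "\<mu> \<in> Lam G" for \<kappa> \<mu>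
    proof (cases "mdeg G \<kappa> = mdeg G \<mu>")
      case True
      then show ?thesis
        using kms_same_deg[OF k(1) L] kms_same_deg[OF k(2) L] kms_diag[OF k(1) L(1)] kms_diag[OF k(2) L(1)] o
        by (cases "\<kappa> = \<mu>") (simp_all del: times_fun_apply)
    next
      case False
      have "E (mono \<kappa> \<mu>) = 0" "E' (mono \<kappa> \<mu>) = 0"
        using False by (simp_all only: gauge_expectation_mono[OF E(1) L] gauge_expectation_mono[OF E'(1) L] if_False)
      then have "\<phi> (mono \<kappa> \<mu>) = 0" "\<phi>' (mono \<kappa> \<mu>) = 0"
        using E(2)[OF span_NT[OF span_mono[OF L]]] E'(2)[OF span_NT[OF span_mono[OF L]]] state_zero[OF st(1)] state_zero[OF st(2)]
        by (simp_all only:)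
      then show ?thesis by simp
    qed
    show "x \<in> NT G" by (rule x)
  qed
  then show "\<phi> x = \<phi>' x" by simp
qed


text \<open>If this vector were zero, so would be its series, which is \<open>om \<phi>\<close> and
  has mass 1. The division in \<open>Phi\<close> is thus legitimate.\<close>

lemma DL_nonneg_sum_pos:
  assumes F: "F \<subseteq> {1..ncolours G}" and \<phi>: "\<phi> \<in> kmsF G F \<beta>"
  defines "e \<equiv> DL \<beta> (sorted_list_of_set F) (om \<phi>)"
  shows "\<And>v. 0 \<le> e $ v" "0 < (\<Sum>v\<in>UNIV. e $ v)"
proof -
  have k: "\<phi> \<in> kms G \<beta>" using \<phi> by (simp add: kmsF_def)
  show nn: "0 \<le> e $ v" for v unfolding e_def by (rule kms_QL_Tv(2)[OF k]) simp
  have "(\<Sum>v\<in>UNIV. e $ v) \<noteq> 0"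
  proof
    assume "(\<Sum>v\<in>UNIV. e $ v) = 0"
    then have "e = 0" using nn by (simp add: sum_nonneg_eq_0_iff Finite_Cartesian_Product.vec_eq_iff)
    then have "((\<lambda>n. Bop \<beta> n 0) has_sum om \<phi>) (degs_in F)"
      using kmsF_om_sum[OF F \<phi>] by (simp add: e_def)
    moreover have "Bop \<beta> n 0 = 0" for n by (rule linear_0[OF Bop_linear])
    ultimately have "((\<lambda>n. 0) has_sum om \<phi>) (degs_in F)" by simp
    then have "om \<phi> = 0" by (rule has_sum_unique) (rule has_sum_0, rule refl)
    then show False using om_T(3)[OF kmsD(1)[OF k]] by simp
  qed
  then show "0 < (\<Sum>v\<in>UNIV. e $ v)" using nn by (simp add: less_le sum_nonneg)
qed

section \<open>The correspondence between traces and vertex vectors\<close>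

lemma Bop_summableI:
  assumes "\<And>v. (\<lambda>n. Bop \<beta> n x $ v) summable_on A"
  shows "(\<lambda>n. Bop \<beta> n x) summable_on A"
proof -
  have "((\<lambda>n. Bop \<beta> n x) has_sum (\<chi> v. infsum (\<lambda>n. Bop \<beta> n x $ v) A)) A"
    unfolding has_sum_vec_iff using assms by (simp add: has_sum_infsum)
  then show ?thesis by (rule has_sum_imp_summable)
qed

lemma Bop_summable_nth:
  assumes "(\<lambda>n. Bop \<beta> n x) summable_on A"
  shows "(\<lambda>n. Bop \<beta> n x $ v) summable_on A"
proof -
  obtain s where "((\<lambda>n. Bop \<beta> n x) has_sum s) A" using assms by (auto simp: summable_on_def)
  then show ?thesis unfolding has_sum_vec_iff by (meson has_sum_imp_summable)
qed

lemma Bop_summable_iff: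
  assumes nn: "\<And>v. 0 \<le> \<tau> $ v"
  shows "(\<lambda>n. Bop \<beta> n \<tau>) summable_on degs_in F \<longleftrightarrow>
    (\<lambda>\<mu>. exp (- real (mlen G \<mu>) * \<beta>) * \<tau> $ msrc \<mu>) summable_on {\<mu> \<in> Lam G. mdeg G \<mu> \<in> degs_in F}"
proof
  assume "(\<lambda>n. Bop \<beta> n \<tau>) summable_on degs_in F"
  then obtain w where w: "((\<lambda>n. Bop \<beta> n \<tau>) has_sum w) (degs_in F)" by (auto simp: summable_on_def)
  have "((\<lambda>n. \<Sum>v\<in>UNIV. Bop \<beta> n \<tau> $ v) has_sum (\<Sum>v\<in>UNIV. w $ v)) (degs_in F)"
    using has_sum_bounded_linear[OF total_bounded_linear w] by (simp add: o_def)
  then have "((\<lambda>n. \<Sum>\<mu> | \<mu> \<in> Lam G \<and> mdeg G \<mu> = n \<and> True. wt \<beta> \<mu> * \<tau> $ msrc \<mu>) has_sum (\<Sum>v\<in>UNIV. w $ v)) (degs_in F)"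
    by (simp add: sum_Bop)
  from paths_has_sum[OF _ this] have "((\<lambda>\<mu>. wt \<beta> \<mu> * \<tau> $ msrc \<mu>) has_sum (\<Sum>v\<in>UNIV. w $ v)) {\<mu> \<in> Lam G. mdeg G \<mu> \<in> degs_in F}"
    using nn by simp
  then show "(\<lambda>\<mu>. wt \<beta> \<mu> * \<tau> $ msrc \<mu>) summable_on {\<mu> \<in> Lam G. mdeg G \<mu> \<in> degs_in F}"
    by (rule has_sum_imp_summable)
next
  assume "(\<lambda>\<mu>. wt \<beta> \<mu> * \<tau> $ msrc \<mu>) summable_on {\<mu> \<in> Lam G. mdeg G \<mu> \<in> degs_in F}"
  then obtain c where "((\<lambda>\<mu>. wt \<beta> \<mu> * \<tau> $ msrc \<mu>) has_sum c) {\<mu> \<in> Lam G. mdeg G \<mu> \<in> degs_in F \<and> True}"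
    by (auto simp: summable_on_def)
  from paths_has_sumD[OF this]
  have c: "(\<lambda>n. \<Sum>v\<in>UNIV. Bop \<beta> n \<tau> $ v) summable_on degs_in F"
    by (simp add: sum_Bop has_sum_imp_summable)
  have "(\<lambda>n. Bop \<beta> n \<tau> $ v) summable_on degs_in F" for v
  proof (rule summable_on_comparison_test[OF c])
    show "0 \<le> Bop \<beta> n \<tau> $ v" for n by (rule Bop_nonneg[OF nn])
    show "Bop \<beta> n \<tau> $ v \<le> (\<Sum>v\<in>UNIV. Bop \<beta> n \<tau> $ v)" for n
      by (rule member_le_sum) (auto intro: Bop_nonneg nn)
  qed
  then show "(\<lambda>n. Bop \<beta> n \<tau>) summable_on degs_in F" by (rule Bop_summableI)
qed

text \<open>For F empty only degree 0 occurs and the series is trivially summable, so one formula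
  covers both cases of the definition.\<close>

lemma tracesF_iff:
  "\<tau> \<in> tracesF G F \<beta> \<longleftrightarrow> \<tau> \<in> traces \<and> (\<lambda>n. Bop \<beta> n \<tau>) summable_on degs_in F \<and>
     (\<forall>i\<in>{1..ncolours G} - F. Bop \<beta> (unit_deg i) \<tau> = \<tau>)"
proof (cases "\<tau> \<in> traces")
  case True
  then have nn: "0 \<le> \<tau> $ v" for v by (simp add: traces_def)
  have "(\<lambda>n. Bop \<beta> n \<tau>) summable_on degs_in {}" by (simp add: degs_in_empty)
  then show ?thesis using True Bop_summable_iff[OF nn, of \<beta> F] Bop_unit_fixed_iff
    by (cases "F = {}") (auto simp: tracesF_def)
qed (simp add: tracesF_def)

definition Sm :: "nat set \<Rightarrow> real \<Rightarrow> real ^ 'v \<Rightarrow> real ^ 'v" where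
  "Sm F \<beta> \<tau> = infsum (\<lambda>n. Bop \<beta> n \<tau>) (degs_in F)"

text \<open>The vertex vector of the KMS-state over \<tau>: its series, normalised to mass
  1.\<close>

definition Om :: "nat set \<Rightarrow> real \<Rightarrow> real ^ 'v \<Rightarrow> real ^ 'v" where
  "Om F \<beta> \<tau> = (1 / (\<Sum>v\<in>UNIV. Sm F \<beta> \<tau> $ v)) *\<^sub>R Sm F \<beta> \<tau>"

lemma Sm_has_sum: "\<tau> \<in> tracesF G F \<beta> \<Longrightarrow> ((\<lambda>n. Bop \<beta> n \<tau>) has_sum Sm F \<beta> \<tau>) (degs_in F)"
  unfolding Sm_def tracesF_iff by (rule has_sum_infsum) blast

lemma Sm_ge: assumes "\<tau> \<in> tracesF G F \<beta>" shows "\<tau> $ v \<le> Sm F \<beta> \<tau> $ v"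
proof -
  have nn: "0 \<le> \<tau> $ v" for v using assms by (simp add: tracesF_def traces_def)
  have 1: "((\<lambda>n. Bop \<beta> n \<tau> $ v) has_sum Sm F \<beta> \<tau> $ v) (degs_in F)"
    using Sm_has_sum[OF assms] unfolding has_sum_vec_iff by blast
  have 2: "((\<lambda>n. Bop \<beta> n \<tau> $ v) has_sum \<tau> $ v) {0}"
    using has_sum_finite[of "{0}" "\<lambda>n. Bop \<beta> n \<tau> $ v"] by simp
  show ?thesis by (rule has_sum_mono2[OF 2 1]) (auto simp: degs_in_def intro: Bop_nonneg nn)
qed

lemma Sm_total_pos: assumes "\<tau> \<in> tracesF G F \<beta>" shows "0 < (\<Sum>v\<in>UNIV. Sm F \<beta> \<tau> $ v)"
proof -
  have "1 = (\<Sum>v\<in>UNIV. \<tau> $ v)" using assms by (simp add: tracesF_def traces_def)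
  also have "\<dots> \<le> (\<Sum>v\<in>UNIV. Sm F \<beta> \<tau> $ v)" by (intro sum_mono Sm_ge assms)
  finally show ?thesis by simp
qed

lemma kmsF_of_trace:
  assumes F: "F \<subseteq> {1..ncolours G}" and \<tau>: "\<tau> \<in> tracesF G F \<beta>"
  shows "\<exists>\<phi>\<in>gauge_kmsF G F \<beta>. om \<phi> = Om F \<beta> \<tau> \<and> Phi G F \<phi> = \<tau>"
proof -
  let ?c = "\<Sum>v\<in>UNIV. Sm F \<beta> \<tau> $ v" and ?js = "sorted_list_of_set F" and ?w = "Om F \<beta> \<tau>"
  \<comment> \<open>Scaled so that the series of \<sigma>, rather than \<sigma> itself, has mass
    1.\<close>
  define \<sigma> where "\<sigma> = (1 / ?c) *\<^sub>R \<tau>"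
  have c: "?c > 0" by (rule Sm_total_pos[OF \<tau>])
  have fin: "finite F" using F finite_subset by blast
  have t: "\<And>v. 0 \<le> \<tau> $ v" "(\<Sum>v\<in>UNIV. \<tau> $ v) = 1" using \<tau> by (auto simp: tracesF_def traces_def)
  have nn: "0 \<le> \<sigma> $ v" for v using t c by (simp add: \<sigma>_def)
  have s: "((\<lambda>n. Bop \<beta> n \<sigma>) has_sum ?w) (degs_in F)"
    using has_sum_bounded_linear[OF bounded_linear_scaleR_right Sm_has_sum[OF \<tau>], of "1 / ?c"]
    by (simp add: \<sigma>_def Bop_scaleR Om_def o_def)
  have tot: "(\<Sum>v\<in>UNIV. ?w $ v) = 1"
  proof -
    have "(\<Sum>v\<in>UNIV. ?w $ v) = (1 / ?c) * ?c" by (simp add: Om_def sum_distrib_left del: times_divide_eq_left)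
    then show ?thesis using c by simp
  qed
  have fx: "Bop \<beta> (unit_deg i) \<sigma> = \<sigma>" if "i \<in> {1..ncolours G} - F" for i
    using \<tau> that unfolding tracesF_iff \<sigma>_def by (simp add: Bop_scaleR)
  obtain \<phi> where \<phi>: "\<phi> \<in> kms G \<beta>" "\<And>x. x \<in> NT G \<Longrightarrow> \<phi> (gE x) = \<phi> x" "om \<phi> = ?w"
    using kms_exists[OF F nn s tot fx] by blast
  \<comment> \<open>All colours of F are undone, so only degree 0 remains and the defect vector of
    the constructed state is \<sigma>.\<close>
  have "((\<lambda>n. Bop \<beta> n \<sigma>) has_sum DL \<beta> ?js ?w) (degs_in {})"
    by (rule DL_of_sum) (use s fin in auto)
  then have "((\<lambda>n. Bop \<beta> n \<sigma>) has_sum DL \<beta> ?js ?w) {0}" by (simp only: degs_in_empty)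
  moreover have "((\<lambda>n. Bop \<beta> n \<sigma>) has_sum \<sigma>) {0}" using has_sum_finite[of "{0}" "\<lambda>n. Bop \<beta> n \<sigma>"] by simp
  ultimately have D: "DL \<beta> ?js ?w = \<sigma>" by (rule has_sum_unique)
  have f1: "((\<lambda>n. \<Sum>v\<in>UNIV. Bop \<beta> n \<sigma> $ v) has_sum 1) (degs_in F)"
    using has_sum_bounded_linear[OF total_bounded_linear s] tot by (simp add: o_def)
  have f2: "Bop \<beta> (unit_deg i) ?w = ?w" if "i \<in> {1..ncolours G} - F" for i
  proof -
    have "((\<lambda>n. Bop \<beta> (unit_deg i) (Bop \<beta> n \<sigma>)) has_sum Bop \<beta> (unit_deg i) ?w) (degs_in F)"
      using has_sum_bounded_linear[OF Bop_bounded_linear s] by (simp add: o_def)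
    then have "((\<lambda>n. Bop \<beta> n \<sigma>) has_sum Bop \<beta> (unit_deg i) ?w) (degs_in F)"
      by (subst (asm) Bop_commute) (simp only: fx[OF that])
    then show ?thesis using s by (rule has_sum_unique)
  qed
  have "\<phi> \<in> kmsF G F \<beta>" unfolding kmsF_iff[OF F] \<phi>(3) D using \<phi>(1) f1 f2 by blast
  then have "\<phi> \<in> gauge_kmsF G F \<beta>" unfolding gauge_kmsF_def using gauge_expectation_gE \<phi>(2) by blast
  moreover have "Phi G F \<phi> = \<tau>"
  proof -
    have "(\<Sum>v\<in>UNIV. \<sigma> $ v) = 1 / ?c" using t(2) by (simp add: \<sigma>_def flip: sum_divide_distrib)
    then show ?thesis unfolding Phi_eq[OF \<phi>(1) F] \<phi>(3) D using c by (simp add: \<sigma>_def)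
  qed
  ultimately show ?thesis using \<phi>(3) by blast
qed

text \<open>The defect vector has series \<open>om \<phi>\<close>; dividing by its mass rescales the
  series, and the factor disappears on normalising because \<open>om \<phi>\<close> has mass
  1.\<close>

lemma Phi_trace:
  assumes F: "F \<subseteq> {1..ncolours G}" and \<phi>: "\<phi> \<in> kmsF G F \<beta>"
  shows "Phi G F \<phi> \<in> tracesF G F \<beta>" "Om F \<beta> (Phi G F \<phi>) = om \<phi>"
proof -
  let ?js = "sorted_list_of_set F"
  define e where "e = DL \<beta> ?js (om \<phi>)"
  define c where "c = (\<Sum>v\<in>UNIV. e $ v)"
  have k: "\<phi> \<in> kms G \<beta>" using \<phi> by (simp add: kmsF_def)
  have e: "\<And>v. 0 \<le> e $ v" "0 < c" using DL_nonneg_sum_pos[OF F \<phi>] by (auto simp: e_def c_def)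
  have P: "Phi G F \<phi> = (1 / c) *\<^sub>R e" unfolding Phi_eq[OF k F] c_def e_def ..
  have s: "((\<lambda>n. Bop \<beta> n (Phi G F \<phi>)) has_sum (1 / c) *\<^sub>R om \<phi>) (degs_in F)"
    using has_sum_bounded_linear[OF bounded_linear_scaleR_right kmsF_om_sum[OF F \<phi>], of "1 / c"]
    by (simp add: P Bop_scaleR o_def e_def)
  have "(\<Sum>v\<in>UNIV. Phi G F \<phi> $ v) = 1" using e(2) by (simp add: P c_def flip: sum_divide_distrib)
  then have "Phi G F \<phi> \<in> traces" using e by (simp add: traces_def P)
  moreover have "Bop \<beta> (unit_deg i) (Phi G F \<phi>) = Phi G F \<phi>" if "i \<in> {1..ncolours G} - F" for i
  proof -
    have "Bop \<beta> (unit_deg i) (om \<phi>) = om \<phi>" using \<phi> that unfolding kmsF_iff[OF F] by blast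
    then show ?thesis by (simp add: P Bop_scaleR e_def Bop_DL)
  qed
  ultimately show t: "Phi G F \<phi> \<in> tracesF G F \<beta>"
    unfolding tracesF_iff using has_sum_imp_summable[OF s] by blast
  have S: "Sm F \<beta> (Phi G F \<phi>) = (1 / c) *\<^sub>R om \<phi>"
    using Sm_has_sum[OF t] s by (rule has_sum_unique)
  have "(\<Sum>v\<in>UNIV. Sm F \<beta> (Phi G F \<phi>) $ v) = 1 / c"
    unfolding S using om_T(3)[OF kmsD(1)[OF k]] by (simp flip: sum_divide_distrib)
  then show "Om F \<beta> (Phi G F \<phi>) = om \<phi>" unfolding Om_def using e(2) by (simp add: S)
qed

lemma gauge_kmsF_eqI:
  assumes "\<phi> \<in> gauge_kmsF G F \<beta>" "\<phi>' \<in> gauge_kmsF G F \<beta>" "om \<phi> = om \<phi>'"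
  shows "\<phi> = \<phi>'"
  using assms gauge_kms_eqI unfolding gauge_kmsF_def kmsF_def by blast

section \<open>The inverse map and its continuity\<close>

definition GS :: "nat set \<Rightarrow> real \<Rightarrow> real ^ 'v \<Rightarrow> ('v, 'e) nt \<Rightarrow> complex" where
  "GS F \<beta> \<tau> = (SOME \<phi>. \<phi> \<in> gauge_kmsF G F \<beta> \<and> om \<phi> = Om F \<beta> \<tau> \<and> Phi G F \<phi> = \<tau>)"

lemma GS:
  assumes "F \<subseteq> {1..ncolours G}" "\<tau> \<in> tracesF G F \<beta>"
  shows "GS F \<beta> \<tau> \<in> gauge_kmsF G F \<beta>" "om (GS F \<beta> \<tau>) = Om F \<beta> \<tau>" "Phi G F (GS F \<beta> \<tau>) = \<tau>"
proof -
  have "\<exists>\<phi>. \<phi> \<in> gauge_kmsF G F \<beta> \<and> om \<phi> = Om F \<beta> \<tau> \<and> Phi G F \<phi> = \<tau>"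
    using kmsF_of_trace[OF assms] by blast
  from someI_ex[OF this]
  show "GS F \<beta> \<tau> \<in> gauge_kmsF G F \<beta>" "om (GS F \<beta> \<tau>) = Om F \<beta> \<tau>" "Phi G F (GS F \<beta> \<tau>) = \<tau>"
    unfolding GS_def by blast+
qed

lemma gauge_kmsF_kms: "\<phi> \<in> gauge_kmsF G F \<beta> \<Longrightarrow> \<phi> \<in> kms G \<beta>"
  by (simp add: gauge_kmsF_def kmsF_def)

text \<open>\<tau> dominates its own component at v, so the series of the vertex vector is bounded
  by a multiple of the series of \<tau>.\<close>

lemma axis_summable:
  assumes \<tau>: "\<tau> \<in> tracesF G F \<beta>" and v: "\<tau> $ v \<noteq> 0"
  shows "(\<lambda>n. Bop \<beta> n (axis v 1)) summable_on degs_in F"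
proof -
  have nn: "0 \<le> \<tau> $ v" for v using \<tau> by (simp add: tracesF_def traces_def)
  then have pos: "0 < \<tau> $ v" using v by (simp add: less_le)
  have ax: "0 \<le> axis v (1::real) $ w" for w by (simp add: axis_def)
  have "(\<lambda>n. (1 / \<tau> $ v) * Bop \<beta> n \<tau> $ w) summable_on degs_in F" for w
    using \<tau> unfolding tracesF_iff by (intro summable_on_cmult_right Bop_summable_nth) blast
  then have "(\<lambda>n. Bop \<beta> n (axis v 1) $ w) summable_on degs_in F" for w
  proof (rule summable_on_comparison_test)
    show "0 \<le> Bop \<beta> n (axis v 1) $ w" for n by (rule Bop_nonneg[OF ax])
    have "0 \<le> Bop \<beta> n (\<tau> - \<tau> $ v *\<^sub>R axis v 1) $ w" for n
      by (rule Bop_nonneg) (auto simp: axis_def nn)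
    then have "\<tau> $ v * Bop \<beta> n (axis v 1) $ w \<le> Bop \<beta> n \<tau> $ w" for n
      by (simp add: Bop_diff_right Bop_scaleR)
    then show "Bop \<beta> n (axis v 1) $ w \<le> (1 / \<tau> $ v) * Bop \<beta> n \<tau> $ w" for n
      using pos by (simp add: field_simps)
  qed
  then have "((\<lambda>n. Bop \<beta> n (axis v 1)) has_sum (\<chi> w. infsum (\<lambda>n. Bop \<beta> n (axis v 1) $ w) (degs_in F))) (degs_in F)"
    unfolding has_sum_vec_iff by (simp add: has_sum_infsum)
  then show ?thesis by (rule has_sum_imp_summable)
qed

lemma axis_decomp: "(x :: real ^ 'v) = (\<Sum>v\<in>UNIV. x $ v *\<^sub>R axis v 1)"
proof -
  have "(\<Sum>v\<in>UNIV. x $ v *\<^sub>R axis v (1::real)) $ w = (\<Sum>v\<in>UNIV. if v = w then x $ v else 0)" for w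
    by (simp add: axis_def if_distrib cong: if_cong) 
  then show ?thesis by (simp add: Finite_Cartesian_Product.vec_eq_iff)
qed

text \<open>For \<open>\<tau>\<^sub>v = 0\<close> the series \<open>\<Sum>\<^sub>n B\<^sup>n \<delta>\<^sub>v\<close> may diverge; then \<^const>\<open>infsum\<close> is \<open>0\<close> and its
  coefficient vanishes anyway.\<close>

lemma Sm_linear:
  assumes \<tau>: "\<tau> \<in> tracesF G F \<beta>"
  shows "Sm F \<beta> \<tau> = (\<Sum>v\<in>UNIV. \<tau> $ v *\<^sub>R Sm F \<beta> (axis v 1))"
proof -
  have "((\<lambda>n. \<tau> $ v *\<^sub>R Bop \<beta> n (axis v 1)) has_sum \<tau> $ v *\<^sub>R Sm F \<beta> (axis v 1)) (degs_in F)" for v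
  proof (cases "\<tau> $ v = 0")
    case False
    have "((\<lambda>n. Bop \<beta> n (axis v 1)) has_sum Sm F \<beta> (axis v 1)) (degs_in F)"
      unfolding Sm_def by (rule has_sum_infsum[OF axis_summable[OF \<tau> False]])
    from has_sum_bounded_linear[OF bounded_linear_scaleR_right this] show ?thesis by (simp add: o_def)
  qed (simp add: has_sum_0)
  then have "((\<lambda>n. \<Sum>v\<in>UNIV. \<tau> $ v *\<^sub>R Bop \<beta> n (axis v 1)) has_sum (\<Sum>v\<in>UNIV. \<tau> $ v *\<^sub>R Sm F \<beta> (axis v 1))) (degs_in F)"
    by (intro has_sum_finite_sum) auto
  moreover have "(\<Sum>v\<in>UNIV. \<tau> $ v *\<^sub>R Bop \<beta> n (axis v 1)) = Bop \<beta> n \<tau>" for n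
    by (subst (3) axis_decomp) (simp only: Bop_sum_right Bop_scaleR)
  ultimately show ?thesis using has_sum_unique[OF Sm_has_sum[OF \<tau>]] by simp
qed

text \<open>Numerator and denominator are linear in \<tau> with coefficient vectors that do not
  depend on \<tau>, and the denominator is positive.\<close>

lemma continuous_on_Om: "continuous_on (tracesF G F \<beta>) (\<lambda>\<tau>. Om F \<beta> \<tau> $ w)"
proof -
  let ?S = "\<lambda>\<tau>. \<Sum>v\<in>UNIV. \<tau> $ v *\<^sub>R Sm F \<beta> (axis v 1)"
  have "continuous_on (tracesF G F \<beta>) (\<lambda>\<tau>. (1 / (\<Sum>v\<in>UNIV. ?S \<tau> $ v)) * ?S \<tau> $ w)"
  proof (intro continuous_intros ballI)
    fix \<tau> assume t: "\<tau> \<in> tracesF G F \<beta>"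
    show "(\<Sum>v\<in>UNIV. ?S \<tau> $ v) \<noteq> 0" using Sm_total_pos[OF t] unfolding Sm_linear[OF t] by linarith
  qed
  then show ?thesis
    by (rule continuous_on_eq) (simp only: Om_def Sm_linear vector_scaleR_component real_scaleR_def)
qed

text \<open>On monomials the value is zero or a multiple of a coordinate of \<open>Om\<close>.
  States are contractive, so approximation of x is uniform in \<tau> and continuity passes to the
  limit.\<close>

lemma continuous_on_GS:
  assumes F: "F \<subseteq> {1..ncolours G}" and x: "x \<in> NT G"
  shows "continuous_on (tracesF G F \<beta>) (\<lambda>\<tau>. GS F \<beta> \<tau> x)"
proof -
  let ?T = "tracesF G F \<beta>"
  have k: "GS F \<beta> \<tau> \<in> kms G \<beta>" if "\<tau> \<in> ?T" for \<tau> using GS(1)[OF F that] by (rule gauge_kmsF_kms)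
  have st: "nt_state G (GS F \<beta> \<tau>)" if "\<tau> \<in> ?T" for \<tau> using k[OF that] by (rule kmsD(1))
  have sp: "continuous_on ?T (\<lambda>\<tau>. GS F \<beta> \<tau> y)" if "y \<in> nt_span" for y
    using that
  proof (induct rule: nt_span.induct)
    case (mono \<kappa> \<mu>)
    note L = mono(1,2)
    have m: "mono \<kappa> \<mu> \<in> NT G" by (rule span_NT[OF span_mono[OF L]])
    have zero: "\<phi> (mono \<kappa> \<mu>) = 0" if ph: "\<phi> \<in> gauge_kmsF G F \<beta>" "\<kappa> \<noteq> \<mu>" for \<phi>
    proof (cases "mdeg G \<kappa> = mdeg G \<mu>")
      case True
      then show ?thesis by (rule kms_same_deg[OF gauge_kmsF_kms[OF ph(1)] L _ ph(2)])
    next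
      case False
      obtain E where E: "gauge_expectation G E" "\<forall>x\<in>NT G. \<phi> (E x) = \<phi> x"
        using ph(1) unfolding gauge_kmsF_def by blast
      have "E (mono \<kappa> \<mu>) = 0" using False by (simp only: gauge_expectation_mono[OF E(1) L] if_False)
      then show ?thesis using E(2)[rule_format, OF m] state_zero[OF kmsD(1)[OF gauge_kmsF_kms[OF ph(1)]]] by (simp only:)
    qed
    show ?case
    proof (cases "\<kappa> = \<mu>")
      case True
      have "continuous_on ?T (\<lambda>\<tau>. complex_of_real (wt \<beta> \<mu> * Om F \<beta> \<tau> $ msrc \<mu>))"
        by (intro continuous_intros continuous_on_Om)
      then show ?thesis
        by (rule continuous_on_eq) (simp only: True kms_diag[OF k L(2)] GS(2)[OF F])
    next
      case False
      show ?thesis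
        by (rule continuous_on_eq[OF continuous_on_const[of _ 0]]) (simp only: zero[OF GS(1)[OF F] False])
    qed
  next
    case zero
    show ?case by (rule continuous_on_eq[OF continuous_on_const[of _ 0]]) (simp only: state_zero[OF st])
  next
    case (scale x c)
    show ?case
      by (rule continuous_on_eq[OF continuous_on_mult_left[OF scale(2), of c]])
        (simp only: nt_stateD(2)[OF st span_NT[OF scale(1)]])
  next
    case (add x y)
    show ?case
      by (rule continuous_on_eq[OF continuous_on_add[OF add(2,4)]])
        (simp only: nt_stateD(1)[OF st span_NT[OF add(1)] span_NT[OF add(3)]])
  qed
  have "\<exists>y. y \<in> nt_span \<and> (\<forall>S. norm (x S - y S) \<le> 1 / Suc n)" for n
    using NT_approx[OF x, of "1 / Suc n"] by (metis of_nat_0_less_iff zero_less_Suc zero_less_divide_1_iff)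
  then obtain y where y: "\<And>n. y n \<in> nt_span" "\<And>n S. norm (x S - y n S) \<le> 1 / Suc n" by metis
  have "uniform_limit ?T (\<lambda>n \<tau>. GS F \<beta> \<tau> (y n)) (\<lambda>\<tau>. GS F \<beta> \<tau> x) sequentially"
  proof (rule uniform_limitI)
    fix e :: real assume "e > 0"
    then obtain N where N: "1 / Suc N < e" using nat_approx_posE by metis
    show "\<forall>\<^sub>F n in sequentially. \<forall>\<tau>\<in>?T. dist (GS F \<beta> \<tau> (y n)) (GS F \<beta> \<tau> x) < e"
    proof (rule eventually_sequentiallyI[of N], rule ballI)
      fix n \<tau> assume n: "N \<le> n" and t: "\<tau> \<in> ?T"
      have "dist (GS F \<beta> \<tau> (y n)) (GS F \<beta> \<tau> x) = cmod (GS F \<beta> \<tau> (x - y n))"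
        using state_diff[OF st[OF t] x span_NT[OF y(1)]] by (simp add: dist_norm norm_minus_commute)
      also have "\<dots> \<le> nt_norm G (x - y n)" by (rule nt_stateD(4)[OF st[OF t] NT_diff[OF x span_NT[OF y(1)]]])
      also have "\<dots> \<le> 1 / Suc n" by (rule nt_norm_le) (use y(2) in simp)
      also have "\<dots> \<le> 1 / Suc N" using n by (intro divide_left_mono) auto
      finally show "dist (GS F \<beta> \<tau> (y n)) (GS F \<beta> \<tau> x) < e" using N by linarith
    qed
  qed
  then show ?thesis
    by (rule uniform_limit_theorem[rotated]) (use sp[OF y(1)] in auto)
qed

text \<open>The maps are mutually inverse because a gauge-invariant KMS-state is determined by its
  vertex vector. Weak* continuity of \<open>Phi\<close> holds since it is a quotient of evaluations
  with nonvanishing denominator.\<close>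

theorem Phi_homeomorphic:
  assumes F: "F \<subseteq> {1..ncolours G}"
  shows "homeomorphic_map (weak_star G (gauge_kmsF G F \<beta>)) (top_of_set (tracesF G F \<beta>)) (Phi G F)"
proof (rule homeomorphic_maps_imp_map)
  let ?X = "gauge_kmsF G F \<beta>" and ?T = "tracesF G F \<beta>"
  have ext: "\<phi> \<in> extensional (NT G)" if "\<phi> \<in> ?X" for \<phi>
    using nt_stateD(6)[OF kmsD(1)[OF gauge_kmsF_kms[OF that]]] .
  have top: "topspace (weak_star G ?X) = ?X"
    using ext by (auto simp: weak_star_def PiE_def)
  have XF: "\<phi> \<in> kmsF G F \<beta>" if "\<phi> \<in> ?X" for \<phi> using that by (simp add: gauge_kmsF_def)
  have ev: "continuous_map (weak_star G ?X) euclidean (\<lambda>\<phi>. \<phi> x)" if "x \<in> NT G" for x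
    unfolding weak_star_def
    by (rule continuous_map_from_subtopology) (use continuous_map_product_projection[OF that, of "\<lambda>_. euclidean"] in simp)
  have Q: "nt_QF G F \<in> NT G" "nt_QF G F * Tv v * nt_QF G F \<in> NT G" for v
    unfolding nt_QF_QL by (intro NT_mult span_NT QL_span span_T vert_simps)+
  have Q0: "\<phi> (nt_QF G F) \<noteq> 0" if "\<phi> \<in> ?X" for \<phi>
    using DL_nonneg_sum_pos(2)[OF F XF[OF that]] kms_QL[OF gauge_kmsF_kms[OF that], of "sorted_list_of_set F"]
    unfolding nt_QF_QL by (simp del: of_real_sum)
  have cPhi: "continuous_map (weak_star G ?X) euclidean (Phi G F)"
    unfolding continuous_map_atin
  proof
    fix \<phi> assume p: "\<phi> \<in> topspace (weak_star G ?X)"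
    have lim: "((\<lambda>\<phi>. \<phi> x) \<longlongrightarrow> \<phi> x) (atin (weak_star G ?X) \<phi>)" if "x \<in> NT G" for x
      using ev[OF that] p unfolding continuous_map_atin by simp
    have "(Phi G F \<longlongrightarrow> Phi G F \<phi>) (atin (weak_star G ?X) \<phi>)"
      unfolding Phi_def by (intro vec_tendstoI, simp only: vec_lambda_beta)
        (intro tendsto_intros lim Q, use Q0 p top in simp)
    then show "limitin euclidean (Phi G F) (Phi G F \<phi>) (atin (weak_star G ?X) \<phi>)" by simp
  qed
  have cGS: "continuous_map (top_of_set ?T) (weak_star G ?X) (GS F \<beta>)"
    unfolding weak_star_def continuous_map_in_subtopology continuous_map_componentwise
    using ext GS(1)[OF F] continuous_on_GS[OF F] by auto
  show "homeomorphic_maps (weak_star G ?X) (top_of_set ?T) (Phi G F) (GS F \<beta>)"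
    unfolding homeomorphic_maps_def
  proof (intro conjI ballI)
    show "continuous_map (weak_star G ?X) (top_of_set ?T) (Phi G F)"
      unfolding continuous_map_in_subtopology using cPhi Phi_trace(1)[OF F XF] top by auto
    show "continuous_map (top_of_set ?T) (weak_star G ?X) (GS F \<beta>)" by (rule cGS)
    show "GS F \<beta> (Phi G F \<phi>) = \<phi>" if "\<phi> \<in> topspace (weak_star G ?X)" for \<phi>
    proof -
      have p: "\<phi> \<in> ?X" using that top by simp
      note t = Phi_trace[OF F XF[OF p]]
      show ?thesis by (rule gauge_kmsF_eqI[OF GS(1)[OF F t(1)] p]) (simp only: GS(2)[OF F t(1)] t(2))
    qed
    show "Phi G F (GS F \<beta> \<tau>) = \<tau>" if "\<tau> \<in> topspace (top_of_set ?T)" for \<tau>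
      using that GS(3)[OF F] by simp
  qed
qed


section \<open>Comparison of path series\<close>

lemma Bop_mono:
  assumes "\<And>v. x $ v \<le> y $ v" shows "Bop \<beta> n x $ v \<le> Bop \<beta> n y $ v"
proof -
  have "0 \<le> Bop \<beta> n (y - x) $ v" by (rule Bop_nonneg) (simp add: assms)
  then show ?thesis by (simp add: Bop_diff_right)
qed

lemma Bop_ge:
  assumes "\<mu> \<in> Lam G" "\<And>v. 0 \<le> x $ v"
  shows "wt \<beta> \<mu> * x $ msrc \<mu> \<le> Bop \<beta> (mdeg G \<mu>) x $ mrng G \<mu>"
  unfolding Bop_nth
  by (rule member_le_sum[of \<mu> _ "\<lambda>\<mu>. wt \<beta> \<mu> * x $ msrc \<mu>"]) (use assms in auto)

lemma Bop_summable_mono: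
  assumes "(\<lambda>n. Bop \<beta> n y) summable_on A" "\<And>v. 0 \<le> x $ v" "\<And>v. x $ v \<le> y $ v"
  shows "(\<lambda>n. Bop \<beta> n x) summable_on A"
proof (rule Bop_summableI)
  show "(\<lambda>n. Bop \<beta> n x $ v) summable_on A" for v
  proof (rule summable_on_comparison_test[OF Bop_summable_nth[OF assms(1)]])
    show "0 \<le> Bop \<beta> n x $ v" for n by (rule Bop_nonneg[OF assms(2)])
    show "Bop \<beta> n x $ v \<le> Bop \<beta> n y $ v" for n by (rule Bop_mono[OF assms(3)])
  qed
qed

text \<open>Each colour reproduces a multiple of the same vector u, so the colours can be summed in
  turn and the constants multiply.\<close>

lemma Rop_le:
  assumes "finite F" and "\<And>i. i \<in> F \<Longrightarrow> 0 \<le> C i"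
    and "\<And>i v. i \<in> F \<Longrightarrow> (\<Sum>k<K. Bop \<beta> (ku i k) u) $ v \<le> C i * u $ v"
  shows "Rop \<beta> F K u $ v \<le> (\<Prod>i\<in>F. C i) * u $ v"
  using assms
proof (induct F arbitrary: v)
  case empty
  have "box {} K = {0}" by (auto simp: box_def fun_eq_iff zero_fun_def)
  then show ?case by (simp add: Rop_def)
next
  case (insert i F)
  let ?P = "\<Prod>i\<in>F. C i"
  have P: "0 \<le> ?P" by (rule prod_nonneg) (simp add: insert.prems(1))
  have IH: "Rop \<beta> F K u $ w \<le> (?P *\<^sub>R u) $ w" for w
    using insert.hyps(3)[of w] insert.prems by simp
  have "Rop \<beta> (insert i F) K u $ v = (\<Sum>k<K. Bop \<beta> (ku i k) (Rop \<beta> F K u) $ v)"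
    by (simp only: Rop_insert[OF insert.hyps(2,1)] sum_component)
  also have "\<dots> \<le> (\<Sum>k<K. Bop \<beta> (ku i k) (?P *\<^sub>R u) $ v)" by (intro sum_mono Bop_mono IH)
  also have "\<dots> = ?P * (\<Sum>k<K. Bop \<beta> (ku i k) u) $ v"
    by (simp add: Bop_scaleR sum_component sum_distrib_left)
  also have "\<dots> \<le> ?P * (C i * u $ v)"
    by (rule mult_left_mono[OF _ P]) (rule insert.prems(2), simp)
  also have "\<dots> = (\<Prod>i\<in>insert i F. C i) * u $ v" using insert.hyps(1,2) by simp
  finally show ?case .
qed

lemma Bop_summable_of_bounds:
  assumes F: "finite F" and u: "\<And>v. 0 \<le> u $ v"
    and C: "\<And>i. i \<in> F \<Longrightarrow> \<exists>C\<ge>0. \<forall>K v. (\<Sum>k<K. Bop \<beta> (ku i k) u) $ v \<le> C * u $ v"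
  shows "(\<lambda>n. Bop \<beta> n u) summable_on degs_in F"
proof -
  have "\<exists>c. \<forall>i\<in>F. 0 \<le> c i \<and> (\<forall>K v. (\<Sum>k<K. Bop \<beta> (ku i k) u) $ v \<le> c i * u $ v)"
    by (rule bchoice) (use C in blast)
  then obtain c where c: "\<forall>i\<in>F. 0 \<le> c i \<and> (\<forall>K v. (\<Sum>k<K. Bop \<beta> (ku i k) u) $ v \<le> c i * u $ v)" ..
  have bd: "(\<Sum>n\<in>A. Bop \<beta> n u $ v) \<le> (\<Prod>i\<in>F. c i) * u $ v" if A: "finite A" "A \<subseteq> degs_in F" for A v
  proof -
    define K where "K = Suc (Max ((\<lambda>(n, i). n i) ` (A \<times> F)))"
    have "A \<subseteq> box F K"
    proof
      fix n assume n: "n \<in> A"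
      have "n i < K" if "i \<in> F" for i
        unfolding K_def less_Suc_eq_le by (rule Max_ge) (use n that A(1) F in \<open>auto intro!: image_eqI[of _ _ "(n, i)"]\<close>)
      moreover have "n i = 0" if "i \<notin> F" for i using n A(2) that by (auto simp: degs_in_def)
      ultimately show "n \<in> box F K" by (simp add: box_def)
    qed
    then have "(\<Sum>n\<in>A. Bop \<beta> n u $ v) \<le> (\<Sum>n\<in>box F K. Bop \<beta> n u $ v)"
      by (intro sum_mono2 finite_box Bop_nonneg u F)
    also have "\<dots> = Rop \<beta> F K u $ v" by (simp add: Rop_def)
    also have "\<dots> \<le> (\<Prod>i\<in>F. c i) * u $ v" by (rule Rop_le[OF F]) (use c in auto)
    finally show ?thesis .
  qed
  show ?thesis
  proof (rule Bop_summableI, rule nonneg_bdd_above_summable_on)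
    show "0 \<le> Bop \<beta> n u $ v" for n v by (rule Bop_nonneg[OF u])
    show "bdd_above (sum (\<lambda>n. Bop \<beta> n u $ v) ` {A. A \<subseteq> degs_in F \<and> finite A})" for v
      by (rule bdd_aboveI2) (use bd in auto)
  qed
qed

section \<open>Temperatures with a subharmonic phase\<close>

lemma Bop_ku_Suc: "Bop \<beta> (ku i (Suc k)) x = Bop \<beta> (unit_deg i) (Bop \<beta> (ku i k) x)"
  by (simp only: ku_simps Bop_add)

lemma Bop_ku_eigen:
  assumes i: "i \<in> {1..ncolours G}" and x: "adj G i *v x = d *\<^sub>R x"
  shows "Bop \<beta> (ku i k) x = (exp (- \<beta>) * d) ^ k *\<^sub>R x"
proof (induct k)
  case (Suc k)
  have "Bop \<beta> (ku i (Suc k)) x = (exp (- \<beta>) * d) ^ k *\<^sub>R exp (- \<beta>) *\<^sub>R (adj G i *v x)"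
    by (simp only: Bop_ku_Suc Suc Bop_scaleR Bop_unit[OF i])
  also have "\<dots> = (exp (- \<beta>) * d) ^ Suc k *\<^sub>R x"
    unfolding x scaleR_scaleR by (simp only: power_Suc mult.assoc mult.commute mult.left_commute)
  finally show ?case .
qed (simp only: ku_simps power_0 scaleR_one Bop_0)

lemma rho_of_kmsF:
  assumes F: "F \<subset> {1..ncolours G}" and \<phi>: "\<phi> \<in> kmsF G F \<beta>"
  shows "exp \<beta> \<in> sink_radii G"
proof -
  let ?\<omega> = "om \<phi>"
  define W where "W = {v. ?\<omega> $ v \<noteq> 0}"
  have F': "F \<subseteq> {1..ncolours G}" using F by blast
  have k: "\<phi> \<in> kms G \<beta>" using \<phi> by (simp add: kmsF_def)
  note om = om_T(2,3)[OF kmsD(1)[OF k]]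
  have W0: "?\<omega> $ v = 0" if "v \<notin> W" for v using that by (simp add: W_def)
  have Wpos: "0 < ?\<omega> $ v" if "v \<in> W" for v using that om(1)[of v] by (simp add: W_def less_le)
  have \<omega>0: "?\<omega> \<noteq> 0" using om(2) by auto
  have Wne: "W \<noteq> {}"
  proof
    assume "W = {}"
    then have "?\<omega> $ v = 0" for v using W0 by blast
    then show False using om(2) by simp
  qed
  \<comment> \<open>An edge carries a positive multiple of the weight of its source to its range,
    and B_i does not increase \<open>om \<phi>\<close>; so the support is closed under
    edges.\<close>
  have W: "sink_subgraph G W"
    unfolding sink_subgraph_def
  proof (intro conjI ballI impI)
    fix e assume e: "e \<in> edges G" "src G e \<in> W"
    note c = edge_cls[OF e(1)]
    have "0 < wt \<beta> (cls (src G e, [e])) * ?\<omega> $ src G e" using Wpos[OF e(2)] by simp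
    also have "\<dots> \<le> Bop \<beta> (unit_deg (colour G e)) ?\<omega> $ rng G e"
      using Bop_ge[OF c(1), of ?\<omega> \<beta>] om(1) by (simp only: c)
    also have "\<dots> \<le> ?\<omega> $ rng G e" by (rule kms_Q(2)[OF k])
    finally show "rng G e \<in> W" by (simp add: W_def)
  qed (rule Wne)
  \<comment> \<open>On its support \<open>om \<phi>\<close> is a strictly positive supersolution for
    every colour.\<close>
  have le: "sr i W \<le> exp \<beta>" if i: "i \<in> {1..ncolours G}" for i
  proof (rule spectral_radius_le_of_super[OF Wne adj_nonneg Wpos])
    fix v
    have "exp (- \<beta>) * (adj G i *v ?\<omega>) $ v \<le> ?\<omega> $ v"
      using kms_Q(2)[OF k, of i v] by (simp add: Bop_unit[OF i])
    then have "exp \<beta> * (exp (- \<beta>) * (adj G i *v ?\<omega>) $ v) \<le> exp \<beta> * ?\<omega> $ v"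
      by (intro mult_left_mono) auto
    then have "(adj G i *v ?\<omega>) $ v \<le> exp \<beta> * ?\<omega> $ v"
      by (simp flip: mult.assoc exp_add)
    then show "(\<Sum>u\<in>W. adj G i $ v $ u * ?\<omega> $ u) \<le> exp \<beta> * ?\<omega> $ v"
      by (simp only: adj_supported[OF W0])
  qed
  \<comment> \<open>For a colour outside F the vector is a genuine eigenvector, which gives the
    reverse bound.\<close>
  obtain j where j: "j \<in> {1..ncolours G} - F" using F by blast
  then have "Bop \<beta> (unit_deg j) ?\<omega> = ?\<omega>" using \<phi> unfolding kmsF_iff[OF F'] by blast
  then have adj_om: "adj G j *v ?\<omega> = exp \<beta> *\<^sub>R ?\<omega>" using Bop_unit_fixed_iff[of j] j by blast
  have "exp \<beta> \<le> sr j W" by (rule eigen_le_sr[OF Wne _ \<omega>0 adj_om]) (rule W0)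
  also have "\<dots> \<le> rho G W" by (rule sr_le_rho) (use j in blast)
  finally have "exp \<beta> \<le> rho G W" .
  moreover have "rho G W \<le> exp \<beta>" using rho_attained[of W] le by auto
  ultimately show ?thesis using W unfolding sink_radii_def by force
qed

lemma geometric_partial_le:
  fixes q :: real assumes "0 \<le> q" "q < 1" shows "(\<Sum>k<K. q ^ k) \<le> 1 / (1 - q)"
proof -
  have "(\<Sum>k<K. q ^ k) \<le> (\<Sum>k. q ^ k)" by (rule sum_le_suminf) (use assms in auto)
  then show ?thesis using assms by (simp add: suminf_geometric)
qed

lemma kmsF_of_rho:
  assumes r: "r \<in> sink_radii G" "0 < r"
  shows "\<exists>F. F \<subset> {1..ncolours G} \<and> kmsF G F (ln r) \<noteq> {}"
proof -
  let ?N = "{1..ncolours G}"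
  obtain W where W: "sink_subgraph G W" "r = rho G W" using r(1) by (auto simp: sink_radii_def)
  obtain i where i: "i \<in> ?N" "r = sr i W" using rho_attained[of W] W(2) by blast
  obtain x where x: "\<forall>v. 0 \<le> x $ v" "x \<noteq> 0" "adj G i *v x = sr i W *\<^sub>R x"
    "\<forall>j\<in>?N. \<exists>d\<ge>0. d \<le> sr j W \<and> adj G j *v x = d *\<^sub>R x"
    using joint_eigenvector[OF W(1) i(1)] by blast
  define s where "s = (\<Sum>v\<in>UNIV. x $ v)"
  have s: "0 < s" unfolding s_def by (rule nonneg_total_pos) (use x in auto)
  define \<tau> where "\<tau> = (1 / s) *\<^sub>R x"
  have \<tau>0: "0 \<le> \<tau> $ v" for v using x(1) s by (simp add: \<tau>_def)
  have scale: "adj G j *v \<tau> = d *\<^sub>R \<tau>" if "adj G j *v x = d *\<^sub>R x" for j d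
    using that by (simp add: \<tau>_def matrix_vector_mult_scaleR)
  \<comment> \<open>For these colours the eigenvalue is strictly below r, so their series is
    geometric with ratio less than 1. The colour attaining r stays outside, which makes F
    proper.\<close>
  define F where "F = {j \<in> ?N. adj G j *v x \<noteq> r *\<^sub>R x}"
  have "i \<notin> F" unfolding F_def i(2) using x(3) by blast
  then have F: "F \<subset> ?N" using i(1) unfolding F_def by blast
  have "(\<lambda>n. Bop (ln r) n \<tau>) summable_on degs_in F"
  proof (rule Bop_summable_of_bounds[OF _ \<tau>0])
    show "finite F" using F finite_subset by blast
    fix j assume j: "j \<in> F"
    then have jN: "j \<in> ?N" by (simp add: F_def)
    obtain d where d: "0 \<le> d" "d \<le> sr j W" "adj G j *v x = d *\<^sub>R x" using x(4) jN by blast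
    have "d \<noteq> r" using j d(3) unfolding F_def by blast
    moreover have "d \<le> r" using d(2) sr_le_rho[OF jN, of W] W(2) by simp
    ultimately have q: "0 \<le> exp (- ln r) * d" "exp (- ln r) * d < 1"
      using d(1) r(2) by (simp_all add: exp_minus field_simps)
    let ?q = "exp (- ln r) * d"
    show "\<exists>C\<ge>0. \<forall>K v. (\<Sum>k<K. Bop (ln r) (ku j k) \<tau>) $ v \<le> C * \<tau> $ v"
    proof (intro exI[of _ "1 / (1 - ?q)"] conjI allI)
      show "0 \<le> 1 / (1 - ?q)" using q by simp
      fix K v
      have "(\<Sum>k<K. Bop (ln r) (ku j k) \<tau>) $ v = (\<Sum>k<K. ?q ^ k) * \<tau> $ v"
        by (simp only: sum_component Bop_ku_eigen[OF jN scale[OF d(3)]] vector_scaleR_component real_scaleR_def sum_distrib_right)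
      also have "\<dots> \<le> 1 / (1 - ?q) * \<tau> $ v" by (rule mult_right_mono[OF geometric_partial_le[OF q] \<tau>0])
      finally show "(\<Sum>k<K. Bop (ln r) (ku j k) \<tau>) $ v \<le> 1 / (1 - ?q) * \<tau> $ v" .
    qed
  qed
  moreover have "\<tau> \<in> traces"
  proof -
    have "(\<Sum>v\<in>UNIV. \<tau> $ v) = 1 / s * s" unfolding s_def \<tau>_def
      by (simp only: vector_scaleR_component real_scaleR_def sum_distrib_left)
    then show ?thesis using \<tau>0 s by (simp add: traces_def)
  qed
  moreover have "Bop (ln r) (unit_deg j) \<tau> = \<tau>" if "j \<in> ?N - F" for j
  proof -
    have "adj G j *v \<tau> = r *\<^sub>R \<tau>" by (rule scale) (use that in \<open>unfold F_def, blast\<close>)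
    then show ?thesis using Bop_unit_fixed_iff[of j "ln r" \<tau>] that r(2) by simp
  qed
  ultimately have "\<tau> \<in> tracesF G F (ln r)" unfolding tracesF_iff by blast
  then have "gauge_kmsF G F (ln r) \<noteq> {}" using kmsF_of_trace[of F \<tau> "ln r"] F by blast
  then show ?thesis using F by (auto simp: gauge_kmsF_def)
qed

text \<open>If the partial sums were unbounded, a limit of their normalisations would be a nonnegative
  vector expanded by \<open>\<Lambda>\<^sup>(\<^sup>i\<^sup>)\<close> at least by \<open>e\<^sup>\<beta>\<close>.\<close>

lemma partial_sums_bounded:
  assumes W: "sink_subgraph G W" and i: "i \<in> {1..ncolours G}" and less: "sr i W < exp \<beta>"
  defines "e \<equiv> (\<chi> v. if v \<in> W then 1 else 0) :: real ^ 'v"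
  shows "\<exists>C\<ge>0. \<forall>K v. (\<Sum>k<K. Bop \<beta> (ku i k) e) $ v \<le> C * e $ v"
proof -
  define u where "u K = (\<Sum>k<K. Bop \<beta> (ku i k) e)" for K
  define m where "m K = (\<Sum>v\<in>UNIV. u K $ v)" for K
  have e0: "0 \<le> e $ v" for v by (simp add: e_def)
  have eW: "e $ v = 0" if "v \<notin> W" for v using that by (simp add: e_def)
  have unn: "0 \<le> u K $ v" for K v unfolding u_def sum_component by (intro sum_nonneg Bop_nonneg e0)
  have B0: "Bop \<beta> (ku i k) e $ v = 0" if "v \<notin> W" for k v using that
  proof (induct k arbitrary: v)
    case (Suc k)
    then show ?case by (simp add: Bop_ku_Suc Bop_unit[OF i] adj_supported_zero[OF W Suc(1) Suc(2)])
  qed (simp add: ku_simps eW)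
  have uW: "u K $ v = 0" if "v \<notin> W" for K v unfolding u_def sum_component by (simp add: B0[OF that])
  \<comment> \<open>The partial sums increase with K and obey u_(K+1) = e + B_i u_K.\<close>
  have step: "u K $ v \<le> e $ v + Bop \<beta> (unit_deg i) (u K) $ v" for K v
  proof -
    have "u K $ v \<le> u (Suc K) $ v" using Bop_nonneg[OF e0] by (simp add: u_def)
    also have "u (Suc K) = e + Bop \<beta> (unit_deg i) (u K)"
      unfolding u_def sum.lessThan_Suc_shift Bop_sum_right by (simp only: ku_simps(1) Bop_0 Bop_ku_Suc)
    finally show ?thesis by simp
  qed
  have mge: "u K $ v \<le> m K" for K v unfolding m_def by (rule member_le_sum) (use unn in auto)
  show ?thesis
  proof (cases "\<exists>C. \<forall>K. m K \<le> C")
    case True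
    then obtain C where C: "m K \<le> C" for K by blast
    show ?thesis
    proof (intro exI[of _ "max C 0"] conjI allI)
      fix K v
      show "(\<Sum>k<K. Bop \<beta> (ku i k) e) $ v \<le> max C 0 * e $ v"
        unfolding u_def[symmetric]
        using mge[of K v] C[of K] uW[of v K] by (cases "v \<in> W") (auto simp: e_def)
    qed simp
  next
    case False
    have "\<exists>K. real (Suc n) < m K" for n using False by (meson not_le)
    then obtain f where f: "real (Suc n) < m (f n)" for n by metis
    have mp: "0 < m (f n)" for n using f[of n] by linarith
    define y where "y n = (1 / m (f n)) *\<^sub>R u (f n)" for n
    let ?S = "{x :: real ^ 'v. (\<forall>v. 0 \<le> x $ v) \<and> (\<Sum>v\<in>UNIV. x $ v) = 1}"
    have yS: "y n \<in> ?S" for n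
    proof -
      have "(\<Sum>v\<in>UNIV. y n $ v) = 1 / m (f n) * m (f n)"
        unfolding y_def by (simp only: m_def vector_scaleR_component real_scaleR_def sum_distrib_left)
      then show ?thesis using mp[of n] unn by (simp add: y_def)
    qed
    have sc: "seq_compact ?S" using compact_simplex compact_eq_seq_compact_metric by blast
    have "\<forall>n. y n \<in> ?S" using yS ..
    from seq_compactE[OF sc this] obtain x g where x: "x \<in> ?S" and g: "strict_mono g" "(y \<circ> g) \<longlonglongrightarrow> x" .
    have lim: "(\<lambda>n. y (g n) $ v) \<longlonglongrightarrow> x $ v" for v
      using tendsto_vec_nth[OF g(2)] by (simp add: o_def)
    have "(\<lambda>n. Bop \<beta> (unit_deg i) (y (g n))) \<longlonglongrightarrow> Bop \<beta> (unit_deg i) x"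
      using bounded_linear.tendsto[OF Bop_bounded_linear g(2)] by (simp add: o_def)
    then have limB: "(\<lambda>n. Bop \<beta> (unit_deg i) (y (g n)) $ v) \<longlonglongrightarrow> Bop \<beta> (unit_deg i) x $ v" for v
      by (rule tendsto_vec_nth)
    have small: "(\<lambda>n. e $ v / real (Suc (g n))) \<longlonglongrightarrow> 0" for v
    proof -
      have "(\<lambda>n. e $ v / real (Suc n)) \<longlonglongrightarrow> 0" by (rule lim_const_over_n[THEN LIMSEQ_Suc])
      from LIMSEQ_subseq_LIMSEQ[OF this g(1)] show ?thesis by (simp add: o_def)
    qed
    \<comment> \<open>The recursion divided by the total mass; the inhomogeneous term tends to zero
      because the masses exceed n + 1.\<close>
    have bnd: "y n $ v \<le> e $ v / real (Suc n) + Bop \<beta> (unit_deg i) (y n) $ v" for n v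
    proof -
      have "y n $ v \<le> 1 / m (f n) * (e $ v + Bop \<beta> (unit_deg i) (u (f n)) $ v)"
        unfolding y_def vector_scaleR_component real_scaleR_def
        by (rule mult_left_mono[OF step]) (use mp[of n] in simp)
      also have "\<dots> = e $ v / m (f n) + Bop \<beta> (unit_deg i) (y n) $ v"
        by (simp add: y_def Bop_scaleR distrib_left)
      also have "e $ v / m (f n) \<le> e $ v / real (Suc n)"
        by (rule divide_left_mono) (use e0 f[of n] mp[of n] in auto)
      finally show ?thesis by simp
    qed
    have ge: "x $ v \<le> Bop \<beta> (unit_deg i) x $ v" for v
      by (rule LIMSEQ_le[OF lim, of "\<lambda>n. e $ v / real (Suc (g n)) + Bop \<beta> (unit_deg i) (y (g n)) $ v"])
        (use tendsto_add[OF small limB] bnd in auto)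
    have xW: "x $ v = 0" if "v \<notin> W" for v
    proof -
      have "(\<lambda>n. y (g n) $ v) = (\<lambda>n. 0)" by (simp add: y_def uW[OF that])
      then show ?thesis using lim[of v] by (simp add: LIMSEQ_const_iff)
    qed
    have expand: "exp \<beta> * x $ v \<le> (adj G i *v x) $ v" for v
    proof -
      have "exp \<beta> * x $ v \<le> exp \<beta> * (exp (- \<beta>) * (adj G i *v x) $ v)"
        using ge[of v] by (simp add: Bop_unit[OF i])
      then show ?thesis by (simp flip: mult.assoc exp_add)
    qed
    have "x \<in> subcone i (exp \<beta>) W" using x xW expand by (simp add: subcone_def)
    moreover have "x \<noteq> 0" using x by auto
    ultimately have "\<exists>x\<in>subcone i (exp \<beta>) W. x \<noteq> 0" by blast
    from subcone_eigen[OF W i this] obtain z d where z: "z \<in> subcone i (exp \<beta>) W" "z \<noteq> 0" "adj G i *v z = d *\<^sub>R z"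
      using i by blast
    have z': "\<And>v. 0 \<le> z $ v" "\<And>v. v \<notin> W \<Longrightarrow> z $ v = 0" "\<And>v. exp \<beta> * z $ v \<le> d * z $ v"
      using z by (auto simp: subcone_def)
    obtain v where "z $ v \<noteq> 0" using z(2) by (auto simp: Finite_Cartesian_Product.vec_eq_iff)
    then have "exp \<beta> \<le> d" using z'(1,3)[of v] by (simp add: less_le)
    moreover have "d \<le> sr i W"
      by (rule eigen_le_sr[OF _ z'(2) z(2,3)]) (use W in \<open>simp add: sink_subgraph_def\<close>)
    ultimately show ?thesis using less by simp
  qed
qed

text \<open>Below the threshold the vertex vector is dominated by the indicator of its forward set,
  which is bounded in each colour. At or above it, a joint eigenvector on the forward set is
  dominated by finitely many images of the vertex vector, and its terms in one colour do not
  decay.\<close>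

lemma axis_summable_iff:
  "(\<lambda>n. Bop \<beta> n (axis v 1)) summable_on degs_in {1..ncolours G} \<longleftrightarrow> rho G (forward G v) < exp \<beta>"
proof
  let ?N = "{1..ncolours G}" and ?W = "forward G v" and ?a = "axis v 1 :: real ^ 'v"
  note W = sink_forward[of v]
  have a0: "0 \<le> ?a $ w" for w by (simp add: axis_def)
  show "(\<lambda>n. Bop \<beta> n ?a) summable_on degs_in ?N" if less: "rho G ?W < exp \<beta>"
  proof (rule Bop_summable_mono[OF Bop_summable_of_bounds a0])
    let ?e = "(\<chi> w. if w \<in> ?W then 1 else 0) :: real ^ 'v"
    show "0 \<le> ?e $ w" "?a $ w \<le> ?e $ w" for w using forward_self[of v] by (auto simp: axis_def)
    show "\<exists>C\<ge>0. \<forall>K w. (\<Sum>k<K. Bop \<beta> (ku i k) ?e) $ w \<le> C * ?e $ w" if "i \<in> ?N" for i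
      by (rule partial_sums_bounded[OF W that]) (use sr_le_rho[OF that, of ?W] less in linarith)
  qed simp
  assume sm: "(\<lambda>n. Bop \<beta> n ?a) summable_on degs_in ?N"
  show "rho G ?W < exp \<beta>"
  proof (rule ccontr)
    assume "\<not> rho G ?W < exp \<beta>"
    then obtain i where i: "i \<in> ?N" "exp \<beta> \<le> sr i ?W" using rho_attained[of ?W] by fastforce
    obtain x where x: "\<forall>w. 0 \<le> x $ w" "\<forall>w. w \<notin> ?W \<longrightarrow> x $ w = 0" "x \<noteq> 0" "adj G i *v x = sr i ?W *\<^sub>R x"
      using joint_eigenvector[OF W i(1)] by blast
    have "\<exists>p. \<forall>w\<in>?W. p w \<in> Lam G \<and> msrc (p w) = v \<and> mrng G (p w) = w"
      by (rule bchoice) (auto simp: forward_Lam)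
    then obtain p where p: "\<forall>w\<in>?W. p w \<in> Lam G \<and> msrc (p w) = v \<and> mrng G (p w) = w" ..
    \<comment> \<open>One chosen path from v to each reachable w; the coefficient makes the
      contribution of that path at w at least the coordinate of x.\<close>
    define L where "L y = (\<Sum>w\<in>?W. (x $ w / wt \<beta> (p w)) *\<^sub>R Bop \<beta> (mdeg G (p w)) y)" for y
    have L: "bounded_linear L" unfolding L_def
      by (intro bounded_linear_sum bounded_linear_const_scaleR Bop_bounded_linear)
    have BL: "Bop \<beta> n (L ?a) = L (Bop \<beta> n ?a)" for n
      unfolding L_def Bop_sum_right Bop_scaleR by (simp only: Bop_commute[of \<beta> n])
    have "(\<lambda>n. Bop \<beta> n (L ?a)) summable_on degs_in ?N"
      unfolding BL by (rule summable_on_bounded_linear[OF L sm])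
    then have "(\<lambda>n. Bop \<beta> n x) summable_on degs_in ?N"
    proof (rule Bop_summable_mono)
      have nn: "0 \<le> ((x $ w / wt \<beta> (p w)) *\<^sub>R Bop \<beta> (mdeg G (p w)) ?a) $ t" for w t
        using x(1) Bop_nonneg[OF a0] by simp
      show "x $ w \<le> L ?a $ w" for w
      proof (cases "w \<in> ?W")
        case True
        then have pw: "p w \<in> Lam G" "msrc (p w) = v" "mrng G (p w) = w" using p by auto
        have "wt \<beta> (p w) \<le> Bop \<beta> (mdeg G (p w)) ?a $ w"
          using Bop_ge[OF pw(1) a0, of \<beta>] by (simp add: pw(2,3))
        then have "x $ w / wt \<beta> (p w) * wt \<beta> (p w) \<le> x $ w / wt \<beta> (p w) * Bop \<beta> (mdeg G (p w)) ?a $ w"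
          by (rule mult_left_mono) (use x(1) in simp)
        then have "x $ w \<le> ((x $ w / wt \<beta> (p w)) *\<^sub>R Bop \<beta> (mdeg G (p w)) ?a) $ w" by simp
        also have "\<dots> \<le> L ?a $ w" unfolding L_def sum_component
          by (rule member_le_sum[OF True, of "\<lambda>t. ((x $ t / wt \<beta> (p t)) *\<^sub>R Bop \<beta> (mdeg G (p t)) ?a) $ w"]) (use nn in auto)
        finally show ?thesis .
      next
        case False
        then have "x $ w = 0" using x(2) by blast
        then show ?thesis unfolding L_def sum_component by (simp only:) (rule sum_nonneg, rule nn)
      qed
    qed (use x(1) in blast)
    then have sx: "(\<lambda>n. Bop \<beta> n x $ w) summable_on degs_in ?N" for w by (rule Bop_summable_nth)
    obtain w where w: "x $ w \<noteq> 0" using x(3) by (auto simp: Finite_Cartesian_Product.vec_eq_iff)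
    have "range (ku i) \<subseteq> degs_in ?N" using i(1) by (auto simp: degs_in_def ku_def split: if_splits)
    then have "(\<lambda>n. Bop \<beta> n x $ w) summable_on range (ku i)" by (rule summable_on_subset_banach[OF sx])
    moreover have "inj (ku i)" by (rule injI) (metis ku_def)
    ultimately have "(\<lambda>k. Bop \<beta> (ku i k) x $ w) summable_on UNIV"
      by (simp add: summable_on_reindex o_def)
    then have "summable (\<lambda>k. Bop \<beta> (ku i k) x $ w)" by (rule summable_on_imp_summable)
    then have "(\<lambda>k. Bop \<beta> (ku i k) x $ w) \<longlonglongrightarrow> 0" by (rule summable_LIMSEQ_zero)
    moreover have "x $ w \<le> Bop \<beta> (ku i k) x $ w" for k
    proof -
      have "1 \<le> exp (- \<beta>) * sr i ?W" using i(2) by (simp add: exp_minus field_simps)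
      then have "1 \<le> (exp (- \<beta>) * sr i ?W) ^ k" by simp
      then have "1 * x $ w \<le> (exp (- \<beta>) * sr i ?W) ^ k * x $ w" by (rule mult_right_mono) (use x(1) in simp)
      then show ?thesis by (simp add: Bop_ku_eigen[OF i(1) x(4)])
    qed
    ultimately have "x $ w \<le> 0" by (intro LIMSEQ_le_const) auto
    then show False using x(1) w by (simp add: order_antisym)
  qed
qed

text \<open>With all colours in F only convergence of the series remains, and it is decided
  separately at each vertex of the support.\<close>

lemma tracesF_full:
  "tracesF G {1..ncolours G} \<beta> = convex hull {axis v 1 | v. rho G (forward G v) < exp \<beta>}"
  (is "?T = convex hull ?A")
proof
  have mem: "\<tau> \<in> ?T \<longleftrightarrow> \<tau> \<in> traces \<and> (\<lambda>n. Bop \<beta> n \<tau>) summable_on degs_in {1..ncolours G}" for \<tau>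
    by (simp add: tracesF_iff)
  show "?T \<subseteq> convex hull ?A"
  proof
    fix \<tau> assume \<tau>: "\<tau> \<in> ?T"
    then have t: "\<And>v. 0 \<le> \<tau> $ v" "(\<Sum>v\<in>UNIV. \<tau> $ v) = 1" by (auto simp: tracesF_def traces_def)
    let ?S = "{v. \<tau> $ v \<noteq> 0}"
    have "(\<Sum>v\<in>?S. \<tau> $ v) = (\<Sum>v\<in>UNIV. \<tau> $ v)" by (rule sum.mono_neutral_left) auto
    from trans[OF this t(2)] have s1: "(\<Sum>v\<in>?S. \<tau> $ v) = 1" .
    have "(\<Sum>v\<in>UNIV. \<tau> $ v *\<^sub>R axis v (1::real)) = (\<Sum>v\<in>?S. \<tau> $ v *\<^sub>R axis v 1)"
      by (rule sum.mono_neutral_right) auto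
    from trans[OF axis_decomp[of \<tau>] this] have "\<tau> = (\<Sum>v\<in>?S. \<tau> $ v *\<^sub>R axis v 1)" .
    also have "\<dots> \<in> convex hull ?A"
    proof (rule convex_sum)
      show "axis v 1 \<in> convex hull ?A" if "v \<in> ?S" for v
      proof (rule hull_inc)
        have "\<tau> $ v \<noteq> 0" using that by simp
        from axis_summable[OF \<tau> this] show "axis v 1 \<in> ?A" unfolding axis_summable_iff by blast
      qed
    qed (use t(1) s1 in auto)
    finally show "\<tau> \<in> convex hull ?A" .
  qed
  show "convex hull ?A \<subseteq> ?T"
  proof (rule hull_minimal)
    show "?A \<subseteq> ?T"
    proof
      fix y assume "y \<in> ?A"
      then obtain v where v: "y = axis v 1" "rho G (forward G v) < exp \<beta>" by blast
      have "(\<Sum>w\<in>UNIV. (axis v 1 :: real ^ 'v) $ w) = 1" by (simp add: axis_def)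
      then have "(axis v 1 :: real ^ 'v) \<in> traces" by (simp add: traces_def axis_def)
      then show "y \<in> ?T" unfolding v(1) mem axis_summable_iff using v(2) by blast
    qed
    show "convex ?T"
    proof (rule convexI)
      fix x y :: "real ^ 'v" and a b :: real
      assume "x \<in> ?T" "y \<in> ?T" and ab: "0 \<le> a" "0 \<le> b" "a + b = 1"
      then have x: "x \<in> traces" "(\<lambda>n. Bop \<beta> n x) summable_on degs_in {1..ncolours G}"
        and y: "y \<in> traces" "(\<lambda>n. Bop \<beta> n y) summable_on degs_in {1..ncolours G}"
        unfolding mem by blast+
      have "(\<Sum>v\<in>UNIV. (a *\<^sub>R x + b *\<^sub>R y) $ v) = a * (\<Sum>v\<in>UNIV. x $ v) + b * (\<Sum>v\<in>UNIV. y $ v)"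
        by (simp add: sum.distrib sum_distrib_left)
      then have "a *\<^sub>R x + b *\<^sub>R y \<in> traces" using x(1) y(1) ab by (simp add: traces_def)
      moreover have "(\<lambda>n. a *\<^sub>R Bop \<beta> n x + b *\<^sub>R Bop \<beta> n y) summable_on degs_in {1..ncolours G}"
        by (intro summable_on_add summable_on_scaleR_right x(2) y(2))
      ultimately show "a *\<^sub>R x + b *\<^sub>R y \<in> ?T" unfolding mem Bop_add_right Bop_scaleR ..
    qed
  qed
qed

lemma sink_radii_nonneg: "r \<in> sink_radii G \<Longrightarrow> 0 \<le> r"
  using rho_nonneg by (auto simp: sink_radii_def sink_subgraph_def)

text \<open>No radius lies strictly between r and r', so the strict bound by e^\<beta> that governs
  convergence agrees with the bound by r. The value of \<open>elog\<close> at 0 accounts for r =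
  0.\<close>

lemma successive_radii:
  assumes "r \<in> sink_radii G" "r < r'" "\<not> (\<exists>q\<in>sink_radii G. r < q \<and> q < r')"
    and "elog r < ereal \<beta>" "ereal \<beta> \<le> elog r'" "q \<in> sink_radii G"
  shows "q \<le> r \<longleftrightarrow> q < exp \<beta>"
proof -
  have r: "0 \<le> r" "0 < r'" using sink_radii_nonneg[OF assms(1)] assms(2) by auto
  have "r < exp \<beta>"
  proof (cases "r = 0")
    case False
    then have "ln r < \<beta>" "0 < r" using assms(4) r(1) by (auto simp: elog_def)
    then show ?thesis using exp_less_cancel_iff[of "ln r" \<beta>] by simp
  qed simp
  moreover have "exp \<beta> \<le> r'"
  proof -
    have "\<beta> \<le> ln r'" using assms(5) r(2) by (simp add: elog_def)
    then show ?thesis using exp_le_cancel_iff[of \<beta> "ln r'"] r(2) by simp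
  qed
  moreover have "\<not> (r < q \<and> q < r')" using assms(3,6) by blast
  ultimately show ?thesis by linarith
qed

end

theorem theorem3p7:
  fixes G :: "('v :: finite, 'e) hrg"
  assumes "finite_hrg G"
  shows
    "(\<forall>\<beta>\<ge>0. (\<exists>F. F \<subset> {1..ncolours G} \<and> kmsF G F \<beta> \<noteq> {}) \<longleftrightarrow>
        (\<exists>r\<in>sink_radii G. 1 \<le> r \<and> \<beta> = ln r)) \<and>
     (\<forall>F r. F \<subset> {1..ncolours G} \<and> r \<in> sink_radii G \<and> 1 \<le> r \<longrightarrow>
        homeomorphic_map (weak_star G (gauge_kmsF G F (ln r)))
          (top_of_set (tracesF G F (ln r))) (Phi G F)) \<and>
     (\<forall>r r' \<beta>. r \<in> sink_radii G \<and> r' \<in> sink_radii G \<and> r < r' \<and>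
        \<not> (\<exists>q\<in>sink_radii G. r < q \<and> q < r') \<and>
        0 < \<beta> \<and> elog r < ereal \<beta> \<and> ereal \<beta> \<le> elog r' \<longrightarrow>
        gauge_kmsF G {1..ncolours G} \<beta> \<noteq> {} \<and>
        homeomorphic_map (weak_star G (gauge_kmsF G {1..ncolours G} \<beta>))
          (top_of_set (convex hull {axis v 1 | v. rho G (forward G v) \<le> r}))
          (Phi G {1..ncolours G}))"
proof -
  interpret finite_hrg G by fact
  let ?N = "{1..ncolours G}"
  have radii: "(\<exists>F. F \<subset> ?N \<and> kmsF G F \<beta> \<noteq> {}) \<longleftrightarrow> (\<exists>r\<in>sink_radii G. 1 \<le> r \<and> \<beta> = ln r)" if "0 \<le> \<beta>" for \<beta>
  proof
    assume "\<exists>F. F \<subset> ?N \<and> kmsF G F \<beta> \<noteq> {}"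
    then have "exp \<beta> \<in> sink_radii G" using rho_of_kmsF by blast
    then show "\<exists>r\<in>sink_radii G. 1 \<le> r \<and> \<beta> = ln r" by (rule rev_bexI) (use that in simp)
  next
    assume "\<exists>r\<in>sink_radii G. 1 \<le> r \<and> \<beta> = ln r"
    then obtain r where r: "r \<in> sink_radii G" "1 \<le> r" "\<beta> = ln r" by blast
    show "\<exists>F. F \<subset> ?N \<and> kmsF G F \<beta> \<noteq> {}" unfolding r(3) by (rule kmsF_of_rho) (use r in auto)
  qed
  have subharmonic: "homeomorphic_map (weak_star G (gauge_kmsF G F (ln r))) (top_of_set (tracesF G F (ln r))) (Phi G F)"
    if "F \<subset> ?N" for F r
    by (rule Phi_homeomorphic) (use that in blast)
  have finite_type: "gauge_kmsF G ?N \<beta> \<noteq> {} \<and>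
      homeomorphic_map (weak_star G (gauge_kmsF G ?N \<beta>))
        (top_of_set (convex hull {axis v 1 | v. rho G (forward G v) \<le> r})) (Phi G ?N)"
    if h: "r \<in> sink_radii G" "r < r'" "\<not> (\<exists>q\<in>sink_radii G. r < q \<and> q < r')"
      "elog r < ereal \<beta>" "ereal \<beta> \<le> elog r'" for r r' \<beta>
  proof -
    have "rho G (forward G v) \<in> sink_radii G" for v using sink_forward by (auto simp: sink_radii_def)
    then have T: "convex hull {axis v 1 | v. rho G (forward G v) \<le> r} = tracesF G ?N \<beta>"
      unfolding tracesF_full by (simp only: successive_radii[OF h])
    \<comment> \<open>A vertex of a sink subgraph of radius r reaches only that subgraph, so its
      forward radius is at most r and the simplex is nonempty.\<close>
    obtain W where W: "sink_subgraph G W" "r = rho G W" using h(1) by (auto simp: sink_radii_def)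
    obtain v where "v \<in> W" using W(1) by (auto simp: sink_subgraph_def)
    then have "rho G (forward G v) \<le> r"
      unfolding W(2) by (intro rho_mono sink_forward forward_subset W(1))
    then have "axis v 1 \<in> tracesF G ?N \<beta>" unfolding T[symmetric] by (intro hull_inc) blast
    then have "gauge_kmsF G ?N \<beta> \<noteq> {}" using kmsF_of_trace[OF order_refl] by blast
    then show ?thesis unfolding T using Phi_homeomorphic[OF order_refl] by blast
  qed
  show ?thesis
  proof (rule conjI[OF _ conjI], goal_cases)
    case 1
    show ?case by (intro allI impI) (rule radii)
  next
    case 2
    show ?case by (intro allI impI, elim conjE) (rule subharmonic)
  next
    case 3
    show ?case by (intro allI impI, elim conjE) (rule finite_type)
  qed
qed

end
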